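(* In the Luttinger-Sy model none of the kinetic-energy eigenstates is macroscopically occupied: almost surely, $$\lim_{l\to\infty}\frac1l\,\langle N_l(\psi_k^l)\rangle_l=0\qquad\text{for all }k,$$ even though for $\overline\rho>\rho_c$ there is generalized Bose-Einstein condensation in the kinetic-energy eigenstates, i.e. the almost sure weak limit $\tilde m$ of the kinetic-energy occupation measures $\tilde m_l$ satisfies $\tilde m(\{0\})>0$.
   Context: Luttinger-Sy model (dimension $d=1$): $\Lambda_l=(-l/2,l/2)$, $l=1,2,3,\dots$. Fix $\beta>0$, $\overline\rho>0$, $\lambda>0$. Let $X^\omega=\{x_j^\omega\}_j\subset\mathbb R$ be the atoms of a homogeneous Poisson point process on $\mathbb R$ of intensity $\lambda$, on a probability space $(\Omega,\mathcal F,\mathbb P)$. The points of $X^\omega$ cut $\Lambda_l$ into finitely many open subintervals $I_1^\omega,\dots,I_{M^l(\omega)}^\omega$ (the connected components of $\Lambda_l\setminus X^\omega$). The one-particle random Hamiltonian is $h_l^\omega=h_{l,D}^\omega=\bigoplus_{j=1}^{M^l(\omega)}h_D(I_j^\omega)$, where $h_D(I)$ is $-\frac12\frac{d^2}{dx^2}$ on $L^2(I)$ with Dirichlet boundary conditions (formally: point impurities $a\sum_j\delta(x-x_j^\omega)$ with $a\to+\infty$). Its eigenvalues are $E_1^{\omega,l}\le E_2^{\omega,l}\le\cdots$. $h_l^0$ is $-\frac12\frac{d^2}{dx^2}$ on $L^2(\Lambda_l)$ with Dirichlet boundary conditions, with orthonormal eigenfunctions $\psi_k=\psi_k^l$ and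 eigenvalues $\varepsilon_1^l\le\varepsilon_2^l\le\cdots$, $k=1,2,\dots$ $\nu(E)=\lim_{l\to\infty}l^{-1}\#\{i:E_i^{\omega,l}\le E\}$ is the (almost surely non-random) integrated density of states, and $\rho_c=\lim_{\mu\uparrow0}\int_0^\infty(e^{\beta(E-\mu)}-1)^{-1}\nu(dE)<\infty$. Perfect Bose gas: $\mu_l=\mu_l^\omega<E_1^{\omega,l}$ is the unique solution of $\overline\rho=l^{-1}\sum_{i\ge1}(e^{\beta(E_i^{\omega,l}-\mu)}-1)^{-1}$; $\langle\cdot\rangle_l$ is the grand-canonical Gibbs state on the symmetric Fock space over $L^2(\Lambda_l)$ at inverse temperature $\beta$ with Hamiltonian $d\Gamma(h_l^\omega)-\mu_l^\omega N_l$, and $N_l(f)=a^*(f)a(f)$; thus $\langle N_l(f)\rangle_l=(f,(e^{\beta(h_l^\omega-\mu_l^\omega)}-1)^{-1}f)$ for normalized $f$. The kinetic-energy occupation measure is $\tilde m_l(A)=l^{-1}\sum_{k:\varepsilon_k^l\in A}\langle N_l(\psi_k)\rangle_l$, $A\subset\mathbb R$ Borel. *)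

theory Defs
  imports "HOL-Probability.Probability" "HOL-Library.Multiset"
begin

section \<open>The space L2(S) of complex functions on a set of reals\<close>

text \<open>Elements of L2(S) are represented by functions; all notions below are insensitive to
  changing such a function on a null set.\<close>

definition L2 :: "real set \<Rightarrow> (real \<Rightarrow> complex) \<Rightarrow> bool" where
  "L2 S f \<longleftrightarrow> set_borel_measurable lborel S f \<and> set_integrable lborel S (\<lambda>x. (cmod (f x))\<^sup>2)"

definition L2_inner :: "real set \<Rightarrow> (real \<Rightarrow> complex) \<Rightarrow> (real \<Rightarrow> complex) \<Rightarrow> complex" where
  "L2_inner S f g = (LINT x:S|lborel. cnj (f x) * g x)"

definition orthonormal_basis :: "real set \<Rightarrow> (nat \<Rightarrow> real \<Rightarrow> complex) \<Rightarrow> bool" where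
  "orthonormal_basis S \<phi> \<longleftrightarrow>
     (\<forall>i. L2 S (\<phi> i)) \<and>
     (\<forall>i j. L2_inner S (\<phi> i) (\<phi> j) = (if i = j then 1 else 0)) \<and>
     (\<forall>f. L2 S f \<longrightarrow> (\<forall>i. L2_inner S (\<phi> i) f = 0) \<longrightarrow> (AE x in lborel. x \<in> S \<longrightarrow> f x = 0))"

text \<open>An operator on L2(S) is given by its graph \<^term>\<open>H\<close>: \<^term>\<open>H f g\<close> says that f is in the
  domain and is mapped to g. Eigenvalues are listed in increasing order and according to
  multiplicity; indices start at 0.\<close>

definition eigensystem ::
  "real set \<Rightarrow> ((real \<Rightarrow> complex) \<Rightarrow> (real \<Rightarrow> complex) \<Rightarrow> bool) \<Rightarrow>
   (nat \<Rightarrow> real \<Rightarrow> complex) \<Rightarrow> (nat \<Rightarrow> real) \<Rightarrow> bool" where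
  "eigensystem S H \<phi> E \<longleftrightarrow>
     orthonormal_basis S \<phi> \<and>
     (\<forall>i. H (\<phi> i) (\<lambda>x. complex_of_real (E i) * \<phi> i x)) \<and>
     mono E"


section \<open>One-particle Hamiltonians\<close>

text \<open>The operator -(1/2) d^2/dx^2 with Dirichlet boundary conditions on a bounded open interval J,
  on its self-adjointness domain: f has an absolutely continuous representative u on the closed
  interval vanishing at both end points, whose derivative v is absolutely continuous with
  square-integrable derivative v' = -2g. Absolute continuity is expressed by u and v being
  integrals of their derivatives.\<close>

definition dirichlet_hamiltonian ::
  "real set \<Rightarrow> (real \<Rightarrow> complex) \<Rightarrow> (real \<Rightarrow> complex) \<Rightarrow> bool" where
  "dirichlet_hamiltonian J f g \<longleftrightarrow>
     L2 J f \<and> L2 J g \<and>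
     (\<exists>u v. (AE x in lborel. x \<in> J \<longrightarrow> f x = u x) \<and>
            u (Inf J) = 0 \<and> u (Sup J) = 0 \<and>
            (\<forall>x\<in>{Inf J..Sup J}. u x = u (Inf J) + (LINT t:{Inf J..x}|lborel. v t)) \<and>
            (\<forall>x\<in>{Inf J..Sup J}. v x = v (Inf J) + (LINT t:{Inf J..x}|lborel. - 2 * g t)))"

definition \<Lambda> :: "nat \<Rightarrow> real set" where
  "\<Lambda> l = {- real l / 2 <..< real l / 2}"

text \<open>The direct sum of the Dirichlet operators over the intervals into which the points of X
  cut \<^term>\<open>\<Lambda> l\<close>.\<close>

definition LS_hamiltonian ::
  "real set \<Rightarrow> nat \<Rightarrow> (real \<Rightarrow> complex) \<Rightarrow> (real \<Rightarrow> complex) \<Rightarrow> bool" where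
  "LS_hamiltonian X l f g \<longleftrightarrow>
     L2 (\<Lambda> l) f \<and> L2 (\<Lambda> l) g \<and>
     (\<forall>J\<in>components (\<Lambda> l - X). dirichlet_hamiltonian J f g)"


section \<open>The Poisson point process\<close>

text \<open>Since the homogeneous process is simple, it is identified with its set of atoms.\<close>

definition poisson_process :: "'w measure \<Rightarrow> real \<Rightarrow> ('w \<Rightarrow> real set) \<Rightarrow> bool" where
  "poisson_process M r X \<longleftrightarrow>
     (\<forall>\<omega>\<in>space M. \<forall>B. bounded B \<longrightarrow> finite (X \<omega> \<inter> B)) \<and>
     (\<forall>B\<in>sets borel. bounded B \<longrightarrow>
        (\<lambda>\<omega>. card (X \<omega> \<inter> B)) \<in> measurable M (count_space UNIV) \<and>
        (\<forall>n. measure M {\<omega>\<in>space M. card (X \<omega> \<inter> B) = n} =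
               exp (- (r * measure lborel B)) * (r * measure lborel B) ^ n / fact n)) \<and>
     (\<forall>(B :: nat \<Rightarrow> real set) n.
        (\<forall>i<n. B i \<in> sets borel \<and> bounded (B i)) \<longrightarrow> disjoint_family_on B {..<n} \<longrightarrow>
        prob_space.indep_vars M (\<lambda>_. count_space UNIV) (\<lambda>i \<omega>. card (X \<omega> \<inter> B i)) {..<n})"


section \<open>Integrated density of states and critical density\<close>

definition ids :: "'w measure \<Rightarrow> ('w \<Rightarrow> nat \<Rightarrow> nat \<Rightarrow> real) \<Rightarrow> real \<Rightarrow> real" where
  "ids M E e =
     (THE n. AE \<omega> in M. (\<lambda>l. real (card {i. E \<omega> l i \<le> e}) / real l) \<longlonglongrightarrow> n)"

definition critical_density :: "real \<Rightarrow> (real \<Rightarrow> real) \<Rightarrow> ennreal" where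
  "critical_density \<beta> \<nu> =
     Lim (at_left (0::real))
       (\<lambda>\<mu>. \<integral>\<^sup>+e\<in>{0..}. ennreal (1 / (exp (\<beta> * (e - \<mu>)) - 1)) \<partial>interval_measure \<nu>)"


section \<open>Grand-canonical Gibbs state on the symmetric Fock space\<close>

text \<open>Given an orthonormal basis \<^term>\<open>\<phi>\<close> of the one-particle space, the symmetric Fock space is
  used in its occupation-number representation: a finite multiset of indices stands for the
  normalised symmetric basis vector in which mode i is occupied as often as i occurs, and Fock
  vectors are given by their coefficients in this basis. For the annihilation and creation
  operators a(f), a*(f) of f = sum of (\<phi>_i, f) \<phi>_i, the scalar product is antilinear in
  its first argument, so that a(f) = sum of (f, \<phi>_i) a_i.\<close>

type_synonym fock = "nat multiset \<Rightarrow> complex"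

definition ket :: "nat multiset \<Rightarrow> fock" where
  "ket \<eta> = (\<lambda>\<zeta>. if \<zeta> = \<eta> then 1 else 0)"

definition annihilation ::
  "real set \<Rightarrow> (nat \<Rightarrow> real \<Rightarrow> complex) \<Rightarrow> (real \<Rightarrow> complex) \<Rightarrow> fock \<Rightarrow> fock" where
  "annihilation S \<phi> f \<Psi> = (\<lambda>\<eta>. \<Sum>\<^sub>\<infinity>i\<in>UNIV.
     L2_inner S f (\<phi> i) * complex_of_real (sqrt (real (count \<eta> i + 1))) * \<Psi> (add_mset i \<eta>))"

definition creation ::
  "real set \<Rightarrow> (nat \<Rightarrow> real \<Rightarrow> complex) \<Rightarrow> (real \<Rightarrow> complex) \<Rightarrow> fock \<Rightarrow> fock" where
  "creation S \<phi> f \<Psi> = (\<lambda>\<eta>. \<Sum>i\<in>set_mset \<eta>.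
     L2_inner S (\<phi> i) f * complex_of_real (sqrt (real (count \<eta> i))) * \<Psi> (\<eta> - {#i#}))"

definition number_op ::
  "real set \<Rightarrow> (nat \<Rightarrow> real \<Rightarrow> complex) \<Rightarrow> (real \<Rightarrow> complex) \<Rightarrow> fock \<Rightarrow> fock" where
  "number_op S \<phi> f = creation S \<phi> f \<circ> annihilation S \<phi> f"

text \<open>If \<^term>\<open>\<phi>\<close> is an eigenbasis of h with eigenvalues E, then the second quantisation of h
  minus \<^term>\<open>\<mu>\<close> times the particle number operator is diagonal in the basis \<^const>\<open>ket\<close>,
  with the eigenvalues \<open>grand_energy\<close>. Hence the state Tr(exp(-\<beta> K) A) / Tr(exp(-\<beta> K))
  is given by the traces taken in this basis.\<close>

definition grand_energy :: "(nat \<Rightarrow> real) \<Rightarrow> real \<Rightarrow> nat multiset \<Rightarrow> real" where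
  "grand_energy E \<mu> \<eta> = (\<Sum>i\<in>#\<eta>. (E i - \<mu>))"

definition gibbs_state ::
  "real \<Rightarrow> (nat \<Rightarrow> real) \<Rightarrow> real \<Rightarrow> (fock \<Rightarrow> fock) \<Rightarrow> complex" where
  "gibbs_state \<beta> E \<mu> A =
     (\<Sum>\<^sub>\<infinity>\<eta>\<in>UNIV. complex_of_real (exp (- \<beta> * grand_energy E \<mu> \<eta>)) * A (ket \<eta>) \<eta>) /
     (\<Sum>\<^sub>\<infinity>\<eta>\<in>UNIV. complex_of_real (exp (- \<beta> * grand_energy E \<mu> \<eta>)))"

text \<open>The expectation of N(f) = a*(f) a(f); it is real since N(f) is symmetric.\<close>

definition mean_occupation ::
  "real \<Rightarrow> real set \<Rightarrow> (nat \<Rightarrow> real \<Rightarrow> complex) \<Rightarrow> (nat \<Rightarrow> real) \<Rightarrow> real \<Rightarrow>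
   (real \<Rightarrow> complex) \<Rightarrow> real" where
  "mean_occupation \<beta> S \<phi> E \<mu> f = Re (gibbs_state \<beta> E \<mu> (number_op S \<phi> f))"


section \<open>Occupation measures\<close>

text \<open>The Borel measure with mass n k / l at the point e k, for every k.\<close>

definition occupation_measure :: "nat \<Rightarrow> (nat \<Rightarrow> real) \<Rightarrow> (nat \<Rightarrow> real) \<Rightarrow> real measure" where
  "occupation_measure l e n =
     distr (density (count_space UNIV) (\<lambda>k. ennreal (n k / real l))) borel e"

lemma emeasure_occupation_measure:
  assumes "A \<in> sets borel"
  shows "emeasure (occupation_measure l e n) A = (\<Sum>k. ennreal (n k / real l) * indicator {k. e k \<in> A} k)"
  using assms
  by (simp add: occupation_measure_def emeasure_distr emeasure_density
      nn_integral_count_space_nat vimage_def)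

text \<open>Weak convergence of finite Borel measures, whose total masses need not be 1.\<close>

definition converges_weakly :: "(nat \<Rightarrow> real measure) \<Rightarrow> real measure \<Rightarrow> bool" where
  "converges_weakly \<nu>s \<nu> \<longleftrightarrow>
     (\<forall>f :: real \<Rightarrow> real. continuous_on UNIV f \<longrightarrow> bounded (range f) \<longrightarrow>
        (\<lambda>l. \<integral>x. f x \<partial>\<nu>s l) \<longlonglongrightarrow> (\<integral>x. f x \<partial>\<nu>))"

end

theory Submission
  imports Defs
begin

text \<open>The Bose factor of the impurity Hamiltonian acts in each gap \<open>J\<close> separately, so that the
  occupation of \<open>\<psi>\<^sub>k\<close> is the sum over all gap modes of their Bose factor times a weight, the squared
  overlap of \<open>\<psi>\<^sub>k\<close> with the mode. This weight is at most of order \<open>|J| / l\<close>, and the longest gap has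
  length \<open>o(l)\<close> by the law of large numbers for the gap lengths; hence no single \<open>\<psi>\<^sub>k\<close> is macroscopically
  occupied.

  For the condensate one looks at the symmetrised momentum distribution. Summing the weights of a gap mode
  against cosines gives the overlap of the mode with its translates, which depends on the gap length only,
  so the law of large numbers yields a deterministic limit of the characteristic functions. The kinetic
  energy per volume stays bounded, so that the distributions are tight and Levy's theorem gives weak
  convergence. Above the critical density a fixed fraction of the particles sits in gap modes of arbitrarily
  small energy, and a mode of small energy has small momenta; the limit therefore has an atom at zero.\<close>

section \<open>Orthonormal systems in L2\<close>

text \<open>Two obstacles shape the proof. The eigenbasis \<open>\<phi>\<close> is arbitrary: when
  levels of different gaps coincide, \<open>\<phi> i\<close> may be a superposition spread over
  several gaps. The passage to gap modes is therefore made on the level of squared overlaps, by a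
  one-sided spectral inequality that equality of the finite traces turns into an equality. Second,
  the chemical potential is a random sequence tending to 0, where the Bose factor blows up like the
  inverse of the energy. The law of large numbers is therefore applied to \<open>1 - cos\<close>
  instead of \<open>cos\<close>: one minus the overlap of a mode with its translate is at most
  \<open>t\<^sup>2\<close> times its energy, which cancels the singularity and leaves a bounded
  function of the gap length, evaluated at potential 0. Deterministic limits are essential, because
  one measure \<open>m\<close> has to serve almost every sample. The momenta are symmetrised so that
  a cosine transform becomes a characteristic function, and the atom is detected through tent
  functions shrinking to 0, since weak convergence does not give the mass of a point
  directly.\<close>

definition sqi :: "'a measure \<Rightarrow> ('a \<Rightarrow> complex) \<Rightarrow> bool" where
  "sqi N f \<longleftrightarrow> f \<in> borel_measurable N \<and> integrable N (\<lambda>x. (cmod (f x))\<^sup>2)"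

definition ip :: "'a measure \<Rightarrow> ('a \<Rightarrow> complex) \<Rightarrow> ('a \<Rightarrow> complex) \<Rightarrow> complex" where
  "ip N f g = (LINT x|N. cnj (f x) * g x)"

definition nrm2 :: "'a measure \<Rightarrow> ('a \<Rightarrow> complex) \<Rightarrow> real" where
  "nrm2 N f = (LINT x|N. (cmod (f x))\<^sup>2)"

lemma measurable_cnj [measurable]: "cnj \<in> borel_measurable borel"
  by (intro borel_measurable_continuous_onI continuous_intros)

definition orthonormal :: "'a measure \<Rightarrow> 'i set \<Rightarrow> ('i \<Rightarrow> 'a \<Rightarrow> complex) \<Rightarrow> bool" where
  "orthonormal N I e \<longleftrightarrow> (\<forall>i\<in>I. sqi N (e i)) \<and>
     (\<forall>i\<in>I. \<forall>j\<in>I. ip N (e i) (e j) = (if i = j then 1 else 0))"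

lemma sqi_mult_integrable:
  assumes "sqi N f" "sqi N g"
  shows "integrable N (\<lambda>x. cnj (f x) * g x)"
proof (rule Bochner_Integration.integrable_bound)
  show "integrable N (\<lambda>x. (cmod (f x))\<^sup>2 + (cmod (g x))\<^sup>2)"
    using assms by (auto simp: sqi_def)
  have [measurable]: "f \<in> borel_measurable N" "g \<in> borel_measurable N"
    using assms by (auto simp: sqi_def)
  show "(\<lambda>x. cnj (f x) * g x) \<in> borel_measurable N" 
    by measurable
  have "a * b \<le> a\<^sup>2 + b\<^sup>2" if "a \<ge> 0" "b \<ge> 0" for a b :: real
  proof -
    have "2 * a * b \<le> a\<^sup>2 + b\<^sup>2" by (rule sum_squares_bound)
    moreover have "0 \<le> a * b" using that by simp
    ultimately show ?thesis by linarith
  qed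
  then show "AE x in N. norm (cnj (f x) * g x) \<le> norm ((cmod (f x))\<^sup>2 + (cmod (g x))\<^sup>2)"
    by (auto simp: norm_mult)
qed

lemma sqi_add: assumes "sqi N f" "sqi N g" shows "sqi N (\<lambda>x. f x + g x)"
proof -
  have [measurable]: "f \<in> borel_measurable N" "g \<in> borel_measurable N"
    using assms by (auto simp: sqi_def)
  have "integrable N (\<lambda>x. (cmod (f x + g x))\<^sup>2)"
  proof (rule Bochner_Integration.integrable_bound)
    show "integrable N (\<lambda>x. 2 * ((cmod (f x))\<^sup>2 + (cmod (g x))\<^sup>2))"
      using assms by (auto simp: sqi_def)
    have "(cmod (f x + g x))\<^sup>2 \<le> 2 * ((cmod (f x))\<^sup>2 + (cmod (g x))\<^sup>2)" for x
    proof -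
      have "(cmod (f x + g x))\<^sup>2 \<le> (cmod (f x) + cmod (g x))\<^sup>2"
        by (intro power_mono norm_triangle_ineq) auto
      also have "\<dots> \<le> 2 * ((cmod (f x))\<^sup>2 + (cmod (g x))\<^sup>2)"
        using sum_squares_bound[of "cmod (f x)" "cmod (g x)"] by (simp add: power2_sum)
      finally show ?thesis .
    qed
    then show "AE x in N. norm ((cmod (f x + g x))\<^sup>2) \<le> norm (2 * ((cmod (f x))\<^sup>2 + (cmod (g x))\<^sup>2))"
      by auto
  qed measurable
  then show ?thesis by (auto simp: sqi_def)
qed

lemma sqi_cmult: "sqi N f \<Longrightarrow> sqi N (\<lambda>x. c * f x)"
  by (auto simp: sqi_def norm_mult power_mult_distrib)

lemma sqi_0: "sqi N (\<lambda>x. 0)"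
  by (simp add: sqi_def)

lemma sqi_sum: "(\<And>i. i \<in> I \<Longrightarrow> sqi N (f i)) \<Longrightarrow> sqi N (\<lambda>x. \<Sum>i\<in>I. f i x)"
  by (induction I rule: infinite_finite_induct) (auto intro: sqi_0 sqi_add)

lemma sqi_diff: assumes "sqi N f" "sqi N g" shows "sqi N (\<lambda>x. f x - g x)"
  using sqi_add[OF assms(1) sqi_cmult[OF assms(2), of "-1"]] by simp

lemma ip_add_right: "sqi N f \<Longrightarrow> sqi N g \<Longrightarrow> sqi N h \<Longrightarrow> ip N f (\<lambda>x. g x + h x) = ip N f g + ip N f h"
  by (simp add: ip_def distrib_left sqi_mult_integrable)

lemma ip_diff_right: "sqi N f \<Longrightarrow> sqi N g \<Longrightarrow> sqi N h \<Longrightarrow> ip N f (\<lambda>x. g x - h x) = ip N f g - ip N f h"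
  by (simp add: ip_def right_diff_distrib sqi_mult_integrable)

lemma ip_cmult_right: "ip N f (\<lambda>x. c * g x) = c * ip N f g"
  by (simp add: ip_def flip: integral_mult_right_zero) (simp add: algebra_simps)

lemma ip_cnj: "ip N g f = cnj (ip N f g)"
  unfolding ip_def by (subst Bochner_Integration.integral_cnj[symmetric]) (simp add: mult.commute)

lemma ip_sum_right:
  assumes "sqi N f" "\<And>i. i \<in> I \<Longrightarrow> sqi N (g i)"
  shows "ip N f (\<lambda>x. \<Sum>i\<in>I. g i x) = (\<Sum>i\<in>I. ip N f (g i))"
  using assms(2)
proof (induction I rule: infinite_finite_induct)
  case (insert i I)
  then show ?case
    by (simp add: ip_add_right assms(1) sqi_sum)
qed (simp_all add: ip_def)

lemma ip_self: "ip N f f = complex_of_real (nrm2 N f)"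
  by (simp add: ip_def nrm2_def complex_norm_square[symmetric] mult.commute
      flip: integral_complex_of_real)

lemma nrm2_nonneg: "nrm2 N f \<ge> 0"
  by (simp add: nrm2_def)

lemma nrm2_cmult: "nrm2 N (\<lambda>x. c * f x) = (cmod c)\<^sup>2 * nrm2 N f"
  by (simp add: nrm2_def norm_mult power_mult_distrib)

lemma nrm2_add:
  assumes "sqi N f" "sqi N g"
  shows "nrm2 N (\<lambda>x. f x + g x) = nrm2 N f + 2 * Re (ip N f g) + nrm2 N g"
proof -
  have s: "sqi N (\<lambda>x. f x + g x)" using assms by (rule sqi_add)
  have "complex_of_real (nrm2 N (\<lambda>x. f x + g x)) = ip N (\<lambda>x. f x + g x) f + ip N (\<lambda>x. f x + g x) g"
    by (simp add: ip_self[symmetric] ip_add_right s assms)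
  also have "\<dots> = cnj (ip N f (\<lambda>x. f x + g x)) + cnj (ip N g (\<lambda>x. f x + g x))"
    by (metis ip_cnj)
  also have "\<dots> = cnj (ip N f f + ip N f g + (cnj (ip N f g) + ip N g g))"
    using ip_cnj[of N g f] by (simp add: ip_add_right assms)
  finally have "Re (complex_of_real (nrm2 N (\<lambda>x. f x + g x))) = Re \<dots>" by (rule arg_cong)
  then show ?thesis by (simp add: ip_self)
qed

text \<open>The squared norm of \<open>g - t z f\<close> with \<open>z = ip N f g\<close> is
  nonnegative as a quadratic in real \<open>t\<close>.\<close>

lemma cauchy_schwarz:
  assumes "sqi N f" "sqi N g"
  shows "(cmod (ip N f g))\<^sup>2 \<le> nrm2 N f * nrm2 N g"
proof -
  define a where "a = nrm2 N f"
  define b where "b = nrm2 N g"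
  define z where "z = ip N f g"
  have *: "0 \<le> t\<^sup>2 * (cmod z)\<^sup>2 * a - 2 * t * (cmod z)\<^sup>2 + b" for t :: real
  proof -
    define c where "c = - of_real t * z"
    have "0 \<le> nrm2 N (\<lambda>x. c * f x + g x)" by (rule nrm2_nonneg)
    also have "\<dots> = nrm2 N (\<lambda>x. c * f x) + 2 * Re (ip N (\<lambda>x. c * f x) g) + nrm2 N g"
      by (intro nrm2_add sqi_cmult assms)
    also have "ip N (\<lambda>x. c * f x) g = cnj c * z"
      using ip_cnj[of N "\<lambda>x. c * f x" g] ip_cnj[of N f g] by (simp add: ip_cmult_right z_def)
    also have "cnj c * z = - of_real (t * (cmod z)\<^sup>2)"
      unfolding c_def by (simp add: complex_norm_square mult.commute)
        (metis complex_norm_square mult.commute of_real_power)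
    also have "Re \<dots> = - (t * (cmod z)\<^sup>2)" by (simp del: of_real_power of_real_mult)
    finally show ?thesis
      unfolding nrm2_cmult by (simp add: c_def norm_mult power_mult_distrib a_def b_def)
  qed
  show ?thesis
  proof (cases "a = 0")
    case True
    \<comment> \<open>With \<open>a = 0\<close> the quadratic is affine in \<open>t\<close> with
      slope \<open>-2 |z|^2\<close>, so it would become negative.\<close>
    have "(cmod z)\<^sup>2 \<le> 0"
    proof (rule ccontr)
      assume n: "\<not> ?thesis"
      from *[of "(b+1)/(cmod z)\<^sup>2"] True n have "2 * (b+1) \<le> b" by auto
      moreover have "b \<ge> 0" by (simp add: b_def nrm2_nonneg)
      ultimately show False by simp
    qed
    then show ?thesis using True by (simp add: a_def z_def)
  next
    case False
    then have a: "a > 0" using nrm2_nonneg[of N f] by (simp add: a_def)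
    from *[of "1/a"] have "0 \<le> (cmod z)\<^sup>2 / a - 2 * (cmod z)\<^sup>2 / a + b"
      using a by (simp add: power2_eq_square field_simps)
    then have "(cmod z)\<^sup>2 / a \<le> b" by simp
    then show ?thesis using a by (simp add: a_def b_def z_def field_simps)
  qed
qed

lemma orthonormal_ip_sum:
  assumes "orthonormal N I e" "finite F" "F \<subseteq> I" "i \<in> I"
  shows "ip N (e i) (\<lambda>x. \<Sum>j\<in>F. c j * e j x) = (if i \<in> F then c i else 0)"
proof -
  have "ip N (e i) (\<lambda>x. \<Sum>j\<in>F. c j * e j x) = (\<Sum>j\<in>F. ip N (e i) (\<lambda>x. c j * e j x))"
    using assms by (intro ip_sum_right sqi_cmult) (auto simp: orthonormal_def)
  also have "\<dots> = (\<Sum>j\<in>F. if i = j then c j else 0)"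
    using assms by (intro sum.cong) (auto simp: ip_cmult_right orthonormal_def subset_iff)
  finally show ?thesis using assms by simp
qed

lemma nrm2_orthonormal_sum:
  assumes "orthonormal N I e" "finite F" "F \<subseteq> I"
  shows "nrm2 N (\<lambda>x. \<Sum>j\<in>F. c j * e j x) = (\<Sum>j\<in>F. (cmod (c j))\<^sup>2)"
proof -
  define f where "f = (\<lambda>x. \<Sum>j\<in>F. c j * e j x)"
  have s: "sqi N f" unfolding f_def 
    using assms by (intro sqi_sum sqi_cmult) (auto simp: orthonormal_def)
  have "complex_of_real (nrm2 N f) = ip N f f" by (simp add: ip_self)
  also have "\<dots> = (\<Sum>j\<in>F. ip N f (\<lambda>x. c j * e j x))"
    apply (subst (2) f_def)
    using assms s by (intro ip_sum_right sqi_cmult) (auto simp: orthonormal_def)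
  also have "\<dots> = (\<Sum>j\<in>F. c j * cnj (c j))"
  proof (intro sum.cong refl)
    fix j assume j: "j \<in> F"
    have "ip N f (\<lambda>x. c j * e j x) = c j * cnj (ip N (e j) f)"
      by (metis ip_cmult_right ip_cnj)
    also have "ip N (e j) f = c j"
      unfolding f_def using orthonormal_ip_sum[OF assms, of j c] j assms(3) by auto
    finally show "ip N f (\<lambda>x. c j * e j x) = c j * cnj (c j)" .
  qed
  also have "\<dots> = complex_of_real (\<Sum>j\<in>F. (cmod (c j))\<^sup>2)"
    by (simp add: complex_norm_square[symmetric] del: of_real_power)
  finally show ?thesis unfolding f_def by (simp only: of_real_eq_iff)
qed

lemma nrm2_diff_orthonormal_sum:
  assumes "orthonormal N I e" "finite F" "F \<subseteq> I" "sqi N f"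
  shows "nrm2 N (\<lambda>x. f x - (\<Sum>j\<in>F. ip N (e j) f * e j x)) = nrm2 N f - (\<Sum>j\<in>F. (cmod (ip N (e j) f))\<^sup>2)"
proof -
  let ?g = "\<lambda>x. \<Sum>j\<in>F. ip N (e j) f * e j x"
  have s: "sqi N ?g"
    using assms by (intro sqi_sum sqi_cmult) (auto simp: orthonormal_def)
  have "nrm2 N (\<lambda>x. f x + (-1) * ?g x) = nrm2 N f + 2 * Re (ip N f (\<lambda>x. (-1) * ?g x)) + nrm2 N (\<lambda>x. (-1) * ?g x)"
    by (intro nrm2_add sqi_cmult s assms)
  also have "nrm2 N (\<lambda>x. (-1) * ?g x) = (\<Sum>j\<in>F. (cmod (ip N (e j) f))\<^sup>2)"
    by (subst nrm2_cmult) (simp add: nrm2_orthonormal_sum[OF assms(1-3)])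
  also have "ip N f (\<lambda>x. (-1) * ?g x) = - ip N f ?g"
    by (subst ip_cmult_right) simp
  also have "ip N f ?g = (\<Sum>j\<in>F. ip N f (\<lambda>x. ip N (e j) f * e j x))"
    using assms by (intro ip_sum_right sqi_cmult) (auto simp: orthonormal_def)
  also have "\<dots> = (\<Sum>j\<in>F. complex_of_real ((cmod (ip N (e j) f))\<^sup>2))"
    by (intro sum.cong refl) (simp add: ip_cmult_right complex_norm_square ip_cnj[of N f "e _"] del: of_real_power)
  finally show ?thesis by simp
qed

lemma bessel:
  assumes "orthonormal N I e" "finite F" "F \<subseteq> I" "sqi N f"
  shows "(\<Sum>j\<in>F. (cmod (ip N (e j) f))\<^sup>2) \<le> nrm2 N f"
  using nrm2_diff_orthonormal_sum[OF assms] nrm2_nonneg[of N "\<lambda>x. f x - (\<Sum>j\<in>F. ip N (e j) f * e j x)"]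
  by simp

lemma bessel_summable:
  assumes "orthonormal N (UNIV :: nat set) e" "sqi N f"
  shows "summable (\<lambda>i. (cmod (ip N (e i) f))\<^sup>2)"
  by (intro bounded_imp_summable[where B = "nrm2 N f"])
     (auto intro: bessel[OF assms(1)] assms(2))

text \<open>Cauchy-Schwarz against the constant 1, which is square integrable because the measure is
  finite.\<close>

lemma L1_le_nrm2:
  assumes "finite_measure N" "sqi N f"
  shows "integrable N (\<lambda>x. cmod (f x))" "(LINT x|N. cmod (f x)) \<le> sqrt (measure N (space N) * nrm2 N f)"
proof -
  interpret finite_measure N by fact
  have 1: "sqi N (\<lambda>x. 1)" by (simp add: sqi_def)
  have [measurable]: "f \<in> borel_measurable N" using assms by (auto simp: sqi_def)
  have a: "sqi N (\<lambda>x. complex_of_real (cmod (f x)))" using assms by (auto simp: sqi_def)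
  have "integrable N (\<lambda>x. cnj 1 * complex_of_real (cmod (f x)))" using sqi_mult_integrable[OF 1 a] by simp
  then have "integrable N (\<lambda>x. Re (complex_of_real (cmod (f x))))" by (intro integrable_Re) simp
  then show "integrable N (\<lambda>x. cmod (f x))" by simp
  have "ip N (\<lambda>x. 1) (\<lambda>x. complex_of_real (cmod (f x))) = complex_of_real (LINT x|N. cmod (f x))"
    by (simp add: ip_def)
  then have "(LINT x|N. cmod (f x))\<^sup>2 \<le> measure N (space N) * nrm2 N f"
    using cauchy_schwarz[OF 1 a] by (simp add: nrm2_def)
  then show "(LINT x|N. cmod (f x)) \<le> sqrt (measure N (space N) * nrm2 N f)"
    by (simp add: real_le_rsqrt)
qed

text \<open>A subsequence of the partial sums has summable increments in \<open>L\<^sup>1\<close>, hence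
  converges almost everywhere, and Fatou's lemma identifies its limit as the limit in \<open>L\<^sup>2\<close>.\<close>

lemma riesz_fischer:
  assumes fm: "finite_measure N" and on: "orthonormal N (UNIV :: nat set) e"
    and c: "summable (\<lambda>i. (cmod (c i))\<^sup>2)"
  obtains f where "sqi N f" "\<And>i. ip N (e i) f = c i"
    "nrm2 N f = (\<Sum>i. (cmod (c i))\<^sup>2)"
proof -
  interpret finite_measure N by fact
  define S where "S n = (\<lambda>x. \<Sum>i<n. c i * e i x)" for n
  define T where "T n = (\<Sum>i. (cmod (c (i + n)))\<^sup>2)" for n
  have sq: "sqi N (e i)" for i using on by (auto simp: orthonormal_def)
  have sS: "sqi N (S n)" for n unfolding S_def by (intro sqi_sum sqi_cmult sq)
  have [measurable]: "S n \<in> borel_measurable N" for n using sS by (auto simp: sqi_def)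
  have T: "T \<longlonglongrightarrow> 0" unfolding T_def using suminf_exist_split2[OF c] by simp
  have cs: "summable (\<lambda>i. (cmod (c (i + n)))\<^sup>2)" for n
    using c by (subst summable_iff_shift)
  have diff: "nrm2 N (\<lambda>x. S m x - S n x) \<le> T n" if "n \<le> m" for m n
  proof -
    have "(\<lambda>x. S m x - S n x) = (\<lambda>x. \<Sum>i\<in>{n..<m}. c i * e i x)"
    proof (rule ext)
      fix x
      have eq: "{..<m} = {..<n} \<union> {n..<m}" using that by auto
      have "S m x = S n x + (\<Sum>i\<in>{n..<m}. c i * e i x)"
        unfolding S_def eq by (subst sum.union_disjoint) auto
      then show "S m x - S n x = (\<Sum>i\<in>{n..<m}. c i * e i x)" by simp
    qed
    then have "nrm2 N (\<lambda>x. S m x - S n x) = (\<Sum>i\<in>{n..<m}. (cmod (c i))\<^sup>2)"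
      using nrm2_orthonormal_sum[OF on, of "{n..<m}" c] by simp
    also have "\<dots> = (\<Sum>i<m-n. (cmod (c (i+n)))\<^sup>2)"
      by (rule sum.reindex_bij_witness[of _ "\<lambda>i. i + n" "\<lambda>i. i - n"]) auto
    also have "\<dots> \<le> T n" unfolding T_def by (intro sum_le_suminf cs) auto
    finally show ?thesis .
  qed
  \<comment> \<open>Tails below \<open>4^-k\<close> give L1 increments below a multiple of
    \<open>2^-k\<close> by \<open>L1_le_nrm2\<close>, hence a summable series.\<close>
  have "\<exists>n>k. T n < (1/4)^j" for k j
  proof -
    have "eventually (\<lambda>n. T n < (1/4)^j) sequentially"
      using T by (rule order_tendstoD) simp
    then show ?thesis
      unfolding eventually_sequentially by (meson le_add2 less_add_Suc1 nat_le_linear order_less_le_trans)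
  qed
  then have "\<exists>r. \<forall>k. T (r k) < (1/4)^k \<and> r k < r (Suc k)"
    by (intro dependent_nat_choice) blast+
  then obtain r where "\<And>k. T (r k) < (1/4)^k" "\<And>k. r k < r (Suc k)"
    by blast
  then have r: "strict_mono r" "\<And>k. T (r k) < (1/4)^k"
    by (auto intro: strict_monoI_Suc)
  have r_mono: "r k \<le> r j" if "k \<le> j" for k j
    using r(1) that by (simp add: strict_mono_less_eq)
  define G where "G k = (\<lambda>x. S (r (Suc k)) x - S (r k) x)" for k
  have sG: "sqi N (G k)" for k unfolding G_def by (intro sqi_diff sS)
  have [measurable]: "G k \<in> borel_measurable N" for k using sG by (auto simp: sqi_def)
  define K where "K = sqrt (measure N (space N))"
  have L1: "(LINT x|N. cmod (G k x)) \<le> K * (1/2)^k" for k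
  proof -
    have "(LINT x|N. cmod (G k x)) \<le> sqrt (measure N (space N) * nrm2 N (G k))"
      by (rule L1_le_nrm2[OF fm sG])
    also have "\<dots> \<le> sqrt (measure N (space N) * (1/4)^k)"
      using diff[OF r_mono, of k "Suc k"] r(2)[of k]
      by (intro real_sqrt_le_mono mult_left_mono) (auto simp: G_def)
    also have "\<dots> = K * (1/2)^k"
    proof -
      have "(1/4::real)^k = ((1/2)^k)\<^sup>2"
        by (simp add: power2_eq_square flip: power_mult_distrib)
      then show ?thesis
        by (simp add: K_def real_sqrt_mult)
    qed
    finally show ?thesis .
  qed
  have "(\<integral>\<^sup>+x. (\<Sum>k. ennreal (cmod (G k x))) \<partial>N) = (\<Sum>k. \<integral>\<^sup>+x. ennreal (cmod (G k x)) \<partial>N)"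
    by (intro nn_integral_suminf) measurable
  also have "\<dots> \<le> (\<Sum>k. ennreal (K * (1/2)^k))"
    using L1 by (intro suminf_le allI)
      (auto simp: nn_integral_eq_integral L1_le_nrm2(1)[OF fm sG] intro!: ennreal_leI)
  also have "\<dots> = ennreal (\<Sum>k. K * (1/2)^k)"
    by (intro suminf_ennreal2 summable_mult summable_geometric) (auto simp: K_def)
  finally have "(\<integral>\<^sup>+x. (\<Sum>k. ennreal (cmod (G k x))) \<partial>N) \<noteq> \<infinity>"
    by (auto simp: top_unique)
  then have "AE x in N. (\<Sum>k. ennreal (cmod (G k x))) \<noteq> \<infinity>"
    by (intro nn_integral_PInf_AE) measurable
  then have conv: "AE x in N. convergent (\<lambda>k. S (r k) x)"
  proof eventually_elim
    case (elim x)
    then have "summable (\<lambda>k. cmod (G k x))"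
      by (intro summable_suminf_not_top) auto
    then have "summable (\<lambda>k. G k x)" by (rule summable_norm_cancel)
    then have "convergent (\<lambda>n. \<Sum>k<n. G k x)" by (simp add: summable_iff_convergent)
    also have "(\<lambda>n. \<Sum>k<n. G k x) = (\<lambda>n. S (r n) x - S (r 0) x)"
      unfolding G_def by (rule ext) (rule sum_lessThan_telescope)
    finally have "convergent (\<lambda>n. S (r n) x - S (r 0) x + S (r 0) x)"
      by (intro convergent_add convergent_const)
    then show ?case by simp
  qed
  define f where "f = (\<lambda>x. lim (\<lambda>k. S (r k) x))"
  have [measurable]: "f \<in> borel_measurable N" unfolding f_def by measurable
  have lim: "AE x in N. (\<lambda>k. S (r k) x) \<longlonglongrightarrow> f x"
    using conv by eventually_elim (simp add: f_def convergent_LIMSEQ_iff)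
  \<comment> \<open>Fatou along the subsequence: \<open>f - S n\<close> is the almost everywhere
    limit of \<open>S (r k) - S n\<close>, whose squared norms are at most \<open>T n\<close> as
    soon as \<open>n \<le> r k\<close>.\<close>
  have tail: "(\<integral>\<^sup>+x. ennreal ((cmod (f x - S n x))\<^sup>2) \<partial>N) \<le> ennreal (T n)" for n
  proof -
    have "(\<integral>\<^sup>+x. ennreal ((cmod (f x - S n x))\<^sup>2) \<partial>N) = 
          (\<integral>\<^sup>+x. liminf (\<lambda>k. ennreal ((cmod (S (r k) x - S n x))\<^sup>2)) \<partial>N)"
    proof (intro nn_integral_cong_AE, use lim in eventually_elim)
      case (elim x)
      then have "(\<lambda>k. ennreal ((cmod (S (r k) x - S n x))\<^sup>2)) \<longlonglongrightarrow> ennreal ((cmod (f x - S n x))\<^sup>2)"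
        by (intro tendsto_ennrealI tendsto_intros)
      then show ?case by (intro lim_imp_Liminf[symmetric]) auto
    qed
    also have "\<dots> \<le> liminf (\<lambda>k. \<integral>\<^sup>+x. ennreal ((cmod (S (r k) x - S n x))\<^sup>2) \<partial>N)"
      by (intro nn_integral_liminf) measurable
    also have "\<dots> \<le> ennreal (T n)"
    proof (rule Liminf_le)
      have "eventually (\<lambda>k. n \<le> r k) sequentially"
        using filterlim_subseq[OF r(1)] by (simp add: filterlim_at_top)
      then show "\<forall>\<^sub>F k in sequentially. (\<integral>\<^sup>+x. ennreal ((cmod (S (r k) x - S n x))\<^sup>2) \<partial>N) \<le> ennreal (T n)"
      proof eventually_elim
        case (elim k)
        have "(\<integral>\<^sup>+x. ennreal ((cmod (S (r k) x - S n x))\<^sup>2) \<partial>N) = ennreal (nrm2 N (\<lambda>x. S (r k) x - S n x))"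
          unfolding nrm2_def using sqi_diff[OF sS sS] by (intro nn_integral_eq_integral) (auto simp: sqi_def)
        also have "\<dots> \<le> ennreal (T n)" by (intro ennreal_leI diff elim)
        finally show ?case .
      qed
    qed simp
    finally show ?thesis .
  qed
  have T_nonneg: "T n \<ge> 0" for n unfolding T_def by (intro suminf_nonneg cs) auto
  have sd: "sqi N (\<lambda>x. f x - S n x)" for n
  proof -
    have "integrable N (\<lambda>x. (cmod (f x - S n x))\<^sup>2)"
      using order_le_less_trans[OF tail[of n]] by (intro integrableI_nonneg) auto
    then show ?thesis by (auto simp: sqi_def)
  qed
  have "nrm2 N (\<lambda>x. f x - S n x) \<le> T n" for n
  proof -
    have "ennreal (nrm2 N (\<lambda>x. f x - S n x)) = (\<integral>\<^sup>+x. ennreal ((cmod (f x - S n x))\<^sup>2) \<partial>N)"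
      unfolding nrm2_def using sd[of n] by (intro nn_integral_eq_integral[symmetric]) (auto simp: sqi_def)
    also have "\<dots> \<le> ennreal (T n)" by (rule tail)
    finally show ?thesis using T_nonneg[of n] by simp
  qed
  then have dn: "(\<lambda>n. nrm2 N (\<lambda>x. f x - S n x)) \<longlonglongrightarrow> 0"
    by (intro tendsto_sandwich[OF _ _ tendsto_const T]) (auto simp: nrm2_nonneg)
  have sf: "sqi N f" using sqi_add[OF sd[of 0] sS[of 0]] by simp
  have coef: "ip N (e i) f = c i" for i
  proof -
    have "(cmod (ip N (e i) f - c i))\<^sup>2 \<le> nrm2 N (\<lambda>x. f x - S n x)" if "n > i" for n
    proof -
      have "ip N (e i) (\<lambda>x. f x - S n x) = ip N (e i) f - c i"
        using orthonormal_ip_sum[OF on, of "{..<n}" i c] that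
        by (simp add: ip_diff_right sq sf sS) (simp add: S_def)
      then show ?thesis using cauchy_schwarz[OF sq[of i] sd[of n]] 
        using on by (simp add: orthonormal_def) (metis mult_1 of_real_eq_1_iff ip_self)
    qed
    then have "(cmod (ip N (e i) f - c i))\<^sup>2 \<le> 0"
      by (intro LIMSEQ_le_const[OF dn]) (auto intro!: exI[of _ "Suc i"])
    then show ?thesis by simp
  qed
  have "nrm2 N (\<lambda>x. f x - S n x) = nrm2 N f - (\<Sum>i<n. (cmod (c i))\<^sup>2)" for n
    using nrm2_diff_orthonormal_sum[OF on _ _ sf, of "{..<n}"] by (simp add: coef S_def)
  then have "(\<lambda>n. nrm2 N f - nrm2 N (\<lambda>x. f x - S n x)) = (\<lambda>n. \<Sum>i<n. (cmod (c i))\<^sup>2)" by simp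
  moreover have "(\<lambda>n. nrm2 N f - nrm2 N (\<lambda>x. f x - S n x)) \<longlonglongrightarrow> nrm2 N f - 0"
    by (intro tendsto_intros dn)
  ultimately have "(\<lambda>i. (cmod (c i))\<^sup>2) sums nrm2 N f" by (simp add: sums_def)
  then have "nrm2 N f = (\<Sum>i. (cmod (c i))\<^sup>2)" by (simp add: sums_iff)
  with sf coef show ?thesis by (rule that)
qed

definition total :: "'a measure \<Rightarrow> (nat \<Rightarrow> 'a \<Rightarrow> complex) \<Rightarrow> bool" where
  "total N e \<longleftrightarrow> orthonormal N UNIV e \<and>
     (\<forall>f. sqi N f \<longrightarrow> (\<forall>i. ip N (e i) f = 0) \<longrightarrow> (AE x in N. f x = 0))"

text \<open>Riesz-Fischer produces \<open>g\<close> with the coefficients of \<open>f\<close> and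
  with norm equal to the coefficient sum; totality forces \<open>f = g\<close> almost everywhere.
  This passes from completeness as a trivial orthogonal complement, which is how
  \<open>orthonormal_basis\<close> states it, to the expansion of norms.\<close>

lemma parseval:
  assumes fm: "finite_measure N" and tot: "total N e" and f: "sqi N f"
  shows "(\<lambda>i. (cmod (ip N (e i) f))\<^sup>2) sums nrm2 N f"
proof -
  have on: "orthonormal N UNIV e" using tot by (simp add: total_def)
  have sq: "sqi N (e i)" for i using on by (auto simp: orthonormal_def)
  have sm: "summable (\<lambda>i. (cmod (ip N (e i) f))\<^sup>2)" by (rule bessel_summable[OF on f])
  obtain g where g: "sqi N g" "\<And>i. ip N (e i) g = ip N (e i) f" 
    "nrm2 N g = (\<Sum>i. (cmod (ip N (e i) f))\<^sup>2)"
    using riesz_fischer[OF fm on sm] by blast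
  have "AE x in N. f x - g x = 0"
    using tot sqi_diff[OF f g(1)] unfolding total_def 
    by (auto simp add: ip_diff_right sq f g simp del: right_minus_eq)
  then have "nrm2 N f = nrm2 N g" unfolding nrm2_def
    using f g(1) by (intro integral_cong_AE) (auto simp: sqi_def)
  with sm g(3) show ?thesis by (simp add: sums_iff)
qed

text \<open>The error after \<open>n\<close> terms is the inner product of \<open>f\<close> with the
  remainder of \<open>g\<close>; Cauchy-Schwarz and Parseval for \<open>g\<close> send it to
  0.\<close>

lemma parseval_polarised:
  assumes fm: "finite_measure N" and tot: "total N e" and f: "sqi N f" and g: "sqi N g"
  shows "(\<lambda>i. cnj (ip N (e i) f) * ip N (e i) g) sums ip N f g"
proof -
  have on: "orthonormal N UNIV e" using tot by (simp add: total_def)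
  have sq: "sqi N (e i)" for i using on by (auto simp: orthonormal_def)
  define S where "S n = (\<lambda>x. \<Sum>i<n. ip N (e i) g * e i x)" for n
  have sS: "sqi N (S n)" for n unfolding S_def by (intro sqi_sum sqi_cmult sq)
  have eq: "ip N f g - (\<Sum>i<n. cnj (ip N (e i) f) * ip N (e i) g) = ip N f (\<lambda>x. g x - S n x)" for n
  proof -
    have "ip N f (S n) = (\<Sum>i<n. ip N (e i) g * cnj (ip N (e i) f))"
      unfolding S_def using sq f
      by (subst ip_sum_right) (auto simp: ip_cmult_right sqi_cmult ip_cnj[of N f "e _"])
    also have "\<dots> = (\<Sum>i<n. cnj (ip N (e i) f) * ip N (e i) g)"
      by (rule sum.cong[OF refl mult.commute])
    finally have "ip N f (S n) = (\<Sum>i<n. cnj (ip N (e i) f) * ip N (e i) g)" .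
    then show ?thesis by (simp add: ip_diff_right f g sS)
  qed
  have "(\<lambda>n. nrm2 N g - (\<Sum>i<n. (cmod (ip N (e i) g))\<^sup>2)) \<longlonglongrightarrow> nrm2 N g - nrm2 N g"
    using parseval[OF fm tot g] by (intro tendsto_diff tendsto_const) (simp add: sums_def)
  moreover have "nrm2 N (\<lambda>x. g x - S n x) = nrm2 N g - (\<Sum>i<n. (cmod (ip N (e i) g))\<^sup>2)" for n
    unfolding S_def by (rule nrm2_diff_orthonormal_sum[OF on]) (auto simp: g)
  ultimately have lim: "(\<lambda>n. nrm2 N (\<lambda>x. g x - S n x)) \<longlonglongrightarrow> 0" by simp
  have lim: "(\<lambda>n. sqrt (nrm2 N f * nrm2 N (\<lambda>x. g x - S n x))) \<longlonglongrightarrow> 0"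
    using tendsto_real_sqrt[OF tendsto_mult_right_zero[OF lim, of "nrm2 N f"]] by simp
  have le: "cmod (ip N f g - (\<Sum>i<n. cnj (ip N (e i) f) * ip N (e i) g)) \<le> sqrt (nrm2 N f * nrm2 N (\<lambda>x. g x - S n x))" for n
    unfolding eq using cauchy_schwarz[OF f sqi_diff[OF g sS]] by (rule real_le_rsqrt)
  have "(\<lambda>n. ip N f g - (\<Sum>i<n. cnj (ip N (e i) f) * ip N (e i) g)) \<longlonglongrightarrow> 0"
    by (rule Lim_null_comparison[OF always_eventually[OF allI] lim]) (rule le)
  from tendsto_diff[OF tendsto_const this, of "ip N f g"] show ?thesis by (simp add: sums_def)
qed

section \<open>Eigenfunctions of the Dirichlet Laplacian\<close>

lemma vector_derivative_zero_eq:
  fixes f :: "real \<Rightarrow> complex"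
  assumes "a < b" "\<And>x. x \<in> {a..b} \<Longrightarrow> (f has_vector_derivative 0) (at x within {a..b})" "x \<in> {a..b}"
  shows "f x = f a"
proof -
  obtain c where "\<And>x. x \<in> {a..b} \<Longrightarrow> f x = c"
    using has_vector_derivative_zero_constant[of "{a..b}" f] assms(2) by (auto simp: convex_real_interval)
  then show ?thesis using assms by auto
qed

lemma has_vector_derivative_complex_trig:
  fixes w :: complex
  shows "((\<lambda>x. sin (w * of_real (x - a))) has_vector_derivative w * cos (w * of_real (x - a))) (at x within S)"
    and "((\<lambda>x. cos (w * of_real (x - a))) has_vector_derivative - w * sin (w * of_real (x - a))) (at x within S)"
proof -
  have "((\<lambda>z. sin (w * (z - of_real a))) has_field_derivative w * cos (w * (of_real x - of_real a))) (at (of_real x))"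
    by (auto intro!: derivative_eq_intros)
  from has_vector_derivative_real_field[OF this]
  show "((\<lambda>x. sin (w * of_real (x - a))) has_vector_derivative w * cos (w * of_real (x - a))) (at x within S)"
    by simp
  have "((\<lambda>z. cos (w * (z - of_real a))) has_field_derivative - w * sin (w * (of_real x - of_real a))) (at (of_real x))"
    by (auto intro!: derivative_eq_intros)
  from has_vector_derivative_real_field[OF this]
  show "((\<lambda>x. cos (w * of_real (x - a))) has_vector_derivative - w * sin (w * of_real (x - a))) (at x within S)"
    by simp
qed

text \<open>The two combinations of \<open>u\<close> and \<open>v\<close> below are the coefficients in the variation of constants.\<close>

lemma harmonic_ode:
  fixes u v :: "real \<Rightarrow> complex" and w :: complex
  assumes ab: "a < b" and w: "w \<noteq> 0"
    and u: "\<And>x. x \<in> {a..b} \<Longrightarrow> (u has_vector_derivative v x) (at x within {a..b})"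
    and v: "\<And>x. x \<in> {a..b} \<Longrightarrow> (v has_vector_derivative - (w\<^sup>2) * u x) (at x within {a..b})"
    and x: "x \<in> {a..b}" and ua: "u a = 0"
  shows "u x = v a / w * sin (w * of_real (x - a))"
proof -
  define s where "s x = sin (w * of_real (x - a))" for x
  define c where "c x = cos (w * of_real (x - a))" for x
  have ds: "(s has_vector_derivative w * c x) (at x within S)" for x S
    unfolding s_def c_def by (rule has_vector_derivative_complex_trig)
  have dc: "(c has_vector_derivative - w * s x) (at x within S)" for x S
    unfolding s_def c_def by (rule has_vector_derivative_complex_trig)
  define A where "A x = u x * c x - v x / w * s x" for x
  define B where "B x = u x * s x + v x / w * c x" for x
  have dv: "((\<lambda>x. v x / w) has_vector_derivative - w * u x) (at x within {a..b})" if "x \<in> {a..b}" for x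
    using has_vector_derivative_mult_right[OF v[OF that], of "inverse w"] w
    by (simp add: field_simps power2_eq_square)
  have "(A has_vector_derivative 0) (at x within {a..b})" if "x \<in> {a..b}" for x
    unfolding A_def
    by (rule has_vector_derivative_eq_rhs, rule has_vector_derivative_diff[OF
        has_vector_derivative_mult[OF u[OF that] dc] has_vector_derivative_mult[OF dv[OF that] ds]])
       (use w in \<open>simp add: field_simps\<close>)
  then have A: "A x = A a" using vector_derivative_zero_eq[OF ab _ x] by blast
  have "(B has_vector_derivative 0) (at x within {a..b})" if "x \<in> {a..b}" for x
    unfolding B_def
    by (rule has_vector_derivative_eq_rhs, rule has_vector_derivative_add[OF
        has_vector_derivative_mult[OF u[OF that] ds] has_vector_derivative_mult[OF dv[OF that] dc]])
       (use w in \<open>simp add: field_simps\<close>)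
  then have B: "B x = B a" using vector_derivative_zero_eq[OF ab _ x] by blast
  have sc: "s x * s x + c x * c x = 1" 
    unfolding s_def c_def using sin_cos_squared_add[of "w * of_real (x - a)"] by (simp only: power2_eq_square)
  have "u x = u x * (s x * s x + c x * c x)" by (simp add: sc)
  also have "\<dots> = A x * c x + B x * s x" by (simp add: A_def B_def algebra_simps)
  also have "\<dots> = v a / w * s x" unfolding A B by (simp add: A_def B_def ua s_def c_def)
  finally show ?thesis by (simp add: s_def)
qed

lemma L2_set_integrable:
  assumes "L2 S f" "S \<in> sets borel" "emeasure lborel S < \<infinity>"
  shows "set_integrable lborel S f"
  unfolding set_integrable_def
proof (rule Bochner_Integration.integrable_bound)
  show "integrable lborel (\<lambda>x. indicator S x + indicator S x *\<^sub>R (cmod (f x))\<^sup>2)"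
    using assms by (intro Bochner_Integration.integrable_add) (auto simp: L2_def set_integrable_def)
  show "(\<lambda>x. indicator S x *\<^sub>R f x) \<in> borel_measurable lborel"
    using assms by (auto simp: L2_def set_borel_measurable_def)
  have "t \<le> 1 + t\<^sup>2" for t :: real using zero_le_power2[of "t - 1/2"] by (simp add: power2_eq_square field_simps)
  then show "AE x in lborel. norm (indicator S x *\<^sub>R f x) \<le> norm (indicat_real S x + indicator S x *\<^sub>R (cmod (f x))\<^sup>2)"
    by (auto simp: indicator_def)
qed

text \<open>Bootstrapping: \<open>v\<close> is an indefinite integral, hence continuous, so
  \<open>u\<close> is continuously differentiable, and then \<open>v\<close> is differentiable with
  derivative \<open>-2 E u\<close>. The explicit solution that vanishes at \<open>a\<close> is
  compared with the condition at \<open>b\<close>. The alternative of vanishing almost everywhere is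
  essential: an eigenfunction of the direct sum may be zero on a given gap.\<close>

lemma dirichlet_eigenfunction:
  assumes ab: "a < b" and ham: "dirichlet_hamiltonian {a<..<b} f (\<lambda>x. complex_of_real E * f x)"
  shows "(AE x in lborel. x \<in> {a<..<b} \<longrightarrow> f x = 0) \<or>
    (\<exists>n::nat. \<exists>c. E = (real (Suc n) * pi / (b - a))\<^sup>2 / 2 \<and>
      (AE x in lborel. x \<in> {a<..<b} \<longrightarrow>
         f x = c * complex_of_real (sin (real (Suc n) * pi * (x - a) / (b - a)))))"
proof -
  let ?J = "{a<..<b}"
  have J: "Inf ?J = a" "Sup ?J = b" using ab by auto
  obtain u v where f_u: "AE x in lborel. x \<in> ?J \<longrightarrow> f x = u x" and u0: "u a = 0" "u b = 0"
    and u: "\<And>x. x \<in> {a..b} \<Longrightarrow> u x = u a + (LINT t:{a..x}|lborel. v t)"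
    and v: "\<And>x. x \<in> {a..b} \<Longrightarrow> v x = v a + (LINT t:{a..x}|lborel. - 2 * (complex_of_real E * f t))"
    using ham unfolding dirichlet_hamiltonian_def J by blast
  have u: "u x = (LINT t:{a..x}|lborel. v t)" if "x \<in> {a..b}" for x
    using u[OF that] u0 by (simp only: add_0)
  have L2f: "L2 ?J f" using ham by (simp add: dirichlet_hamiltonian_def)
  \<comment> \<open>Square integrability on the open interval says nothing about the values at
    \<open>a\<close> and \<open>b\<close>, whereas the defining integrals run over closed intervals;
    \<open>F\<close> removes the end points, a null set.\<close>
  define F where "F = (\<lambda>t. indicator ?J t *\<^sub>R f t)"
  have F[measurable]: "F \<in> borel_measurable borel"
    using L2f by (simp add: F_def L2_def set_borel_measurable_def)
  have Fint: "integrable lborel F"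
    using L2_set_integrable[OF L2f] ab by (simp add: F_def set_integrable_def)
  have nul: "AE t in lborel. t \<noteq> a \<and> t \<noteq> b"
    using AE_lborel_singleton[of a] AE_lborel_singleton[of b] by eventually_elim auto
  have fF: "(LINT t:{a..x}|lborel. - 2 * (complex_of_real E * f t)) = integral {a..x} (\<lambda>t. - 2 * (complex_of_real E * F t))"
    if "x \<in> {a..b}" for x
  proof -
    have eq: "(\<lambda>t. indicator {a..x} t *\<^sub>R f t) =
      (\<lambda>t. if t = a then indicator {a..x} a *\<^sub>R f a else if t = b then indicator {a..x} b *\<^sub>R f b
        else indicator {a..x} t *\<^sub>R F t)"
      using that by (auto simp: fun_eq_iff F_def indicator_def)
    have [measurable]: "(\<lambda>t. indicator {a..x} t *\<^sub>R f t) \<in> borel_measurable lborel"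
      unfolding eq by measurable
    have "(LINT t:{a..x}|lborel. - 2 * (complex_of_real E * f t)) = 
          (LINT t|lborel. - 2 * (complex_of_real E * (indicator {a..x} t *\<^sub>R f t)))"
      unfolding set_lebesgue_integral_def by (intro Bochner_Integration.integral_cong) (auto simp: indicator_def)
    also have "\<dots> = (LINT t|lborel. - 2 * (complex_of_real E * (indicator {a..x} t *\<^sub>R F t)))"
    proof (rule integral_cong_AE)
      show "AE t in lborel. - 2 * (complex_of_real E * (indicator {a..x} t *\<^sub>R f t)) = - 2 * (complex_of_real E * (indicator {a..x} t *\<^sub>R F t))"
        using nul by eventually_elim (use that in \<open>auto simp: F_def indicator_def\<close>)
    qed measurable
    also have "\<dots> = (LINT t:{a..x}|lborel. - 2 * (complex_of_real E * F t))"
      unfolding set_lebesgue_integral_def by (intro Bochner_Integration.integral_cong) (auto simp: indicator_def)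
    also have "\<dots> = integral {a..x} (\<lambda>t. - 2 * (complex_of_real E * F t))"
      by (intro set_borel_integral_eq_integral(2))
        (use Fint in \<open>auto simp: set_integrable_def intro!: integrable_mult_indicator\<close>)
    finally show ?thesis .
  qed
  have int: "(\<lambda>t. - 2 * (complex_of_real E * F t)) integrable_on {a..b}"
    by (intro set_borel_integral_eq_integral(1))
      (use Fint in \<open>auto simp: set_integrable_def intro!: integrable_mult_indicator\<close>)
  have "continuous_on {a..b} (\<lambda>x. v a + integral {a..x} (\<lambda>t. - 2 * (complex_of_real E * F t)))"
    by (intro continuous_intros indefinite_integral_continuous_1 int)
  then have cv: "continuous_on {a..b} v"
  proof (rule continuous_on_eq)
    fix x assume x: "x \<in> {a..b}"
    show "v a + integral {a..x} (\<lambda>t. - 2 * (complex_of_real E * F t)) = v x"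
      using v[OF x] fF[OF x] by simp
  qed
  have u': "u x = integral {a..x} v" if "x \<in> {a..b}" for x
  proof -
    have "continuous_on {a..x} v" using cv by (rule continuous_on_subset) (use that in auto)
    then show ?thesis unfolding u[OF that]
      by (intro set_borel_integral_eq_integral(2) borel_integrable_atLeastAtMost')
  qed
  have du: "(u has_vector_derivative v x) (at x within {a..b})" if "x \<in> {a..b}" for x
    by (rule has_vector_derivative_transform[OF that _ integral_has_vector_derivative[OF cv that]])
       (use u' in auto)
  have cu: "continuous_on {a..b} u"
    using du by (metis continuous_on_eq_continuous_within has_vector_derivative_continuous)
  have v': "v x = v a + integral {a..x} (\<lambda>t. - 2 * (complex_of_real E * u t))" if "x \<in> {a..b}" for x
  proof -
    have cux: "continuous_on {a..x} (\<lambda>t. - 2 * (complex_of_real E * u t))"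
      using cu by (intro continuous_intros) (use that in \<open>auto elim: continuous_on_subset\<close>)
    have 1: "set_integrable lborel {a..x} (\<lambda>t. - 2 * (complex_of_real E * u t))"
      by (rule borel_integrable_atLeastAtMost'[OF cux])
    have "integral {a..x} (\<lambda>t. - 2 * (complex_of_real E * F t)) = (LINT t:{a..x}|lborel. - 2 * (complex_of_real E * F t))"
      by (intro set_borel_integral_eq_integral(2)[symmetric])
        (use Fint in \<open>auto simp: set_integrable_def intro!: integrable_mult_indicator\<close>)
    also have "\<dots> = (LINT t:{a..x}|lborel. - 2 * (complex_of_real E * u t))"
      unfolding set_lebesgue_integral_def
    proof (rule integral_cong_AE)
      show "(\<lambda>t. indicat_real {a..x} t *\<^sub>R (- 2 * (complex_of_real E * u t))) \<in> borel_measurable lborel"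
        using 1 by (auto simp: set_integrable_def)
      show "AE t in lborel. indicat_real {a..x} t *\<^sub>R (- 2 * (complex_of_real E * F t)) = indicat_real {a..x} t *\<^sub>R (- 2 * (complex_of_real E * u t))"
        using f_u nul by eventually_elim (use that in \<open>auto simp: F_def indicator_def\<close>)
    qed measurable
    also have "\<dots> = integral {a..x} (\<lambda>t. - 2 * (complex_of_real E * u t))"
      by (intro set_borel_integral_eq_integral(2) 1)
    finally show ?thesis using v[OF that] fF[OF that] by simp
  qed
  have dv: "(v has_vector_derivative - 2 * (complex_of_real E * u x)) (at x within {a..b})" if "x \<in> {a..b}" for x
  proof (rule has_vector_derivative_transform[OF that])
    show "v y = v a + integral {a..y} (\<lambda>t. - 2 * (complex_of_real E * u t))" if "y \<in> {a..b}" for y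
      by (rule v'[OF that])
    have "continuous_on {a..b} (\<lambda>t. - 2 * (complex_of_real E * u t))" by (intro continuous_intros cu)
    from integral_has_vector_derivative[OF this that]
    show "((\<lambda>x. v a + integral {a..x} (\<lambda>t. - 2 * (complex_of_real E * u t))) has_vector_derivative 
        - 2 * (complex_of_real E * u x)) (at x within {a..b})"
      using has_vector_derivative_add[OF has_vector_derivative_const[of "v a"]] by fastforce
  qed
  have zero: ?thesis if "\<And>x. x \<in> {a..b} \<Longrightarrow> u x = 0"
  proof -
    have "AE x in lborel. x \<in> ?J \<longrightarrow> f x = 0" using f_u by eventually_elim (use that in auto)
    then show ?thesis ..
  qed
  show ?thesis
  proof (cases "E = 0")
    case True
    have vc: "v x = v a" if "x \<in> {a..b}" for x
      using vector_derivative_zero_eq[OF ab _ that, of v] dv True by simp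
    have "((\<lambda>x. u x - of_real (x - a) * v a) has_vector_derivative 0) (at x within {a..b})" if "x \<in> {a..b}" for x
      by (rule derivative_eq_intros du[OF that] | simp add: vc[OF that])+
    from vector_derivative_zero_eq[OF ab this] have ux: "u x = of_real (x - a) * v a" if "x \<in> {a..b}" for x
      using that u0 by fastforce
    from ux[of b] u0 ab have "v a = 0" by simp
    with ux show ?thesis by (intro zero) simp
  next
    case False
    \<comment> \<open>A complex root treats positive and negative \<open>E\<close> alike: complex
      \<open>sin\<close> vanishes only at real multiples of \<open>pi\<close>, which excludes
      negative energies.\<close>
    define w where "w = csqrt (2 * complex_of_real E)"
    have w2: "w\<^sup>2 = 2 * complex_of_real E" by (simp add: w_def)
    have w0: "w \<noteq> 0" using False by (simp add: w_def)
    have ux: "u x = v a / w * sin (w * of_real (x - a))" if "x \<in> {a..b}" for x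
      by (rule harmonic_ode[OF ab w0 du _ that u0(1)]) (use dv w2 in \<open>simp_all add: mult.assoc\<close>)
    show ?thesis
    proof (cases "v a = 0")
      case True
      then show ?thesis using ux by (intro zero) simp
    next
      case va: False
      have "sin (w * of_real (b - a)) = 0"
        using ux[of b] u0 ab va w0 by auto
      then obtain k :: int where k: "w * of_real (b - a) = of_real (real_of_int k * pi)"
        by (auto simp: Complex_Transcendental.sin_eq_0)
      then have wk: "w = of_real (real_of_int k * pi / (b - a))"
        using ab by (simp add: field_simps)
      have k0: "k \<noteq> 0" using wk w0 by auto
      \<comment> \<open>The sign of \<open>k\<close> is moved into the constant \<open>c\<close>,
        and modes are counted from 0.\<close>
      define n where "n = nat \<bar>k\<bar> - 1"
      have n: "real (Suc n) = \<bar>real_of_int k\<bar>" using k0 by (simp add: n_def)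
      have "complex_of_real (2 * E) = of_real ((real_of_int k * pi / (b - a))\<^sup>2)"
        using w2 unfolding wk by simp
      then have "2 * E = (real_of_int k * pi / (b - a))\<^sup>2" by (simp only: of_real_eq_iff)
      then have E: "E = (real (Suc n) * pi / (b - a))\<^sup>2 / 2"
        unfolding n by (simp add: power_divide power_mult_distrib)
      have sk: "sin (w * of_real (x - a)) = of_real (sgn (real_of_int k)) * of_real (sin (real (Suc n) * pi * (x - a) / (b - a)))" for x
      proof -
        have "sin (w * of_real (x - a)) = of_real (sin (real_of_int k * pi / (b - a) * (x - a)))"
          unfolding wk by (simp flip: sin_of_real)
        also have "sin (real_of_int k * pi / (b - a) * (x - a)) = sgn (real_of_int k) * sin (real (Suc n) * pi * (x - a) / (b - a))"
          unfolding n using k0 by (cases "k > 0") (auto simp: sgn_if)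
        finally show ?thesis by simp
      qed
      have "AE x in lborel. x \<in> ?J \<longrightarrow> f x = (v a / w * of_real (sgn (real_of_int k))) * of_real (sin (real (Suc n) * pi * (x - a) / (b - a)))"
        using f_u by eventually_elim (use ux sk in \<open>auto simp: mult.assoc\<close>)
      with E show ?thesis by blast
    qed
  qed
qed

section \<open>Mean occupation numbers\<close>

text \<open>The traces over Fock space are computed as integrals against counting measure, where
  sums of nonnegative terms may be interchanged freely; this returns to the unordered sums of
  \<open>gibbs_state\<close>.\<close>

lemma has_sum_nn_integral:
  fixes g :: "'a \<Rightarrow> real"
  assumes nonneg: "\<And>x. g x \<ge> 0" and c: "c \<ge> 0"
    and int: "(\<integral>\<^sup>+x. ennreal (g x) \<partial>count_space UNIV) = ennreal c"
  shows "(g has_sum c) UNIV"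
proof -
  have "integrable (count_space UNIV) g"
    using int by (intro integrableI_nonneg) (auto simp: nonneg)
  then have "Infinite_Set_Sum.abs_summable_on g UNIV"
    by (simp add: Infinite_Set_Sum.abs_summable_on_def)
  then have "infsum g UNIV = infsetsum g UNIV" by (simp add: infsetsum_infsum)
  also have "\<dots> = c"
    unfolding infsetsum_def by (subst integral_eq_nn_integral) (auto simp: nonneg int c)
  finally have "infsum g UNIV = c" .
  moreover have "g summable_on UNIV"
    using \<open>Infinite_Set_Sum.abs_summable_on g UNIV\<close>
    by (metis abs_summable_equivalent abs_summable_summable)
  ultimately show ?thesis by (metis has_sum_infsum)
qed

text \<open>With \<open>x i = exp (- \<beta> * (E i - \<mu>))\<close> this is the Boltzmann factor
  of the configuration \<open>\<eta>\<close>.\<close>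

definition mweight :: "(nat \<Rightarrow> real) \<Rightarrow> nat multiset \<Rightarrow> real" where
  "mweight x \<eta> = (\<Prod>i\<in>#\<eta>. x i)"

lemma mweight_nonneg: "(\<And>i. x i \<ge> 0) \<Longrightarrow> mweight x \<eta> \<ge> 0"
  unfolding mweight_def by (induction \<eta>) auto

lemma mweight_add: "mweight x (\<eta> + \<zeta>) = mweight x \<eta> * mweight x \<zeta>"
  by (simp add: mweight_def)

lemma mweight_replicate: "mweight x (replicate_mset k i) = x i ^ k"
  by (induction k) (simp_all add: mweight_def)

text \<open>The partition function is the product of \<open>1 / (1 - x i)\<close>, and
  \<open>1 / (1 - x) = 1 + x / (1 - x) \<le> exp (x / (1 - x))\<close>. Truncating to modes below
  \<open>N\<close> and occupations at most \<open>K\<close> makes the sum finite, while the bound is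
  free of \<open>K\<close>.\<close>

lemma sum_mweight_bounded_le:
  fixes K :: nat
  assumes x: "\<And>i. 0 \<le> x i" "\<And>i. x i < 1"
  defines "A \<equiv> \<lambda>N. {\<eta>. set_mset \<eta> \<subseteq> {..<N} \<and> (\<forall>i. count \<eta> i \<le> K)}"
  shows "finite (A N) \<and> sum (mweight x) (A N) \<le> exp (\<Sum>i<N. x i / (1 - x i))"
proof (induction N)
  case 0
  have "A 0 = {{#}}" by (auto simp: A_def)
  then show ?case by (simp add: mweight_def)
next
  case (Suc N)
  let ?g = "\<lambda>(k, \<eta>). \<eta> + replicate_mset k N"
  have sub: "A (Suc N) \<subseteq> ?g ` ({..K} \<times> A N)"
  proof
    fix \<eta> assume \<eta>: "\<eta> \<in> A (Suc N)"
    define \<zeta> where "\<zeta> = filter_mset (\<lambda>i. i \<noteq> N) \<eta>"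
    have "\<eta> = \<zeta> + replicate_mset (count \<eta> N) N"
      by (rule multiset_eqI) (auto simp: \<zeta>_def)
    moreover have "\<zeta> \<in> A N"
      using \<eta> by (auto simp: A_def \<zeta>_def less_Suc_eq)
    moreover have "count \<eta> N \<le> K" using \<eta> by (auto simp: A_def)
    ultimately show "\<eta> \<in> ?g ` ({..K} \<times> A N)"
      by (intro image_eqI[of _ _ "(count \<eta> N, \<zeta>)"]) auto
  qed
  have fin: "finite ({..K} \<times> A N)" using Suc by auto
  have geo: "(\<Sum>k\<le>K. x N ^ k) \<le> exp (x N / (1 - x N))"
  proof -
    have "(\<Sum>k\<le>K. x N ^ k) \<le> (\<Sum>k. x N ^ k)"
      using x[of N] by (intro sum_le_suminf summable_geometric) auto
    also have "\<dots> = 1 + x N / (1 - x N)"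
      using x[of N] by (subst suminf_geometric) (auto simp: field_simps)
    also have "\<dots> \<le> exp (x N / (1 - x N))" by (rule exp_ge_add_one_self)
    finally show ?thesis .
  qed
  have "sum (mweight x) (A (Suc N)) \<le> sum (mweight x) (?g ` ({..K} \<times> A N))"
    by (intro sum_mono2 finite_imageI fin sub mweight_nonneg x)
  also have "\<dots> \<le> sum (mweight x \<circ> ?g) ({..K} \<times> A N)"
    by (intro sum_image_le fin mweight_nonneg x)
  also have "\<dots> = (\<Sum>(k, \<eta>)\<in>{..K} \<times> A N. x N ^ k * mweight x \<eta>)"
    by (intro sum.cong) (auto simp: mweight_add mweight_replicate mult.commute)
  also have "\<dots> = (\<Sum>k\<le>K. x N ^ k) * sum (mweight x) (A N)"
    by (simp add: sum.cartesian_product sum_product)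
  also have "\<dots> \<le> exp (x N / (1 - x N)) * exp (\<Sum>i<N. x i / (1 - x i))"
    using Suc geo by (intro mult_mono sum_nonneg mweight_nonneg x) auto
  also have "\<dots> = exp (\<Sum>i<Suc N. x i / (1 - x i))"
    by (simp add: exp_add mult.commute)
  finally show ?case using finite_subset[OF sub] fin by auto
qed

text \<open>Any finite set of configurations lies inside one truncation, so
  \<open>sum_mweight_bounded_le\<close> controls all finite partial sums.\<close>

lemma nn_integral_mweight_finite:
  assumes x: "\<And>i. 0 \<le> x i" "\<And>i. x i < 1" and sm: "summable (\<lambda>i. x i / (1 - x i))"
  shows "(\<integral>\<^sup>+\<eta>. ennreal (mweight x \<eta>) \<partial>count_space UNIV) < \<infinity>"
proof -
  have "mweight x summable_on UNIV"
  proof (rule nonneg_bdd_above_summable_on)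
    show "bdd_above (sum (mweight x) ` {F. F \<subseteq> UNIV \<and> finite F})"
    proof (rule bdd_aboveI2)
      fix F assume "F \<in> {F::nat multiset set. F \<subseteq> UNIV \<and> finite F}"
      then have F: "finite F" by auto
      obtain N where N: "\<Union>(set_mset ` F) \<subseteq> {..<N}"
        using finite_nat_bounded[of "\<Union>(set_mset ` F)"] F by auto
      obtain K where K: "\<And>\<eta>. \<eta> \<in> F \<Longrightarrow> size \<eta> \<le> K"
        using F by (meson finite_imageI finite_nat_set_iff_bounded_le imageI)
      define A where "A = {\<eta>. set_mset \<eta> \<subseteq> {..<N} \<and> (\<forall>i. count \<eta> i \<le> K)}"
      have A: "finite A" "sum (mweight x) A \<le> exp (\<Sum>i<N. x i / (1 - x i))"
        using sum_mweight_bounded_le[OF x] by (auto simp: A_def)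
      have "F \<subseteq> A" using N K by (auto simp: A_def intro: order_trans[OF count_le_size])
      then have "sum (mweight x) F \<le> sum (mweight x) A"
        by (intro sum_mono2 A mweight_nonneg x)
      also have "\<dots> \<le> exp (\<Sum>i<N. x i / (1 - x i))" by (rule A)
      also have "(\<Sum>i<N. x i / (1 - x i)) \<le> (\<Sum>i. x i / (1 - x i))"
        using x by (intro sum_le_suminf sm) (auto intro!: divide_nonneg_pos)
      finally show "sum (mweight x) F \<le> exp (\<Sum>i. x i / (1 - x i))" by simp
    qed
  qed (auto intro: mweight_nonneg x)
  then have "(\<lambda>\<eta>. norm (mweight x \<eta>)) summable_on UNIV" by (simp add: mweight_nonneg x)
  then have "Infinite_Set_Sum.abs_summable_on (mweight x) UNIV"
    by (simp only: abs_summable_equivalent)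
  then have "integrable (count_space UNIV) (mweight x)"
    by (simp only: Infinite_Set_Sum.abs_summable_on_def)
  then show ?thesis by (simp add: integrable_iff_bounded mweight_nonneg x)
qed

text \<open>Adding \<open>k\<close> particles to mode \<open>i\<close> maps all configurations
  bijectively onto those with at least \<open>k\<close> particles there and multiplies the weight by
  \<open>x i ^ k\<close>.\<close>

lemma nn_integral_mweight_count_ge:
  assumes x: "\<And>i. 0 \<le> x i"
  shows "(\<integral>\<^sup>+\<eta>. ennreal (mweight x \<eta>) * indicator {\<eta>. k \<le> count \<eta> i} \<eta> \<partial>count_space UNIV) =
     ennreal (x i ^ k) * (\<integral>\<^sup>+\<eta>. ennreal (mweight x \<eta>) \<partial>count_space UNIV)"
proof -
  have "bij_betw (\<lambda>\<eta>. \<eta> + replicate_mset k i) UNIV {\<eta>. k \<le> count \<eta> i}"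
    by (rule bij_betwI[where g = "\<lambda>\<eta>. \<eta> - replicate_mset k i"])
       (auto simp: multiset_eq_iff)
  then have "(\<integral>\<^sup>+\<eta>. ennreal (mweight x \<eta>) \<partial>count_space {\<eta>. k \<le> count \<eta> i}) = 
      (\<integral>\<^sup>+\<eta>. ennreal (mweight x (\<eta> + replicate_mset k i)) \<partial>count_space UNIV)"
    by (subst nn_integral_bij_count_space[symmetric]) auto
  also have "\<dots> = (\<integral>\<^sup>+\<eta>. ennreal (x i ^ k) * ennreal (mweight x \<eta>) \<partial>count_space UNIV)"
    by (simp add: mweight_add mweight_replicate ennreal_mult mweight_nonneg x mult.commute)
  also have "\<dots> = ennreal (x i ^ k) * (\<integral>\<^sup>+\<eta>. ennreal (mweight x \<eta>) \<partial>count_space UNIV)"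
    by (rule nn_integral_cmult) auto
  finally show ?thesis by (simp add: nn_integral_count_space_indicator)
qed

text \<open>Write the occupation as the number of \<open>k\<close> with
  \<open>Suc k \<le> count \<eta> i\<close> and sum the geometric series.\<close>

lemma nn_integral_mweight_count:
  assumes x: "\<And>i. 0 \<le> x i" "\<And>i. x i < 1"
  shows "(\<integral>\<^sup>+\<eta>. ennreal (mweight x \<eta> * real (count \<eta> i)) \<partial>count_space UNIV) =
     ennreal (x i / (1 - x i)) * (\<integral>\<^sup>+\<eta>. ennreal (mweight x \<eta>) \<partial>count_space UNIV)"
proof -
  let ?Z = "\<integral>\<^sup>+\<eta>. ennreal (mweight x \<eta>) \<partial>count_space UNIV"
  have eq: "ennreal (mweight x \<eta> * real (count \<eta> i)) = (\<Sum>k. ennreal (mweight x \<eta>) * indicator {\<eta>. Suc k \<le> count \<eta> i} \<eta>)" for \<eta>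
  proof -
    have "(\<Sum>k. ennreal (mweight x \<eta>) * indicator {\<eta>. Suc k \<le> count \<eta> i} \<eta>) = 
      (\<Sum>k<count \<eta> i. ennreal (mweight x \<eta>) * indicator {\<eta>. Suc k \<le> count \<eta> i} \<eta>)"
      by (rule suminf_finite) auto
    also have "\<dots> = (\<Sum>k<count \<eta> i. ennreal (mweight x \<eta>))"
      by (rule sum.cong) auto
    finally show ?thesis 
      by (simp add: ennreal_mult mweight_nonneg x mult.commute ennreal_of_nat_eq_real_of_nat)
  qed
  have "(\<integral>\<^sup>+\<eta>. ennreal (mweight x \<eta> * real (count \<eta> i)) \<partial>count_space UNIV) =
     (\<Sum>k. \<integral>\<^sup>+\<eta>. ennreal (mweight x \<eta>) * indicator {\<eta>. Suc k \<le> count \<eta> i} \<eta> \<partial>count_space UNIV)"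
    unfolding eq by (rule nn_integral_suminf) auto
  also have "\<dots> = (\<Sum>k. ennreal (x i ^ Suc k) * ?Z)"
    by (simp only: nn_integral_mweight_count_ge[OF x(1)])
  also have "\<dots> = (\<Sum>k. ennreal (x i ^ Suc k)) * ?Z"
    by (rule ennreal_suminf_multc)
  also have "(\<Sum>k. ennreal (x i ^ Suc k)) = ennreal (\<Sum>k. x i * x i ^ k)"
    using x by (subst suminf_ennreal2) (auto intro!: summable_mult summable_geometric mult_nonneg_nonneg)
  also have "(\<Sum>k. x i * x i ^ k) = x i / (1 - x i)"
    using x[of i] by (subst suminf_mult) (auto simp: suminf_geometric)
  finally show ?thesis .
qed

lemma L2_inner_cnj: "L2_inner S g f = cnj (L2_inner S f g)"
proof -
  have "cnj (L2_inner S f g) = (LINT x:S|lborel. cnj (cnj (f x) * g x))"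
    unfolding L2_inner_def set_lebesgue_integral_def
    by (subst Bochner_Integration.integral_cnj[symmetric]) simp
  then show ?thesis by (simp add: L2_inner_def mult.commute)
qed

text \<open>Among the terms of the annihilation sum only the one restoring the removed particle
  meets \<open>ket \<eta>\<close>; so although \<open>number_op\<close> mixes modes, its diagonal
  sees just the squared overlaps.\<close>

lemma number_op_ket:
  "number_op S \<phi> f (ket \<eta>) \<eta> =
     complex_of_real (\<Sum>i\<in>set_mset \<eta>. (cmod (L2_inner S (\<phi> i) f))\<^sup>2 * real (count \<eta> i))"
proof -
  have ann: "annihilation S \<phi> f (ket \<eta>) (\<eta> - {#i#}) = L2_inner S f (\<phi> i) * complex_of_real (sqrt (real (count \<eta> i)))"
    if i: "i \<in># \<eta>" for i
  proof -
    have "add_mset k (\<eta> - {#i#}) = \<eta> \<longleftrightarrow> k = i" for k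
    proof -
      have "add_mset k (\<eta> - {#i#}) = \<eta> \<longleftrightarrow> (\<eta> - {#i#}) + {#k#} = (\<eta> - {#i#}) + {#i#}"
        using i by simp
      also have "\<dots> \<longleftrightarrow> k = i" unfolding add_left_cancel by simp
      finally show ?thesis .
    qed
    then have "annihilation S \<phi> f (ket \<eta>) (\<eta> - {#i#}) = 
      (\<Sum>\<^sub>\<infinity>k\<in>{i}. L2_inner S f (\<phi> k) * complex_of_real (sqrt (real (count (\<eta> - {#i#}) k + 1))))"
      unfolding annihilation_def ket_def by (intro infsum_cong_neutral) auto
    also have "\<dots> = L2_inner S f (\<phi> i) * complex_of_real (sqrt (real (count \<eta> i)))"
      using i by (simp add: Suc_diff_le[symmetric] flip: of_nat_Suc)
    finally show ?thesis .
  qed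
  have "number_op S \<phi> f (ket \<eta>) \<eta> = (\<Sum>i\<in>set_mset \<eta>. complex_of_real ((cmod (L2_inner S (\<phi> i) f))\<^sup>2 * real (count \<eta> i)))"
    unfolding number_op_def creation_def comp_def
  proof (intro sum.cong refl)
    fix i assume i: "i \<in># \<eta>"
    have "L2_inner S (\<phi> i) f * complex_of_real (sqrt (real (count \<eta> i))) * annihilation S \<phi> f (ket \<eta>) (\<eta> - {#i#})
      = (L2_inner S (\<phi> i) f * cnj (L2_inner S (\<phi> i) f)) * complex_of_real (sqrt (real (count \<eta> i)) * sqrt (real (count \<eta> i)))"
      unfolding ann[OF i] L2_inner_cnj[of S f "\<phi> i"] by (simp only: of_real_mult ac_simps)
    also have "\<dots> = complex_of_real ((cmod (L2_inner S (\<phi> i) f))\<^sup>2 * real (count \<eta> i))"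
      by (simp only: complex_norm_square[symmetric] of_real_mult real_sqrt_mult_self abs_of_nat)
    finally show "L2_inner S (\<phi> i) f * complex_of_real (sqrt (real (count \<eta> i))) * annihilation S \<phi> f (ket \<eta>) (\<eta> - {#i#}) = 
       complex_of_real ((cmod (L2_inner S (\<phi> i) f))\<^sup>2 * real (count \<eta> i))" .
  qed
  then show ?thesis by (simp only: of_real_sum)
qed

definition bose :: "real \<Rightarrow> real \<Rightarrow> real \<Rightarrow> real" where
  "bose \<beta> \<mu> e = 1 / (exp (\<beta> * (e - \<mu>)) - 1)"

text \<open>The trace involves only diagonal elements, which gives the quadratic form at
  \<open>f\<close> of the Bose function of the one-particle Hamiltonian, written in the
  eigenbasis.\<close>

lemma mean_occupation_eq:
  assumes pos: "\<And>i. \<beta> * (E i - \<mu>) > 0" and sm: "summable (\<lambda>i. bose \<beta> \<mu> (E i))"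
    and sm': "summable (\<lambda>i. bose \<beta> \<mu> (E i) * (cmod (L2_inner S (\<phi> i) f))\<^sup>2)"
  shows "mean_occupation \<beta> S \<phi> E \<mu> f = (\<Sum>i. bose \<beta> \<mu> (E i) * (cmod (L2_inner S (\<phi> i) f))\<^sup>2)"
proof -
  define x where "x i = exp (- \<beta> * (E i - \<mu>))" for i
  define a where "a i = (cmod (L2_inner S (\<phi> i) f))\<^sup>2" for i
  have x: "0 \<le> x i" "x i < 1" for i using pos[of i] by (auto simp: x_def)
  have bose: "x i / (1 - x i) = bose \<beta> \<mu> (E i)" for i
  proof -
    have "x i = 1 / exp (\<beta> * (E i - \<mu>))" by (simp add: x_def exp_minus inverse_eq_divide)
    moreover have "exp (\<beta> * (E i - \<mu>)) > 1" using pos[of i] by simp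
    moreover have "(1 / y) / (1 - 1 / y) = 1 / (y - 1)" if "y > 1" for y :: real
      using that by (simp add: field_simps)
    ultimately show ?thesis unfolding bose_def by simp
  qed
  have b0: "bose \<beta> \<mu> (E i) \<ge> 0" for i using pos[of i] by (simp add: bose_def)
  have w: "exp (- \<beta> * grand_energy E \<mu> \<eta>) = mweight x \<eta>" for \<eta>
  proof (induction \<eta>)
    case (add i \<eta>)
    have "exp (- \<beta> * grand_energy E \<mu> (add_mset i \<eta>)) = x i * exp (- \<beta> * grand_energy E \<mu> \<eta>)"
      by (simp only: grand_energy_def image_mset_add_mset sum_mset.add_mset distrib_left exp_add x_def)
    then show ?case using add.IH unfolding mweight_def by simp
  qed (simp add: grand_energy_def mweight_def)
  define Z where "Z = enn2real (\<integral>\<^sup>+\<eta>. ennreal (mweight x \<eta>) \<partial>count_space UNIV)"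
  have Z: "(\<integral>\<^sup>+\<eta>. ennreal (mweight x \<eta>) \<partial>count_space UNIV) = ennreal Z"
    unfolding Z_def using nn_integral_mweight_finite[OF x] sm by (simp add: bose)
  have Z0: "Z \<ge> 0" by (simp add: Z_def)
  \<comment> \<open>The vacuum contributes 1, so the normalising denominator is not 0.\<close>
  have "ennreal (mweight x {#}) \<le> (\<integral>\<^sup>+\<eta>. ennreal (mweight x \<eta>) \<partial>count_space UNIV)"
    by (intro nn_integral_ge_point) auto
  then have Zpos: "Z > 0" using Z0 unfolding Z by (auto simp: mweight_def)
  define c where "c = (\<Sum>i. bose \<beta> \<mu> (E i) * a i)"
  have c0: "c \<ge> 0" unfolding c_def using sm' b0 by (intro suminf_nonneg) (auto simp: a_def)
  define B where "B \<eta> = (\<Sum>i\<in>set_mset \<eta>. a i * real (count \<eta> i))" for \<eta>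
  have B0: "B \<eta> \<ge> 0" for \<eta> by (auto simp: B_def a_def intro!: sum_nonneg)
  have num: "(\<integral>\<^sup>+\<eta>. ennreal (mweight x \<eta> * B \<eta>) \<partial>count_space UNIV) = ennreal (c * Z)"
  proof -
    have "ennreal (mweight x \<eta> * B \<eta>) = (\<Sum>i. ennreal (a i) * ennreal (mweight x \<eta> * real (count \<eta> i)))" for \<eta>
    proof -
      have "(\<Sum>i. ennreal (a i) * ennreal (mweight x \<eta> * real (count \<eta> i))) = 
        (\<Sum>i\<in>set_mset \<eta>. ennreal (a i) * ennreal (mweight x \<eta> * real (count \<eta> i)))"
        by (rule suminf_finite) (auto simp: not_in_iff)
      also have "\<dots> = (\<Sum>i\<in>set_mset \<eta>. ennreal (mweight x \<eta> * (a i * real (count \<eta> i))))"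
        by (intro sum.cong refl) (simp add: ennreal_mult[symmetric] mweight_nonneg x a_def ac_simps)
      also have "\<dots> = ennreal (mweight x \<eta> * B \<eta>)"
        by (subst sum_ennreal) (auto simp: B_def sum_distrib_left mweight_nonneg x a_def)
      finally show ?thesis by simp
    qed
    then have "(\<integral>\<^sup>+\<eta>. ennreal (mweight x \<eta> * B \<eta>) \<partial>count_space UNIV) =
      (\<Sum>i. \<integral>\<^sup>+\<eta>. ennreal (a i) * ennreal (mweight x \<eta> * real (count \<eta> i)) \<partial>count_space UNIV)"
      by (simp only: nn_integral_suminf borel_measurable_count_space)
    also have "\<dots> = (\<Sum>i. ennreal (a i) * (ennreal (bose \<beta> \<mu> (E i)) * ennreal Z))"
      by (simp add: nn_integral_cmult nn_integral_mweight_count[OF x] bose Z)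
    also have "\<dots> = (\<Sum>i. ennreal (bose \<beta> \<mu> (E i) * a i) * ennreal Z)"
      by (simp add: ennreal_mult b0 a_def ac_simps)
    also have "\<dots> = (\<Sum>i. ennreal (bose \<beta> \<mu> (E i) * a i)) * ennreal Z"
      by (rule ennreal_suminf_multc)
    also have "(\<Sum>i. ennreal (bose \<beta> \<mu> (E i) * a i)) = ennreal c"
      unfolding c_def using sm' b0 by (intro suminf_ennreal2) (auto simp: a_def)
    finally show ?thesis by (simp add: ennreal_mult c0 Z0)
  qed
  have "(\<Sum>\<^sub>\<infinity>\<eta>\<in>UNIV. complex_of_real (mweight x \<eta>)) = complex_of_real Z"
    by (intro infsumI has_sum_of_real has_sum_nn_integral[OF _ Z0 Z] mweight_nonneg x)
  moreover have "(\<Sum>\<^sub>\<infinity>\<eta>\<in>UNIV. complex_of_real (mweight x \<eta>) * number_op S \<phi> f (ket \<eta>) \<eta>) = complex_of_real (c * Z)"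
  proof -
    have "(\<Sum>\<^sub>\<infinity>\<eta>\<in>UNIV. complex_of_real (mweight x \<eta>) * number_op S \<phi> f (ket \<eta>) \<eta>) = (\<Sum>\<^sub>\<infinity>\<eta>\<in>UNIV. complex_of_real (mweight x \<eta> * B \<eta>))"
      by (simp add: number_op_ket B_def a_def)
    also have "\<dots> = complex_of_real (c * Z)"
      using c0 Z0 by (intro infsumI has_sum_of_real has_sum_nn_integral num) (auto simp: mweight_nonneg x B0)
    finally show ?thesis .
  qed
  ultimately have "gibbs_state \<beta> E \<mu> (number_op S \<phi> f) = complex_of_real c"
    unfolding gibbs_state_def w using Zpos by simp
  then show ?thesis by (simp add: mean_occupation_def c_def a_def)
qed

section \<open>Gaps of a Poisson process\<close>

lemma poisson_empty_prob:
  assumes "poisson_process M r X" "B \<in> sets borel" "bounded B"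
  shows "{\<omega>\<in>space M. X \<omega> \<inter> B = {}} \<in> sets M"
    and "measure M {\<omega>\<in>space M. X \<omega> \<inter> B = {}} = exp (- (r * measure lborel B))"
proof -
  have eq: "{\<omega>\<in>space M. X \<omega> \<inter> B = {}} = {\<omega>\<in>space M. card (X \<omega> \<inter> B) = 0}"
    using assms unfolding poisson_process_def by (auto simp: card_eq_0_iff)
  have meas: "(\<lambda>\<omega>. card (X \<omega> \<inter> B)) \<in> measurable M (count_space UNIV)"
    using assms unfolding poisson_process_def by blast
  show "{\<omega>\<in>space M. X \<omega> \<inter> B = {}} \<in> sets M"
    unfolding eq using measurable_sets[OF meas, of "{0}"] by (simp add: vimage_def Int_def conj_commute)
  have "measure M {\<omega>\<in>space M. card (X \<omega> \<inter> B) = 0} = 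
      exp (- (r * measure lborel B)) * (r * measure lborel B) ^ 0 / fact 0"
    using assms unfolding poisson_process_def by blast
  then show "measure M {\<omega>\<in>space M. X \<omega> \<inter> B = {}} = exp (- (r * measure lborel B))"
    unfolding eq by simp
qed

text \<open>Emptiness indicators of disjoint sets are independent with values in
  \<open>[0, 1]\<close>, so Hoeffding's inequality applies with the void probability as
  mean.\<close>

lemma poisson_empty_deviation:
  assumes M: "prob_space M" and pp: "poisson_process M r X"
    and B: "\<And>j. j < n \<Longrightarrow> B j \<in> sets borel \<and> bounded (B j) \<and> measure lborel (B j) = c"
    and disj: "disjoint_family_on B {..<n}" and n: "n > 0" and \<epsilon>: "\<epsilon> \<ge> 0"
  defines "T \<equiv> \<lambda>\<omega>. (\<Sum>j<n. if X \<omega> \<inter> B j = {} then 1 else 0) - real n * exp (- (r * c))"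
  shows "{\<omega>\<in>space M. \<bar>T \<omega>\<bar> \<ge> \<epsilon>} \<in> sets M"
    and "measure M {\<omega>\<in>space M. \<bar>T \<omega>\<bar> \<ge> \<epsilon>} \<le> 2 * exp (- 2 * \<epsilon>\<^sup>2 / real n)"
proof -
  interpret prob_space M by fact
  define Z where "Z j \<omega> = (if card (X \<omega> \<inter> B j) = 0 then 1 else 0 :: real)" for j \<omega>
  have fin: "finite (X \<omega> \<inter> B j)" if "\<omega> \<in> space M" "j < n" for \<omega> j
    using pp B[OF that(2)] that unfolding poisson_process_def by blast
  have Z: "Z j \<omega> = (if X \<omega> \<inter> B j = {} then 1 else 0)" if "\<omega> \<in> space M" "j < n" for j \<omega>
    using fin[OF that] by (simp add: Z_def)
  have ind: "indep_vars (\<lambda>_. count_space UNIV) (\<lambda>j \<omega>. card (X \<omega> \<inter> B j)) {..<n}"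
    using pp[unfolded poisson_process_def, THEN conjunct2, THEN conjunct2, rule_format, of n B] B disj
    by simp
  have indZ: "indep_vars (\<lambda>_. borel) Z {..<n}"
    unfolding Z_def by (rule indep_vars_compose2[OF ind]) auto
  have expZ: "expectation (Z j) = exp (- (r * c))" if "j < n" for j
  proof -
    have "expectation (Z j) = (\<integral>\<omega>. indicator {\<omega>\<in>space M. X \<omega> \<inter> B j = {}} \<omega> \<partial>M)"
      by (intro Bochner_Integration.integral_cong) (auto simp: Z that indicator_def)
    also have "\<dots> = measure M {\<omega>\<in>space M. X \<omega> \<inter> B j = {}}"
      using poisson_empty_prob(1)[OF pp] B[OF that] by simp
    also have "\<dots> = exp (- (r * c))"
      using poisson_empty_prob(2)[OF pp] B[OF that] by simp
    finally show ?thesis .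
  qed
  interpret H: Hoeffding_ineq M "{..<n}" Z "\<lambda>_. 0" "\<lambda>_. 1" "real n * exp (- (r * c))"
    by unfold_locales (use indZ expZ in \<open>auto simp: Z_def\<close>)
  have eq: "{\<omega>\<in>space M. \<bar>T \<omega>\<bar> \<ge> \<epsilon>} = {\<omega>\<in>space M. \<bar>(\<Sum>j<n. Z j \<omega>) - real n * exp (- (r * c))\<bar> \<ge> \<epsilon>}"
  proof (rule Collect_cong, rule conj_cong[OF refl])
    fix \<omega> assume "\<omega> \<in> space M"
    then have "T \<omega> = (\<Sum>j<n. Z j \<omega>) - real n * exp (- (r * c))"
      unfolding T_def by (intro arg_cong2[where f = minus] sum.cong) (simp_all add: Z)
    then show "(\<bar>T \<omega>\<bar> \<ge> \<epsilon>) = (\<bar>(\<Sum>j<n. Z j \<omega>) - real n * exp (- (r * c))\<bar> \<ge> \<epsilon>)" by simp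
  qed
  have [measurable]: "(\<lambda>\<omega>. \<Sum>j<n. Z j \<omega>) \<in> borel_measurable M"
    using H.random_variable by (intro borel_measurable_sum) simp
  show "{\<omega>\<in>space M. \<bar>T \<omega>\<bar> \<ge> \<epsilon>} \<in> sets M"
    unfolding eq by measurable
  show "measure M {\<omega>\<in>space M. \<bar>T \<omega>\<bar> \<ge> \<epsilon>} \<le> 2 * exp (- 2 * \<epsilon>\<^sup>2 / real n)"
    unfolding eq using H.Hoeffding_ineq_abs_ge[OF \<epsilon>] n by simp
qed

text \<open>The sets change with \<open>l\<close>, so this is a law for a triangular array. The
  Hoeffding bound is exponentially small in \<open>l\<close>, hence summable, and Borel-Cantelli
  requires no relation between different \<open>l\<close>.\<close>

lemma poisson_empty_slln:
  fixes B :: "nat \<Rightarrow> nat \<Rightarrow> real set" and n :: "nat \<Rightarrow> nat"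
  assumes M: "prob_space M" and pp: "poisson_process M r X"
    and B: "\<And>l j. j < n l \<Longrightarrow> B l j \<in> sets borel \<and> bounded (B l j) \<and> measure lborel (B l j) = c"
    and disj: "\<And>l. disjoint_family_on (B l) {..<n l}"
    and C: "C > 0" "\<And>l. real (n l) \<le> C * real l"
  shows "AE \<omega> in M. (\<lambda>l. ((\<Sum>j<n l. if X \<omega> \<inter> B l j = {} then 1 else 0) - real (n l) * exp (- (r * c))) / real l) \<longlonglongrightarrow> 0"
proof -
  interpret prob_space M by fact
  define T where "T l \<omega> = (\<Sum>j<n l. if X \<omega> \<inter> B l j = {} then 1 else 0) - real (n l) * exp (- (r * c))" for l \<omega>
  have bound: "{\<omega>\<in>space M. \<bar>T l \<omega>\<bar> \<ge> \<epsilon> * real l} \<in> sets M"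
    "measure M {\<omega>\<in>space M. \<bar>T l \<omega>\<bar> \<ge> \<epsilon> * real l} \<le> 2 * exp (- 2 * \<epsilon>\<^sup>2 / C) ^ l" 
    if \<epsilon>: "\<epsilon> > 0" and l: "l > 0" for \<epsilon> l
  proof -
    consider "n l = 0" | "n l > 0" by blast
    then have "{\<omega>\<in>space M. \<bar>T l \<omega>\<bar> \<ge> \<epsilon> * real l} \<in> sets M \<and>
      measure M {\<omega>\<in>space M. \<bar>T l \<omega>\<bar> \<ge> \<epsilon> * real l} \<le> 2 * exp (- 2 * \<epsilon>\<^sup>2 / C) ^ l"
    proof cases
      case 1
      then have eq: "{\<omega>\<in>space M. \<bar>T l \<omega>\<bar> \<ge> \<epsilon> * real l} = {}"
        using \<epsilon> l by (auto simp: T_def mult_le_0_iff)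
      show ?thesis unfolding eq by simp
    next
      case 2
      have "- 2 * (\<epsilon> * real l)\<^sup>2 / real (n l) \<le> real l * (- 2 * \<epsilon>\<^sup>2 / C)"
      proof -
        have "real l * (2 * \<epsilon>\<^sup>2 / C) = 2 * (\<epsilon> * real l)\<^sup>2 / (C * real l)"
          using l C by (simp add: field_simps power2_eq_square)
        also have "\<dots> \<le> 2 * (\<epsilon> * real l)\<^sup>2 / real (n l)"
          using C(2)[of l] 2 by (intro divide_left_mono) (auto simp: C l intro!: mult_pos_pos)
        finally show ?thesis by simp
      qed
      then have "2 * exp (- 2 * (\<epsilon> * real l)\<^sup>2 / real (n l)) \<le> 2 * exp (- 2 * \<epsilon>\<^sup>2 / C) ^ l"
        by (simp add: exp_of_nat_mult[symmetric])
      moreover have \<epsilon>l: "\<epsilon> * real l \<ge> 0" using \<epsilon> by simp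
      ultimately show ?thesis
        using poisson_empty_deviation(1)[OF M pp B disj[of l] 2 \<epsilon>l]
          order_trans[OF poisson_empty_deviation(2)[OF M pp B disj[of l] 2 \<epsilon>l]] unfolding T_def
        by (intro conjI) blast+
    qed
    then show "{\<omega>\<in>space M. \<bar>T l \<omega>\<bar> \<ge> \<epsilon> * real l} \<in> sets M"
      "measure M {\<omega>\<in>space M. \<bar>T l \<omega>\<bar> \<ge> \<epsilon> * real l} \<le> 2 * exp (- 2 * \<epsilon>\<^sup>2 / C) ^ l" by auto
  qed
  \<comment> \<open>The bound holds for \<open>l > 0\<close> only, hence the shift to
    \<open>Suc l\<close>; the first term does not influence the limit.\<close>
  have ev: "AE \<omega> in M. \<forall>\<^sub>F l in sequentially. \<bar>T (Suc l) \<omega>\<bar> < \<epsilon> * real (Suc l)" if \<epsilon>: "\<epsilon> > 0" for \<epsilon>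
  proof -
    let ?A = "\<lambda>l. {\<omega>\<in>space M. \<bar>T (Suc l) \<omega>\<bar> \<ge> \<epsilon> * real (Suc l)}"
    have "summable (\<lambda>l. 2 * exp (- 2 * \<epsilon>\<^sup>2 / C) ^ Suc l)"
      using \<epsilon> C by (intro summable_mult summable_Suc_iff[THEN iffD2] summable_geometric) auto
    then have "summable (\<lambda>l. measure M (?A l))"
    proof (rule summable_comparison_test'[where N = 0])
      show "norm (measure M (?A l)) \<le> 2 * exp (- 2 * \<epsilon>\<^sup>2 / C) ^ Suc l" for l
        using bound(2)[OF \<epsilon>, of "Suc l"] by (simp del: power_Suc of_nat_Suc)
    qed
    then have "AE \<omega> in M. \<forall>\<^sub>F l in sequentially. \<omega> \<in> space M - ?A l"
      using bound(1)[OF \<epsilon>] by (intro borel_cantelli_AE1) (auto simp: emeasure_eq_measure simp del: of_nat_Suc)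
    then show ?thesis
      by eventually_elim (auto elim!: eventually_mono)
  qed
  have "AE \<omega> in M. \<forall>m. \<forall>\<^sub>F l in sequentially. \<bar>T (Suc l) \<omega>\<bar> < 1 / real (Suc m) * real (Suc l)"
    by (subst AE_all_countable) (intro allI ev, simp)
  then show ?thesis
  proof eventually_elim
    case (elim \<omega>)
    have "(\<lambda>l. T (Suc l) \<omega> / real (Suc l)) \<longlonglongrightarrow> 0"
    proof (rule LIMSEQ_I)
      fix e :: real assume "e > 0"
      then obtain m where m: "1 / real (Suc m) < e" using nat_approx_posE by metis
      from elim[rule_format, of m] have "\<forall>\<^sub>F l in sequentially. norm (T (Suc l) \<omega> / real (Suc l) - 0) < e"
      proof eventually_elim
        case (elim l)
        then have "\<bar>T (Suc l) \<omega>\<bar> / real (Suc l) < 1 / real (Suc m)"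
          by (simp add: divide_less_eq)
        with m show ?case by simp
      qed
      then show "\<exists>no. \<forall>l\<ge>no. norm (T (Suc l) \<omega> / real (Suc l) - 0) < e"
        by (simp add: eventually_sequentially)
    qed
    then have "(\<lambda>l. T l \<omega> / real l) \<longlonglongrightarrow> 0" by (rule LIMSEQ_imp_Suc)
    then show ?case by (simp add: T_def)
  qed
qed

section \<open>Gaps of a sample: finiteness, total length, and counting by tiles\<close>

definition gaps :: "real set \<Rightarrow> nat \<Rightarrow> real set set" where
  "gaps X l = components (\<Lambda> l - X)"

definition gaplen :: "real set \<Rightarrow> real" where
  "gaplen J = Sup J - Inf J"

text \<open>The Lebesgue measure of the set of positions at which a window of length
  \<open>c\<close> fits into a gap. Per unit length it tends to the void probability
  \<open>exp (- (r * c))\<close>, and as a function of \<open>c\<close> it determines the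
  distribution of gap lengths.\<close>

definition excess :: "real set \<Rightarrow> nat \<Rightarrow> real \<Rightarrow> real" where
  "excess X l c = (\<Sum>J\<in>gaps X l. max 0 (gaplen J - c))"

lemma open_connected_bounded_interval:
  fixes J :: "real set"
  assumes "open J" "connected J" "bounded J" "J \<noteq> {}"
  shows "J = {Inf J<..<Sup J}" "Inf J < Sup J"
proof -
  have bb: "bdd_above J" "bdd_below J" using assms by (auto simp: bounded_imp_bdd_above bounded_imp_bdd_below)
  have sub: "J \<subseteq> {Inf J<..<Sup J}"
  proof
    fix x assume x: "x \<in> J"
    obtain e where e: "e > 0" "\<And>y. \<bar>y - x\<bar> < e \<Longrightarrow> y \<in> J"
      using assms(1) x by (auto simp: open_real)
    have "x - e/2 \<in> J" "x + e/2 \<in> J" using e by auto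
    then have "Inf J \<le> x - e/2" "x + e/2 \<le> Sup J" using bb by (auto intro: cInf_lower cSup_upper)
    then show "x \<in> {Inf J<..<Sup J}" using e by auto
  qed
  moreover have "{Inf J<..<Sup J} \<subseteq> J"
  proof
    fix y assume y: "y \<in> {Inf J<..<Sup J}"
    obtain x1 where x1: "x1 \<in> J" "x1 < y" using cInf_lessD[of J y] assms(4) y by auto
    obtain x2 where x2: "x2 \<in> J" "y < x2" using less_cSupD[of J y] assms(4) y by auto
    show "y \<in> J" using assms(2) x1 x2 by (meson connected_contains_Icc atLeastAtMost_iff less_imp_le subsetD)
  qed
  ultimately show "J = {Inf J<..<Sup J}" by auto
  then show "Inf J < Sup J" using assms(4) by (metis greaterThanLessThan_empty_iff not_le)
qed

lemma \<Lambda>_props: "open (\<Lambda> l)" "bounded (\<Lambda> l)" "\<Lambda> l \<in> sets borel" "measure lborel (\<Lambda> l) = real l"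
  by (auto simp: \<Lambda>_def)

context
  fixes X :: "real set" and l :: nat
  assumes fin: "finite (X \<inter> \<Lambda> l)"
begin

lemma open_gap_region: "open (\<Lambda> l - X)"
proof -
  have "\<Lambda> l - X = \<Lambda> l - X \<inter> \<Lambda> l" by auto
  moreover have "open (\<Lambda> l - X \<inter> \<Lambda> l)" using fin by (intro open_Diff \<Lambda>_props finite_imp_closed)
  ultimately show ?thesis by metis
qed

lemma gap_interval:
  assumes "J \<in> gaps X l"
  shows "J = {Inf J<..<Sup J}" "Inf J < Sup J" "- real l / 2 \<le> Inf J" "Sup J \<le> real l / 2" "J \<subseteq> \<Lambda> l"
proof -
  have sub: "J \<subseteq> \<Lambda> l" using in_components_subset assms unfolding gaps_def by blast
  then have "bounded J" using \<Lambda>_props(2) bounded_subset by blast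
  moreover have "open J" "connected J" "J \<noteq> {}"
    using assms open_gap_region unfolding gaps_def
    by (auto intro: open_components in_components_connected dest: in_components_nonempty)
  ultimately show J: "J = {Inf J<..<Sup J}" "Inf J < Sup J"
    using open_connected_bounded_interval[of J] by blast+
  show "J \<subseteq> \<Lambda> l" by (rule sub)
  have "{Inf J<..<Sup J} \<subseteq> {- real l / 2<..<real l / 2}"
    using order_trans[OF eq_refl[OF J(1)[symmetric]] sub] by (simp only: \<Lambda>_def)
  then show "- real l / 2 \<le> Inf J" "Sup J \<le> real l / 2" using J(2)
    by (simp_all add: greaterThanLessThan_subseteq_greaterThanLessThan)
qed

lemma gap_sets: "J \<in> gaps X l \<Longrightarrow> J \<in> sets borel"
  using gap_interval(1) by (metis borel_open open_greaterThanLessThan)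

lemma gaplen_pos: "J \<in> gaps X l \<Longrightarrow> gaplen J > 0"
  using gap_interval(2) by (simp add: gaplen_def)

lemma measure_gap: "J \<in> gaps X l \<Longrightarrow> measure lborel J = gaplen J"
  using gap_interval(1,2)[of J] by (metis gaplen_def measure_lborel_Ioo less_imp_le)

lemma emeasure_gap: "J \<in> gaps X l \<Longrightarrow> emeasure lborel J = ennreal (gaplen J)"
  using gap_interval(1,2)[of J] by (metis gaplen_def emeasure_lborel_Ioo less_imp_le)

lemma gaps_disjoint: "J \<in> gaps X l \<Longrightarrow> J' \<in> gaps X l \<Longrightarrow> J \<noteq> J' \<Longrightarrow> J \<inter> J' = {}"
  unfolding gaps_def using components_nonoverlap by blast

lemma Union_gaps: "\<Union>(gaps X l) = \<Lambda> l - X"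
  unfolding gaps_def by (rule Union_components)

text \<open>A gap is determined by its left end point, which must be the left end of the box or a
  point of \<open>X\<close>: otherwise a ball around it would extend the component.\<close>

lemma finite_gaps: "finite (gaps X l)"
proof (rule inj_on_finite)
  show "inj_on Inf (gaps X l)"
  proof (rule inj_onI, rule ccontr)
    fix J J' assume J: "J \<in> gaps X l" "J' \<in> gaps X l" "Inf J = Inf J'" "J \<noteq> J'"
    obtain z where "Inf J < z" "z < min (Sup J) (Sup J')"
      using gap_interval(2)[OF J(1)] gap_interval(2)[OF J(2)] J(3) dense[of "Inf J" "min (Sup J) (Sup J')"] by auto
    then have "z \<in> J" "z \<in> J'" using gap_interval(1)[OF J(1)] gap_interval(1)[OF J(2)] J(3) 
      by (metis greaterThanLessThan_iff min_less_iff_conj)+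
    then show False using gaps_disjoint J by blast
  qed
  show "Inf ` gaps X l \<subseteq> insert (- real l / 2) (X \<inter> \<Lambda> l)"
  proof (clarify)
    fix J assume J: "J \<in> gaps X l" and n: "Inf J \<notin> X \<inter> \<Lambda> l"
    show "Inf J = - real l / 2"
    proof (rule ccontr)
      assume ne: "Inf J \<noteq> - real l / 2"
      have "Inf J \<in> \<Lambda> l" using gap_interval[OF J] ne by (auto simp: \<Lambda>_def)
      then have "Inf J \<in> \<Lambda> l - X" using n by auto
      then obtain e where e: "e > 0" "ball (Inf J) e \<subseteq> \<Lambda> l - X"
        using open_gap_region open_contains_ball by blast
      obtain z where z: "Inf J < z" "z < min (Sup J) (Inf J + e)"
        using gap_interval(2)[OF J] e dense[of "Inf J" "min (Sup J) (Inf J + e)"] by auto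
      have "z \<in> J" using gap_interval(1)[OF J] z by (metis greaterThanLessThan_iff min_less_iff_conj)
      moreover have "z \<in> ball (Inf J) e" using z by (simp add: dist_real_def)
      ultimately have "J \<inter> ball (Inf J) e \<noteq> {}" by blast
      then have "ball (Inf J) e \<subseteq> J"
        by (rule components_maximal[OF J[unfolded gaps_def] connected_ball e(2)])
      then have "Inf J \<in> J" using e by auto
      then show False using gap_interval(1)[OF J] by (metis greaterThanLessThan_iff less_irrefl)
    qed
  qed
  show "finite (insert (- real l / 2) (X \<inter> \<Lambda> l))" using fin by simp
qed

lemma sum_gaplen_subset:
  assumes "K \<subseteq> gaps X l"
  shows "(\<Sum>J\<in>K. gaplen J) = measure lborel (\<Union>K)"
proof -
  have "measure lborel (\<Union>J\<in>K. J) = (\<Sum>J\<in>K. measure lborel J)"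
  proof (rule measure_finite_Union)
    show "finite K" using finite_gaps assms finite_subset by blast
    show "disjoint_family_on (\<lambda>J. J) K"
      unfolding disjoint_family_on_def using assms gaps_disjoint by (meson subsetD)
  qed (use assms gap_sets emeasure_gap in auto)
  also have "\<dots> = (\<Sum>J\<in>K. gaplen J)"
    using assms by (intro sum.cong refl measure_gap) auto
  finally show ?thesis by simp
qed

lemma sum_gaplen: "(\<Sum>J\<in>gaps X l. gaplen J) = real l"
proof -
  have "(\<Sum>J\<in>gaps X l. gaplen J) = measure lborel (\<Lambda> l - X)"
    by (simp add: sum_gaplen_subset Union_gaps)
  also have "\<Lambda> l - X = \<Lambda> l - X \<inter> \<Lambda> l" by auto
  also have "measure lborel (\<Lambda> l - X \<inter> \<Lambda> l) = measure lborel (\<Lambda> l)"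
    using fin by (intro measure_Diff_null_set countable_imp_null_set_lborel) (auto simp: countable_finite \<Lambda>_props)
  finally show ?thesis by (simp add: \<Lambda>_props)
qed

end

text \<open>The error is 0, not \<open>h\<close>, for an empty range. This later keeps short gaps
  from contributing to the total error.\<close>

lemma card_multiples_between:
  fixes A B h :: real
  assumes h: "h > 0" and A: "A \<ge> 0"
  defines "S \<equiv> {k::nat. A \<le> real k * h \<and> real k * h \<le> B}"
  shows "finite S" "\<bar>h * real (card S) - max 0 (B - A)\<bar> \<le> (if A \<le> B then h else 0)"
proof -
  have S: "S = {k. A / h \<le> real k \<and> real k \<le> B / h}"
    using h by (auto simp: S_def field_simps)
  then have S': "S = (if B < 0 then {} else {nat \<lceil>A / h\<rceil>..nat \<lfloor>B / h\<rfloor>})"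
    using h by (auto simp: nat_le_iff le_nat_iff ceiling_le_iff le_floor_iff field_simps)
       (meson A order_trans mult_nonneg_nonneg of_nat_0_le_iff less_imp_le not_le)+
  then show "finite S" by auto
  show "\<bar>h * real (card S) - max 0 (B - A)\<bar> \<le> (if A \<le> B then h else 0)"
  proof (cases "A \<le> B")
    case False
    then have "S = {}" by (auto simp: S_def)
    then show ?thesis using False by simp
  next
    case True
    then have B: "B \<ge> 0" using A by simp
    define p where "p = \<lceil>A / h\<rceil>"
    define q where "q = \<lfloor>B / h\<rfloor>"
    have "A / h \<ge> 0" "B / h \<ge> 0" using A B h by simp_all
    then have p0: "p \<ge> 0" and q0: "q \<ge> 0" unfolding p_def q_def by linarith+
    have AB: "A / h \<le> B / h" using True h by (simp add: divide_right_mono)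
    have p: "real_of_int p < A / h + 1" "A / h \<le> real_of_int p" unfolding p_def by linarith+
    have q: "real_of_int q > B / h - 1" "real_of_int q \<le> B / h" unfolding q_def by linarith+
    have pq: "p \<le> q + 1" using AB p q by linarith
    have "card S = Suc (nat q) - nat p" using S' B by (simp add: p_def q_def)
    then have "real (card S) = real_of_int q + 1 - real_of_int p"
      using pq p0 q0 by (simp add: of_nat_diff nat_le_iff)
    then have "\<bar>real (card S) - (B / h - A / h)\<bar> \<le> 1" using p q by linarith
    then have "h * \<bar>real (card S) - (B / h - A / h)\<bar> \<le> h * 1" using h by (intro mult_left_mono) auto
    also have "h * \<bar>real (card S) - (B / h - A / h)\<bar> = \<bar>h * real (card S) - (B - A)\<bar>"
    proof -
      have "h * real (card S) - (B - A) = h * (real (card S) - (B / h - A / h))"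
        using h by (simp add: field_simps)
      then show ?thesis using h by (simp only: abs_mult abs_of_pos)
    qed
    finally show ?thesis using True by simp
  qed
qed

text \<open>Consecutive tiles are shifted by \<open>h\<close>, in use a fraction
  \<open>c / m\<close> of their length, so that they overlap: a discretisation of a sliding
  window.\<close>

definition tile :: "nat \<Rightarrow> real \<Rightarrow> real \<Rightarrow> nat \<Rightarrow> real set" where
  "tile l h c k = {- real l / 2 + real k * h <..< - real l / 2 + real k * h + c}"

text \<open>A tile inside the gap region is connected and so lies in a single gap; a gap of length L
  holds about \<open>(L - c) / h\<close> of them. Only gaps of length at least \<open>c\<close>
  produce an error, at most \<open>h \<le> h * L / c\<close> each, and the lengths add up to
  \<open>l\<close>.\<close>

lemma excess_tiles:
  assumes fin: "finite (X \<inter> \<Lambda> l)" and h: "h > 0" and c: "c > 0"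
  shows "finite {k. tile l h c k \<subseteq> \<Lambda> l - X}"
    "\<bar>h * real (card {k. tile l h c k \<subseteq> \<Lambda> l - X}) - excess X l c\<bar> \<le> h * real l / c"
proof -
  define S where "S J = {k. tile l h c k \<subseteq> J}" for J
  have ne: "tile l h c k \<noteq> {}" for k using c by (simp add: tile_def)
  have SJ: "finite (S J)" "\<bar>h * real (card (S J)) - max 0 (gaplen J - c)\<bar> \<le> h * gaplen J / c" if J: "J \<in> gaps X l" for J
  proof -
    note I = gap_interval[OF fin J]
    have S: "S J = {k. Inf J + real l / 2 \<le> real k * h \<and> real k * h \<le> Sup J - c + real l / 2}"
      unfolding S_def tile_def using c
      by (subst I(1), subst greaterThanLessThan_subseteq_greaterThanLessThan) auto
    have A: "Inf J + real l / 2 \<ge> 0" using I by simp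
    show "finite (S J)" unfolding S by (rule card_multiples_between[OF h A])
    have "\<bar>h * real (card (S J)) - max 0 (gaplen J - c)\<bar> \<le> (if Inf J + real l / 2 \<le> Sup J - c + real l / 2 then h else 0)"
      using card_multiples_between(2)[OF h A, of "Sup J - c + real l / 2"] unfolding S by (simp add: gaplen_def)
    also have "\<dots> \<le> h * gaplen J / c"
    proof (cases "Inf J + real l / 2 \<le> Sup J - c + real l / 2")
      case True
      then have "h * c / c \<le> h * gaplen J / c"
        using h c by (intro divide_right_mono mult_left_mono) (auto simp: gaplen_def)
      then show ?thesis using True c by simp
    next
      case False
      then show ?thesis using h c gaplen_pos[OF fin J] by simp
    qed
    finally show "\<bar>h * real (card (S J)) - max 0 (gaplen J - c)\<bar> \<le> h * gaplen J / c" .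
  qed
  have eq: "{k. tile l h c k \<subseteq> \<Lambda> l - X} = (\<Union>J\<in>gaps X l. S J)"
  proof (intro equalityI subsetI)
    fix k assume k: "k \<in> {k. tile l h c k \<subseteq> \<Lambda> l - X}"
    obtain z where z: "z \<in> tile l h c k" using ne by blast
    with k obtain J where J: "J \<in> gaps X l" "z \<in> J" using Union_gaps[OF fin] by blast
    have "connected (tile l h c k)" unfolding tile_def by (rule connected_Ioo)
    moreover have "tile l h c k \<subseteq> \<Lambda> l - X" using k by simp
    moreover have "J \<inter> tile l h c k \<noteq> {}" using J z by blast
    ultimately have "tile l h c k \<subseteq> J" 
      by (rule components_maximal[OF J(1)[unfolded gaps_def]])
    then show "k \<in> (\<Union>J\<in>gaps X l. S J)" using J by (auto simp: S_def)
  next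
    fix k assume "k \<in> (\<Union>J\<in>gaps X l. S J)"
    then show "k \<in> {k. tile l h c k \<subseteq> \<Lambda> l - X}" using Union_gaps[OF fin] by (auto simp: S_def)
  qed
  show "finite {k. tile l h c k \<subseteq> \<Lambda> l - X}" unfolding eq using SJ finite_gaps[OF fin] by auto
  have "card (\<Union>J\<in>gaps X l. S J) = (\<Sum>J\<in>gaps X l. card (S J))"
  proof (rule card_UN_disjoint)
    show "\<forall>J\<in>gaps X l. \<forall>J'\<in>gaps X l. J \<noteq> J' \<longrightarrow> S J \<inter> S J' = {}"
      using ne gaps_disjoint[OF fin] unfolding S_def by fastforce
  qed (use SJ finite_gaps[OF fin] in auto)
  then have "h * real (card {k. tile l h c k \<subseteq> \<Lambda> l - X}) - excess X l c = 
    (\<Sum>J\<in>gaps X l. h * real (card (S J)) - max 0 (gaplen J - c))"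
    unfolding eq excess_def by (simp add: sum_distrib_left sum_subtractf)
  also have "\<bar>\<dots>\<bar> \<le> (\<Sum>J\<in>gaps X l. h * gaplen J / c)"
    by (rule sum_abs[THEN order_trans]) (intro sum_mono SJ)
  also have "\<dots> = h * real l / c"
    using sum_gaplen[OF fin] by (simp add: sum_distrib_left[symmetric] sum_divide_distrib[symmetric])
  finally show "\<bar>h * real (card {k. tile l h c k \<subseteq> \<Lambda> l - X}) - excess X l c\<bar> \<le> h * real l / c" .
qed

lemma excess_antimono: "c \<le> d \<Longrightarrow> excess X l d \<le> excess X l c"
  unfolding excess_def by (intro sum_mono) auto

lemma tile_subset_region:
  assumes "c > 0"
  shows "tile l h c k \<subseteq> \<Lambda> l - X \<longleftrightarrow> 
    X \<inter> tile l h c k = {} \<and> 0 \<le> real k * h \<and> real k * h + c \<le> real l"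
proof -
  have "tile l h c k \<subseteq> \<Lambda> l \<longleftrightarrow> 0 \<le> real k * h \<and> real k * h + c \<le> real l"
    unfolding tile_def \<Lambda>_def using assms
    by (subst greaterThanLessThan_subseteq_greaterThanLessThan) auto
  then show ?thesis by blast
qed

lemma sum_mod_split:
  fixes f :: "nat \<Rightarrow> real"
  shows "(\<Sum>k<m * n. f k) = (\<Sum>a<m. \<Sum>j<n. f (a + j * m))"
proof (cases "m = 0")
  case False
  have "(\<Sum>a<m. \<Sum>j<n. f (a + j * m)) = (\<Sum>(a, j)\<in>{..<m} \<times> {..<n}. f (a + j * m))"
    by (rule sum.cartesian_product)
  also have "\<dots> = (\<Sum>k<m * n. f k)"
  proof (rule sum.reindex_bij_witness[of _ "\<lambda>k. (k mod m, k div m)" "\<lambda>(a, j). a + j * m"])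
    fix p assume "p \<in> {..<m} \<times> {..<n}"
    then obtain a j where p: "p = (a, j)" "a < m" "j < n" by auto
    have "a + j * m < (Suc j) * m" using p by simp
    also have "\<dots> \<le> n * m" using p by (intro mult_right_mono) auto
    finally show "(case p of (a, j) \<Rightarrow> a + j * m) \<in> {..<m * n}" using p by (simp add: mult.commute)
  qed (use False in \<open>auto simp: less_mult_imp_div_less mult.commute split: prod.splits\<close>)
  finally show ?thesis by simp
qed simp

text \<open>Overlapping tiles are dependent. With step \<open>c / m\<close> the tiles whose indices
  agree modulo \<open>m\<close> are disjoint, so the law of large numbers is applied to each of the
  \<open>m\<close> residue classes and the results are added.\<close>

lemma tiles_slln:
  assumes M: "prob_space M" and pp: "poisson_process M r X" and c: "c > 0" and m: "m > 0"
  shows "AE \<omega> in M. (\<lambda>l. c / real m * real (card {k. tile l (c / real m) c k \<subseteq> \<Lambda> l - X \<omega>}) / real l) \<longlonglongrightarrow> exp (- (r * c))"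
proof -
  define h where "h = c / real m"
  have h: "h > 0" "real m * h = c" using c m by (auto simp: h_def)
  \<comment> \<open>The subtracted 1 leaves room at the right end, so that tiles with index below
    \<open>m * n l\<close> stay inside the box for every residue.\<close>
  define n where "n l = nat \<lfloor>real l / c\<rfloor> - 1" for l :: nat
  have fl: "real (nat \<lfloor>real l / c\<rfloor>) = of_int \<lfloor>real l / c\<rfloor>" for l
    using c by simp
  have n_le: "real (n l) \<le> real l / c" for l
  proof -
    have "real (n l) \<le> real (nat \<lfloor>real l / c\<rfloor>)" by (simp only: n_def of_nat_le_iff diff_le_self)
    then show ?thesis using fl[of l] by linarith
  qed
  have n_ge: "real (n l) \<ge> real l / c - 2" for l
  proof -
    have "real (n l) \<ge> real (nat \<lfloor>real l / c\<rfloor>) - 1" unfolding n_def by (simp add: of_nat_diff_real)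
    then show ?thesis using fl[of l] by linarith
  qed
  have n_lim: "(\<lambda>l. real (n l) / real l) \<longlonglongrightarrow> 1 / c"
  proof (rule tendsto_sandwich[where f = "\<lambda>l. 1 / c - 2 / real l" and h = "\<lambda>l. 1 / c"])
    show "\<forall>\<^sub>F l in sequentially. 1 / c - 2 / real l \<le> real (n l) / real l"
      using eventually_gt_at_top[of 0]
    proof eventually_elim
      case (elim l)
      have "(real l / c - 2) / real l \<le> real (n l) / real l"
        by (intro divide_right_mono n_ge) auto
      then show ?case using elim by (simp add: field_simps)
    qed
    show "\<forall>\<^sub>F l in sequentially. real (n l) / real l \<le> 1 / c"
      using eventually_gt_at_top[of 0]
    proof eventually_elim
      case (elim l)
      have "real (n l) / real l \<le> (real l / c) / real l"
        by (intro divide_right_mono n_le) auto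
      then show ?case using elim by simp
    qed
    show "(\<lambda>l. 1 / c - 2 / real l) \<longlonglongrightarrow> 1 / c"
      using tendsto_diff[OF tendsto_const[of "1/c"] lim_const_over_n[of 2]] by simp
  qed simp
  define Z where "Z \<omega> l k = (if X \<omega> \<inter> tile l h c k = {} then 1 else 0 :: real)" for \<omega> l k
  have "AE \<omega> in M. (\<lambda>l. ((\<Sum>j<n l. Z \<omega> l (a + j * m)) - real (n l) * exp (- (r * c))) / real l) \<longlonglongrightarrow> 0" for a
    unfolding Z_def
  proof (rule poisson_empty_slln[OF M pp, where C = "1 / c"])
    show "tile l h c (a + j * m) \<in> sets borel \<and> bounded (tile l h c (a + j * m)) \<and> measure lborel (tile l h c (a + j * m)) = c" for l j
      using c by (simp add: tile_def)
    show "disjoint_family_on (\<lambda>j. tile l h c (a + j * m)) {..<n l}" for l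
    proof -
      have "tile l h c (a + i * m) \<inter> tile l h c (a + j * m) = {}" if "i < j" for i j
      proof -
        have "real (Suc i) * c \<le> real j * c" using that c by (intro mult_right_mono) auto
        then have "real (a + i * m) * h + c \<le> real (a + j * m) * h"
          using h by (simp add: algebra_simps) (metis h(2) mult.assoc mult.commute)
        then show ?thesis by (auto simp: tile_def)
      qed
      then show ?thesis unfolding disjoint_family_on_def by (metis Int_commute linorder_neqE_nat)
    qed
    show "real (n l) \<le> 1 / c * real l" for l using n_le[of l] by simp
  qed (use c in auto)
  then have "AE \<omega> in M. \<forall>a. (\<lambda>l. ((\<Sum>j<n l. Z \<omega> l (a + j * m)) - real (n l) * exp (- (r * c))) / real l) \<longlonglongrightarrow> 0"
    by (subst AE_all_countable) simp
  moreover have "AE \<omega> in M. \<omega> \<in> space M" by simp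
  ultimately show ?thesis
  proof eventually_elim
    case (elim \<omega>)
    have fin: "finite (X \<omega> \<inter> \<Lambda> l)" for l
      using pp elim(2) \<Lambda>_props(2) unfolding poisson_process_def by blast
    define T where "T l = (\<Sum>k<m * n l. Z \<omega> l k)" for l
    define N where "N l = card {k. tile l h c k \<subseteq> \<Lambda> l - X \<omega>}" for l
    have "(\<lambda>l. (\<Sum>a<m. ((\<Sum>j<n l. Z \<omega> l (a + j * m)) - real (n l) * exp (- (r * c))) / real l)) \<longlonglongrightarrow> (\<Sum>a<m. 0)"
      using elim(1) by (intro tendsto_sum) auto
    then have "(\<lambda>l. T l / real l - real m * exp (- (r * c)) * (real (n l) / real l)) \<longlonglongrightarrow> 0"
      by (simp add: T_def sum_mod_split sum_subtractf diff_divide_distrib sum_divide_distrib[symmetric] mult_ac)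
    from tendsto_add[OF this tendsto_mult[OF tendsto_const[of "real m * exp (- (r * c))"] n_lim]]
    have T: "(\<lambda>l. T l / real l) \<longlonglongrightarrow> real m * exp (- (r * c)) / c" by simp
    \<comment> \<open>Tiles that fit but have index at least \<open>m * n l\<close> lie near the
      right end of the box; there are at most \<open>3 * m + 1\<close> of them, negligible against
      \<open>l\<close>.\<close>
    have NT: "T l \<le> real (N l) \<and> real (N l) \<le> T l + (3 * real m + 1)" for l
    proof -
      define A where "A = {k. k < m * n l \<and> X \<omega> \<inter> tile l h c k = {}}"
      have finA: "finite A" unfolding A_def by auto
      have TA: "T l = real (card A)"
      proof -
        have "T l = (\<Sum>k\<in>{..<m * n l}. if k \<in> {k. X \<omega> \<inter> tile l h c k = {}} then 1 else 0)"
          unfolding T_def Z_def by simp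
        also have "\<dots> = (\<Sum>k\<in>{..<m * n l} \<inter> {k. X \<omega> \<inter> tile l h c k = {}}. 1)"
          by (rule sum.inter_restrict[symmetric]) simp
        also have "{..<m * n l} \<inter> {k. X \<omega> \<inter> tile l h c k = {}} = A" by (auto simp: A_def)
        finally show ?thesis by simp
      qed
      have finN: "finite {k. tile l h c k \<subseteq> \<Lambda> l - X \<omega>}"
        by (rule excess_tiles(1)[OF fin h(1) c])
      have sub1: "A \<subseteq> {k. tile l h c k \<subseteq> \<Lambda> l - X \<omega>}"
      proof
        fix k assume k: "k \<in> A"
        have "real k * h + c \<le> real l"
        proof -
          have n1: "n l \<ge> 1" using k by (cases "n l = 0") (auto simp: A_def)
          then have f: "real (n l) + 1 \<le> real l / c" unfolding n_def by linarith
          have "k \<le> m * n l" using k by (simp add: A_def)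
          then have "real k \<le> real (m * n l)" by (simp only: of_nat_le_iff)
          then have "real k * h + c \<le> real (m * n l) * h + c" using h by (intro add_right_mono mult_right_mono) auto
          also have "\<dots> = (real (n l) + 1) * c" using h by (simp add: algebra_simps)
          also have "\<dots> \<le> real l / c * c" using f c by (intro mult_right_mono) auto
          finally show ?thesis using c by simp
        qed
        then show "k \<in> {k. tile l h c k \<subseteq> \<Lambda> l - X \<omega>}"
          using k tile_subset_region[OF c, of l h k "X \<omega>"] h by (auto simp: A_def)
      qed
      have sub2: "{k. tile l h c k \<subseteq> \<Lambda> l - X \<omega>} \<subseteq> A \<union> {m * n l..<m * n l + (3 * m + 1)}"
      proof
        fix k assume k: "k \<in> {k. tile l h c k \<subseteq> \<Lambda> l - X \<omega>}"
        then have k1: "X \<omega> \<inter> tile l h c k = {}" "real k * h + c \<le> real l"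
          using tile_subset_region[OF c, of l h k "X \<omega>"] by auto
        have "real k * h \<le> real l" using k1 c by simp
        also have "\<dots> = (real l / c) * c" using c by simp
        also have "\<dots> \<le> (real (n l) + 2) * c" using n_ge[of l] c by (intro mult_right_mono) auto
        also have "\<dots> = (real (n l) + 2) * real m * h" using h by simp
        finally have "real k \<le> (real (n l) + 2) * real m" using h(1) by (metis mult_le_cancel_right_pos)
        then have "real k \<le> real (m * n l + 2 * m)" by (simp add: algebra_simps)
        then have "k \<le> m * n l + 2 * m" by (simp only: of_nat_le_iff)
        then show "k \<in> A \<union> {m * n l..<m * n l + (3 * m + 1)}" using k1 by (auto simp: A_def)
      qed
      have "card A \<le> N l" unfolding N_def by (rule card_mono[OF finN sub1])
      moreover have "N l \<le> card A + (3 * m + 1)"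
      proof -
        have "N l \<le> card (A \<union> {m * n l..<m * n l + (3 * m + 1)})"
          unfolding N_def by (rule card_mono[OF _ sub2]) (simp add: finA)
        also have "\<dots> \<le> card A + card {m * n l..<m * n l + (3 * m + 1)}" by (rule card_Un_le)
        finally show ?thesis by simp
      qed
      ultimately show ?thesis unfolding TA by linarith
    qed
    have "(\<lambda>l. real (N l) / real l) \<longlonglongrightarrow> real m * exp (- (r * c)) / c"
    proof (rule tendsto_sandwich[OF _ _ T])
      show "(\<lambda>l. T l / real l + (3 * real m + 1) / real l) \<longlonglongrightarrow> real m * exp (- (r * c)) / c"
        using tendsto_add[OF T lim_const_over_n] by simp
    qed (use NT in \<open>auto simp: add_divide_distrib[symmetric] intro!: divide_right_mono always_eventually\<close>)
    from tendsto_mult[OF tendsto_const[of "c / real m"] this] 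
    show ?case using c m by (simp add: N_def h_def)
  qed
qed

text \<open>The asymptotic law of the gap lengths, as the only probabilistic input used later.\<close>

definition regular :: "real set \<Rightarrow> real \<Rightarrow> bool" where
  "regular X r \<longleftrightarrow> (\<forall>l. finite (X \<inter> \<Lambda> l)) \<and> (\<forall>c>0. (\<lambda>l. excess X l c / real l) \<longlonglongrightarrow> exp (- (r * c)))"

text \<open>Only countably many pairs of a rational window length and a subdivision enter the
  exceptional null set. Refining the subdivision passes from tile counts to \<open>excess\<close>;
  monotonicity of \<open>excess\<close> in the window and continuity of the limit pass from rational
  to real windows.\<close>

lemma AE_regular:
  assumes M: "prob_space M" and pp: "poisson_process M r X"
  shows "AE \<omega> in M. regular (X \<omega>) r"
proof -
  have "AE \<omega> in M. \<forall>q\<in>\<rat>. \<forall>m. q > 0 \<longrightarrow>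
      (\<lambda>l. q / real (Suc m) * real (card {k. tile l (q / real (Suc m)) q k \<subseteq> \<Lambda> l - X \<omega>}) / real l) \<longlonglongrightarrow> exp (- (r * q))"
  proof (subst AE_ball_countable[OF countable_rat], intro ballI, subst AE_all_countable, intro allI)
    fix q :: real and m :: nat
    show "AE \<omega> in M. q > 0 \<longrightarrow>
      (\<lambda>l. q / real (Suc m) * real (card {k. tile l (q / real (Suc m)) q k \<subseteq> \<Lambda> l - X \<omega>}) / real l) \<longlonglongrightarrow> exp (- (r * q))"
    proof (cases "q > 0")
      case True
      then show ?thesis using tiles_slln[OF M pp True, of "Suc m"] by (simp del: of_nat_Suc)
    qed simp
  qed
  moreover have "AE \<omega> in M. \<omega> \<in> space M" by simp
  ultimately show ?thesis
  proof eventually_elim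
    case (elim \<omega>)
    have fin: "finite (X \<omega> \<inter> \<Lambda> l)" for l
      using pp elim(2) \<Lambda>_props(2) unfolding poisson_process_def by blast
    have rat: "(\<lambda>l. excess (X \<omega>) l q / real l) \<longlonglongrightarrow> exp (- (r * q))" if q: "q \<in> \<rat>" "q > 0" for q
    proof (rule LIMSEQ_I)
      fix e :: real assume e: "e > 0"
      \<comment> \<open>Per unit length the tile count misses \<open>excess\<close> by at most
        \<open>1 / real (Suc m)\<close>.\<close>
      obtain m where m: "1 / real (Suc m) < e / 2" using nat_approx_posE[of "e/2"] e by auto
      define h where "h = q / real (Suc m)"
      have h: "h > 0" using q by (simp add: h_def)
      define N where "N l = real (card {k. tile l h q k \<subseteq> \<Lambda> l - X \<omega>})" for l
      have "(\<lambda>l. h * N l / real l) \<longlonglongrightarrow> exp (- (r * q))"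
        using elim(1) q unfolding N_def h_def by blast
      then have "\<forall>\<^sub>F l in sequentially. dist (h * N l / real l) (exp (- (r * q))) < e / 2"
        using e by (intro tendstoD) auto
      then have "\<forall>\<^sub>F l in sequentially. norm (excess (X \<omega>) l q / real l - exp (- (r * q))) < e"
        using eventually_gt_at_top[of 0]
      proof eventually_elim
        case (elim l)
        have "\<bar>h * N l - excess (X \<omega>) l q\<bar> / real l \<le> (h * real l / q) / real l"
          using excess_tiles(2)[OF fin h q(2), of l] by (intro divide_right_mono) (auto simp: N_def)
        also have "\<dots> = 1 / real (Suc m)" using elim q by (simp add: h_def)
        finally have "\<bar>h * N l / real l - excess (X \<omega>) l q / real l\<bar> \<le> 1 / real (Suc m)"
          by (simp add: diff_divide_distrib[symmetric] abs_divide)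
        moreover have "\<bar>b - x\<bar> < e" if "\<bar>a - b\<bar> \<le> t" "\<bar>a - x\<bar> < e / 2" "t < e / 2" for a b x t :: real
          using that by linarith
        ultimately show ?case using elim m unfolding dist_real_def real_norm_def by blast
      qed
      then show "\<exists>no. \<forall>l\<ge>no. norm (excess (X \<omega>) l q / real l - exp (- (r * q))) < e"
        by (simp add: eventually_sequentially)
    qed
    have "(\<lambda>l. excess (X \<omega>) l c / real l) \<longlonglongrightarrow> exp (- (r * c))" if c: "c > 0" for c
    proof (rule LIMSEQ_I)
      fix e :: real assume e: "e > 0"
      have "isCont (\<lambda>q. exp (- (r * q))) c" by (intro continuous_intros)
      then obtain d where d: "d > 0" "\<And>q. \<bar>q - c\<bar> < d \<Longrightarrow> \<bar>exp (- (r * q)) - exp (- (r * c))\<bar> < e / 2"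
        using e unfolding continuous_at_eps_delta dist_real_def by (metis half_gt_zero)
      obtain p where p: "p \<in> \<rat>" "max (c - d) 0 < p" "p < c" using Rats_dense_in_real[of "max (c - d) 0" c] c d by auto
      obtain q where q: "q \<in> \<rat>" "c < q" "q < c + d" using Rats_dense_in_real[of c "c + d"] d by auto
      have "\<forall>\<^sub>F l in sequentially. dist (excess (X \<omega>) l p / real l) (exp (- (r * p))) < e / 2"
        using e p by (intro tendstoD rat) auto
      moreover have "\<forall>\<^sub>F l in sequentially. dist (excess (X \<omega>) l q / real l) (exp (- (r * q))) < e / 2"
        using e q c by (intro tendstoD rat) auto
      ultimately have "\<forall>\<^sub>F l in sequentially. norm (excess (X \<omega>) l c / real l - exp (- (r * c))) < e"
      proof eventually_elim
        case (elim l)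
        have "excess (X \<omega>) l c / real l \<le> excess (X \<omega>) l p / real l"
          using p by (intro divide_right_mono excess_antimono) auto
        moreover have "excess (X \<omega>) l q / real l \<le> excess (X \<omega>) l c / real l"
          using q by (intro divide_right_mono excess_antimono) auto
        moreover have "\<bar>exp (- (r * p)) - exp (- (r * c))\<bar> < e / 2" "\<bar>exp (- (r * q)) - exp (- (r * c))\<bar> < e / 2"
          using p q d by auto
        ultimately show ?case using elim unfolding dist_real_def real_norm_def by linarith
      qed
      then show "\<exists>no. \<forall>l\<ge>no. norm (excess (X \<omega>) l c / real l - exp (- (r * c))) < e"
        by (simp add: eventually_sequentially)
    qed
    with fin show ?case by (simp add: regular_def)
  qed
qed


text \<open>One gap of length L alone contributes at least \<open>L - c\<close> to
  \<open>excess X l c\<close>, which is of order \<open>exp (- (r * c)) * l\<close>;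
  \<open>c\<close> is taken so large that this factor is at most
  \<open>\<delta> / 4\<close>.\<close>

lemma eventually_gaplen_le:
  assumes reg: "regular X r" and r: "r > 0" and \<delta>: "\<delta> > 0"
  shows "\<forall>\<^sub>F l in sequentially. \<forall>J\<in>gaps X l. gaplen J \<le> \<delta> * real l"
proof -
  define c where "c = max 1 (- ln (\<delta> / 4) / r)"
  have c: "c > 0" by (simp add: c_def)
  have "- (r * c) \<le> ln (\<delta> / 4)"
    using r by (simp add: c_def max_def field_simps)
  then have ec: "exp (- (r * c)) \<le> \<delta> / 4" using \<delta> by (metis exp_le_cancel_iff exp_ln divide_pos_pos zero_less_numeral)
  have "(\<lambda>l. excess X l c / real l) \<longlonglongrightarrow> exp (- (r * c))"
    using reg c by (simp add: regular_def)
  then have "\<forall>\<^sub>F l in sequentially. excess X l c / real l < \<delta> / 2"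
    using ec \<delta> by (intro order_tendstoD) auto
  moreover have "\<forall>\<^sub>F l in sequentially. real l \<ge> 2 * c / \<delta>"
    by (rule eventually_sequentiallyI[of "nat \<lceil>2 * c / \<delta>\<rceil>"]) linarith
  ultimately show ?thesis using eventually_gt_at_top[of 0]
  proof eventually_elim
    case (elim l)
    have fin: "finite (X \<inter> \<Lambda> l)" using reg by (simp add: regular_def)
    have "gaplen J \<le> \<delta> * real l" if J: "J \<in> gaps X l" for J
    proof -
      have "max 0 (gaplen J - c) \<le> excess X l c"
        unfolding excess_def by (rule member_le_sum) (use J finite_gaps[OF fin] in auto)
      then have "gaplen J \<le> c + excess X l c" by simp
      moreover have "excess X l c < \<delta> / 2 * real l" using elim by (simp add: divide_less_eq)
      moreover have "c \<le> \<delta> / 2 * real l" using elim(2) \<delta> by (simp add: field_simps)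
      ultimately show ?thesis by (simp add: field_simps)
    qed
    then show ?case by blast
  qed
qed

text \<open>Otherwise \<open>excess X l c\<close> would vanish, while its limit per unit length is
  positive.\<close>

lemma eventually_long_gap:
  assumes reg: "regular X r" and c: "c > 0"
  shows "\<forall>\<^sub>F l in sequentially. \<exists>J\<in>gaps X l. gaplen J > c"
proof -
  have "(\<lambda>l. excess X l c / real l) \<longlonglongrightarrow> exp (- (r * c))"
    using reg c by (simp add: regular_def)
  then have "\<forall>\<^sub>F l in sequentially. excess X l c / real l > 0"
    by (rule order_tendstoD) simp
  then show ?thesis
  proof eventually_elim
    case (elim l)
    show ?case
    proof (rule ccontr)
      assume "\<not> (\<exists>J\<in>gaps X l. gaplen J > c)"
      then have "excess X l c = 0" unfolding excess_def by (intro sum.neutral) auto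
      then show False using elim by simp
    qed
  qed
qed

text \<open>The law of the length of the gap containing a uniformly chosen point of the box. Its
  limit \<open>gap_law\<close> is the size-biased exponential law, a Gamma law of shape 2, since
  long gaps are hit more often.\<close>

definition gap_measure :: "real set \<Rightarrow> nat \<Rightarrow> real measure" where
  "gap_measure X l = distr (point_measure (gaps X l) (\<lambda>J. ennreal (gaplen J / real l))) borel gaplen"

definition gap_law :: "real \<Rightarrow> real measure" where
  "gap_law r = density lborel (erlang_density 1 r)"

context
  fixes X :: "real set" and l :: nat
  assumes fin: "finite (X \<inter> \<Lambda> l)" and l: "l \<ge> 1"
begin

lemma real_distribution_gap_measure: "real_distribution (gap_measure X l)"
proof -
  let ?P = "point_measure (gaps X l) (\<lambda>J. ennreal (gaplen J / real l))"
  have "(\<Sum>J\<in>gaps X l. gaplen J / real l) = 1"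
    using sum_gaplen[OF fin] l by (simp add: sum_divide_distrib[symmetric])
  then have "emeasure ?P (space ?P) = 1"
    using finite_gaps[OF fin] gaplen_pos[OF fin]
    by (simp add: space_point_measure emeasure_point_measure_finite sum_ennreal less_imp_le)
  then interpret prob_space ?P by (rule prob_spaceI)
  show ?thesis unfolding gap_measure_def by (rule real_distribution_distr) simp
qed

lemma integral_gap_measure:
  fixes G :: "real \<Rightarrow> real"
  assumes [measurable]: "G \<in> borel_measurable borel"
  shows "(\<integral>x. G x \<partial>gap_measure X l) = (\<Sum>J\<in>gaps X l. gaplen J * G (gaplen J)) / real l"
  unfolding gap_measure_def
  using finite_gaps[OF fin] gaplen_pos[OF fin]
  by (subst integral_distr) (auto simp: lebesgue_integral_point_measure_finite sum_divide_distrib less_imp_le)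

lemma cdf_gap_measure: "cdf (gap_measure X l) x = (\<Sum>J\<in>gaps X l. if gaplen J \<le> x then gaplen J else 0) / real l"
proof -
  interpret real_distribution "gap_measure X l" by (rule real_distribution_gap_measure)
  have "cdf (gap_measure X l) x = (\<integral>y. indicator {..x} y \<partial>gap_measure X l)"
    by (simp add: cdf_def)
  also have "\<dots> = (\<Sum>J\<in>gaps X l. if gaplen J \<le> x then gaplen J else 0) / real l"
    by (subst integral_gap_measure) (auto intro!: sum.cong arg_cong2[where f = "(/)"])
  finally show ?thesis .
qed

text \<open>The total length of gaps longer than \<open>c\<close> equals \<open>excess\<close> at
  \<open>c\<close> plus \<open>c\<close> times their number. That number is minus a one-sided slope
  of the convex function \<open>excess\<close> and lies between its difference quotients of step
  \<open>d\<close>.\<close>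

lemma excess_squeeze:
  assumes c: "c > 0" and d: "0 < d" "d < c"
  defines "W \<equiv> (\<Sum>J\<in>gaps X l. if gaplen J \<le> c then gaplen J else 0)"
  shows "excess X l c + c / d * (excess X l c - excess X l (c + d)) \<le> real l - W"
    and "real l - W \<le> excess X l c + c / d * (excess X l (c - d) - excess X l c)"
proof -
  have W: "real l - W = (\<Sum>J\<in>gaps X l. if gaplen J \<le> c then 0 else gaplen J)"
    unfolding W_def sum_gaplen[OF fin, symmetric] sum_subtractf[symmetric] by (rule sum.cong) auto
  have 1: "max 0 (L - c) + c / d * (max 0 (L - c) - max 0 (L - (c + d))) \<le> (if L \<le> c then 0 else L)" for L
  proof -
    have "c / d * (max 0 (L - c) - max 0 (L - (c + d))) \<le> c / d * d" if "L > c"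
      using that c d by (intro mult_left_mono) auto
    then show ?thesis using c d by auto
  qed
  have 2: "(if L \<le> c then 0 else L) \<le> max 0 (L - c) + c / d * (max 0 (L - (c - d)) - max 0 (L - c))" for L
  proof -
    have "max 0 (L - (c - d)) - max 0 (L - c) = d" if "L > c" using that d by auto
    then show ?thesis using c d by auto
  qed
  show "excess X l c + c / d * (excess X l c - excess X l (c + d)) \<le> real l - W"
    unfolding W excess_def sum_subtractf[symmetric] sum_distrib_left sum.distrib[symmetric]
    by (intro sum_mono 1)
  show "real l - W \<le> excess X l c + c / d * (excess X l (c - d) - excess X l c)"
    unfolding W excess_def sum_subtractf[symmetric] sum_distrib_left sum.distrib[symmetric]
    by (intro sum_mono 2)
qed

end

lemma real_distribution_gap_law: "r > 0 \<Longrightarrow> real_distribution (gap_law r)"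
  unfolding gap_law_def real_distribution_def real_distribution_axioms_def
  by (auto simp: prob_space_erlang_density)

lemma cdf_gap_law: 
  assumes "r > 0" 
  shows "cdf (gap_law r) x = (if x < 0 then 0 else 1 - (1 + r * x) * exp (- (r * x)))"
proof -
  have "cdf (gap_law r) x = enn2real (ennreal (erlang_CDF 1 r x))"
    using assms by (simp add: cdf_def gap_law_def measure_def emeasure_erlang_density)
  also have "\<dots> = erlang_CDF 1 r x" using assms by simp
  finally show ?thesis by (simp add: erlang_CDF_def algebra_simps)
qed

text \<open>With \<open>f c = exp (- (r * c))\<close> the limit of \<open>excess\<close>, the mass
  of lengths above x tends to f(x) - x f'(x) = (1 + r x) f(x), the tail of \<open>gap_law\<close>.
  The sandwich between difference quotients allows the limit in \<open>l\<close> to be taken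
  first.\<close>

lemma weak_conv_gap_measure:
  assumes reg: "regular X r" and r: "r > 0"
  shows "weak_conv_m (\<lambda>l. gap_measure X (Suc l)) (gap_law r)"
  unfolding weak_conv_m_def weak_conv_def
proof (intro allI impI)
  fix x :: real
  have fin: "finite (X \<inter> \<Lambda> l)" for l using reg by (simp add: regular_def)
  show "(\<lambda>l. cdf (gap_measure X (Suc l)) x) \<longlonglongrightarrow> cdf (gap_law r) x"
  proof (cases "x > 0")
    case False
    have "cdf (gap_measure X (Suc l)) x = 0" for l
    proof -
      have "(\<Sum>J\<in>gaps X (Suc l). if gaplen J \<le> x then gaplen J else 0) = 0"
        using gaplen_pos[OF fin] False by (intro sum.neutral) force
      then show ?thesis by (simp add: cdf_gap_measure[OF fin])
    qed
    moreover have "cdf (gap_law r) x = 0" using False r by (auto simp: cdf_gap_law)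
    ultimately show ?thesis by simp
  next
    case True
    define W where "W l = (\<Sum>J\<in>gaps X l. if gaplen J \<le> x then gaplen J else 0)" for l
    define w where "w = (1 + r * x) * exp (- (r * x))"
    define f where "f c = exp (- (r * c))" for c
    have V: "(\<lambda>l. excess X l c / real l) \<longlonglongrightarrow> f c" if "c > 0" for c
      using reg that by (simp add: regular_def f_def)
    have "(f has_field_derivative - r * f x) (at x)"
      unfolding f_def by (auto intro!: derivative_eq_intros)
    then have df: "(\<lambda>h. (f (x + h) - f x) / h) \<midarrow>0\<rightarrow> - r * f x" by (simp add: DERIV_def)
    have "(\<lambda>l. 1 - W l / real l) \<longlonglongrightarrow> w"
    proof (rule LIMSEQ_I)
      fix e :: real assume e: "e > 0"
      \<comment> \<open>\<open>lo\<close> and \<open>up\<close> differ from \<open>w\<close> by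
        \<open>x\<close> times the error of a difference quotient, hence the division by
        \<open>2 * x\<close>.\<close>
      have "e / (2 * x) > 0" using e True by simp
      from LIM_D[OF df this] obtain s where s: "s > 0" 
        "\<And>h. h \<noteq> 0 \<Longrightarrow> \<bar>h\<bar> < s \<Longrightarrow> \<bar>(f (x + h) - f x) / h + r * f x\<bar> < e / (2 * x)"
        by auto
      define d where "d = min s x / 2"
      have d: "0 < d" "d < x" "d < s" using s True by (auto simp: d_def)
      define lo where "lo = f x + x / d * (f x - f (x + d))"
      define up where "up = f x + x / d * (f (x - d) - f x)"
      have lo: "\<bar>lo - w\<bar> < e / 2" 
      proof -
        have "lo - w = - x * ((f (x + d) - f x) / d + r * f x)"
          using d by (simp add: lo_def w_def f_def field_simps)
        then have "\<bar>lo - w\<bar> = x * \<bar>(f (x + d) - f x) / d + r * f x\<bar>" using True by (simp add: abs_mult)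
        also have "\<dots> < x * (e / (2 * x))" using s(2)[of d] d True by (intro mult_strict_left_mono) auto
        finally show ?thesis using True by simp
      qed
      have up: "\<bar>up - w\<bar> < e / 2" 
      proof -
        have "up - w = - x * ((f (x + (- d)) - f x) / (- d) + r * f x)"
          using d by (simp add: up_def w_def f_def field_simps)
        then have "\<bar>up - w\<bar> = x * \<bar>(f (x + (- d)) - f x) / (- d) + r * f x\<bar>" using True by (simp add: abs_mult)
        also have "\<dots> < x * (e / (2 * x))" using s(2)[of "- d"] d True by (intro mult_strict_left_mono) auto
        finally show ?thesis using True by simp
      qed
      have "(\<lambda>l. excess X l x / real l + x / d * (excess X l x / real l - excess X l (x + d) / real l)) \<longlonglongrightarrow> lo"
        unfolding lo_def using True d by (intro tendsto_add tendsto_mult tendsto_diff tendsto_const V) auto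
      then have "\<forall>\<^sub>F l in sequentially. dist (excess X l x / real l + x / d * (excess X l x / real l - excess X l (x + d) / real l)) lo < e / 2"
        using e by (intro tendstoD) auto
      moreover have "(\<lambda>l. excess X l x / real l + x / d * (excess X l (x - d) / real l - excess X l x / real l)) \<longlonglongrightarrow> up"
        unfolding up_def using True d by (intro tendsto_add tendsto_mult tendsto_diff tendsto_const V) auto
      then have "\<forall>\<^sub>F l in sequentially. dist (excess X l x / real l + x / d * (excess X l (x - d) / real l - excess X l x / real l)) up < e / 2"
        using e by (intro tendstoD) auto
      ultimately have "\<forall>\<^sub>F l in sequentially. norm (1 - W l / real l - w) < e"
        using eventually_ge_at_top[of 1]
      proof eventually_elim
        case (elim l)
        have eq: "1 - W l / real l = (real l - W l) / real l" using elim by (simp add: field_simps)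
        have dist: "(a + x / d * (b - c)) / real l = a / real l + x / d * (b / real l - c / real l)" for a b c
          using elim(3) d(1) by (simp add: field_simps)
        have 1: "(excess X l x + x / d * (excess X l x - excess X l (x + d))) / real l \<le> 1 - W l / real l"
          unfolding eq unfolding W_def using excess_squeeze(1)[OF fin elim(3) True d(1,2)] by (intro divide_right_mono) auto
        have 2: "1 - W l / real l \<le> (excess X l x + x / d * (excess X l (x - d) - excess X l x)) / real l"
          unfolding eq unfolding W_def using excess_squeeze(2)[OF fin elim(3) True d(1,2)] by (intro divide_right_mono) auto
        have "\<bar>t - w\<bar> < e" if "p \<le> t" "t \<le> q" "\<bar>p - lo\<bar> < e / 2" "\<bar>q - up\<bar> < e / 2" for p q t
          using that lo up by linarith
        then show ?case 
          using 1[unfolded dist] 2[unfolded dist] elim unfolding dist_real_def real_norm_def by blast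
      qed
      then show "\<exists>no. \<forall>l\<ge>no. norm (1 - W l / real l - w) < e"
        by (simp add: eventually_sequentially)
    qed
    from tendsto_diff[OF tendsto_const[of 1] this] have "(\<lambda>l. W l / real l) \<longlonglongrightarrow> 1 - w" by simp
    then have "(\<lambda>l. W (Suc l) / real (Suc l)) \<longlonglongrightarrow> 1 - w" by (rule LIMSEQ_Suc)
    moreover have "cdf (gap_measure X (Suc l)) x = W (Suc l) / real (Suc l)" for l
      by (simp add: cdf_gap_measure[OF fin] W_def)
    moreover have "cdf (gap_law r) x = 1 - w" using True r by (simp add: cdf_gap_law w_def)
    ultimately show ?thesis by simp
  qed
qed

text \<open>Weak convergence for bounded functions with a null set of discontinuities: countable
  sets are null because the limit law has a density, and the law is carried by positive
  lengths.\<close>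

lemma gap_average:
  fixes G :: "real \<Rightarrow> real"
  assumes reg: "regular X r" and r: "r > 0"
    and [measurable]: "G \<in> borel_measurable borel" and B: "\<And>x. \<bar>G x\<bar> \<le> B"
    and D: "countable D" "\<And>x. x > 0 \<Longrightarrow> x \<notin> D \<Longrightarrow> isCont G x"
  shows "(\<lambda>l. (\<Sum>J\<in>gaps X l. gaplen J * G (gaplen J)) / real l) \<longlonglongrightarrow> (\<integral>x. G x \<partial>gap_law r)"
proof -
  have fin: "finite (X \<inter> \<Lambda> l)" for l using reg by (simp add: regular_def)
  interpret T: real_distribution "gap_law r" by (rule real_distribution_gap_law[OF r])
  have "D \<in> null_sets lborel" using D(1) by (rule countable_imp_null_set_lborel)
  then have "D \<in> null_sets (gap_law r)"
    unfolding gap_law_def using absolutely_continuousI_density[of "erlang_density 1 r" lborel]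
    by (auto simp: absolutely_continuous_def)
  moreover have "{..0} \<in> null_sets (gap_law r)"
  proof -
    have "measure (gap_law r) {..0} = 0" using cdf_gap_law[OF r, of 0] by (simp add: cdf_def)
    then show ?thesis by (auto simp: null_sets_def T.emeasure_eq_measure)
  qed
  ultimately have null: "{..0} \<union> D \<in> null_sets (gap_law r)" by (rule null_sets.Un[rotated])
  \<comment> \<open>If the set of discontinuities were not measurable, its \<open>emeasure\<close>
    would be 0 by convention.\<close>
  have "emeasure (gap_law r) {x. \<not> isCont G x} = 0"
  proof (cases "{x. \<not> isCont G x} \<in> sets (gap_law r)")
    case True
    have "{x. \<not> isCont G x} \<subseteq> {..0} \<union> D"
    proof
      fix x assume "x \<in> {x. \<not> isCont G x}"
      then show "x \<in> {..0} \<union> D" using D(2)[of x] by (cases "x > 0") auto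
    qed
    then show ?thesis using null_sets_subset[OF null True] by auto
  qed (simp add: emeasure_notin_sets)
  then have "(\<lambda>l. \<integral>x. G x \<partial>gap_measure X (Suc l)) \<longlonglongrightarrow> (\<integral>x. G x \<partial>gap_law r)"
    using B by (intro weak_conv_imp_bdd_ae_continuous_conv[of _ _ G B])
      (auto intro: real_distribution_gap_measure[OF fin] real_distribution_gap_law r weak_conv_gap_measure[OF reg r])
  then have "(\<lambda>l. (\<Sum>J\<in>gaps X (Suc l). gaplen J * G (gaplen J)) / real (Suc l)) \<longlonglongrightarrow> (\<integral>x. G x \<partial>gap_law r)"
    by (simp add: integral_gap_measure[OF fin])
  then show ?thesis by (rule LIMSEQ_imp_Suc)
qed

section \<open>Modes of the gaps and modes of the box\<close>

lemma L2_iff_sqi: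
  assumes "S \<in> sets borel"
  shows "L2 S f \<longleftrightarrow> sqi (restrict_space lborel S) f"
  using assms unfolding L2_def sqi_def set_borel_measurable_def set_integrable_def
  by (subst borel_measurable_restrict_space_iff) (auto simp: integrable_restrict_space)

lemma L2_inner_eq_ip:
  assumes "S \<in> sets borel"
  shows "L2_inner S f g = ip (restrict_space lborel S) f g"
  using assms unfolding L2_inner_def ip_def set_lebesgue_integral_def
  by (subst integral_restrict_space) auto

lemma orthonormal_basis_iff_total:
  assumes "S \<in> sets borel"
  shows "orthonormal_basis S \<phi> \<longleftrightarrow> total (restrict_space lborel S) \<phi>"
  using assms unfolding orthonormal_basis_def total_def orthonormal_def
  by (simp add: L2_iff_sqi L2_inner_eq_ip AE_restrict_space_iff)

lemma integral_Ioo_FTC: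
  fixes f F :: "real \<Rightarrow> real"
  assumes ab: "a \<le> b" and F: "\<And>x. (F has_real_derivative f x) (at x)" and f: "\<And>x. isCont f x"
  shows "integrable lborel (\<lambda>x. indicator {a<..<b} x * f x)"
    "(\<integral>x. indicator {a<..<b} x * f x \<partial>lborel) = F b - F a"
proof -
  have "has_bochner_integral lborel (\<lambda>x. f x * indicator {a..b} x) (F b - F a)"
    using ab F f by (intro has_bochner_integral_FTC_Icc_real) auto
  moreover have [measurable]: "f \<in> borel_measurable borel"
    using f by (intro borel_measurable_continuous_onI continuous_at_imp_continuous_on) auto
  have "AE x in lborel. f x * indicator {a..b} x = indicator {a<..<b} x * f x"
    using AE_lborel_singleton[of a] AE_lborel_singleton[of b] by eventually_elim (auto simp: indicator_def)
  ultimately have "has_bochner_integral lborel (\<lambda>x. indicator {a<..<b} x * f x) (F b - F a)"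
    by (subst (asm) has_bochner_integral_cong_AE) auto
  then show "integrable lborel (\<lambda>x. indicator {a<..<b} x * f x)"
    "(\<integral>x. indicator {a<..<b} x * f x \<partial>lborel) = F b - F a"
    by (auto simp: has_bochner_integral_iff)
qed

definition wave :: "real \<Rightarrow> nat \<Rightarrow> real" where
  "wave L n = real (Suc n) * pi / L"

definition box_energy :: "real \<Rightarrow> nat \<Rightarrow> real" where
  "box_energy L n = (wave L n)\<^sup>2 / 2"

text \<open>The normalised Dirichlet eigenfunction of the gap, extended by 0, with
  \<open>n = 0\<close> for the ground state.\<close>

definition smode :: "real set \<Rightarrow> nat \<Rightarrow> real \<Rightarrow> real" where
  "smode J n x = indicator J x * (sqrt (2 / gaplen J) * sin (wave (gaplen J) n * (x - Inf J)))"

lemma sin_wave: "L > 0 \<Longrightarrow> sin (wave L n * L) = 0"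
  by (simp add: wave_def del: of_nat_Suc)

lemma wave_pos: "L > 0 \<Longrightarrow> wave L n > 0"
  by (simp add: wave_def)

lemma wave_inj: "L > 0 \<Longrightarrow> wave L n = wave L m \<longleftrightarrow> n = m"
  by (auto simp: wave_def)

lemma box_energy_pos: "L > 0 \<Longrightarrow> box_energy L n > 0"
  using wave_pos[of L n] by (simp add: box_energy_def)

lemma smode_measurable [measurable]: "J \<in> sets borel \<Longrightarrow> smode J n \<in> borel_measurable borel"
  unfolding smode_def[abs_def] by (intro borel_measurable_times borel_measurable_indicator) (simp_all, measurable)

lemma integral_sin_sin:
  fixes a b p q :: real
  assumes ab: "a < b" and p: "sin (p * (b - a)) = 0" "p \<noteq> 0" and q: "sin (q * (b - a)) = 0" "q \<noteq> 0"
    and ne: "p\<^sup>2 \<noteq> q\<^sup>2 \<or> p = q"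
  shows "(\<integral>x. indicator {a<..<b} x * (sin (p * (x - a)) * sin (q * (x - a))) \<partial>lborel) = (if p = q then (b - a) / 2 else 0)"
proof (cases "p = q")
  case True
  have "(\<integral>x. indicator {a<..<b} x * (sin (p * (x - a)) * sin (q * (x - a))) \<partial>lborel) = 
    ((b - a) / 2 - sin (p * (b - a)) * cos (p * (b - a)) / (2 * p)) - ((a - a) / 2 - sin (p * (a - a)) * cos (p * (a - a)) / (2 * p))"
  proof (rule integral_Ioo_FTC(2))
    fix x
    have "((\<lambda>x. (x - a) / 2 - sin (p * (x - a)) * cos (p * (x - a)) / (2 * p)) has_real_derivative 
       1 / 2 - ((cos (p * (x - a)))\<^sup>2 - (sin (p * (x - a)))\<^sup>2) / 2) (at x)"
      using p by (auto intro!: derivative_eq_intros simp: field_simps power2_eq_square)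
    also have "1 / 2 - ((cos (p * (x - a)))\<^sup>2 - (sin (p * (x - a)))\<^sup>2) / 2 = sin (p * (x - a)) * sin (q * (x - a))"
      unfolding cos_squared_eq True by (simp add: power2_eq_square field_simps)
    finally show "((\<lambda>x. (x - a) / 2 - sin (p * (x - a)) * cos (p * (x - a)) / (2 * p)) has_real_derivative 
       sin (p * (x - a)) * sin (q * (x - a))) (at x)" .
  qed (use ab in auto)
  then show ?thesis using p True by simp
next
  case False
  define F where "F x = (q * sin (p * (x - a)) * cos (q * (x - a)) - p * cos (p * (x - a)) * sin (q * (x - a))) / (p\<^sup>2 - q\<^sup>2)" for x
  have "(\<integral>x. indicator {a<..<b} x * (sin (p * (x - a)) * sin (q * (x - a))) \<partial>lborel) = F b - F a"
  proof (rule integral_Ioo_FTC(2))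
    fix x
    have "((\<lambda>x. q * sin (p * (x - a)) * cos (q * (x - a)) - p * cos (p * (x - a)) * sin (q * (x - a))) has_real_derivative
      (p\<^sup>2 - q\<^sup>2) * (sin (p * (x - a)) * sin (q * (x - a)))) (at x)"
      by (auto intro!: derivative_eq_intros simp: algebra_simps power2_eq_square)
    from DERIV_cdivide[OF this, of "p\<^sup>2 - q\<^sup>2"]
    show "(F has_real_derivative sin (p * (x - a)) * sin (q * (x - a))) (at x)"
      unfolding F_def using False ne by simp
  qed (use ab in auto)
  then show ?thesis using p q False by (simp add: F_def)
qed

lemma (in -) ip_of_real:
  assumes "S \<in> sets borel" 
  shows "ip (restrict_space lborel S) (\<lambda>x. complex_of_real (f x)) (\<lambda>x. complex_of_real (g x)) =
    complex_of_real (\<integral>x. indicator S x * (f x * g x) \<partial>lborel)"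
  using assms unfolding ip_def
  by (subst integral_restrict_space) 
    (auto simp: of_real_mult[symmetric] scaleR_conv_of_real simp del: of_real_mult)

lemma sqi_bounded:
  fixes f :: "real \<Rightarrow> complex"
  assumes S: "S \<in> sets borel" "emeasure lborel S < \<infinity>" and [measurable]: "f \<in> borel_measurable borel"
    and B: "\<And>x. cmod (f x) \<le> B"
  shows "sqi (restrict_space lborel S) f"
proof -
  have fm: "finite_measure (restrict_space lborel S)"
    using S by (intro finite_measureI) (simp add: space_restrict_space emeasure_restrict_space)
  interpret finite_measure "restrict_space lborel S" by fact
  have m[measurable]: "f \<in> borel_measurable (restrict_space lborel S)"
    by (rule measurable_restrict_space1) simp
  have "integrable (restrict_space lborel S) (\<lambda>x. (cmod (f x))\<^sup>2)"
    by (rule integrable_const_bound[where B = "B\<^sup>2"]) (use B in \<open>auto intro!: power_mono\<close>)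
  then show ?thesis by (simp add: sqi_def)
qed

lemma cmod_smode_le: "gaplen J > 0 \<Longrightarrow> cmod (complex_of_real (smode J n x)) \<le> sqrt (2 / gaplen J)"
  unfolding smode_def by (auto simp: norm_mult abs_mult indicator_def intro: mult_left_le)

text \<open>One sample in a box: \<open>\<phi>\<close> and \<open>E\<close> diagonalise the Hamiltonian with impurities, \<open>\<psi>\<close> and \<open>\<epsilon>\<close>
  the kinetic energy.\<close>

locale LS_box =
  fixes X :: "real set" and l :: nat
    and \<phi> :: "nat \<Rightarrow> real \<Rightarrow> complex" and E :: "nat \<Rightarrow> real"
    and \<psi> :: "nat \<Rightarrow> real \<Rightarrow> complex" and \<epsilon> :: "nat \<Rightarrow> real"
  assumes l: "l \<ge> 1" and fin: "finite (X \<inter> \<Lambda> l)"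
    and eig: "eigensystem (\<Lambda> l) (LS_hamiltonian X l) \<phi> E"
    and kin: "eigensystem (\<Lambda> l) (dirichlet_hamiltonian (\<Lambda> l)) \<psi> \<epsilon>"
begin

abbreviation N where "N \<equiv> restrict_space lborel (\<Lambda> l)"

abbreviation cmode :: "real set \<Rightarrow> nat \<Rightarrow> real \<Rightarrow> complex" where
  "cmode J n \<equiv> (\<lambda>x. complex_of_real (smode J n x))"

lemma fmN: "finite_measure N"
  by (intro finite_measureI) (simp add: space_restrict_space emeasure_restrict_space \<Lambda>_props, simp add: \<Lambda>_def)

lemma total_\<phi>: "total N \<phi>"
  using eig \<Lambda>_props(3) by (simp add: eigensystem_def orthonormal_basis_iff_total)

lemma total_\<psi>: "total N \<psi>"
  using kin \<Lambda>_props(3) by (simp add: eigensystem_def orthonormal_basis_iff_total)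

lemma sqi_\<phi>: "sqi N (\<phi> i)" and sqi_\<psi>: "sqi N (\<psi> i)"
  using total_\<phi> total_\<psi> by (auto simp: total_def orthonormal_def)

lemma sqi_borel_bounded: "f \<in> borel_measurable borel \<Longrightarrow> (\<And>x. cmod (f x) \<le> B) \<Longrightarrow> sqi N f"
  by (rule sqi_bounded[OF \<Lambda>_props(3)]) (simp add: \<Lambda>_def)

lemma sqi_cmode: 
  assumes J: "J \<in> gaps X l" 
  shows "sqi N (cmode J n)"
proof (rule sqi_borel_bounded)
  have [measurable]: "J \<in> sets borel" using gap_sets[OF fin J] .
  show "cmode J n \<in> borel_measurable borel" by measurable
qed (rule cmod_smode_le[OF gaplen_pos[OF fin J]])

lemma ip_cmode: 
  assumes J: "J \<in> gaps X l" "J' \<in> gaps X l"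
  shows "ip N (cmode J n) (cmode J' m) = (if J = J' \<and> n = m then 1 else 0)"
proof -
  have eq: "ip N (cmode J n) (cmode J' m) = complex_of_real (\<integral>x. indicator (\<Lambda> l) x * (smode J n x * smode J' m x) \<partial>lborel)"
    by (rule ip_of_real[OF \<Lambda>_props(3)])
  show ?thesis
  proof (cases "J = J'")
    case False
    have "indicator (\<Lambda> l) x * (smode J n x * smode J' m x) = 0" for x
      using gaps_disjoint[OF fin J False] by (auto simp: smode_def indicator_def)
    then have "(\<lambda>x. indicator (\<Lambda> l) x * (smode J n x * smode J' m x)) = (\<lambda>x. 0)" by (rule ext)
    then have "(\<integral>x. indicator (\<Lambda> l) x * (smode J n x * smode J' m x) \<partial>lborel) = 0" by (simp only: Bochner_Integration.integral_zero)
    then show ?thesis unfolding eq using False by simp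
  next
    case True
    note I = gap_interval[OF fin J(1)]
    let ?L = "gaplen J"
    have L: "?L > 0" by (rule gaplen_pos[OF fin J(1)])
    have "indicator (\<Lambda> l) x * (smode J n x * smode J m x) = 
        2 / ?L * (indicator {Inf J<..<Sup J} x * (sin (wave ?L n * (x - Inf J)) * sin (wave ?L m * (x - Inf J))))" for x
    proof -
      have i: "indicator J x = (indicator {Inf J<..<Sup J} x :: real)" using I(1) by metis
      show ?thesis
      proof (cases "x \<in> J")
        case True
        have s2: "sqrt (2 / ?L) * sqrt (2 / ?L) = 2 / ?L" using L by simp
        have one: "indicator J x = (1::real)" "indicator (\<Lambda> l) x = (1::real)" using True I(5) by auto
        have "smode J n x * smode J m x = 
            (sqrt (2 / ?L) * sqrt (2 / ?L)) * (sin (wave ?L n * (x - Inf J)) * sin (wave ?L m * (x - Inf J)))"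
          unfolding smode_def one by (simp only: mult_1_left ac_simps)
        then show ?thesis unfolding s2 i[symmetric] one by (simp only: mult_1_left)
      next
        case False
        then show ?thesis by (simp add: smode_def i[symmetric])
      qed
    qed
    then have "(\<integral>x. indicator (\<Lambda> l) x * (smode J n x * smode J m x) \<partial>lborel) = 
      2 / ?L * (\<integral>x. indicator {Inf J<..<Sup J} x * (sin (wave ?L n * (x - Inf J)) * sin (wave ?L m * (x - Inf J))) \<partial>lborel)"
      by (simp only: integral_mult_right_zero)
    also have "(\<integral>x. indicator {Inf J<..<Sup J} x * (sin (wave ?L n * (x - Inf J)) * sin (wave ?L m * (x - Inf J))) \<partial>lborel) = 
      (if wave ?L n = wave ?L m then (Sup J - Inf J) / 2 else 0)"
      using I(2) sin_wave[OF L] wave_pos[OF L, of n] wave_pos[OF L, of m]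
      by (intro integral_sin_sin) (auto simp: gaplen_def power2_eq_iff_nonneg)
    also have "Sup J - Inf J = ?L" by (simp add: gaplen_def)
    finally have "(\<integral>x. indicator (\<Lambda> l) x * (smode J n x * smode J m x) \<partial>lborel) = (if n = m then 1 else 0)"
      using wave_inj[OF L] L by simp
    then show ?thesis unfolding eq using True by simp
  qed
qed

lemma orthonormal_modes: "orthonormal N (gaps X l \<times> UNIV) (\<lambda>(J, n). cmode J n)"
  unfolding orthonormal_def using sqi_cmode ip_cmode by auto

definition amp :: "nat \<Rightarrow> real set \<Rightarrow> nat \<Rightarrow> complex" where
  "amp i J n = ip N (cmode J n) (\<phi> i)"

lemma ip_cmode_cong:
  assumes J: "J \<in> gaps X l" and f: "sqi N f" and g: "sqi N g"
    and AE: "AE x in lborel. x \<in> J \<longrightarrow> f x = g x"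
  shows "ip N (cmode J n) f = ip N (cmode J n) g"
  unfolding ip_def
proof (rule integral_cong_AE)
  have "AE x in N. x \<in> J \<longrightarrow> f x = g x"
    using AE \<Lambda>_props(3) by (simp add: AE_restrict_space_iff) (auto elim: eventually_mono)
  then show "AE x in N. cnj (cmode J n x) * f x = cnj (cmode J n x) * g x"
    by eventually_elim (auto simp: smode_def)
qed (rule borel_measurable_integrable[OF sqi_mult_integrable[OF sqi_cmode[OF J] f]],
    rule borel_measurable_integrable[OF sqi_mult_integrable[OF sqi_cmode[OF J] g]])

text \<open>On one gap the restriction of \<open>\<phi> i\<close> solves the eigenvalue equation, so
  it is 0 or a multiple of a single mode, levels of one interval being simple. Different gaps may
  carry such pieces at the same time if their levels coincide.\<close>

lemma \<phi>_on_gap: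
  assumes J: "J \<in> gaps X l"
  shows "(\<forall>n. amp i J n \<noteq> 0 \<longrightarrow> E i = box_energy (gaplen J) n) \<and>
    (\<exists>n0. \<forall>m\<ge>n0. AE x in lborel. x \<in> J \<longrightarrow> \<phi> i x = (\<Sum>n<m. amp i J n * cmode J n x))"
proof -
  note I = gap_interval[OF fin J]
  let ?L = "gaplen J"
  have L: "?L > 0" by (rule gaplen_pos[OF fin J])
  have "dirichlet_hamiltonian J (\<phi> i) (\<lambda>x. complex_of_real (E i) * \<phi> i x)"
    using eig J by (simp add: eigensystem_def LS_hamiltonian_def gaps_def)
  then have "dirichlet_hamiltonian {Inf J<..<Sup J} (\<phi> i) (\<lambda>x. complex_of_real (E i) * \<phi> i x)"
    using I(1) by metis
  from dirichlet_eigenfunction[OF I(2) this] 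
  consider "AE x in lborel. x \<in> J \<longrightarrow> \<phi> i x = 0"
    | n0 c where "E i = box_energy ?L n0" 
       "AE x in lborel. x \<in> J \<longrightarrow> \<phi> i x = c * complex_of_real (sin (wave ?L n0 * (x - Inf J)))"
    unfolding I(1)[symmetric] by (auto simp: box_energy_def wave_def gaplen_def)
  then show ?thesis
  proof cases
    case 1
    have "amp i J n = 0" for n
      unfolding amp_def ip_cmode_cong[OF J sqi_\<phi> sqi_0 1] by (simp add: ip_def)
    then show ?thesis using 1 by simp
  next
    case 2
    define d where "d = c / complex_of_real (sqrt (2 / ?L))"
    have AE: "AE x in lborel. x \<in> J \<longrightarrow> \<phi> i x = d * cmode J n0 x"
      using 2(2) by eventually_elim (use L in \<open>auto simp: smode_def d_def\<close>)
    have amp: "amp i J n = (if n = n0 then d else 0)" for n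
      unfolding amp_def ip_cmode_cong[OF J sqi_\<phi> sqi_cmult[OF sqi_cmode[OF J]] AE]
      by (simp add: ip_cmult_right ip_cmode[OF J J])
    have "(\<Sum>n<m. amp i J n * cmode J n x) = d * cmode J n0 x" if "m \<ge> Suc n0" for m x
    proof -
      have "(\<Sum>n<m. amp i J n * cmode J n x) = (\<Sum>n<m. if n = n0 then d * cmode J n0 x else 0)"
        by (rule sum.cong) (auto simp: amp)
      then show ?thesis using that by simp
    qed
    then show ?thesis using AE 2(1) amp by (intro conjI exI[of _ "Suc n0"]) auto
  qed
qed

lemma amp_energy: "J \<in> gaps X l \<Longrightarrow> amp i J n \<noteq> 0 \<Longrightarrow> E i = box_energy (gaplen J) n"
  using \<phi>_on_gap by blast

text \<open>At most one mode per gap and finitely many gaps: the expansion is a finite sum, which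
  any larger cut-off leaves unchanged.\<close>

lemma \<phi>_expansion:
  "\<exists>m0. \<forall>m\<ge>m0. AE x in N. \<phi> i x = (\<Sum>(J, n)\<in>gaps X l \<times> {..<m}. amp i J n * cmode J n x)"
proof -
  have "\<forall>J\<in>gaps X l. \<exists>n0. \<forall>m\<ge>n0. AE x in lborel. x \<in> J \<longrightarrow> \<phi> i x = (\<Sum>n<m. amp i J n * cmode J n x)"
    using \<phi>_on_gap by blast
  from bchoice[OF this] obtain n0 where n0: "\<And>J m. J \<in> gaps X l \<Longrightarrow> m \<ge> n0 J \<Longrightarrow> 
      AE x in lborel. x \<in> J \<longrightarrow> \<phi> i x = (\<Sum>n<m. amp i J n * cmode J n x)"
    by blast
  define m0 where "m0 = Max (insert 0 (n0 ` gaps X l))"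
  have "AE x in N. \<phi> i x = (\<Sum>(J, n)\<in>gaps X l \<times> {..<m}. amp i J n * cmode J n x)" if m: "m \<ge> m0" for m
  proof -
    have "n0 J \<le> m" if "J \<in> gaps X l" for J
    proof -
      have "n0 J \<le> m0" unfolding m0_def using that finite_gaps[OF fin] by (intro Max_ge) auto
      then show ?thesis using m by simp
    qed
    then have "AE x in lborel. \<forall>J\<in>gaps X l. x \<in> J \<longrightarrow> \<phi> i x = (\<Sum>n<m. amp i J n * cmode J n x)"
      using finite_gaps[OF fin] by (intro AE_finite_allI n0) auto
    moreover have "AE x in lborel. x \<notin> X \<inter> \<Lambda> l"
      using fin by (intro AE_not_in countable_imp_null_set_lborel) (auto simp: countable_finite)
    ultimately have "AE x in lborel. x \<in> \<Lambda> l \<longrightarrow> \<phi> i x = (\<Sum>(J, n)\<in>gaps X l \<times> {..<m}. amp i J n * cmode J n x)"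
    proof eventually_elim
      case (elim x)
      show ?case
      proof
        assume "x \<in> \<Lambda> l"
        then obtain J where J: "J \<in> gaps X l" "x \<in> J" using elim(2) Union_gaps[OF fin] by blast
        have other: "cmode J' n x = 0" if "J' \<in> gaps X l" "J' \<noteq> J" for J' n
        proof -
          have "x \<notin> J'" using gaps_disjoint[OF fin J(1) that(1)] that(2) J(2) by blast
          then show ?thesis by (simp add: smode_def)
        qed
        have "(\<Sum>(J', n)\<in>gaps X l \<times> {..<m}. amp i J' n * cmode J' n x) = (\<Sum>J'\<in>gaps X l. \<Sum>n<m. amp i J' n * cmode J' n x)"
          by (simp add: sum.cartesian_product)
        also have "\<dots> = (\<Sum>J'\<in>{J}. \<Sum>n<m. amp i J' n * cmode J' n x)"
          using finite_gaps[OF fin] J other by (intro sum.mono_neutral_right) auto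
        also have "\<dots> = \<phi> i x" using elim(1) J by simp
        finally show "\<phi> i x = (\<Sum>(J, n)\<in>gaps X l \<times> {..<m}. amp i J n * cmode J n x)" by simp
      qed
    qed
    then show ?thesis using \<Lambda>_props(3) by (simp add: AE_restrict_space_iff)
  qed
  then show ?thesis by blast
qed

end

section \<open>Change of basis between eigenstates and gap modes\<close>

lemma ennreal_suminf_commute:
  fixes f :: "nat \<Rightarrow> nat \<Rightarrow> ennreal"
  shows "(\<Sum>i. \<Sum>n. f i n) = (\<Sum>n. \<Sum>i. f i n)"
proof -
  have "(\<Sum>i. \<Sum>n. f i n) = (\<integral>\<^sup>+i. (\<Sum>n. f i n) \<partial>count_space UNIV)"
    by (rule nn_integral_count_space_nat[symmetric])
  also have "\<dots> = (\<Sum>n. \<integral>\<^sup>+i. f i n \<partial>count_space UNIV)"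
    by (rule nn_integral_suminf) simp
  finally show ?thesis by (simp add: nn_integral_count_space_nat)
qed

lemma ennreal_suminf_sum_commute:
  fixes f :: "nat \<Rightarrow> 'b \<Rightarrow> nat \<Rightarrow> ennreal"
  shows "(\<Sum>i. \<Sum>J\<in>A. \<Sum>n. f i J n) = (\<Sum>J\<in>A. \<Sum>n. \<Sum>i. f i J n)"
proof -
  have "(\<Sum>i. \<Sum>J\<in>A. \<Sum>n. f i J n) = (\<Sum>J\<in>A. \<Sum>i. \<Sum>n. f i J n)"
    by (rule suminf_sum) (rule summableI)
  also have "\<dots> = (\<Sum>J\<in>A. \<Sum>n. \<Sum>i. f i J n)"
    by (intro sum.cong refl ennreal_suminf_commute)
  finally show ?thesis .
qed

text \<open>The differences have sum 0. In \<open>occupation_eq\<close> this upgrades the one-sided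
  spectral inequality.\<close>

lemma ennreal_suminf_eq_imp_eq:
  fixes a b :: "nat \<Rightarrow> ennreal"
  assumes le: "\<And>k. a k \<le> b k" and eq: "(\<Sum>k. a k) = (\<Sum>k. b k)" and fin: "(\<Sum>k. a k) \<noteq> \<top>"
  shows "a k = b k"
proof -
  have "(\<Sum>k. b k) = (\<Sum>k. a k + (b k - a k))"
    using le by (simp add: add_diff_inverse_ennreal)
  also have "\<dots> = (\<Sum>k. a k) + (\<Sum>k. b k - a k)"
    by (intro suminf_add[symmetric] summableI)
  finally have "(\<Sum>k. a k) + 0 = (\<Sum>k. a k) + (\<Sum>k. b k - a k)" using eq by simp
  then have "(\<Sum>k. b k - a k) = 0" using fin by (simp only: ennreal_add_left_cancel) auto
  then have "b k - a k = 0" by (simp add: suminf_eq_zero_iff[OF summableI])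
  then show ?thesis using le[of k] by (metis add_diff_inverse_ennreal add.right_neutral)
qed

lemma ip_cong_AE:
  assumes "sqi N f" "sqi N g" "sqi N h" "AE x in N. g x = h x"
  shows "ip N f g = ip N f h"
  unfolding ip_def
proof (rule integral_cong_AE)
  show "AE x in N. cnj (f x) * g x = cnj (f x) * h x" using assms(4) by eventually_elim simp
qed (rule borel_measurable_integrable[OF sqi_mult_integrable[OF assms(1,2)]],
    rule borel_measurable_integrable[OF sqi_mult_integrable[OF assms(1,3)]])

context LS_box
begin

lemma nrm2_cmode: "J \<in> gaps X l \<Longrightarrow> nrm2 N (cmode J n) = 1"
  using ip_cmode[of J J n n] by (simp add: ip_self)

lemma nrm2_\<phi>: "nrm2 N (\<phi> i) = 1" and nrm2_\<psi>: "nrm2 N (\<psi> i) = 1"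
proof -
  have "ip N (\<phi> i) (\<phi> i) = 1" "ip N (\<psi> i) (\<psi> i) = 1"
    using total_\<phi> total_\<psi> unfolding total_def orthonormal_def by simp_all
  then show "nrm2 N (\<phi> i) = 1" "nrm2 N (\<psi> i) = 1" by (simp_all only: ip_self of_real_eq_1_iff)
qed

lemma \<phi>_finite:
  "\<exists>m0. \<forall>m\<ge>m0. (\<forall>J\<in>gaps X l. \<forall>n\<ge>m. amp i J n = 0) \<and>
     (\<Sum>(J, n)\<in>gaps X l \<times> {..<m}. (cmod (amp i J n))\<^sup>2) = 1 \<and>
     (\<forall>f. sqi N f \<longrightarrow> ip N (\<phi> i) f = (\<Sum>(J, n)\<in>gaps X l \<times> {..<m}. cnj (amp i J n) * ip N (cmode J n) f))"
proof -
  obtain m0 where m0: "\<And>m. m \<ge> m0 \<Longrightarrow> AE x in N. \<phi> i x = (\<Sum>(J, n)\<in>gaps X l \<times> {..<m}. amp i J n * cmode J n x)"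
    using \<phi>_expansion by blast
  show ?thesis
  proof (intro exI[of _ m0] allI impI)
    fix m assume "m \<ge> m0"
    define F where "F = gaps X l \<times> {..<m}"
    define e where "e = (\<lambda>p. cmode (fst p) (snd p))"
    define c where "c = (\<lambda>p. amp i (fst p) (snd p))"
    define S where "S = (\<lambda>x. \<Sum>p\<in>F. c p * e p x)"
    have F: "finite F" "F \<subseteq> gaps X l \<times> UNIV" using finite_gaps[OF fin] by (auto simp: F_def)
    have on: "orthonormal N (gaps X l \<times> UNIV) e"
      using orthonormal_modes by (simp add: e_def case_prod_beta')
    have AE: "AE x in N. \<phi> i x = S x"
      using m0[OF \<open>m \<ge> m0\<close>] by (simp add: S_def F_def c_def e_def case_prod_beta')
    have sS: "sqi N S" unfolding S_def by (intro sqi_sum sqi_cmult) (use on F in \<open>auto simp: orthonormal_def\<close>)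
    have 1: "amp i J n = 0" if "J \<in> gaps X l" "n \<ge> m" for J n
    proof -
      have "amp i J n = ip N (e (J, n)) S"
        unfolding amp_def e_def fst_conv snd_conv by (rule ip_cong_AE[OF sqi_cmode[OF that(1)] sqi_\<phi> sS AE])
      also have "\<dots> = 0"
        unfolding S_def using that by (subst orthonormal_ip_sum[OF on F]) (auto simp: F_def)
      finally show ?thesis .
    qed
    have 2: "ip N (\<phi> i) f = (\<Sum>p\<in>F. cnj (c p) * ip N (e p) f)" if f: "sqi N f" for f
    proof -
      have "ip N f (\<phi> i) = ip N f S" by (rule ip_cong_AE[OF f sqi_\<phi> sS AE])
      also have "\<dots> = (\<Sum>p\<in>F. ip N f (\<lambda>x. c p * e p x))"
        unfolding S_def by (intro ip_sum_right f sqi_cmult) (use on F in \<open>auto simp: orthonormal_def\<close>)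
      also have "\<dots> = (\<Sum>p\<in>F. c p * ip N f (e p))" by (simp add: ip_cmult_right)
      finally have "ip N (\<phi> i) f = cnj (\<Sum>p\<in>F. c p * ip N f (e p))" by (subst ip_cnj) simp
      also have "\<dots> = (\<Sum>p\<in>F. cnj (c p) * ip N (e p) f)"
        unfolding cnj_sum complex_cnj_mult by (intro sum.cong refl arg_cong2[where f = "(*)"] ip_cnj[symmetric])
      finally show ?thesis .
    qed
    have "(1::complex) = (\<Sum>p\<in>F. cnj (c p) * ip N (e p) (\<phi> i))"
      using 2[OF sqi_\<phi>[of i]] nrm2_\<phi>[of i] by (simp add: ip_self)
    also have "\<dots> = (\<Sum>p\<in>F. complex_of_real ((cmod (c p))\<^sup>2))"
      by (intro sum.cong refl) (simp only: complex_norm_square mult.commute c_def e_def amp_def)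
    finally have "complex_of_real (\<Sum>p\<in>F. (cmod (c p))\<^sup>2) = complex_of_real 1" by simp
    then have 3: "(\<Sum>p\<in>F. (cmod (c p))\<^sup>2) = 1" by (simp only: of_real_eq_iff)
    show "(\<forall>J\<in>gaps X l. \<forall>n\<ge>m. amp i J n = 0) \<and>
     (\<Sum>(J, n)\<in>gaps X l \<times> {..<m}. (cmod (amp i J n))\<^sup>2) = 1 \<and>
     (\<forall>f. sqi N f \<longrightarrow> ip N (\<phi> i) f = (\<Sum>(J, n)\<in>gaps X l \<times> {..<m}. cnj (amp i J n) * ip N (cmode J n) f))"
      using 1 2 3 unfolding F_def c_def e_def case_prod_beta' by blast
  qed
qed

lemma sum_amp_modes: "(\<Sum>J\<in>gaps X l. \<Sum>n. ennreal ((cmod (amp i J n))\<^sup>2)) = 1"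
proof -
  obtain m where m: "\<forall>J\<in>gaps X l. \<forall>n\<ge>m. amp i J n = 0" 
     "(\<Sum>(J, n)\<in>gaps X l \<times> {..<m}. (cmod (amp i J n))\<^sup>2) = 1"
    using \<phi>_finite[of i] by blast
  have "(\<Sum>J\<in>gaps X l. \<Sum>n. ennreal ((cmod (amp i J n))\<^sup>2)) = (\<Sum>J\<in>gaps X l. \<Sum>n<m. ennreal ((cmod (amp i J n))\<^sup>2))"
    using m(1) by (intro sum.cong refl suminf_finite) (auto simp: not_less)
  also have "\<dots> = ennreal (\<Sum>J\<in>gaps X l. \<Sum>n<m. (cmod (amp i J n))\<^sup>2)"
    by (simp add: sum_nonneg)
  also have "(\<Sum>J\<in>gaps X l. \<Sum>n<m. (cmod (amp i J n))\<^sup>2) = 1"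
    using m(2) by (simp add: sum.cartesian_product)
  finally show ?thesis by simp
qed

lemma sum_amp_states:
  assumes J: "J \<in> gaps X l" 
  shows "(\<Sum>i. ennreal ((cmod (amp i J n))\<^sup>2)) = 1"
proof -
  have "(\<lambda>i. (cmod (ip N (\<phi> i) (cmode J n)))\<^sup>2) sums 1"
    using parseval[OF fmN total_\<phi> sqi_cmode[OF J]] nrm2_cmode[OF J] by simp
  moreover have "cmod (ip N (\<phi> i) (cmode J n)) = cmod (amp i J n)" for i
    unfolding amp_def by (subst ip_cnj) (rule complex_mod_cnj)
  ultimately show ?thesis by (simp add: sums_iff suminf_ennreal2)
qed

text \<open>The squared amplitudes form a doubly stochastic matrix between eigenstates and gap
  modes, supported where the energies agree; so both spectra sum every function of the energy to the
  same value, without a bijection between their indices.\<close>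

lemma trace_eq:
  fixes g :: "real \<Rightarrow> ennreal"
  shows "(\<Sum>i. g (E i)) = (\<Sum>J\<in>gaps X l. \<Sum>n. g (box_energy (gaplen J) n))"
proof -
  define p where "p i J n = ennreal ((cmod (amp i J n))\<^sup>2)" for i J n
  have eq: "g (E i) * p i J n = g (box_energy (gaplen J) n) * p i J n" if "J \<in> gaps X l" for i J n
    using amp_energy[OF that, of i n] by (cases "amp i J n = 0") (auto simp: p_def)
  have "(\<Sum>i. g (E i)) = (\<Sum>i. g (E i) * (\<Sum>J\<in>gaps X l. \<Sum>n. p i J n))"
    unfolding p_def sum_amp_modes by simp
  also have "\<dots> = (\<Sum>i. \<Sum>J\<in>gaps X l. \<Sum>n. g (E i) * p i J n)"
    by (simp add: sum_distrib_left)
  also have "\<dots> = (\<Sum>i. \<Sum>J\<in>gaps X l. \<Sum>n. g (box_energy (gaplen J) n) * p i J n)"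
    using eq by (intro suminf_cong sum.cong refl) auto
  also have "\<dots> = (\<Sum>J\<in>gaps X l. \<Sum>n. \<Sum>i. g (box_energy (gaplen J) n) * p i J n)"
    by (rule ennreal_suminf_sum_commute)
  also have "\<dots> = (\<Sum>J\<in>gaps X l. \<Sum>n. g (box_energy (gaplen J) n))"
    unfolding p_def
    by (intro sum.cong refl suminf_cong) (subst ennreal_suminf_cmult, simp only: sum_amp_states mult_1_right)
  finally show ?thesis .
qed

text \<open>Every mode has total weight 1 in the eigenstates, so some \<open>\<phi> i\<close>
  overlaps with it and its energy is an eigenvalue. This places every gap level above the chemical
  potential.\<close>

lemma box_energy_ge: "J \<in> gaps X l \<Longrightarrow> box_energy (gaplen J) n \<ge> E 0"
proof -
  assume J: "J \<in> gaps X l"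
  have "\<exists>i. amp i J n \<noteq> 0"
  proof (rule ccontr)
    assume "\<not> ?thesis"
    then show False using sum_amp_states[OF J, of n] by simp
  qed
  then obtain i where "E i = box_energy (gaplen J) n" using amp_energy[OF J] by blast
  moreover have "E 0 \<le> E i" using eig by (simp add: eigensystem_def mono_def)
  ultimately show ?thesis by simp
qed

lemma gaps_nonempty: "gaps X l \<noteq> {}"
  using sum_gaplen[OF fin] l by auto

text \<open>Spectral calculus does not depend on the choice of eigenbasis; Bessel's inequality for
  truncations of \<open>sqrt (g H) f\<close> gives one inequality, which is all that is needed.\<close>

lemma spectral_le:
  fixes g :: "real \<Rightarrow> real"
  assumes g: "\<And>e. g e \<ge> 0" and f: "sqi N f"
  shows "(\<Sum>i. ennreal (g (E i) * (cmod (ip N (\<phi> i) f))\<^sup>2)) \<le>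
    (\<Sum>J\<in>gaps X l. \<Sum>n. ennreal (g (box_energy (gaplen J) n) * (cmod (ip N (cmode J n) f))\<^sup>2))"
proof (rule suminf_le_const[OF summableI])
  fix K
  \<comment> \<open>The first \<open>K\<close> states are finite combinations of modes, so one
    cut-off \<open>m\<close> serves all of them; truncating \<open>sqrt (g H) f\<close> there does
    not change its coefficients on these states.\<close>
  have "\<exists>m. \<forall>i<K. (\<forall>f. sqi N f \<longrightarrow> ip N (\<phi> i) f = (\<Sum>(J, n)\<in>gaps X l \<times> {..<m}. cnj (amp i J n) * ip N (cmode J n) f))"
  proof -
    have "\<forall>i. \<exists>m0. \<forall>m\<ge>m0. \<forall>f. sqi N f \<longrightarrow> ip N (\<phi> i) f = (\<Sum>(J, n)\<in>gaps X l \<times> {..<m}. cnj (amp i J n) * ip N (cmode J n) f)"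
      using \<phi>_finite by blast
    from choice[OF this] obtain m0 where m0: "\<And>i m f. m \<ge> m0 i \<Longrightarrow> sqi N f \<Longrightarrow> 
       ip N (\<phi> i) f = (\<Sum>(J, n)\<in>gaps X l \<times> {..<m}. cnj (amp i J n) * ip N (cmode J n) f)" by blast
    have "m0 i \<le> Max (insert 0 (m0 ` {..<K}))" if "i < K" for i using that by (intro Max_ge) auto
    then show ?thesis using m0 by (intro exI[of _ "Max (insert 0 (m0 ` {..<K}))"]) blast
  qed
  then obtain m where m: "\<And>i f. i < K \<Longrightarrow> sqi N f \<Longrightarrow> 
      ip N (\<phi> i) f = (\<Sum>(J, n)\<in>gaps X l \<times> {..<m}. cnj (amp i J n) * ip N (cmode J n) f)" by blast
  define F where "F = gaps X l \<times> {..<m}"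
  define e where "e = (\<lambda>p. cmode (fst p) (snd p))"
  define b where "b = (\<lambda>p. box_energy (gaplen (fst p)) (snd p))"
  define c where "c = (\<lambda>p. complex_of_real (sqrt (g (b p))) * ip N (e p) f)"
  define h where "h = (\<lambda>x. \<Sum>p\<in>F. c p * e p x)"
  have F: "finite F" "F \<subseteq> gaps X l \<times> UNIV" using finite_gaps[OF fin] by (auto simp: F_def)
  have on: "orthonormal N (gaps X l \<times> UNIV) e"
    using orthonormal_modes by (simp add: e_def case_prod_beta')
  have sh: "sqi N h" unfolding h_def by (intro sqi_sum sqi_cmult) (use on F in \<open>auto simp: orthonormal_def\<close>)
  have ih: "ip N (\<phi> i) h = complex_of_real (sqrt (g (E i))) * ip N (\<phi> i) f" if i: "i < K" for i
  proof -
    have "ip N (\<phi> i) h = (\<Sum>p\<in>F. cnj (amp i (fst p) (snd p)) * ip N (e p) h)"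
      using m[OF i sh] by (simp add: F_def e_def case_prod_beta')
    also have "\<dots> = (\<Sum>p\<in>F. complex_of_real (sqrt (g (E i))) * (cnj (amp i (fst p) (snd p)) * ip N (e p) f))"
    proof (intro sum.cong refl)
      fix p assume p: "p \<in> F"
      have "ip N (e p) h = c p"
        unfolding h_def using orthonormal_ip_sum[OF on F, of p c] p F by auto
      moreover have "amp i (fst p) (snd p) \<noteq> 0 \<Longrightarrow> b p = E i"
        using amp_energy[of "fst p" i "snd p"] p by (auto simp: F_def b_def)
      ultimately show "cnj (amp i (fst p) (snd p)) * ip N (e p) h = complex_of_real (sqrt (g (E i))) * (cnj (amp i (fst p) (snd p)) * ip N (e p) f)"
        by (cases "amp i (fst p) (snd p) = 0") (auto simp: c_def)
    qed
    also have "\<dots> = complex_of_real (sqrt (g (E i))) * ip N (\<phi> i) f"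
      using m[OF i f] by (simp add: F_def e_def case_prod_beta' sum_distrib_left)
    finally show ?thesis .
  qed
  have "(\<Sum>i<K. g (E i) * (cmod (ip N (\<phi> i) f))\<^sup>2) = (\<Sum>i<K. (cmod (ip N (\<phi> i) h))\<^sup>2)"
    using g by (intro sum.cong refl) (simp add: ih norm_mult power_mult_distrib)
  also have "\<dots> \<le> nrm2 N h"
    using total_\<phi> unfolding total_def by (intro bessel[OF _ _ _ sh, of UNIV]) auto
  also have "\<dots> = (\<Sum>p\<in>F. (cmod (c p))\<^sup>2)"
    unfolding h_def by (rule nrm2_orthonormal_sum[OF on F])
  also have "\<dots> = (\<Sum>J\<in>gaps X l. \<Sum>n<m. g (box_energy (gaplen J) n) * (cmod (ip N (cmode J n) f))\<^sup>2)"
    using g by (simp add: c_def b_def e_def norm_mult power_mult_distrib F_def sum.cartesian_product case_prod_beta')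
  finally have "ennreal (\<Sum>i<K. g (E i) * (cmod (ip N (\<phi> i) f))\<^sup>2) \<le> 
      ennreal (\<Sum>J\<in>gaps X l. \<Sum>n<m. g (box_energy (gaplen J) n) * (cmod (ip N (cmode J n) f))\<^sup>2)"
    by (rule ennreal_leI)
  also have "\<dots> = (\<Sum>J\<in>gaps X l. \<Sum>n<m. ennreal (g (box_energy (gaplen J) n) * (cmod (ip N (cmode J n) f))\<^sup>2))"
    using g by (simp add: sum_nonneg)
  also have "\<dots> \<le> (\<Sum>J\<in>gaps X l. \<Sum>n. ennreal (g (box_energy (gaplen J) n) * (cmod (ip N (cmode J n) f))\<^sup>2))"
    by (intro sum_mono sum_le_suminf summableI) auto
  finally show "(\<Sum>i<K. ennreal (g (E i) * (cmod (ip N (\<phi> i) f))\<^sup>2)) \<le>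
      (\<Sum>J\<in>gaps X l. \<Sum>n. ennreal (g (box_energy (gaplen J) n) * (cmod (ip N (cmode J n) f))\<^sup>2))"
    using g by simp
qed

definition W :: "real set \<Rightarrow> nat \<Rightarrow> nat \<Rightarrow> real" where
  "W J n k = (cmod (ip N (cmode J n) (\<psi> k)))\<^sup>2"

lemma W_nonneg: "W J n k \<ge> 0" by (simp add: W_def)

lemma W_sums: "J \<in> gaps X l \<Longrightarrow> W J n sums 1"
proof -
  assume J: "J \<in> gaps X l"
  have "(\<lambda>k. (cmod (ip N (\<psi> k) (cmode J n)))\<^sup>2) sums 1"
    using parseval[OF fmN total_\<psi> sqi_cmode[OF J]] nrm2_cmode[OF J] by simp
  moreover have "cmod (ip N (\<psi> k) (cmode J n)) = cmod (ip N (cmode J n) (\<psi> k))" for k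
    by (subst ip_cnj) (rule complex_mod_cnj)
  ultimately show "W J n sums 1" by (simp add: W_def[abs_def])
qed

text \<open>Since \<open>\<psi>\<close> is a basis, summing either side over \<open>k\<close> gives
  the trace of the Bose function, once in eigenstates and once in gap modes; the two agree by
  \<open>trace_eq\<close> and are finite. With \<open>spectral_le\<close> for each \<open>k\<close>
  the terms must agree.\<close>

lemma occupation_eq:
  assumes \<beta>: "\<beta> > 0" and \<mu>: "\<mu> < E 0" and sm: "(\<lambda>i. bose \<beta> \<mu> (E i)) sums c"
  shows "ennreal (mean_occupation \<beta> (\<Lambda> l) \<phi> E \<mu> (\<psi> k)) = 
      (\<Sum>J\<in>gaps X l. \<Sum>n. ennreal (bose \<beta> \<mu> (box_energy (gaplen J) n) * W J n k))" (is ?A)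
    and "mean_occupation \<beta> (\<Lambda> l) \<phi> E \<mu> (\<psi> k) \<ge> 0" (is ?B)
proof -
  \<comment> \<open>\<open>spectral_le\<close> asks for a function that is nonnegative on all reals;
    \<open>bose\<close> is negative below \<open>\<mu>\<close>, where no level lies.\<close>
  define g where "g e = (if e > \<mu> then bose \<beta> \<mu> e else 0)" for e
  have g: "g e \<ge> 0" for e using \<beta> by (auto simp: g_def bose_def)
  have Ei: "E i > \<mu>" for i using eig \<mu> by (auto simp: eigensystem_def mono_def intro: less_le_trans)
  have gE: "g (E i) = bose \<beta> \<mu> (E i)" for i using Ei by (simp add: g_def)
  have gb: "g (box_energy (gaplen J) n) = bose \<beta> \<mu> (box_energy (gaplen J) n)" if "J \<in> gaps X l" for J n
    using box_energy_ge[OF that, of n] \<mu> by (simp add: g_def)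
  define a where "a k = (\<Sum>i. ennreal (g (E i) * (cmod (ip N (\<phi> i) (\<psi> k)))\<^sup>2))" for k
  define b where "b k = (\<Sum>J\<in>gaps X l. \<Sum>n. ennreal (g (box_energy (gaplen J) n) * W J n k))" for k
  have le: "a k \<le> b k" for k unfolding a_def b_def W_def by (rule spectral_le[OF g sqi_\<psi>])
  have psi: "(\<Sum>k. ennreal (q * (cmod (ip N f (\<psi> k)))\<^sup>2)) = ennreal q" if f: "sqi N f" "nrm2 N f = 1" "q \<ge> 0" for f q
  proof -
    have "(\<lambda>k. (cmod (ip N (\<psi> k) f))\<^sup>2) sums 1"
      using parseval[OF fmN total_\<psi> f(1)] f(2) by simp
    moreover have "cmod (ip N (\<psi> k) f) = cmod (ip N f (\<psi> k))" for k
      by (subst ip_cnj) (rule complex_mod_cnj)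
    ultimately have "(\<lambda>k. q * (cmod (ip N f (\<psi> k)))\<^sup>2) sums q" using sums_mult[of _ 1 q] by simp
    then show ?thesis using f(3) by (simp add: sums_iff suminf_ennreal2)
  qed
  have "(\<Sum>k. a k) = (\<Sum>i. \<Sum>k. ennreal (g (E i) * (cmod (ip N (\<phi> i) (\<psi> k)))\<^sup>2))"
    unfolding a_def by (rule ennreal_suminf_commute)
  also have "\<dots> = (\<Sum>i. ennreal (g (E i)))"
    by (intro suminf_cong psi sqi_\<phi> nrm2_\<phi> g)
  finally have suma: "(\<Sum>k. a k) = (\<Sum>i. ennreal (g (E i)))" .
  also have "\<dots> = (\<Sum>J\<in>gaps X l. \<Sum>n. ennreal (g (box_energy (gaplen J) n)))" by (rule trace_eq)
  also have "\<dots> = (\<Sum>J\<in>gaps X l. \<Sum>n. \<Sum>k. ennreal (g (box_energy (gaplen J) n) * W J n k))"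
    unfolding W_def by (intro sum.cong refl suminf_cong psi[symmetric] sqi_cmode nrm2_cmode g)
  also have "\<dots> = (\<Sum>k. b k)" unfolding b_def by (rule ennreal_suminf_sum_commute[symmetric])
  finally have eq: "(\<Sum>k. a k) = (\<Sum>k. b k)" .
  have "(\<Sum>i. ennreal (g (E i))) = ennreal c" 
    using sm g by (simp add: gE sums_iff suminf_ennreal2 flip: gE)
  then have "(\<Sum>k. a k) \<noteq> \<top>" using suma by simp
  then have ab: "a k = b k" for k by (rule ennreal_suminf_eq_imp_eq[OF le eq])
  have smE: "summable (\<lambda>i. bose \<beta> \<mu> (E i))" using sm by (simp add: sums_iff)
  have smk: "summable (\<lambda>i. bose \<beta> \<mu> (E i) * (cmod (ip N (\<phi> i) (\<psi> k)))\<^sup>2)" for k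
  proof (rule summable_comparison_test'[OF smE])
    fix i
    have "(cmod (ip N (\<phi> i) (\<psi> k)))\<^sup>2 \<le> 1"
      using cauchy_schwarz[OF sqi_\<phi>[of i] sqi_\<psi>[of k]] by (simp add: nrm2_\<phi> nrm2_\<psi>)
    then show "norm (bose \<beta> \<mu> (E i) * (cmod (ip N (\<phi> i) (\<psi> k)))\<^sup>2) \<le> bose \<beta> \<mu> (E i)"
      using g[of "E i"] unfolding gE by (simp add: abs_mult mult_left_le)
  qed
  have mo: "mean_occupation \<beta> (\<Lambda> l) \<phi> E \<mu> (\<psi> k) = (\<Sum>i. bose \<beta> \<mu> (E i) * (cmod (ip N (\<phi> i) (\<psi> k)))\<^sup>2)"
    using mean_occupation_eq[of \<beta> E \<mu> "\<Lambda> l" \<phi> "\<psi> k"] smE smk[of k] Ei \<beta> \<Lambda>_props(3)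
    by (simp add: L2_inner_eq_ip)
  show ?B unfolding mo using smk g unfolding gE[symmetric] by (intro suminf_nonneg) auto
  have "ennreal (mean_occupation \<beta> (\<Lambda> l) \<phi> E \<mu> (\<psi> k)) = a k"
    unfolding mo a_def gE using smk[of k] g unfolding gE[symmetric] by (intro suminf_ennreal2[symmetric]) auto
  also have "\<dots> = (\<Sum>J\<in>gaps X l. \<Sum>n. ennreal (bose \<beta> \<mu> (box_energy (gaplen J) n) * W J n k))"
    unfolding ab b_def using gb by (intro sum.cong refl suminf_cong) auto
  finally show ?A .
qed

end

section \<open>Weights of the gap modes in the kinetic-energy eigenfunctions\<close>

lemma integral_cos_cos:
  fixes a b p q :: real
  assumes ab: "a < b" and p: "sin (p * (b - a)) = 0" "p \<noteq> 0" and q: "sin (q * (b - a)) = 0" "q \<noteq> 0"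
    and ne: "p\<^sup>2 \<noteq> q\<^sup>2 \<or> p = q"
  shows "(\<integral>x. indicator {a<..<b} x * (cos (p * (x - a)) * cos (q * (x - a))) \<partial>lborel) = (if p = q then (b - a) / 2 else 0)"
proof (cases "p = q")
  case True
  have "(\<integral>x. indicator {a<..<b} x * (cos (p * (x - a)) * cos (q * (x - a))) \<partial>lborel) = 
    ((b - a) / 2 + sin (p * (b - a)) * cos (p * (b - a)) / (2 * p)) - ((a - a) / 2 + sin (p * (a - a)) * cos (p * (a - a)) / (2 * p))"
  proof (rule integral_Ioo_FTC(2))
    fix x
    have "((\<lambda>x. (x - a) / 2 + sin (p * (x - a)) * cos (p * (x - a)) / (2 * p)) has_real_derivative 
       1 / 2 + ((cos (p * (x - a)))\<^sup>2 - (sin (p * (x - a)))\<^sup>2) / 2) (at x)"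
      using p by (auto intro!: derivative_eq_intros simp: field_simps power2_eq_square)
    also have "1 / 2 + ((cos (p * (x - a)))\<^sup>2 - (sin (p * (x - a)))\<^sup>2) / 2 = cos (p * (x - a)) * cos (q * (x - a))"
      unfolding sin_squared_eq True by (simp add: power2_eq_square field_simps)
    finally show "((\<lambda>x. (x - a) / 2 + sin (p * (x - a)) * cos (p * (x - a)) / (2 * p)) has_real_derivative 
       cos (p * (x - a)) * cos (q * (x - a))) (at x)" .
  qed (use ab in auto)
  then show ?thesis using p True by simp
next
  case False
  define F where "F x = (p * sin (p * (x - a)) * cos (q * (x - a)) - q * cos (p * (x - a)) * sin (q * (x - a))) / (p\<^sup>2 - q\<^sup>2)" for x
  have "(\<integral>x. indicator {a<..<b} x * (cos (p * (x - a)) * cos (q * (x - a))) \<partial>lborel) = F b - F a"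
  proof (rule integral_Ioo_FTC(2))
    fix x
    have "((\<lambda>x. p * sin (p * (x - a)) * cos (q * (x - a)) - q * cos (p * (x - a)) * sin (q * (x - a))) has_real_derivative
      (p\<^sup>2 - q\<^sup>2) * (cos (p * (x - a)) * cos (q * (x - a)))) (at x)"
      by (auto intro!: derivative_eq_intros simp: algebra_simps power2_eq_square)
    from DERIV_cdivide[OF this, of "p\<^sup>2 - q\<^sup>2"]
    show "(F has_real_derivative cos (p * (x - a)) * cos (q * (x - a))) (at x)"
      unfolding F_def using False ne by simp
  qed (use ab in auto)
  then show ?thesis using p q False by (simp add: F_def)
qed

lemma integrable_smode_mult:
  fixes g :: "real \<Rightarrow> real"
  assumes [measurable]: "J \<in> sets borel" "g \<in> borel_measurable borel"
    and J: "emeasure lborel J < \<infinity>" "gaplen J > 0" and B: "\<And>x. \<bar>g x\<bar> \<le> B"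
  shows "integrable lborel (\<lambda>x. smode J n x * g x)"
proof (rule Bochner_Integration.integrable_bound)
  show "integrable lborel (\<lambda>x. indicator J x * (sqrt (2 / gaplen J) * B))"
    using J by simp
  have "\<bar>smode J n x * g x\<bar> \<le> \<bar>indicator J x * (sqrt (2 / gaplen J) * B)\<bar>" for x
  proof (cases "x \<in> J")
    case True
    have "\<bar>smode J n x\<bar> * \<bar>g x\<bar> \<le> sqrt (2 / gaplen J) * B"
      using cmod_smode_le[OF J(2), of n x] B[of x] J(2) by (intro mult_mono) auto
    then have "\<bar>smode J n x * g x\<bar> \<le> sqrt (2 / gaplen J) * B" by (simp only: abs_mult)
    then have "\<bar>smode J n x * g x\<bar> \<le> \<bar>sqrt (2 / gaplen J) * B\<bar>" by (rule order_trans[OF _ abs_ge_self])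
    then show ?thesis using True by simp
  qed (simp add: smode_def)
  then show "AE x in lborel. norm (smode J n x * g x) \<le> norm (indicator J x * (sqrt (2 / gaplen J) * B))" by simp
qed measurable

text \<open>The overlap of \<open>smode J n\<close> with its translate by \<open>t\<close>, for \<open>L = gaplen J\<close>.\<close>

definition overlap :: "real \<Rightarrow> real \<Rightarrow> nat \<Rightarrow> real" where
  "overlap t L n = (if t < L then ((L - t) * cos (wave L n * t) + sin (wave L n * t) / wave L n) / L else 0)"

text \<open>The common support has length \<open>L - t\<close>, and the product of the two sines is
  half a difference of cosines. For \<open>t \<ge> L\<close> the supports are disjoint.\<close>

lemma integral_smode_shift:
  assumes J: "J = {Inf J<..<Sup J}" "Inf J < Sup J" and t: "t \<ge> 0"
  shows "(\<integral>x. smode J n x * smode J n (x + t) \<partial>lborel) = overlap t (gaplen J) n"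
proof -
  define a where "a = Inf J"
  define b where "b = Sup J"
  define L where "L = gaplen J"
  have L: "L > 0" "b = a + L" using J(2) by (auto simp: L_def gaplen_def a_def b_def)
  have mem: "x \<in> J \<longleftrightarrow> a < x \<and> x < b" for x unfolding a_def b_def by (subst J(1)) simp
  define w where "w = wave L n"
  have w: "w > 0" "sin (w * L) = 0" using L wave_pos sin_wave by (auto simp: w_def)
  show ?thesis
  proof (cases "t < L")
    case False
    have "smode J n x * smode J n (x + t) = 0" for x
      using False L by (auto simp: smode_def indicator_def mem)
    then have "(\<lambda>x. smode J n x * smode J n (x + t)) = (\<lambda>x. 0)" by (rule ext)
    then show ?thesis using False by (simp add: overlap_def L_def[symmetric])
  next
    case True
    define F where "F x = cos (w * t) / 2 * x - sin (w * (2 * (x - a) + t)) / (4 * w)" for x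
    have "smode J n x * smode J n (x + t) = 2 / L * (indicator {a<..<b - t} x * (sin (w * (x - a)) * sin (w * (x - a) + w * t)))" for x
    proof (cases "x \<in> {a<..<b - t}")
      case x: True
      have s2: "sqrt (2 / L) * sqrt (2 / L) = 2 / L" using L by simp
      have "indicator J x = (1::real)" "indicator J (x + t) = (1::real)" using x t by (auto simp: mem)
      moreover have "w * (x + t - a) = w * (x - a) + w * t" by (simp add: algebra_simps)
      ultimately have "smode J n x * smode J n (x + t) = (sqrt (2 / L) * sqrt (2 / L)) * (sin (w * (x - a)) * sin (w * (x - a) + w * t))"
        unfolding smode_def L_def[symmetric] w_def[symmetric] a_def[symmetric] by (simp only: mult_1_left ac_simps)
      then show ?thesis unfolding s2 using x by simp
    next
      case x: False
      then have "x \<notin> J \<or> x + t \<notin> J" using t by (auto simp: mem)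
      then show ?thesis using x by (auto simp: smode_def)
    qed
    then have "(\<integral>x. smode J n x * smode J n (x + t) \<partial>lborel) = 
      2 / L * (\<integral>x. indicator {a<..<b - t} x * (sin (w * (x - a)) * sin (w * (x - a) + w * t)) \<partial>lborel)"
      by (simp only: integral_mult_right_zero)
    also have "(\<integral>x. indicator {a<..<b - t} x * (sin (w * (x - a)) * sin (w * (x - a) + w * t)) \<partial>lborel) = F (b - t) - F a"
    proof (rule integral_Ioo_FTC(2))
      fix x
      have "(F has_real_derivative cos (w * t) / 2 - cos (w * (2 * (x - a) + t)) / 2) (at x)"
        unfolding F_def using w by (auto intro!: derivative_eq_intros simp: field_simps)
      also have "cos (w * t) / 2 - cos (w * (2 * (x - a) + t)) / 2 = sin (w * (x - a)) * sin (w * (x - a) + w * t)"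
      proof -
        have "w * (2 * (x - a) + t) = w * (x - a) + (w * (x - a) + w * t)" by (simp add: algebra_simps)
        then show ?thesis unfolding sin_times_sin by simp
      qed
      finally show "(F has_real_derivative sin (w * (x - a)) * sin (w * (x - a) + w * t)) (at x)" .
    qed (use True L in auto)
    also have "F (b - t) - F a = (L - t) * cos (w * t) / 2 - (sin (2 * (w * L) - w * t) - sin (w * t)) / (4 * w)"
      using L w by (simp add: F_def field_simps)
    \<comment> \<open>\<open>w * L\<close> is an integer multiple of \<open>pi\<close>, so its
      double is a period.\<close>
    also have "sin (2 * (w * L) - w * t) = - sin (w * t)"
    proof -
      have "cos (2 * (w * L)) = 1" using w(2) cos_double_sin[of "w * L"] by simp
      moreover have "sin (2 * (w * L)) = 0" using w(2) sin_double[of "w * L"] by simp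
      ultimately show ?thesis by (simp add: sin_diff)
    qed
    finally show ?thesis using True L w by (simp add: overlap_def L_def[symmetric] w_def[symmetric] field_simps)
  qed
qed

context LS_box
begin

definition kin_fun :: "nat \<Rightarrow> real \<Rightarrow> real" where
  "kin_fun m x = sqrt (2 / real l) * sin (wave (real l) m * (x + real l / 2))"

lemma kin_fun_measurable [measurable]: "kin_fun m \<in> borel_measurable borel"
  unfolding kin_fun_def[abs_def] by measurable

lemma abs_kin_fun_le: "\<bar>kin_fun m x\<bar> \<le> sqrt (2 / real l)"
  unfolding kin_fun_def by (auto simp: abs_mult intro: mult_left_le)

lemma sqi_kin: "sqi N (\<lambda>x. complex_of_real (kin_fun m x))"
  by (rule sqi_borel_bounded[where B = "sqrt (2 / real l)"]) (auto simp: abs_kin_fun_le)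

lemma ip_kin: "ip N (\<lambda>x. complex_of_real (kin_fun m x)) (\<lambda>x. complex_of_real (kin_fun m' x)) = (if m = m' then 1 else 0)"
proof -
  have l0: "real l > 0" using l by simp
  have "indicator (\<Lambda> l) x * (kin_fun m x * kin_fun m' x) = 
    2 / real l * (indicator {- real l / 2<..<real l / 2} x * (sin (wave l m * (x - (- real l / 2))) * sin (wave l m' * (x - (- real l / 2)))))" for x
  proof -
    have s2: "sqrt (2 / real l) * sqrt (2 / real l) = 2 / real l" by simp
    have "kin_fun m x * kin_fun m' x = (sqrt (2 / real l) * sqrt (2 / real l)) * 
        (sin (wave l m * (x + real l / 2)) * sin (wave l m' * (x + real l / 2)))"
      unfolding kin_fun_def by (simp only: ac_simps)
    then show ?thesis unfolding s2 by (simp add: \<Lambda>_def)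
  qed
  then have "ip N (\<lambda>x. complex_of_real (kin_fun m x)) (\<lambda>x. complex_of_real (kin_fun m' x)) = 
      complex_of_real (2 / real l * (\<integral>x. indicator {- real l / 2<..<real l / 2} x * (sin (wave l m * (x - (- real l / 2))) * sin (wave l m' * (x - (- real l / 2)))) \<partial>lborel))"
    unfolding ip_of_real[OF \<Lambda>_props(3)] by (simp only: integral_mult_right_zero)
  also have "(\<integral>x. indicator {- real l / 2<..<real l / 2} x * (sin (wave l m * (x - (- real l / 2))) * sin (wave l m' * (x - (- real l / 2)))) \<partial>lborel)
    = (if wave l m = wave l m' then (real l / 2 - (- real l / 2)) / 2 else 0)"
    using l0 sin_wave[OF l0] wave_pos[OF l0, of m] wave_pos[OF l0, of m']
    by (intro integral_sin_sin) (auto simp: power2_eq_iff_nonneg)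
  finally show ?thesis using l0 by (simp add: wave_inj)
qed

text \<open>Levels of the box are simple, so \<open>\<psi> k\<close> is an explicit sine up to a
  factor, which normalisation makes a phase; normalisation also rules out the zero
  alternative.\<close>

lemma \<psi>_form:
  "\<exists>m c. \<epsilon> k = box_energy (real l) m \<and> cmod c = 1 \<and>
     (AE x in N. \<psi> k x = c * complex_of_real (kin_fun m x))"
proof -
  have l0: "real l > 0" using l by simp
  have "dirichlet_hamiltonian {- real l / 2<..<real l / 2} (\<psi> k) (\<lambda>x. complex_of_real (\<epsilon> k) * \<psi> k x)"
    using kin by (simp add: eigensystem_def \<Lambda>_def)
  from dirichlet_eigenfunction[OF _ this] l0
  consider "AE x in lborel. x \<in> \<Lambda> l \<longrightarrow> \<psi> k x = 0"
    | m c where "\<epsilon> k = box_energy (real l) m" 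
       "AE x in lborel. x \<in> \<Lambda> l \<longrightarrow> \<psi> k x = c * complex_of_real (sin (wave (real l) m * (x + real l / 2)))"
    by (auto simp: box_energy_def wave_def \<Lambda>_def)
  then show ?thesis
  proof cases
    case 1
    then have "AE x in N. \<psi> k x = 0" using \<Lambda>_props(3) by (simp add: AE_restrict_space_iff)
    then have "ip N (\<psi> k) (\<psi> k) = ip N (\<psi> k) (\<lambda>x. 0)" by (intro ip_cong_AE sqi_\<psi> sqi_0)
    then have "complex_of_real (nrm2 N (\<psi> k)) = 0" unfolding ip_self by (simp add: ip_def)
    then show ?thesis using nrm2_\<psi>[of k] by simp
  next
    case 2
    define d where "d = c / complex_of_real (sqrt (2 / real l))"
    let ?u = "\<lambda>x. complex_of_real (kin_fun m x)"
    have ne: "sqrt (2 / real l) \<noteq> 0" using l0 by simp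
    have "AE x in N. \<psi> k x = c * complex_of_real (sin (wave (real l) m * (x + real l / 2)))"
      using 2(2) \<Lambda>_props(3) by (simp add: AE_restrict_space_iff)
    then have AE: "AE x in N. \<psi> k x = d * ?u x"
      by eventually_elim (use ne in \<open>simp add: d_def kin_fun_def\<close>)
    have "nrm2 N (\<psi> k) = nrm2 N (\<lambda>x. d * ?u x)"
    proof -
      have "ip N (\<psi> k) (\<psi> k) = ip N (\<psi> k) (\<lambda>x. d * ?u x)"
        by (rule ip_cong_AE[OF sqi_\<psi> sqi_\<psi> sqi_cmult[OF sqi_kin] AE])
      also have "\<dots> = cnj (ip N (\<lambda>x. d * ?u x) (\<psi> k))" by (rule ip_cnj)
      also have "ip N (\<lambda>x. d * ?u x) (\<psi> k) = ip N (\<lambda>x. d * ?u x) (\<lambda>x. d * ?u x)"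
        by (rule ip_cong_AE[OF sqi_cmult[OF sqi_kin] sqi_\<psi> sqi_cmult[OF sqi_kin] AE])
      finally show ?thesis unfolding ip_self by simp
    qed
    also have "\<dots> = (cmod d)\<^sup>2 * nrm2 N ?u" by (rule nrm2_cmult)
    also have "nrm2 N ?u = 1" using ip_kin[of m m] by (simp add: ip_self)
    finally have "(cmod d)\<^sup>2 = 1" by (simp add: nrm2_\<psi>)
    then have "cmod d = 1" by (simp add: power2_eq_1_iff) (metis norm_ge_zero not_one_le_zero neg_0_le_iff_le)
    then show ?thesis using 2(1) AE by blast
  qed
qed

text \<open>Locates \<open>\<psi> k\<close> among the explicit sines; by orthonormality different
  \<open>k\<close> get different indices.\<close>

definition kidx :: "nat \<Rightarrow> nat" where
  "kidx k = (SOME m. \<epsilon> k = box_energy (real l) m \<and> (\<exists>c. cmod c = 1 \<and>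
     (AE x in N. \<psi> k x = c * complex_of_real (kin_fun m x))))"

lemma kidx: "\<epsilon> k = box_energy (real l) (kidx k)"
  "\<exists>c. cmod c = 1 \<and> (AE x in N. \<psi> k x = c * complex_of_real (kin_fun (kidx k) x))"
proof -
  have "\<exists>m. \<epsilon> k = box_energy (real l) m \<and> (\<exists>c. cmod c = 1 \<and>
     (AE x in N. \<psi> k x = c * complex_of_real (kin_fun m x)))" using \<psi>_form by blast
  from someI_ex[OF this] show "\<epsilon> k = box_energy (real l) (kidx k)"
    "\<exists>c. cmod c = 1 \<and> (AE x in N. \<psi> k x = c * complex_of_real (kin_fun (kidx k) x))"
    unfolding kidx_def by blast+
qed

lemma ip_\<psi>:
  "\<exists>c. cmod c = 1 \<and> (\<forall>f. sqi N f \<longrightarrow> ip N (\<psi> k) f = c * ip N (\<lambda>x. complex_of_real (kin_fun (kidx k) x)) f)"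
proof -
  let ?u = "\<lambda>x. complex_of_real (kin_fun (kidx k) x)"
  obtain c where c: "cmod c = 1" "AE x in N. \<psi> k x = c * ?u x" using kidx by blast
  have "ip N (\<psi> k) f = cnj c * ip N ?u f" if f: "sqi N f" for f
  proof -
    have "ip N f (\<psi> k) = c * ip N f ?u"
      unfolding ip_cmult_right[symmetric] by (rule ip_cong_AE[OF f sqi_\<psi> sqi_cmult[OF sqi_kin] c(2)])
    then show ?thesis by (metis ip_cnj complex_cnj_mult)
  qed
  then show ?thesis using c(1) by (intro exI[of _ "cnj c"]) simp
qed

lemma kidx_inj: "kidx i = kidx j \<longleftrightarrow> i = j"
proof (rule iffI, rule ccontr)
  assume eq: "kidx i = kidx j" and ne: "i \<noteq> j"
  let ?u = "\<lambda>x. complex_of_real (kin_fun (kidx i) x)"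
  obtain c where c: "cmod c = 1" "\<And>f. sqi N f \<Longrightarrow> ip N (\<psi> i) f = c * ip N ?u f" using ip_\<psi>[of i] by blast
  obtain d where d: "cmod d = 1" "\<And>f. sqi N f \<Longrightarrow> ip N (\<psi> j) f = d * ip N ?u f" using ip_\<psi>[of j] unfolding eq[symmetric] by blast
  have "ip N (\<psi> i) (\<psi> j) = c * cnj (ip N (\<psi> j) ?u)"
    using c(2)[OF sqi_\<psi>[of j]] ip_cnj[of N ?u "\<psi> j"] by (metis ip_cnj)
  also have "\<dots> = c * cnj d" using d(2)[OF sqi_kin] ip_kin[of "kidx i" "kidx i"] by simp
  finally have "cmod (ip N (\<psi> i) (\<psi> j)) = 1" using c(1) d(1) by (simp add: norm_mult)
  then show False using total_\<psi> ne unfolding total_def orthonormal_def by simp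
qed simp

lemma sqrt_2\<epsilon>: "sqrt (2 * \<epsilon> k) = wave (real l) (kidx k)"
proof -
  have "wave (real l) (kidx k) \<ge> 0" using wave_pos[of "real l"] l by (simp add: less_imp_le)
  then show ?thesis by (simp add: kidx(1) box_energy_def)
qed

lemma \<epsilon>_nonneg: "\<epsilon> k \<ge> 0"
  by (simp add: kidx(1) box_energy_def)

lemma ip_kin_cmode:
  assumes J: "J \<in> gaps X l"
  shows "ip N (\<lambda>x. complex_of_real (kin_fun m x)) (cmode J n) = complex_of_real (\<integral>x. smode J n x * kin_fun m x \<partial>lborel)"
proof -
  have "indicator (\<Lambda> l) x * (kin_fun m x * smode J n x) = smode J n x * kin_fun m x" for x
    using gap_interval(5)[OF fin J] by (auto simp: smode_def indicator_def)
  then show ?thesis unfolding ip_of_real[OF \<Lambda>_props(3)] by (simp only:)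
qed

lemma W_eq:
  assumes J: "J \<in> gaps X l"
  shows "W J n k = (\<integral>x. smode J n x * kin_fun (kidx k) x \<partial>lborel)\<^sup>2"
proof -
  obtain c where c: "cmod c = 1" "ip N (\<psi> k) (cmode J n) = c * ip N (\<lambda>x. complex_of_real (kin_fun (kidx k) x)) (cmode J n)"
    using ip_\<psi>[of k] sqi_cmode[OF J] by blast
  have "cmod (ip N (cmode J n) (\<psi> k)) = cmod (ip N (\<psi> k) (cmode J n))"
    by (subst ip_cnj) (rule complex_mod_cnj)
  then show ?thesis unfolding W_def c(2) ip_kin_cmode[OF J] using c(1) by (simp add: norm_mult)
qed

lemma gap_int:
  assumes J: "J \<in> gaps X l" and [measurable]: "g \<in> borel_measurable borel" and B: "\<And>x. \<bar>g x\<bar> \<le> B"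
  shows "integrable lborel (\<lambda>x. smode J n x * g x)"
  using emeasure_gap[OF fin J] gap_sets[OF fin J]
  by (intro integrable_smode_mult[where B = B] gaplen_pos[OF fin J] B) auto

text \<open>On a set of length L the integrand is at most
  \<open>sqrt (2 / L) * sqrt (2 / l)\<close>, so the overlap is at most
  \<open>2 * sqrt (L / l)\<close>. A mode in a short gap is spread thinly over the kinetic
  states.\<close>

lemma W_le:
  assumes J: "J \<in> gaps X l"
  shows "W J n k \<le> 4 * gaplen J / real l"
proof -
  let ?L = "gaplen J"
  have L: "?L > 0" by (rule gaplen_pos[OF fin J])
  have mJ[measurable]: "J \<in> sets borel" by (rule gap_sets[OF fin J])
  have "\<bar>\<integral>x. smode J n x * kin_fun (kidx k) x \<partial>lborel\<bar> \<le> (\<integral>x. indicator J x * (sqrt (2 / ?L) * sqrt (2 / real l)) \<partial>lborel)"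
  proof (rule order_trans[OF integral_abs_bound integral_mono])
    show "integrable lborel (\<lambda>x. \<bar>smode J n x * kin_fun (kidx k) x\<bar>)"
      using gap_int[OF J _ abs_kin_fun_le] by auto
    show "integrable lborel (\<lambda>x. indicator J x * (sqrt (2 / ?L) * sqrt (2 / real l)))"
      using emeasure_gap[OF fin J] by simp
    fix x
    have "\<bar>smode J n x\<bar> * \<bar>kin_fun (kidx k) x\<bar> \<le> sqrt (2 / ?L) * sqrt (2 / real l)"
      using cmod_smode_le[OF L, of n x] abs_kin_fun_le[of "kidx k" x] L by (intro mult_mono) auto
    then show "\<bar>smode J n x * kin_fun (kidx k) x\<bar> \<le> indicator J x * (sqrt (2 / ?L) * sqrt (2 / real l))"
      by (cases "x \<in> J") (auto simp: abs_mult smode_def)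
  qed
  also have "\<dots> = ?L * (sqrt (2 / ?L) * sqrt (2 / real l))"
    using measure_gap[OF fin J] by simp
  finally have "(\<integral>x. smode J n x * kin_fun (kidx k) x \<partial>lborel)\<^sup>2 \<le> (?L * (sqrt (2 / ?L) * sqrt (2 / real l)))\<^sup>2"
    by (rule power2_le_iff_abs_le[THEN iffD2, rotated]) (use L in auto)
  also have "\<dots> = 4 * ?L / real l"
  proof -
    have "(sqrt (2 / ?L))\<^sup>2 = 2 / ?L" "(sqrt (2 / real l))\<^sup>2 = 2 / real l" using L by simp_all
    then show ?thesis using L l unfolding power_mult_distrib by (simp add: power2_eq_square)
  qed
  finally show ?thesis by (simp add: W_eq[OF J])
qed

text \<open>This is Bessel's inequality for the derivative of \<open>smode J n\<close> with respect to the cosines.\<close>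

lemma W_energy:
  assumes J: "J \<in> gaps X l"
  shows "(\<Sum>k<K. \<epsilon> k * W J n k) \<le> box_energy (gaplen J) n"
proof -
  let ?L = "gaplen J"
  define w where "w = wave ?L n"
  define a where "a = Inf J"
  define b where "b = Sup J"
  have l0: "real l > 0" using l by simp
  have L: "?L > 0" "b - a = ?L" using gaplen_pos[OF fin J] by (auto simp: gaplen_def a_def b_def)
  have ab: "a < b" using L by simp
  have w: "w > 0" "sin (w * (b - a)) = 0" using wave_pos[OF L(1)] sin_wave[OF L(1)] L by (auto simp: w_def)
  have mem: "x \<in> J \<longleftrightarrow> a < x \<and> x < b" for x
    using gap_interval(1)[OF fin J] unfolding a_def b_def by (metis greaterThanLessThan_iff)
  have ind: "indicator J x = (indicator {a<..<b} x :: real)" for x by (auto simp: indicator_def mem)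
  have \<Lambda>J: "x \<in> J \<Longrightarrow> x \<in> \<Lambda> l" for x using gap_interval(5)[OF fin J] by blast
  define \<kappa> where "\<kappa> k = wave (real l) (kidx k)" for k
  \<comment> \<open>\<open>h\<close> is the derivative of the mode and
    \<open>\<kappa> k * v k\<close> that of the kinetic sine. The cosines \<open>v k\<close> are
    orthonormal because the wave numbers are positive and distinct.\<close>
  define v where "v k x = sqrt (2 / real l) * cos (\<kappa> k * (x + real l / 2))" for k x
  define h where "h x = indicator J x * (sqrt (2 / ?L) * (w * cos (w * (x - a))))" for x
  have [measurable]: "v k \<in> borel_measurable borel" for k unfolding v_def[abs_def] by measurable
  have mJ[measurable]: "J \<in> sets borel" by (rule gap_sets[OF fin J])
  have hm: "h \<in> borel_measurable borel"
    unfolding h_def[abs_def] by (intro borel_measurable_times borel_measurable_indicator mJ) measurable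
  have vb: "\<bar>v k x\<bar> \<le> sqrt (2 / real l)" for k x by (auto simp: v_def abs_mult intro: mult_left_le)
  have sv: "sqi N (\<lambda>x. complex_of_real (v k x))" for k
    by (rule sqi_borel_bounded[where B = "sqrt (2 / real l)"]) (simp_all only: norm_of_real vb, measurable)
  have sh: "sqi N (\<lambda>x. complex_of_real (h x))"
  proof (rule sqi_borel_bounded[where B = "sqrt (2 / ?L) * w"])
    have "\<bar>h x\<bar> \<le> sqrt (2 / ?L) * w" for x
      using w(1) L(1) by (auto simp: h_def abs_mult indicator_def intro!: mult_left_mono mult_left_le)
    then show "cmod (complex_of_real (h x)) \<le> sqrt (2 / ?L) * w" for x by (simp only: norm_of_real)
  qed (use hm in measurable)
  have on: "orthonormal N UNIV (\<lambda>k x. complex_of_real (v k x))"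
    unfolding orthonormal_def
  proof (intro conjI ballI sv)
    fix i j
    have "indicator (\<Lambda> l) x * (v i x * v j x) = 
      2 / real l * (indicator {- real l / 2<..<real l / 2} x * (cos (\<kappa> i * (x - (- real l / 2))) * cos (\<kappa> j * (x - (- real l / 2)))))" for x
    proof -
      have s2: "sqrt (2 / real l) * sqrt (2 / real l) = 2 / real l" by simp
      have "v i x * v j x = (sqrt (2 / real l) * sqrt (2 / real l)) * 
          (cos (\<kappa> i * (x + real l / 2)) * cos (\<kappa> j * (x + real l / 2)))"
        unfolding v_def by (simp only: ac_simps)
      then show ?thesis unfolding s2 by (simp add: \<Lambda>_def)
    qed
    then have "ip N (\<lambda>x. complex_of_real (v i x)) (\<lambda>x. complex_of_real (v j x)) = 
        complex_of_real (2 / real l * (\<integral>x. indicator {- real l / 2<..<real l / 2} x * (cos (\<kappa> i * (x - (- real l / 2))) * cos (\<kappa> j * (x - (- real l / 2)))) \<partial>lborel))"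
      unfolding ip_of_real[OF \<Lambda>_props(3)] by (simp only: integral_mult_right_zero)
    also have "(\<integral>x. indicator {- real l / 2<..<real l / 2} x * (cos (\<kappa> i * (x - (- real l / 2))) * cos (\<kappa> j * (x - (- real l / 2)))) \<partial>lborel)
      = (if \<kappa> i = \<kappa> j then (real l / 2 - (- real l / 2)) / 2 else 0)"
      using l0 sin_wave[OF l0] wave_pos[OF l0] unfolding \<kappa>_def
      by (intro integral_cos_cos) (auto simp: power2_eq_iff_nonneg less_imp_le less_imp_neq[symmetric])
    finally show "ip N (\<lambda>x. complex_of_real (v i x)) (\<lambda>x. complex_of_real (v j x)) = (if i = j then 1 else 0)"
      using l0 by (simp add: wave_inj kidx_inj \<kappa>_def)
  qed
  have nh: "nrm2 N (\<lambda>x. complex_of_real (h x)) = w\<^sup>2"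
  proof -
    have "indicator (\<Lambda> l) x * (h x * h x) = 2 / ?L * w\<^sup>2 * (indicator {a<..<b} x * (cos (w * (x - a)) * cos (w * (x - a))))" for x
    proof (cases "x \<in> J")
      case True
      have s2: "sqrt (2 / ?L) * sqrt (2 / ?L) = 2 / ?L" using L by simp
      have "h x * h x = (sqrt (2 / ?L) * sqrt (2 / ?L)) * (w * w) * (cos (w * (x - a)) * cos (w * (x - a)))"
        using True by (simp add: h_def del: real_sqrt_mult_self)
      then show ?thesis unfolding s2 using True \<Lambda>J[OF True] by (simp add: ind[symmetric] power2_eq_square)
    qed (simp add: h_def ind[symmetric])
    then have "ip N (\<lambda>x. complex_of_real (h x)) (\<lambda>x. complex_of_real (h x)) = 
      complex_of_real (2 / ?L * w\<^sup>2 * (\<integral>x. indicator {a<..<b} x * (cos (w * (x - a)) * cos (w * (x - a))) \<partial>lborel))"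
      unfolding ip_of_real[OF \<Lambda>_props(3)] by (simp only: integral_mult_right_zero)
    also have "(\<integral>x. indicator {a<..<b} x * (cos (w * (x - a)) * cos (w * (x - a))) \<partial>lborel) = (b - a) / 2"
      using integral_cos_cos[OF ab w(2) _ w(2)] w(1) by simp
    finally show ?thesis unfolding ip_self of_real_eq_iff using L by simp
  qed
  \<comment> \<open>Integration by parts: \<open>F\<close> collects the boundary terms, which vanish
    because the mode is 0 at both ends of the gap, whatever the cosine does there.\<close>
  have iv: "ip N (\<lambda>x. complex_of_real (v k x)) (\<lambda>x. complex_of_real (h x)) = 
      complex_of_real (\<kappa> k * (\<integral>x. smode J n x * kin_fun (kidx k) x \<partial>lborel))" for k
  proof -
    let ?C = "sqrt (2 / real l) * sqrt (2 / ?L)"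
    define p where "p x = indicator {a<..<b} x * (w * (cos (\<kappa> k * (x + real l / 2)) * cos (w * (x - a))))" for x
    define q where "q x = indicator {a<..<b} x * (\<kappa> k * (sin (\<kappa> k * (x + real l / 2)) * sin (w * (x - a))))" for x
    define F where "F x = cos (\<kappa> k * (x + real l / 2)) * sin (w * (x - a))" for x
    have pq: "integrable lborel (\<lambda>x. indicator {a<..<b} x * (w * (cos (\<kappa> k * (x + real l / 2)) * cos (w * (x - a))) - \<kappa> k * (sin (\<kappa> k * (x + real l / 2)) * sin (w * (x - a)))))"
      "(\<integral>x. indicator {a<..<b} x * (w * (cos (\<kappa> k * (x + real l / 2)) * cos (w * (x - a))) - \<kappa> k * (sin (\<kappa> k * (x + real l / 2)) * sin (w * (x - a)))) \<partial>lborel) = F b - F a"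
    proof -
      have D: "(F has_real_derivative w * (cos (\<kappa> k * (x + real l / 2)) * cos (w * (x - a))) - \<kappa> k * (sin (\<kappa> k * (x + real l / 2)) * sin (w * (x - a)))) (at x)" for x
        unfolding F_def by (auto intro!: derivative_eq_intros simp: algebra_simps)
      have C: "isCont (\<lambda>x. w * (cos (\<kappa> k * (x + real l / 2)) * cos (w * (x - a))) - \<kappa> k * (sin (\<kappa> k * (x + real l / 2)) * sin (w * (x - a)))) x" for x
        by (intro continuous_intros)
      show "integrable lborel (\<lambda>x. indicator {a<..<b} x * (w * (cos (\<kappa> k * (x + real l / 2)) * cos (w * (x - a))) - \<kappa> k * (sin (\<kappa> k * (x + real l / 2)) * sin (w * (x - a)))))"
      "(\<integral>x. indicator {a<..<b} x * (w * (cos (\<kappa> k * (x + real l / 2)) * cos (w * (x - a))) - \<kappa> k * (sin (\<kappa> k * (x + real l / 2)) * sin (w * (x - a)))) \<partial>lborel) = F b - F a"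
        using ab by (intro integral_Ioo_FTC[OF _ D C]; simp)+
    qed
    have Fab: "F b - F a = 0" using w by (simp add: F_def)
    have q_eq: "smode J n x * kin_fun (kidx k) x * \<kappa> k = ?C * q x" for x
      unfolding smode_def kin_fun_def q_def ind \<kappa>_def[symmetric] w_def[symmetric] a_def[symmetric] by (simp only: ac_simps)
    have p_eq: "indicator (\<Lambda> l) x * (v k x * h x) = ?C * p x" for x
    proof (cases "x \<in> J")
      case True
      then show ?thesis using \<Lambda>J[OF True] unfolding v_def h_def p_def by (simp add: ind[symmetric])
    qed (simp add: h_def p_def ind[symmetric])
    have qi: "integrable lborel q"
    proof -
      have "integrable lborel (\<lambda>x. smode J n x * kin_fun (kidx k) x * \<kappa> k)"
        using gap_int[OF J _ abs_kin_fun_le] by auto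
      then have "integrable lborel (\<lambda>x. ?C * q x)" by (simp only: q_eq)
      then show ?thesis using l0 L(1) by (simp add: integrable_mult_right_iff) 
    qed
    have pq_eq: "p x - q x = indicator {a<..<b} x * (w * (cos (\<kappa> k * (x + real l / 2)) * cos (w * (x - a))) - \<kappa> k * (sin (\<kappa> k * (x + real l / 2)) * sin (w * (x - a))))" for x
      by (simp add: p_def q_def right_diff_distrib)
    have "(\<integral>x. p x \<partial>lborel) = (\<integral>x. (p x - q x) + q x \<partial>lborel)" by simp
    also have "\<dots> = (\<integral>x. p x - q x \<partial>lborel) + (\<integral>x. q x \<partial>lborel)"
      using pq(1) qi unfolding pq_eq[symmetric] by (rule Bochner_Integration.integral_add)
    also have "(\<integral>x. p x - q x \<partial>lborel) = 0" using pq(2) Fab unfolding pq_eq[symmetric] by simp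
    finally have "?C * (\<integral>x. p x \<partial>lborel) = ?C * (\<integral>x. q x \<partial>lborel)" by simp
    then have "(\<integral>x. indicator (\<Lambda> l) x * (v k x * h x) \<partial>lborel) = (\<integral>x. smode J n x * kin_fun (kidx k) x * \<kappa> k \<partial>lborel)"
      unfolding p_eq q_eq integral_mult_right_zero .
    then show ?thesis unfolding ip_of_real[OF \<Lambda>_props(3)] by (simp add: mult.commute)
  qed
  have "(\<Sum>k<K. \<epsilon> k * W J n k) = (\<Sum>k<K. (cmod (ip N (\<lambda>x. complex_of_real (v k x)) (\<lambda>x. complex_of_real (h x))))\<^sup>2) / 2"
    unfolding iv W_eq[OF J] sum_divide_distrib
    by (intro sum.cong refl) (simp add: kidx(1) box_energy_def \<kappa>_def norm_mult power_mult_distrib abs_mult)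
  also have "\<dots> \<le> w\<^sup>2 / 2"
    using bessel[OF on _ _ sh, of "{..<K}"] nh by simp
  finally show ?thesis by (simp add: box_energy_def w_def)
qed

text \<open>d'Alembert: multiplying the coefficients by \<open>cos (t sqrt (2 \<epsilon>))\<close> averages the two translates.\<close>

lemma W_cos:
  assumes J: "J \<in> gaps X l" and t: "t \<ge> 0" "- real l / 2 \<le> Inf J - t" "Sup J + t \<le> real l / 2"
  shows "(\<lambda>k. cos (t * sqrt (2 * \<epsilon> k)) * W J n k) sums overlap t (gaplen J) n"
proof -
  note I = gap_interval[OF fin J]
  have mJ[measurable]: "J \<in> sets borel" by (rule gap_sets[OF fin J])
  have [measurable]: "smode J n \<in> borel_measurable borel" by (rule smode_measurable[OF mJ])
  have L: "gaplen J > 0" by (rule gaplen_pos[OF fin J])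
  \<comment> \<open>Average of the two translates. By the hypotheses on \<open>t\<close> it still
    vanishes outside the box, so integrals over the box may be taken over the line.\<close>
  define S where "S x = (smode J n (x - t) + smode J n (x + t)) / 2" for x
  have [measurable]: "S \<in> borel_measurable borel" unfolding S_def[abs_def] by measurable
  have smB: "\<bar>smode J n x\<bar> \<le> sqrt (2 / gaplen J)" for x using cmod_smode_le[OF L, of n x] by simp
  have sS: "sqi N (\<lambda>x. complex_of_real (S x))"
  proof (rule sqi_borel_bounded[where B = "sqrt (2 / gaplen J)"])
    show "cmod (complex_of_real (S x)) \<le> sqrt (2 / gaplen J)" for x
    proof -
      have "\<bar>(u + v) / 2\<bar> \<le> B" if "\<bar>u\<bar> \<le> B" "\<bar>v\<bar> \<le> B" for u v B :: real
        using that abs_triangle_ineq[of u v] by (simp add: abs_divide)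
      then show ?thesis unfolding norm_of_real S_def using smB by blast
    qed
  qed measurable
  have supp: "indicator (\<Lambda> l) x * S x = S x" for x
  proof (cases "x \<in> \<Lambda> l")
    case False
    have mem: "y \<in> J \<longleftrightarrow> Inf J < y \<and> y < Sup J" for y using I(1) by (metis greaterThanLessThan_iff)
    have "x - t \<notin> J" "x + t \<notin> J" using False t unfolding mem \<Lambda>_def by auto
    then show ?thesis by (simp add: S_def smode_def)
  qed simp
  have shift: "(\<integral>x. g x * smode J n (x + s) \<partial>lborel) = (\<integral>x. smode J n x * g (x - s) \<partial>lborel)" 
    "integrable lborel (\<lambda>x. g x * smode J n (x + s))"
    if [measurable]: "g \<in> borel_measurable borel" and B: "\<And>x. \<bar>g x\<bar> \<le> B" for g B s
  proof -
    have "(\<integral>x. smode J n x * g (x - s) \<partial>lborel) = (\<integral>x. smode J n (s + 1 * x) * g (s + 1 * x - s) \<partial>lborel)"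
      using lborel_integral_real_affine[of 1 "\<lambda>x. smode J n x * g (x - s)" s] by simp
    also have "\<dots> = (\<integral>x. g x * smode J n (x + s) \<partial>lborel)" by (simp add: ac_simps)
    finally show "(\<integral>x. g x * smode J n (x + s) \<partial>lborel) = (\<integral>x. smode J n x * g (x - s) \<partial>lborel)" by simp
    have "integrable lborel (\<lambda>x. smode J n x * g (x - s))"
      by (rule gap_int[OF J, where B = B]) (measurable, use B in auto)
    then have "integrable lborel (\<lambda>x. smode J n (s + 1 * x) * g (s + 1 * x - s))"
      using lborel_integrable_real_affine[of "\<lambda>x. smode J n x * g (x - s)" 1 s] by simp
    then show "integrable lborel (\<lambda>x. g x * smode J n (x + s))" by (simp add: ac_simps)
  qed
  have ipS: "ip N (\<lambda>x. complex_of_real (g x)) (\<lambda>x. complex_of_real (S x)) = 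
     complex_of_real (((\<integral>x. smode J n x * g (x + t) \<partial>lborel) + (\<integral>x. smode J n x * g (x - t) \<partial>lborel)) / 2)"
    if [measurable]: "g \<in> borel_measurable borel" and B: "\<And>x. \<bar>g x\<bar> \<le> B" for g B
  proof -
    have eq: "indicator (\<Lambda> l) x * (g x * S x) = (g x * smode J n (x + (- t)) + g x * smode J n (x + t)) / 2" for x
    proof -
      have "indicator (\<Lambda> l) x * (g x * S x) = g x * (indicator (\<Lambda> l) x * S x)" by (simp only: ac_simps)
      then show ?thesis unfolding supp by (simp add: S_def distrib_left)
    qed
    have "(\<integral>x. indicator (\<Lambda> l) x * (g x * S x) \<partial>lborel) = 
        ((\<integral>x. g x * smode J n (x + (- t)) \<partial>lborel) + (\<integral>x. g x * smode J n (x + t) \<partial>lborel)) / 2"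
      unfolding eq integral_divide_zero
      by (subst Bochner_Integration.integral_add[OF shift(2)[OF that, of "- t"] shift(2)[OF that, of t]]) (rule refl)
    then show ?thesis unfolding ip_of_real[OF \<Lambda>_props(3)]
      unfolding shift(1)[OF that, of t] shift(1)[OF that, of "- t"] minus_minus diff_minus_eq_add
      by (simp only:)
  qed
  \<comment> \<open>Move the translations onto the sine, which as a function on the whole line
    satisfies \<open>sin (a + b) + sin (a - b) = 2 * cos b * sin a\<close>.\<close>
  have cosk: "ip N (\<psi> k) (\<lambda>x. complex_of_real (S x)) = complex_of_real (cos (t * sqrt (2 * \<epsilon> k))) * ip N (\<psi> k) (cmode J n)" for k
  proof -
    let ?u = "kin_fun (kidx k)"
    define \<kappa> where "\<kappa> = wave (real l) (kidx k)"
    obtain c where c: "\<And>f. sqi N f \<Longrightarrow> ip N (\<psi> k) f = c * ip N (\<lambda>x. complex_of_real (?u x)) f"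
      using ip_\<psi>[of k] by blast
    have i1: "integrable lborel (\<lambda>x. smode J n x * ?u (x + t))"
      by (rule gap_int[OF J, where B = "sqrt (2 / real l)"]) (measurable, rule abs_kin_fun_le)
    have i2: "integrable lborel (\<lambda>x. smode J n x * ?u (x - t))"
      by (rule gap_int[OF J, where B = "sqrt (2 / real l)"]) (measurable, rule abs_kin_fun_le)
    have sum: "?u (x + t) + ?u (x - t) = 2 * cos (t * \<kappa>) * ?u x" for x
    proof -
      have "\<kappa> * (x + t + real l / 2) = \<kappa> * (x + real l / 2) + t * \<kappa>"
        "\<kappa> * (x - t + real l / 2) = \<kappa> * (x + real l / 2) - t * \<kappa>" by (simp_all add: algebra_simps)
      then show ?thesis unfolding kin_fun_def \<kappa>_def[symmetric] by (simp add: sin_add sin_diff algebra_simps)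
    qed
    have "smode J n x * ?u (x + t) + smode J n x * ?u (x - t) = 2 * cos (t * \<kappa>) * (smode J n x * ?u x)" for x
      unfolding distrib_left[symmetric] sum by (simp only: ac_simps)
    then have "(\<integral>x. smode J n x * ?u (x + t) \<partial>lborel) + (\<integral>x. smode J n x * ?u (x - t) \<partial>lborel) = 
        2 * cos (t * \<kappa>) * (\<integral>x. smode J n x * ?u x \<partial>lborel)"
      unfolding Bochner_Integration.integral_add[OF i1 i2, symmetric] by (simp only: integral_mult_right_zero)
    then have half: "((\<integral>x. smode J n x * ?u (x + t) \<partial>lborel) + (\<integral>x. smode J n x * ?u (x - t) \<partial>lborel)) / 2 = 
        cos (t * \<kappa>) * (\<integral>x. smode J n x * ?u x \<partial>lborel)" by simp
    have "ip N (\<lambda>x. complex_of_real (?u x)) (\<lambda>x. complex_of_real (S x)) = 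
        complex_of_real (cos (t * \<kappa>)) * ip N (\<lambda>x. complex_of_real (?u x)) (cmode J n)"
      unfolding ipS[OF kin_fun_measurable abs_kin_fun_le] ip_kin_cmode[OF J] half by (rule of_real_mult)
    then show ?thesis unfolding c[OF sS] c[OF sqi_cmode[OF J]] sqrt_2\<epsilon> \<kappa>_def by (simp add: ac_simps)
  qed
  \<comment> \<open>Polarised Parseval turns the cosine-weighted sum into the overlap of the mode
    with \<open>S\<close>, to which both translates contribute equally.\<close>
  have "(\<lambda>k. cnj (ip N (\<psi> k) (cmode J n)) * ip N (\<psi> k) (\<lambda>x. complex_of_real (S x))) sums ip N (cmode J n) (\<lambda>x. complex_of_real (S x))"
    by (rule parseval_polarised[OF fmN total_\<psi> sqi_cmode[OF J] sS])
  moreover have "cnj (ip N (\<psi> k) (cmode J n)) * ip N (\<psi> k) (\<lambda>x. complex_of_real (S x)) = complex_of_real (cos (t * sqrt (2 * \<epsilon> k)) * W J n k)" for k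
  proof -
    have "cnj (ip N (\<psi> k) (cmode J n)) * ip N (\<psi> k) (cmode J n) = complex_of_real (W J n k)"
      unfolding W_def complex_norm_square by (metis complex_cnj_cnj ip_cnj mult.commute)
    then show ?thesis unfolding cosk by (simp add: ac_simps)
  qed
  moreover have "ip N (cmode J n) (\<lambda>x. complex_of_real (S x)) = complex_of_real (overlap t (gaplen J) n)"
  proof -
    have "(\<integral>x. smode J n x * smode J n (x - t) \<partial>lborel) = (\<integral>x. smode J n x * smode J n (x + t) \<partial>lborel)"
      using shift(1)[of "smode J n" "sqrt (2 / gaplen J)" t] smB by simp
    then have "((\<integral>x. smode J n x * smode J n (x + t) \<partial>lborel) + (\<integral>x. smode J n x * smode J n (x - t) \<partial>lborel)) / 2 = overlap t (gaplen J) n"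
      using integral_smode_shift[OF I(1,2) t(1), of n] by simp
    then show ?thesis using ipS[of "smode J n" "sqrt (2 / gaplen J)"] smB by (simp only: ) simp
  qed
  ultimately show ?thesis by (simp only: sums_of_real_iff)
qed

end

section \<open>The integrated density of states\<close>

lemma one_minus_cos_le: "1 - cos x \<le> x\<^sup>2 / 2" for x :: real
proof -
  have "1 - cos x = 2 * (sin (x / 2))\<^sup>2"
    using cos_double_sin[of "x / 2"] by simp
  also have "(sin (x / 2))\<^sup>2 \<le> (x / 2)\<^sup>2"
    using abs_sin_x_le_abs_x[of "x / 2"] by (rule power2_le_iff_abs_le[THEN iffD2, OF abs_ge_zero, unfolded power2_abs])
  finally show ?thesis by (simp add: power2_eq_square)
qed

lemma x_minus_sin_le: 
  fixes x :: real
  assumes "x \<ge> 0" 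
  shows "x - sin x \<le> x ^ 3 / 2"
proof -
  have "(\<lambda>x. x ^ 3 / 2 - x + sin x) 0 \<le> (\<lambda>x. x ^ 3 / 2 - x + sin x) x"
  proof (rule DERIV_nonneg_imp_nondecreasing[OF assms])
    fix y :: real assume "0 \<le> y"
    have "((\<lambda>x. x ^ 3 / 2 - x + sin x) has_real_derivative (3 * y\<^sup>2 / 2 - 1 + cos y)) (at y)"
      by (auto intro!: derivative_eq_intros simp: power2_eq_square)
    moreover have "0 \<le> 3 * y\<^sup>2 / 2 - 1 + cos y"
      using one_minus_cos_le[of y] zero_le_power2[of y] by linarith
    ultimately show "\<exists>z. ((\<lambda>x. x ^ 3 / 2 - x + sin x) has_real_derivative z) (at y) \<and> 0 \<le> z" by blast
  qed
  then show ?thesis by simp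
qed

text \<open>For \<open>t < L\<close> and \<open>x = w * t > 0\<close> the overlap is the mean of
  \<open>cos x\<close> and \<open>sin x / x\<close> with weights \<open>1 - t / L\<close> and
  \<open>t / L\<close>, and both fall short of 1 by at most \<open>x\<^sup>2 / 2\<close>. The third
  bound is what cancels the singularity of the Bose factor at zero energy.\<close>

lemma overlap_bounds:
  assumes L: "L > 0" and t: "t \<ge> 0"
  shows "overlap t L n \<le> 1" "- 1 \<le> overlap t L n" "1 - overlap t L n \<le> t\<^sup>2 * box_energy L n"
proof -
  define w where "w = wave L n"
  define x where "x = w * t"
  have w: "w > 0" using wave_pos[OF L] by (simp add: w_def)
  have x: "x \<ge> 0" using w t by (simp add: x_def)
  have E: "t\<^sup>2 * box_energy L n = x\<^sup>2 / 2" by (simp add: box_energy_def x_def w_def power_mult_distrib)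
  have "overlap t L n \<le> 1 \<and> - 1 \<le> overlap t L n \<and> 1 - overlap t L n \<le> t\<^sup>2 * box_energy L n"
  proof (cases "t < L")
    case False
    \<comment> \<open>Here the overlap is 0, but a shift by at least the gap length covers half a
      wave length of the mode, so \<open>t\<^sup>2\<close> times the energy exceeds 1.\<close>
    have "pi * 1 \<le> (real (Suc n) * pi) * (t / L)"
      using False L by (intro mult_mono) (auto simp: field_simps)
    also have "\<dots> = x" by (simp add: x_def w_def wave_def)
    finally have "x \<ge> pi" by simp
    then have "x \<ge> 2" using pi_ge_two by linarith
    then have "2\<^sup>2 \<le> x\<^sup>2" by (intro power_mono) auto
    then show ?thesis using False by (simp add: overlap_def E)
  next
    case True
    have ov: "L * overlap t L n = (L - t) * cos x + sin x / w"
      using True L by (simp add: overlap_def x_def w_def)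
    have s: "\<bar>sin x / w\<bar> \<le> t"
      using abs_sin_x_le_abs_x[of x] x w t by (simp add: abs_divide x_def divide_le_eq mult.commute abs_mult)
    have c: "(L - t) * cos x \<le> (L - t) * 1" "(L - t) * (- 1) \<le> (L - t) * cos x"
      using True by (intro mult_left_mono; simp)+
    have "L * overlap t L n \<le> L * 1" "L * (- 1) \<le> L * overlap t L n"
    proof -
      have 1: "P + q \<le> L" and 2: "- L \<le> P + q" if "\<bar>q\<bar> \<le> t" "P \<le> L - t" "- (L - t) \<le> P" for P q
        using that by linarith+
      have c': "(L - t) * cos x \<le> L - t" "- (L - t) \<le> (L - t) * cos x" using c by simp_all
      show "L * overlap t L n \<le> L * 1" "L * (- 1) \<le> L * overlap t L n"
        unfolding ov using 1[OF s c'] 2[OF s c'] by simp_all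
    qed
    then have 1: "overlap t L n \<le> 1" "- 1 \<le> overlap t L n" using L by (simp_all only: mult_le_cancel_left_pos)
    have "t - sin x / w \<le> t * (x\<^sup>2 / 2)"
    proof -
      have "(x - sin x) / w \<le> (x ^ 3 / 2) / w" using x_minus_sin_le[OF x] w by (intro divide_right_mono) auto
      then show ?thesis using w by (simp add: x_def diff_divide_distrib power2_eq_square power3_eq_cube)
    qed
    moreover have "(L - t) * (1 - cos x) \<le> (L - t) * (x\<^sup>2 / 2)"
      using True by (intro mult_left_mono one_minus_cos_le) auto
    ultimately have "L * (1 - overlap t L n) \<le> L * (x\<^sup>2 / 2)"
      unfolding right_diff_distrib[of L 1] ov by (simp add: algebra_simps)
    then have "1 - overlap t L n \<le> x\<^sup>2 / 2" using L by (simp only: mult_le_cancel_left_pos)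
    then show ?thesis using 1 by (simp add: E)
  qed
  then show "overlap t L n \<le> 1" "- 1 \<le> overlap t L n" "1 - overlap t L n \<le> t\<^sup>2 * box_energy L n" by auto
qed

text \<open>The square of \<open>a * w - 1\<close> trades the quadratic exponent for a linear one,
  that is, the Gaussian sum over modes for a geometric series.\<close>

lemma exp_box_energy_le:
  assumes a: "a > 0" and L: "L > 0"
  shows "exp (- a * box_energy L n) \<le> exp (1 / (2 * a)) * exp (- (pi / L)) ^ Suc n"
proof -
  define w where "w = wave L n"
  have "0 \<le> (a * w - 1)\<^sup>2 / (2 * a)" using a by simp
  also have "\<dots> = a * w\<^sup>2 / 2 - w + 1 / (2 * a)" using a by (simp add: power2_eq_square field_simps)
  finally have "- a * box_energy L n \<le> 1 / (2 * a) + real (Suc n) * (- (pi / L))"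
    by (simp add: box_energy_def w_def wave_def)
  then have "exp (- a * box_energy L n) \<le> exp (1 / (2 * a) + real (Suc n) * (- (pi / L)))" by simp
  then show ?thesis by (simp only: exp_add exp_of_nat_mult)
qed

lemma geometric_exp_sums:
  fixes c :: real
  assumes c: "c > 0"
  shows "(\<lambda>n. exp (- c) ^ Suc n) sums (1 / (exp c - 1))"
proof -
  have "norm (exp (- c)) < 1" using c by simp
  then have "(\<lambda>n. exp (- c) * exp (- c) ^ n) sums (exp (- c) * (1 / (1 - exp (- c))))"
    by (intro sums_mult geometric_sums)
  moreover have "exp (- c) * (1 / (1 - exp (- c))) = 1 / (exp c - 1)"
    using c by (simp add: exp_minus field_simps)
  ultimately show ?thesis by simp
qed

text \<open>The linear growth in \<open>L\<close> is decisive: divided by the gap length, mode sums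
  become bounded functions of it, as \<open>gap_average\<close> requires.\<close>

lemma geometric_exp_le:
  assumes L: "L > 0"
  shows "(\<Sum>n. exp (- (pi / L)) ^ Suc n) \<le> L"
proof -
  have p: "pi / L > 0" using L by simp
  have "1 / (exp y - 1) \<le> 1 / y" if "y > 0" for y :: real
  proof -
    have "y \<le> exp y - 1" using exp_ge_add_one_self[of y] by linarith
    then show ?thesis using that by (intro divide_left_mono mult_pos_pos) auto
  qed
  from this[OF p] have "1 / (exp (pi / L) - 1) \<le> 1 / (pi / L)" .
  also have "\<dots> \<le> L" using L pi_ge_two by (simp add: field_simps)
  finally show ?thesis using geometric_exp_sums[OF p] by (simp add: sums_iff)
qed

text \<open>Functions of level and gap length that can be averaged over the gaps of a sample: the
  exponential bound makes the sum over levels at most linear in the length, and \<open>D\<close>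
  holds the lengths at which continuity may fail.\<close>

locale mode_weight =
  fixes w :: "nat \<Rightarrow> real \<Rightarrow> real" and C a :: real and D :: "real set"
  assumes meas: "\<And>n. w n \<in> borel_measurable borel"
    and C: "C \<ge> 0" and a: "a > 0"
    and bound: "\<And>n L. L > 0 \<Longrightarrow> \<bar>w n L\<bar> \<le> C * exp (- a * box_energy L n)"
    and D: "countable D" and cont: "\<And>n L. L > 0 \<Longrightarrow> L \<notin> D \<Longrightarrow> isCont (w n) L"
begin

definition Kw where "Kw = C * exp (1 / (2 * a))"

lemma Kw_nonneg: "Kw \<ge> 0" using C by (simp add: Kw_def)

lemma le_geometric: "L > 0 \<Longrightarrow> \<bar>w n L\<bar> \<le> Kw * exp (- (pi / L)) ^ Suc n"
  using order_trans[OF bound mult_left_mono[OF exp_box_energy_le[OF a] C]] unfolding Kw_def by (simp add: mult.assoc)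

lemma summable_geometric_Kw: "L > 0 \<Longrightarrow> summable (\<lambda>n. Kw * exp (- (pi / L)) ^ Suc n)"
  by (intro summable_mult) (rule sums_summable[OF geometric_exp_sums], simp)

lemma summable_abs: "L > 0 \<Longrightarrow> summable (\<lambda>n. \<bar>w n L\<bar>)"
  by (rule summable_comparison_test'[OF summable_geometric_Kw, where N = 0]) (auto simp: le_geometric simp del: power_Suc)

lemma summable_w: "L > 0 \<Longrightarrow> summable (\<lambda>n. w n L)"
  by (rule summable_rabs_cancel[OF summable_abs])

lemma suminf_abs_le: 
  assumes L: "L > 0"
  shows "(\<Sum>n. \<bar>w n L\<bar>) \<le> Kw * L"
proof -
  have "(\<Sum>n. \<bar>w n L\<bar>) \<le> (\<Sum>n. Kw * exp (- (pi / L)) ^ Suc n)"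
    by (intro suminf_le le_geometric summable_abs summable_geometric_Kw L)
  also have "\<dots> = Kw * (\<Sum>n. exp (- (pi / L)) ^ Suc n)"
    by (rule suminf_mult) (rule sums_summable[OF geometric_exp_sums], use L in simp)
  also have "\<dots> \<le> Kw * L" using Kw_nonneg geometric_exp_le[OF L] by (rule mult_left_mono[rotated])
  finally show ?thesis .
qed

lemma abs_suminf_le: 
  assumes L: "L > 0"
  shows "\<bar>\<Sum>n. w n L\<bar> \<le> Kw * L"
  using order_trans[OF summable_rabs[OF summable_abs[OF L]] suminf_abs_le[OF L]] .

definition mode_density where "mode_density L = (if L > 0 then (\<Sum>n. w n L) / L else 0)"

lemma mode_density_measurable [measurable]: "mode_density \<in> borel_measurable borel"
  unfolding mode_density_def[abs_def] using meas by measurable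

lemma mode_density_bound: "\<bar>mode_density L\<bar> \<le> Kw"
  using abs_suminf_le[of L] Kw_nonneg by (auto simp: mode_density_def abs_divide divide_le_eq)

lemma mode_density_isCont:
  assumes L: "L > 0" "L \<notin> D"
  shows "isCont mode_density L"
proof -
  \<comment> \<open>A summable majorant valid on the whole neighbourhood
    \<open>{0<..<2 * L}\<close>, as Tannery's theorem demands.\<close>
  define M where "M n = Kw * exp (- (pi / (2 * L))) ^ Suc n" for n
  have ev: "eventually (\<lambda>x. 0 < x \<and> x < 2 * L) (at L)"
    using L by (intro eventually_at_in_open'[of "{0<..<2 * L}", simplified]) auto
  have "eventually (\<lambda>(k, x). norm (w k x) \<le> M k) (at_top \<times>\<^sub>F at L)"
  proof -
    have "norm (w k x) \<le> M k" if x: "0 < x \<and> x < 2 * L" for k x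
    proof -
      have "exp (- (pi / x)) ^ Suc k \<le> exp (- (pi / (2 * L))) ^ Suc k"
        using x by (intro power_mono) (auto intro!: divide_left_mono mult_pos_pos)
      then have "Kw * exp (- (pi / x)) ^ Suc k \<le> M k" unfolding M_def by (intro mult_left_mono Kw_nonneg)
      then show ?thesis using le_geometric[of x k] x by simp
    qed
    then show ?thesis
      using eventually_prodI[OF eventually_True ev, of at_top]
      by (auto elim!: eventually_mono)
  qed
  moreover have "summable M" unfolding M_def by (rule summable_geometric_Kw) (use L in simp)
  moreover have "((\<lambda>x. w k x) \<longlongrightarrow> w k L) (at L)" for k using cont[OF L] by (simp add: isCont_def)
  ultimately have "((\<lambda>x. \<Sum>k. w k x) \<longlongrightarrow> (\<Sum>k. w k L)) (at L)"
    using tannerys_theorem[of w "\<lambda>k. w k L" "at L" M] by simp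
  then have "((\<lambda>x. (\<Sum>k. w k x) / x) \<longlongrightarrow> (\<Sum>k. w k L) / L) (at L)"
    using L by (intro tendsto_divide tendsto_ident_at) auto
  then have "(mode_density \<longlongrightarrow> (\<Sum>k. w k L) / L) (at L)"
    by (rule Lim_transform_eventually) (use ev in \<open>auto simp: mode_density_def elim!: eventually_mono\<close>)
  then show ?thesis using L by (simp add: isCont_def mode_density_def)
qed

text \<open>Factoring the gap length out of each mode sum turns the sum over gaps into a
  length-biased average.\<close>

lemma mode_average:
  assumes reg: "regular X r" and r: "r > 0"
  shows "(\<lambda>l. (\<Sum>J\<in>gaps X l. \<Sum>n. w n (gaplen J)) / real l) \<longlonglongrightarrow> (\<integral>L. mode_density L \<partial>gap_law r)"
proof -
  have "(\<Sum>J\<in>gaps X l. gaplen J * mode_density (gaplen J)) = (\<Sum>J\<in>gaps X l. \<Sum>n. w n (gaplen J))" for l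
  proof (intro sum.cong refl)
    fix J assume J: "J \<in> gaps X l"
    have "finite (X \<inter> \<Lambda> l)" using reg by (simp add: regular_def)
    from gaplen_pos[OF this J] show "gaplen J * mode_density (gaplen J) = (\<Sum>n. w n (gaplen J))" by (simp add: mode_density_def)
  qed
  then show ?thesis
    using gap_average[OF reg r mode_density_measurable mode_density_bound D mode_density_isCont] by simp
qed

end

section \<open>The weights in use: Bose factors, level counts, and one minus the overlap\<close>

lemma isCont_box_energy: "L > 0 \<Longrightarrow> isCont (\<lambda>L. box_energy L n) L"
  unfolding box_energy_def wave_def by (intro continuous_intros) auto

lemma box_energy_measurable [measurable]: "(\<lambda>L. box_energy L n) \<in> borel_measurable borel"
  unfolding box_energy_def wave_def by measurable

lemma exp_minus_one_ge: "exp (\<beta> * e) * (exp (\<beta> * \<eta>) - 1) \<le> exp (\<beta> * (e - - \<eta>)) - 1" if "\<beta> > 0" "e \<ge> 0" for \<beta> e \<eta> :: real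
proof -
  have "exp (\<beta> * e) \<ge> 1" using that by simp
  then show ?thesis by (simp add: exp_add distrib_left algebra_simps)
qed

lemma bose_weight:
  assumes \<beta>: "\<beta> > 0" and \<eta>: "\<eta> > 0"
  shows "mode_weight (\<lambda>n L. bose \<beta> (- \<eta>) (box_energy L n)) (1 / (exp (\<beta> * \<eta>) - 1)) \<beta> {}"
proof
  have e: "exp (\<beta> * \<eta>) - 1 > 0" using assms by simp
  then show "0 \<le> 1 / (exp (\<beta> * \<eta>) - 1)" by simp
  show "(\<lambda>L. bose \<beta> (- \<eta>) (box_energy L n)) \<in> borel_measurable borel" for n
    unfolding bose_def by measurable
  fix n and L :: real assume L: "L > 0"
  have E: "box_energy L n > 0" by (rule box_energy_pos[OF L])
  have p: "exp (\<beta> * (box_energy L n - - \<eta>)) - 1 > 0" using \<beta> \<eta> E by simp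
  show "\<bar>bose \<beta> (- \<eta>) (box_energy L n)\<bar> \<le> 1 / (exp (\<beta> * \<eta>) - 1) * exp (- \<beta> * box_energy L n)"
  proof -
    have "\<bar>bose \<beta> (- \<eta>) (box_energy L n)\<bar> = 1 / (exp (\<beta> * (box_energy L n - - \<eta>)) - 1)"
      using p by (simp add: bose_def)
    also have "\<dots> \<le> 1 / (exp (\<beta> * box_energy L n) * (exp (\<beta> * \<eta>) - 1))"
      using exp_minus_one_ge[OF \<beta> less_imp_le[OF E], of \<eta>] p e by (intro divide_left_mono mult_pos_pos) auto
    also have "\<dots> = 1 / (exp (\<beta> * \<eta>) - 1) * exp (- \<beta> * box_energy L n)"
      by (simp add: exp_minus field_simps)
    finally show ?thesis .
  qed
  have "exp (\<beta> * (box_energy L n - - \<eta>)) - 1 \<noteq> 0" using p by (rule less_imp_neq[symmetric])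
  then show "isCont (\<lambda>L. bose \<beta> (- \<eta>) (box_energy L n)) L"
    unfolding bose_def by (intro continuous_intros isCont_box_energy L)
qed (use assms in auto)

text \<open>The indicator of energies E up to \<open>e\<close> is at most
  \<open>exp (e - E)\<close>, whence the constants. It jumps only at lengths for which some level
  equals \<open>e\<close>, countably many.\<close>

lemma count_weight:
  "mode_weight (\<lambda>n L. if box_energy L n \<le> e then 1 else 0) (exp e) 1 {L. L > 0 \<and> (\<exists>n. box_energy L n = e)}"
proof
  show "(\<lambda>L. if box_energy L n \<le> e then 1 else 0) \<in> borel_measurable borel" for n by measurable
  have "{L. L > 0 \<and> (\<exists>n. box_energy L n = e)} \<subseteq> range (\<lambda>n. real (Suc n) * pi / sqrt (2 * e))"
  proof
    fix L assume "L \<in> {L. L > 0 \<and> (\<exists>n. box_energy L n = e)}"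
    then obtain n where L: "L > 0" "box_energy L n = e" by auto
    then have "2 * e = (wave L n)\<^sup>2" by (auto simp: box_energy_def)
    then have "sqrt (2 * e) = wave L n" using wave_pos[OF L(1), of n] by simp
    moreover from this have "sqrt (2 * e) \<noteq> 0" using wave_pos[OF L(1), of n] by linarith
    ultimately have "L = real (Suc n) * pi / sqrt (2 * e)" using L by (simp add: wave_def field_simps)
    then show "L \<in> range (\<lambda>n. real (Suc n) * pi / sqrt (2 * e))" by blast
  qed
  then show "countable {L. L > 0 \<and> (\<exists>n. box_energy L n = e)}" by (rule countable_subset) simp
  fix n and L :: real assume L: "L > 0"
  show "\<bar>if box_energy L n \<le> e then 1 else 0\<bar> \<le> exp e * exp (- 1 * box_energy L n)"
    by (auto simp: exp_add[symmetric])
  assume "L \<notin> {L. L > 0 \<and> (\<exists>n. box_energy L n = e)}"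
  then have ne: "box_energy L n \<noteq> e" using L by auto
  have tend: "((\<lambda>L. box_energy L n) \<longlongrightarrow> box_energy L n) (at L)" using isCont_box_energy[OF L] by (simp add: isCont_def)
  show "isCont (\<lambda>L. if box_energy L n \<le> e then 1 else 0 :: real) L"
  proof (cases "box_energy L n < e")
    case True
    have "eventually (\<lambda>x. box_energy x n < e) (at L)" using order_tendstoD(2)[OF tend True] .
    then have "eventually (\<lambda>x. (if box_energy x n \<le> e then 1 else 0 :: real) = 1) (at L)" by eventually_elim simp
    then show ?thesis using True unfolding isCont_def by (simp add: tendsto_eventually)
  next
    case False
    then have "e < box_energy L n" using ne by simp
    from order_tendstoD(1)[OF tend this] have "eventually (\<lambda>x. (if box_energy x n \<le> e then 1 else 0 :: real) = 0) (at L)"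
      by eventually_elim simp
    then show ?thesis using \<open>e < box_energy L n\<close> unfolding isCont_def by (simp add: tendsto_eventually)
  qed
qed auto

text \<open>With \<open>y = \<beta> * E / 2\<close> one has
  \<open>exp (\<beta> * E) - 1 = exp y * (exp y - exp (- y))\<close>, and the last factor is at
  least \<open>2 * y\<close>. The pole at 0 is removed and half of the exponential decay
  survives.\<close>

lemma bose_energy_le:
  assumes \<beta>: "\<beta> > 0" and E: "E > 0"
  shows "bose \<beta> 0 E * E \<le> exp (- (\<beta> / 2) * E) / \<beta>" "bose \<beta> 0 E * E \<le> 1 / \<beta>" "bose \<beta> 0 E > 0"
proof -
  define y where "y = \<beta> * E / 2"
  have y: "y > 0" using assms by (simp add: y_def)
  have "exp y - exp (- y) \<ge> 2 * y"
  proof -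
    have "(\<lambda>y. exp y - exp (- y) - 2 * y) 0 \<le> (\<lambda>y. exp y - exp (- y) - 2 * y) y"
    proof (rule DERIV_nonneg_imp_nondecreasing[OF less_imp_le[OF y]])
      fix z :: real
      have "((\<lambda>y. exp y - exp (- y) - 2 * y) has_real_derivative (exp z + exp (- z) - 2)) (at z)"
        by (auto intro!: derivative_eq_intros)
      moreover have "0 \<le> exp z + exp (- z) - 2"
        using exp_ge_add_one_self[of z] exp_ge_add_one_self[of "- z"] by linarith
      ultimately show "\<exists>d. ((\<lambda>y. exp y - exp (- y) - 2 * y) has_real_derivative d) (at z) \<and> 0 \<le> d" by blast
    qed
    then show ?thesis by simp
  qed
  then have "exp y * (2 * y) \<le> exp y * (exp y - exp (- y))" by simp
  also have "\<dots> = exp (\<beta> * E) - 1" by (simp add: right_diff_distrib exp_add[symmetric] y_def)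
  finally have 1: "exp y * (\<beta> * E) \<le> exp (\<beta> * E) - 1" by (simp add: y_def)
  have p: "exp y * (\<beta> * E) > 0" using assms by simp
  have "bose \<beta> 0 E * E = E / (exp (\<beta> * E) - 1)" by (simp add: bose_def)
  also have "\<dots> \<le> E / (exp y * (\<beta> * E))"
    by (intro divide_left_mono 1 less_imp_le[OF E] mult_pos_pos p less_le_trans[OF p 1])
  also have "\<dots> = exp (- (\<beta> / 2) * E) / \<beta>" using assms by (simp add: y_def exp_minus field_simps)
  finally show a: "bose \<beta> 0 E * E \<le> exp (- (\<beta> / 2) * E) / \<beta>" .
  have "exp (- (\<beta> / 2) * E) / \<beta> \<le> 1 / \<beta>" using assms by (intro divide_right_mono) auto
  with a show "bose \<beta> 0 E * E \<le> 1 / \<beta>" by simp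
  show "bose \<beta> 0 E > 0" using assms by (simp add: bose_def)
qed

text \<open>At potential 0 the Bose factor alone is of order \<open>1 / E\<close>, and its mode sums
  are not bounded per unit length; the factor \<open>1 - overlap\<close> restores a bound through
  \<open>bose_energy_le\<close>. The length \<open>t\<close> is where the formula for
  \<open>overlap\<close> switches.\<close>

lemma overlap_weight:
  assumes \<beta>: "\<beta> > 0" and t: "t \<ge> 0"
  shows "mode_weight (\<lambda>n L. bose \<beta> 0 (box_energy L n) * (1 - overlap t L n)) (t\<^sup>2 / \<beta>) (\<beta> / 2) {t}"
proof
  show "(\<lambda>L. bose \<beta> 0 (box_energy L n) * (1 - overlap t L n)) \<in> borel_measurable borel" for n
    unfolding bose_def overlap_def wave_def by measurable
  fix n and L :: real assume L: "L > 0"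
  have E: "box_energy L n > 0" by (rule box_energy_pos[OF L])
  note b = bose_energy_le[OF \<beta> E]
  note o = overlap_bounds[OF L t, of n]
  have "\<bar>bose \<beta> 0 (box_energy L n) * (1 - overlap t L n)\<bar> = bose \<beta> 0 (box_energy L n) * (1 - overlap t L n)"
    using b(3) o(1) by (intro abs_of_nonneg mult_nonneg_nonneg) auto
  also have "\<dots> \<le> bose \<beta> 0 (box_energy L n) * (t\<^sup>2 * box_energy L n)"
    using b(3) o(3) by (intro mult_left_mono) auto
  also have "\<dots> = t\<^sup>2 * (bose \<beta> 0 (box_energy L n) * box_energy L n)" by simp
  also have "\<dots> \<le> t\<^sup>2 * (exp (- (\<beta> / 2) * box_energy L n) / \<beta>)"
    using b(1) by (intro mult_left_mono) auto
  finally show "\<bar>bose \<beta> 0 (box_energy L n) * (1 - overlap t L n)\<bar> \<le> t\<^sup>2 / \<beta> * exp (- (\<beta> / 2) * box_energy L n)" by simp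
  assume "L \<notin> {t}"
  then have ne: "L \<noteq> t" by simp
  have w: "isCont (\<lambda>L. wave L n) L" unfolding wave_def using L by (intro continuous_intros) auto
  have "isCont (\<lambda>L. overlap t L n) L"
  proof (cases "t < L")
    case True
    have "isCont (\<lambda>L. ((L - t) * cos (wave L n * t) + sin (wave L n * t) / wave L n) / L) L"
      using L wave_pos[OF L, of n] by (intro continuous_intros w) auto
    moreover have "eventually (\<lambda>x. ((x - t) * cos (wave x n * t) + sin (wave x n * t) / wave x n) / x = overlap t x n) (nhds L)"
      using eventually_nhds_in_open[of "{t<..}" L] True by (auto simp: overlap_def elim!: eventually_mono)
    ultimately show ?thesis by (simp add: isCont_cong)
  next
    case False
    then have "L < t" using ne by simp
    then have "eventually (\<lambda>x. overlap t x n = 0) (nhds L)"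
      using eventually_nhds_in_open[of "{..<t}" L] by (auto simp: overlap_def elim!: eventually_mono)
    then show ?thesis by (simp add: isCont_cong)
  qed
  moreover have "isCont (\<lambda>L. bose \<beta> 0 (box_energy L n)) L"
    unfolding bose_def using E \<beta> by (intro continuous_intros isCont_box_energy L) auto
  ultimately show "isCont (\<lambda>L. bose \<beta> 0 (box_energy L n) * (1 - overlap t L n)) L"
    by (intro continuous_intros)
qed (use assms in auto)

lemma exp_weight:
  assumes "a > 0"
  shows "mode_weight (\<lambda>n L. exp (- a * box_energy L n)) 1 a {}"
  by standard (use assms in \<open>auto intro!: continuous_intros isCont_box_energy\<close>)

section \<open>The integrated density of states as an explicit measure, and the critical
  density\<close>

abbreviation count_w :: "real \<Rightarrow> nat \<Rightarrow> real \<Rightarrow> real" where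
  "count_w e \<equiv> (\<lambda>n L. if box_energy L n \<le> e then 1 else 0)"

abbreviation bose_w :: "real \<Rightarrow> real \<Rightarrow> nat \<Rightarrow> real \<Rightarrow> real" where
  "bose_w \<beta> \<eta> \<equiv> (\<lambda>n L. bose \<beta> (- \<eta>) (box_energy L n))"

definition law_ids :: "real \<Rightarrow> real \<Rightarrow> real" where
  "law_ids r e = (\<integral>L. mode_weight.mode_density (count_w e) L \<partial>gap_law r)"

lemma (in LS_box) card_eigenvalues:
  "real (card {i. E i \<le> e}) = (\<Sum>J\<in>gaps X l. \<Sum>n. count_w e n (gaplen J))"
proof -
  let ?A = "{i. E i \<le> e}"
  define c where "c = (\<Sum>J\<in>gaps X l. \<Sum>n. count_w e n (gaplen J))"
  have sm: "summable (\<lambda>n. count_w e n (gaplen J))" if "J \<in> gaps X l" for J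
    by (rule mode_weight.summable_w[OF count_weight gaplen_pos[OF fin that]])
  have c0: "c \<ge> 0" unfolding c_def using sm by (intro sum_nonneg suminf_nonneg) auto
  have "emeasure (count_space UNIV) ?A = (\<integral>\<^sup>+i. indicator ?A i \<partial>count_space UNIV)"
    by simp
  also have "\<dots> = (\<Sum>i. indicator {..e} (E i))"
    by (subst nn_integral_count_space_nat) (intro suminf_cong, simp add: indicator_def)
  also have "\<dots> = (\<Sum>J\<in>gaps X l. \<Sum>n. indicator {..e} (box_energy (gaplen J) n))"
    by (rule trace_eq)
  also have "\<dots> = (\<Sum>J\<in>gaps X l. \<Sum>n. ennreal (count_w e n (gaplen J)))"
    by (intro sum.cong refl suminf_cong) (simp add: indicator_def)
  also have "\<dots> = (\<Sum>J\<in>gaps X l. ennreal (\<Sum>n. count_w e n (gaplen J)))"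
    using sm by (intro sum.cong refl suminf_ennreal2) auto
  also have "\<dots> = ennreal c"
    unfolding c_def using sm by (intro sum_ennreal suminf_nonneg) auto
  finally have em: "emeasure (count_space UNIV) ?A = ennreal c" .
  then have f: "finite ?A" by (metis emeasure_count_space_infinite ennreal_neq_top infinity_ennreal_def subset_UNIV top.not_eq_extremum)
  then have "ennreal (real (card ?A)) = ennreal c" using em by (simp add: ennreal_of_nat_eq_real_of_nat)
  then show ?thesis using c0 unfolding c_def[symmetric] by simp
qed

text \<open>The definite description in \<open>ids\<close> demands uniqueness: two almost sure
  limits coincide because they agree at some sample of a probability space.\<close>

lemma ids_eq_law_ids:
  assumes M: "prob_space M" and r: "r > 0" and reg: "AE \<omega> in M. regular (X \<omega>) r"
    and box: "\<And>\<omega> l. \<omega> \<in> space M \<Longrightarrow> regular (X \<omega>) r \<Longrightarrow> l \<ge> 1 \<Longrightarrow> LS_box (X \<omega>) l (\<phi> \<omega> l) (E \<omega> l) (\<psi> l) (\<epsilon> l)"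
  shows "ids M E e = law_ids r e"
proof -
  interpret prob_space M by fact
  have lim: "AE \<omega> in M. (\<lambda>l. real (card {i. E \<omega> l i \<le> e}) / real l) \<longlonglongrightarrow> law_ids r e"
    using reg AE_space
  proof eventually_elim
    case (elim \<omega>)
    have "(\<lambda>l. (\<Sum>J\<in>gaps (X \<omega>) l. \<Sum>n. count_w e n (gaplen J)) / real l) \<longlonglongrightarrow> law_ids r e"
      unfolding law_ids_def by (rule mode_weight.mode_average[OF count_weight elim(1) r])
    moreover have "\<forall>\<^sub>F l in sequentially. (\<Sum>J\<in>gaps (X \<omega>) l. \<Sum>n. count_w e n (gaplen J)) / real l = real (card {i. E \<omega> l i \<le> e}) / real l"
      using eventually_ge_at_top[of 1]
    proof eventually_elim
      case (elim l)
      show ?case using LS_box.card_eigenvalues[OF box[OF \<open>\<omega> \<in> space M\<close> \<open>regular (X \<omega>) r\<close> elim]] by simp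
    qed
    ultimately show ?case by (rule Lim_transform_eventually)
  qed
  show ?thesis
    unfolding ids_def
  proof (rule the_equality)
    show "AE \<omega> in M. (\<lambda>l. real (card {i. E \<omega> l i \<le> e}) / real l) \<longlonglongrightarrow> law_ids r e" by (rule lim)
    fix n assume "AE \<omega> in M. (\<lambda>l. real (card {i. E \<omega> l i \<le> e}) / real l) \<longlonglongrightarrow> n"
    with lim have "AE \<omega> in M. n = law_ids r e"
      by eventually_elim (rule LIMSEQ_unique)
    then show "n = law_ids r e" by simp
  qed
qed

text \<open>The measure with distribution function \<open>law_ids r\<close>, built directly: draw a
  gap by the length-biased law, undo the bias with \<open>1 / L\<close>, and put unit mass at each
  of its levels. Integrals against it reduce to mode densities.\<close>

definition ids_measure :: "real \<Rightarrow> real measure" where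
  "ids_measure r = distr (density (gap_law r \<Otimes>\<^sub>M count_space UNIV) (\<lambda>(L, n). ennreal (if L > 0 then 1 / L else 0)))
     borel (\<lambda>(L, n). box_energy L n)"

lemma box_energy_measurable_pair [measurable]:
  "(\<lambda>(L, n). box_energy L n) \<in> borel_measurable (borel \<Otimes>\<^sub>M count_space UNIV)"
  unfolding box_energy_def wave_def by measurable

lemma sets_gap_law [measurable_cong]: "sets (gap_law r) = sets borel"
  by (simp add: gap_law_def)

lemma nn_integral_ids_measure:
  assumes [measurable]: "f \<in> borel_measurable borel"
  shows "(\<integral>\<^sup>+e. f e \<partial>ids_measure r) = 
    (\<integral>\<^sup>+L. (\<Sum>n. ennreal (if L > 0 then 1 / L else 0) * f (box_energy L n)) \<partial>gap_law r)"
proof -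
  interpret C: sigma_finite_measure "count_space (UNIV :: nat set)" by (rule sigma_finite_measure_count_space)
  let ?P = "gap_law r \<Otimes>\<^sub>M count_space (UNIV :: nat set)"
  have sP[measurable_cong]: "sets ?P = sets (borel \<Otimes>\<^sub>M count_space UNIV)"
    by (intro sets_pair_measure_cong sets_gap_law refl)
  have "(\<integral>\<^sup>+e. f e \<partial>ids_measure r) = (\<integral>\<^sup>+p. ennreal (if fst p > 0 then 1 / fst p else 0) * f (box_energy (fst p) (snd p)) \<partial>?P)"
    unfolding ids_measure_def case_prod_beta'
    by (subst nn_integral_distr, measurable, subst nn_integral_density, measurable)
  also have "\<dots> = (\<integral>\<^sup>+L. \<integral>\<^sup>+n. ennreal (if L > 0 then 1 / L else 0) * f (box_energy L n) \<partial>count_space UNIV \<partial>gap_law r)"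
    by (subst C.nn_integral_fst[symmetric]) (measurable, simp only: fst_conv snd_conv)
  finally show ?thesis by (simp add: nn_integral_count_space_nat)
qed

lemma nn_integral_ids_measure_weight:
  assumes r: "r > 0" and mw: "mode_weight w C a D" and [measurable]: "f \<in> borel_measurable borel"
    and f: "\<And>n L. L > 0 \<Longrightarrow> f (box_energy L n) = ennreal (w n L)" and w: "\<And>n L. L > 0 \<Longrightarrow> w n L \<ge> 0"
  shows "(\<integral>\<^sup>+e. f e \<partial>ids_measure r) = ennreal (\<integral>L. mode_weight.mode_density w L \<partial>gap_law r)"
proof -
  interpret mode_weight w C a D by fact
  interpret T: real_distribution "gap_law r" by (rule real_distribution_gap_law[OF r])
  have "(\<Sum>n. ennreal (if L > 0 then 1 / L else 0) * f (box_energy L n)) = ennreal (mode_density L)" for L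
  proof (cases "L > 0")
    case True
    have "(\<Sum>n. ennreal (1 / L) * f (box_energy L n)) = ennreal (1 / L) * (\<Sum>n. ennreal (w n L))"
      using True by (simp add: f)
    also have "\<dots> = ennreal (1 / L) * ennreal (\<Sum>n. w n L)"
      using True w summable_w by (subst suminf_ennreal2) auto
    also have "\<dots> = ennreal (mode_density L)"
      using True w summable_w by (subst ennreal_mult[symmetric]) (auto simp: mode_density_def intro!: suminf_nonneg)
    finally show ?thesis using True by simp
  qed (simp add: mode_density_def)
  then have "(\<integral>\<^sup>+e. f e \<partial>ids_measure r) = (\<integral>\<^sup>+L. ennreal (mode_density L) \<partial>gap_law r)"
    by (simp add: nn_integral_ids_measure)
  also have "\<dots> = ennreal (\<integral>L. mode_density L \<partial>gap_law r)"
  proof (rule nn_integral_eq_integral)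
    show "integrable (gap_law r) mode_density"
      by (rule T.integrable_const_bound[where B = Kw]) (use mode_density_bound in auto)
    show "AE L in gap_law r. 0 \<le> mode_density L"
      using w summable_w by (auto simp: mode_density_def intro!: AE_I2 divide_nonneg_pos suminf_nonneg)
  qed
  finally show ?thesis .
qed

lemma emeasure_ids_measure:
  assumes r: "r > 0"
  shows "emeasure (ids_measure r) {..e} = ennreal (law_ids r e)"
proof -
  have "emeasure (ids_measure r) {..e} = (\<integral>\<^sup>+x. indicator {..e} x \<partial>ids_measure r)"
    by (rule nn_integral_indicator[symmetric]) (simp add: ids_measure_def)
  also have "\<dots> = ennreal (law_ids r e)"
    unfolding law_ids_def by (rule nn_integral_ids_measure_weight[OF r count_weight]) auto
  finally show ?thesis .
qed

lemma law_ids_nonneg: "law_ids r e \<ge> 0"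
  unfolding law_ids_def using mode_weight.summable_w[OF count_weight]
  by (intro integral_nonneg_AE AE_I2) (auto simp: mode_weight.mode_density_def[OF count_weight] intro!: divide_nonneg_pos suminf_nonneg)

lemma law_ids_mono:
  assumes r: "r > 0" and "a \<le> b"
  shows "law_ids r a \<le> law_ids r b"
proof -
  have "emeasure (ids_measure r) {..a} \<le> emeasure (ids_measure r) {..b}"
    using assms by (intro emeasure_mono) (auto simp: ids_measure_def)
  then show ?thesis using law_ids_nonneg by (simp add: emeasure_ids_measure[OF r])
qed

text \<open>Continuity from above of \<open>ids_measure\<close>; \<open>interval_measure\<close>
  asks for a right-continuous function.\<close>

lemma law_ids_right_continuous:
  assumes r: "r > 0"
  shows "continuous (at_right e) (law_ids r)"
  unfolding continuous_within
proof (rule tendsto_at_right_sequentially[where b = "e + 1"])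
  fix S :: "nat \<Rightarrow> real"
  assume S: "\<And>n. e < S n" "\<And>n. S n < e + 1" "decseq S" "S \<longlonglongrightarrow> e"
  have "(\<lambda>n. emeasure (ids_measure r) {..S n}) \<longlonglongrightarrow> emeasure (ids_measure r) (\<Inter>n. {..S n})"
  proof (rule Lim_emeasure_decseq)
    show "decseq (\<lambda>n. {..S n})" using S(3) by (auto simp: decseq_def intro: order_trans)
  qed (auto simp: emeasure_ids_measure[OF r], simp add: ids_measure_def)
  moreover have "(\<Inter>n. {..S n}) = {..e}"
  proof (intro equalityI subsetI)
    fix x assume "x \<in> (\<Inter>n. {..S n})"
    then have "x \<le> S n" for n by auto
    then have "x \<le> e" using S(4) by (intro LIMSEQ_le_const) auto
    then show "x \<in> {..e}" by simp
  qed (use S(1) in \<open>auto intro: order_trans less_imp_le\<close>)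
  ultimately have "(\<lambda>n. ennreal (law_ids r (S n))) \<longlonglongrightarrow> ennreal (law_ids r e)"
    by (simp add: emeasure_ids_measure[OF r])
  then show "(\<lambda>n. law_ids r (S n)) \<longlonglongrightarrow> law_ids r e"
    by (rule tendsto_ennrealD) (auto simp: law_ids_nonneg)
qed simp

text \<open>Both measures give half-open intervals the increment of \<open>law_ids r\<close>, and
  these intervals are stable under intersection and generate the Borel sets.\<close>

lemma interval_measure_law_ids:
  assumes r: "r > 0"
  shows "interval_measure (law_ids r) = ids_measure r"
proof (rule measure_eqI_generator_eq[where \<Omega> = UNIV and E = "range (\<lambda>(a, b). {a<..b::real})" and A = "\<lambda>i. {- real i<..real i}"])
  show "Int_stable (range (\<lambda>(a, b). {a<..b::real}))"
  proof (rule Int_stableI)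
    fix A B assume "A \<in> range (\<lambda>(a, b). {a<..b::real})" "B \<in> range (\<lambda>(a, b). {a<..b::real})"
    then obtain a b c d where "A = {a<..b}" "B = {c<..d}" by auto
    then have "A \<inter> B = {max a c<..min b d}" by auto
    then show "A \<inter> B \<in> range (\<lambda>(a, b). {a<..b::real})" by auto
  qed
  have sb: "sets borel = sigma_sets UNIV (range (\<lambda>(a, b). {a<..b::real}))"
    by (subst borel_sigma_sets_Ioc) simp
  show "sets (interval_measure (law_ids r)) = sigma_sets UNIV (range (\<lambda>(a, b). {a<..b::real}))"
    "sets (ids_measure r) = sigma_sets UNIV (range (\<lambda>(a, b). {a<..b::real}))"
    using sb by (simp_all add: ids_measure_def)
  have Ioc: "emeasure (interval_measure (law_ids r)) {a<..b} = ennreal (law_ids r b - law_ids r a)" if "a \<le> b" for a b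
    using that by (intro emeasure_interval_measure_Ioc law_ids_mono[OF r] law_ids_right_continuous[OF r])
  show "emeasure (interval_measure (law_ids r)) A = emeasure (ids_measure r) A" if A: "A \<in> range (\<lambda>(a, b). {a<..b::real})" for A
  proof -
    obtain a b where A: "A = {a<..b}" using A by auto
    show ?thesis
    proof (cases "a \<le> b")
      case True
      have eq: "{a<..b} = {..b} - {..a}" by auto
      have "emeasure (ids_measure r) {a<..b} = emeasure (ids_measure r) {..b} - emeasure (ids_measure r) {..a}"
        unfolding eq
      proof (rule emeasure_Diff)
        show "emeasure (ids_measure r) {..a} \<noteq> \<infinity>" by (simp add: emeasure_ids_measure[OF r])
      qed (use True in \<open>auto simp: ids_measure_def\<close>)
      also have "\<dots> = ennreal (law_ids r b - law_ids r a)"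
        by (simp add: emeasure_ids_measure[OF r] ennreal_minus law_ids_nonneg)
      finally show ?thesis using Ioc[OF True] A by simp
    qed (simp add: A)
  qed
  show "range (\<lambda>i. {- real i<..real i}) \<subseteq> range (\<lambda>(a, b). {a<..b::real})" by auto
  show "(\<Union>i. {- real i<..real i}) = (UNIV :: real set)" by (rule UN_Ioc_eq_UNIV)
  show "emeasure (interval_measure (law_ids r)) {- real i<..real i} \<noteq> \<infinity>" for i
    by (subst Ioc) auto
qed auto

definition bose_density :: "real \<Rightarrow> real \<Rightarrow> real \<Rightarrow> real" where
  "bose_density \<beta> r \<eta> = (\<integral>L. mode_weight.mode_density (bose_w \<beta> \<eta>) L \<partial>gap_law r)"

text \<open>The integral increases with \<open>\<mu>\<close>, so the left limit at 0 exists and is a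
  supremum, which dominates the value at \<open>- \<eta>\<close>.\<close>

lemma bose_density_le_critical:
  assumes \<beta>: "\<beta> > 0" and r: "r > 0" and \<eta>: "\<eta> > 0"
  shows "ennreal (bose_density \<beta> r \<eta>) \<le> critical_density \<beta> (law_ids r)"
proof -
  define \<Phi> where "\<Phi> \<mu> = (\<integral>\<^sup>+e\<in>{0..}. ennreal (1 / (exp (\<beta> * (e - \<mu>)) - 1)) \<partial>interval_measure (law_ids r))" for \<mu>
  have mono: "\<Phi> \<mu> \<le> \<Phi> \<mu>'" if "\<mu> \<le> \<mu>'" "\<mu>' < 0" for \<mu> \<mu>'
    unfolding \<Phi>_def
  proof (intro nn_integral_mono)
    fix e :: real
    have "1 / (exp (\<beta> * (e - \<mu>)) - 1) \<le> 1 / (exp (\<beta> * (e - \<mu>')) - 1)" if e: "e \<ge> 0"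
    proof -
      have "0 < \<beta> * (e - \<mu>')" using \<beta> e \<open>\<mu>' < 0\<close> by simp
      moreover have "\<beta> * (e - \<mu>') \<le> \<beta> * (e - \<mu>)" using \<beta> \<open>\<mu> \<le> \<mu>'\<close> by simp
      ultimately show ?thesis by (intro divide_left_mono mult_pos_pos) auto
    qed
    then show "ennreal (1 / (exp (\<beta> * (e - \<mu>)) - 1)) * indicator {0..} e \<le> ennreal (1 / (exp (\<beta> * (e - \<mu>')) - 1)) * indicator {0..} e"
      by (auto simp: indicator_def intro!: ennreal_leI)
  qed
  define S where "S = (SUP \<mu>\<in>{..<0}. \<Phi> \<mu>)"
  have "(\<Phi> \<longlongrightarrow> S) (at_left 0)"
  proof (rule increasing_tendsto)
    show "\<forall>\<^sub>F \<mu> in at_left 0. \<Phi> \<mu> \<le> S"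
      by (rule eventually_at_leftI[of "-1"]) (auto simp: S_def intro!: SUP_upper)
    fix x assume "x < S"
    then obtain \<mu>0 where \<mu>0: "\<mu>0 < 0" "x < \<Phi> \<mu>0" by (auto simp: S_def less_SUP_iff)
    show "\<forall>\<^sub>F \<mu> in at_left 0. x < \<Phi> \<mu>"
      by (rule eventually_at_leftI[of \<mu>0]) (use \<mu>0 mono in \<open>auto intro: less_le_trans\<close>)
  qed
  then have "Lim (at_left 0) \<Phi> = S" by (intro tendsto_Lim) auto
  then have "\<Phi> (- \<eta>) \<le> critical_density \<beta> (law_ids r)"
    unfolding critical_density_def \<Phi>_def[symmetric] using \<eta> by (auto simp: S_def intro!: SUP_upper)
  moreover have "\<Phi> (- \<eta>) = ennreal (bose_density \<beta> r \<eta>)"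
    unfolding \<Phi>_def bose_density_def interval_measure_law_ids[OF r]
  proof (rule nn_integral_ids_measure_weight[OF r bose_weight[OF \<beta> \<eta>]])
    fix n and L :: real assume L: "L > 0"
    show "ennreal (1 / (exp (\<beta> * (box_energy L n - - \<eta>)) - 1)) * indicator {0..} (box_energy L n) = ennreal (bose \<beta> (- \<eta>) (box_energy L n))"
      using box_energy_pos[OF L, of n] by (simp add: bose_def)
    show "bose \<beta> (- \<eta>) (box_energy L n) \<ge> 0"
      using box_energy_pos[OF L, of n] \<beta> \<eta> by (simp add: bose_def)
  qed measurable
  ultimately show ?thesis by simp
qed

section \<open>Vanishing of the single occupations\<close>

lemma bose_mono:
  assumes "\<beta> > 0" "\<mu> \<le> \<mu>'" "\<mu>' < e"
  shows "bose \<beta> \<mu> e \<le> bose \<beta> \<mu>' e"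
proof -
  have "0 < \<beta> * (e - \<mu>')" "\<beta> * (e - \<mu>') \<le> \<beta> * (e - \<mu>)" using assms by simp_all
  then show ?thesis unfolding bose_def by (intro divide_left_mono mult_pos_pos) auto
qed

lemma bose_pos: "\<beta> > 0 \<Longrightarrow> \<mu> < e \<Longrightarrow> bose \<beta> \<mu> e > 0"
  by (simp add: bose_def)

text \<open>With \<open>A\<close> and \<open>B\<close> the exponentials for the two potentials, the
  difference of the Bose factors is \<open>1 / (B - 1)\<close> times
  \<open>(B / A - 1) / (1 - 1 / A)\<close>. The ratio \<open>B / A\<close> does not involve
  \<open>e\<close>, so away from zero energy the relative error is small uniformly in
  \<open>e\<close>.\<close>

lemma bose_compare:
  assumes \<beta>: "\<beta> > 0" and \<delta>: "\<delta> > 0" and e: "e \<ge> \<delta>" and \<mu>: "\<mu> \<le> \<delta> / 2" and \<mu>': "\<mu>' \<le> \<delta> / 2"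
  shows "\<bar>bose \<beta> \<mu> e - bose \<beta> \<mu>' e\<bar> \<le> bose \<beta> \<mu>' e * (\<bar>exp (\<beta> * (\<mu> - \<mu>')) - 1\<bar> / (1 - exp (- (\<beta> * \<delta> / 2))))"
proof -
  define A where "A = exp (\<beta> * (e - \<mu>))"
  define B where "B = exp (\<beta> * (e - \<mu>'))"
  define q where "q = exp (- (\<beta> * \<delta> / 2))"
  have q: "0 < q" "q < 1" using assms by (auto simp: q_def)
  have A: "A > 1" "B > 1" using assms by (auto simp: A_def B_def)
  have "\<beta> * (\<delta> / 2) \<le> \<beta> * (e - \<mu>)" using assms by (intro mult_left_mono) auto
  then have "1 / A \<le> q" by (simp add: A_def q_def exp_minus[symmetric] inverse_eq_divide[symmetric])
  then have Aq: "1 - q \<le> 1 - 1 / A" by simp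
  have BA: "exp (\<beta> * (\<mu> - \<mu>')) = B / A" by (simp add: A_def B_def exp_diff[symmetric] algebra_simps)
  have "bose \<beta> \<mu> e - bose \<beta> \<mu>' e = 1 / (A - 1) - 1 / (B - 1)" by (simp add: bose_def A_def B_def)
  also have "\<dots> = (B - A) / ((A - 1) * (B - 1))" using A by (simp add: field_simps)
  also have "\<dots> = (1 / (B - 1)) * ((B / A - 1) / (1 - 1 / A))" using A by (simp add: divide_simps)
  finally have "\<bar>bose \<beta> \<mu> e - bose \<beta> \<mu>' e\<bar> = (1 / (B - 1)) * (\<bar>B / A - 1\<bar> / (1 - 1 / A))"
    using A by (simp add: abs_mult)
  also have "\<dots> \<le> (1 / (B - 1)) * (\<bar>B / A - 1\<bar> / (1 - q))"
    using A q Aq by (intro mult_left_mono divide_left_mono mult_pos_pos) auto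
  finally show ?thesis by (simp add: bose_def BA q_def B_def)
qed

lemma bose_close:
  assumes \<beta>: "\<beta> > 0" and \<delta>: "\<delta> > 0" and \<kappa>: "\<kappa> > 0"
  obtains s where "s > 0" "s \<le> \<delta> / 2"
    "\<And>\<mu> \<mu>' e. \<bar>\<mu>\<bar> < s \<Longrightarrow> \<bar>\<mu>'\<bar> < s \<Longrightarrow> e \<ge> \<delta> \<Longrightarrow> \<bar>bose \<beta> \<mu> e - bose \<beta> \<mu>' e\<bar> \<le> \<kappa> * bose \<beta> \<mu>' e"
proof -
  define q where "q = 1 - exp (- (\<beta> * \<delta> / 2))"
  have q: "q > 0" using assms by (simp add: q_def)
  have "isCont (\<lambda>y::real. exp (\<beta> * y)) 0" by (intro continuous_intros)
  then obtain d where d: "d > 0" "\<And>y. \<bar>y\<bar> < d \<Longrightarrow> \<bar>exp (\<beta> * y) - 1\<bar> < \<kappa> * q"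
    unfolding continuous_at_eps_delta dist_real_def using mult_pos_pos[OF \<kappa> q] by force
  define s where "s = min (d / 2) (\<delta> / 2)"
  show ?thesis
  proof (rule that[of s])
    fix \<mu> \<mu>' e assume a: "\<bar>\<mu>\<bar> < s" "\<bar>\<mu>'\<bar> < s" "e \<ge> \<delta>"
    have "\<bar>\<mu> - \<mu>'\<bar> < d" using a abs_triangle_ineq4[of \<mu> \<mu>'] by (simp add: s_def)
    then have "\<bar>exp (\<beta> * (\<mu> - \<mu>')) - 1\<bar> \<le> \<kappa> * q" using d by (simp add: less_imp_le)
    then have "\<bar>exp (\<beta> * (\<mu> - \<mu>')) - 1\<bar> / q \<le> \<kappa>" using q by (simp add: divide_le_eq)
    moreover have "bose \<beta> \<mu>' e \<ge> 0" using a \<beta> \<delta> by (intro less_imp_le bose_pos) (auto simp: s_def)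
    ultimately have 1: "bose \<beta> \<mu>' e * (\<bar>exp (\<beta> * (\<mu> - \<mu>')) - 1\<bar> / q) \<le> bose \<beta> \<mu>' e * \<kappa>" by (intro mult_left_mono)
    have m: "\<mu> \<le> \<delta> / 2" "\<mu>' \<le> \<delta> / 2" using a by (auto simp: s_def)
    have 2: "\<bar>bose \<beta> \<mu> e - bose \<beta> \<mu>' e\<bar> \<le> bose \<beta> \<mu>' e * (\<bar>exp (\<beta> * (\<mu> - \<mu>')) - 1\<bar> / q)"
      unfolding q_def by (rule bose_compare[OF \<beta> \<delta> a(3) m])
    show "\<bar>bose \<beta> \<mu> e - bose \<beta> \<mu>' e\<bar> \<le> \<kappa> * bose \<beta> \<mu>' e"
      unfolding mult.commute[of \<kappa>] by (rule order_trans[OF 2 1])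
  qed (use d \<delta> in \<open>auto simp: s_def\<close>)
qed

lemma sum_ennreal_modes:
  fixes f :: "'a \<Rightarrow> nat \<Rightarrow> real"
  assumes "finite A" "\<And>J n. J \<in> A \<Longrightarrow> f J n \<ge> 0"
    and eq: "(\<Sum>J\<in>A. \<Sum>n. ennreal (f J n)) = ennreal c" and c: "c \<ge> 0"
  shows "J \<in> A \<Longrightarrow> summable (f J)" "(\<Sum>J\<in>A. \<Sum>n. f J n) = c"
proof -
  have sm: "summable (f J)" if J: "J \<in> A" for J
  proof (rule summable_suminf_not_top)
    have "(\<Sum>n. ennreal (f J n)) \<le> (\<Sum>J\<in>A. \<Sum>n. ennreal (f J n))"
      using J assms(1) by (intro member_le_sum) auto
    then show "(\<Sum>n. ennreal (f J n)) \<noteq> \<top>" unfolding eq by (auto simp: top_unique)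
  qed (use assms J in auto)
  then show "J \<in> A \<Longrightarrow> summable (f J)" .
  have "(\<Sum>J\<in>A. \<Sum>n. ennreal (f J n)) = (\<Sum>J\<in>A. ennreal (\<Sum>n. f J n))"
    using sm assms by (intro sum.cong refl suminf_ennreal2) auto
  also have "\<dots> = ennreal (\<Sum>J\<in>A. \<Sum>n. f J n)"
    using sm assms by (intro sum_ennreal suminf_nonneg) auto
  finally have "ennreal (\<Sum>J\<in>A. \<Sum>n. f J n) = ennreal c" using eq by simp
  moreover have "(\<Sum>J\<in>A. \<Sum>n. f J n) \<ge> 0" using sm assms by (intro sum_nonneg suminf_nonneg) auto
  ultimately show "(\<Sum>J\<in>A. \<Sum>n. f J n) = c" using c by simp
qed

lemma ennreal_sum_modes:
  fixes f :: "'a \<Rightarrow> nat \<Rightarrow> real"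
  assumes "\<And>J n. J \<in> A \<Longrightarrow> f J n \<ge> 0" "\<And>J. J \<in> A \<Longrightarrow> summable (f J)"
  shows "(\<Sum>J\<in>A. \<Sum>n. ennreal (f J n)) = ennreal (\<Sum>J\<in>A. \<Sum>n. f J n)"
proof -
  have "(\<Sum>J\<in>A. \<Sum>n. ennreal (f J n)) = (\<Sum>J\<in>A. ennreal (\<Sum>n. f J n))"
    using assms by (intro sum.cong refl suminf_ennreal2) auto
  also have "\<dots> = ennreal (\<Sum>J\<in>A. \<Sum>n. f J n)"
    using assms by (intro sum_ennreal suminf_nonneg) auto
  finally show ?thesis .
qed

text \<open>One regular sample with all its boxes. From here on the argument is deterministic;
  probability returns only in the final theorem.\<close>

locale LS_sequence =
  fixes X :: "real set" and r \<beta> \<rho> :: real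
    and \<phi> :: "nat \<Rightarrow> nat \<Rightarrow> real \<Rightarrow> complex" and E :: "nat \<Rightarrow> nat \<Rightarrow> real"
    and \<psi> :: "nat \<Rightarrow> nat \<Rightarrow> real \<Rightarrow> complex" and \<epsilon> :: "nat \<Rightarrow> nat \<Rightarrow> real" and \<mu> :: "nat \<Rightarrow> real"
  assumes reg: "regular X r" and r: "r > 0" and \<beta>: "\<beta> > 0" and \<rho>: "\<rho> > 0"
    and box: "\<And>l. l \<ge> 1 \<Longrightarrow> LS_box X l (\<phi> l) (E l) (\<psi> l) (\<epsilon> l)"
    and \<mu>_less: "\<And>l. l \<ge> 1 \<Longrightarrow> \<mu> l < E l 0"
    and \<mu>_sums: "\<And>l. l \<ge> 1 \<Longrightarrow> (\<lambda>i. bose \<beta> (\<mu> l) (E l i)) sums (real l * \<rho>)"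
begin

lemma fin: "finite (X \<inter> \<Lambda> l)" using reg by (simp add: regular_def)

abbreviation G where "G l \<equiv> gaps X l"
abbreviation e where "e J n \<equiv> box_energy (gaplen J) n"
abbreviation nb where "nb l J n \<equiv> bose \<beta> (\<mu> l) (e J n)"
abbreviation Wt where "Wt l \<equiv> LS_box.W l (\<psi> l)"

definition occ where "occ l k = mean_occupation \<beta> (\<Lambda> l) (\<phi> l) (E l) (\<mu> l) (\<psi> l k)"

lemma finG: "finite (G l)" by (rule finite_gaps[OF fin])

lemma len: "J \<in> G l \<Longrightarrow> gaplen J > 0" by (rule gaplen_pos[OF fin])

lemma e_pos: "J \<in> G l \<Longrightarrow> e J n > 0" using len by (intro box_energy_pos)

lemma \<mu>_less_e: "l \<ge> 1 \<Longrightarrow> J \<in> G l \<Longrightarrow> \<mu> l < e J n"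
  using \<mu>_less[of l] LS_box.box_energy_ge[OF box, of l J n] by simp

lemma nb_pos: "l \<ge> 1 \<Longrightarrow> J \<in> G l \<Longrightarrow> nb l J n > 0"
  by (intro bose_pos \<beta> \<mu>_less_e)

lemma nb_ennreal: 
  assumes "l \<ge> 1"
  shows "(\<Sum>J\<in>G l. \<Sum>n. ennreal (nb l J n)) = ennreal (real l * \<rho>)"
proof -
  interpret LS_box X l "\<phi> l" "E l" "\<psi> l" "\<epsilon> l" by (rule box[OF assms])
  have "E l 0 \<le> E l i" for i using eig by (simp add: eigensystem_def mono_def)
  then have "bose \<beta> (\<mu> l) (E l i) \<ge> 0" for i
    using \<mu>_less[OF assms] by (intro less_imp_le bose_pos \<beta>) (rule less_le_trans)
  then have "(\<Sum>i. ennreal (bose \<beta> (\<mu> l) (E l i))) = ennreal (real l * \<rho>)"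
    using \<mu>_sums[OF assms] by (simp add: sums_iff suminf_ennreal2)
  then show ?thesis using trace_eq[of "\<lambda>x. ennreal (bose \<beta> (\<mu> l) x)"] by simp
qed

lemma nb_summable: "l \<ge> 1 \<Longrightarrow> J \<in> G l \<Longrightarrow> summable (nb l J)"
  using sum_ennreal_modes(1)[OF finG _ nb_ennreal] nb_pos \<rho> by (simp add: less_imp_le)

lemma nb_sum: "l \<ge> 1 \<Longrightarrow> (\<Sum>J\<in>G l. \<Sum>n. nb l J n) = real l * \<rho>"
  using sum_ennreal_modes(2)[OF finG _ nb_ennreal] nb_pos \<rho> by (simp add: less_imp_le)

lemma occ_ennreal: "l \<ge> 1 \<Longrightarrow> ennreal (occ l k) = (\<Sum>J\<in>G l. \<Sum>n. ennreal (nb l J n * Wt l J n k))"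
  unfolding occ_def by (rule LS_box.occupation_eq(1)[OF box \<beta> \<mu>_less \<mu>_sums])

lemma occ_nonneg: "l \<ge> 1 \<Longrightarrow> occ l k \<ge> 0"
  unfolding occ_def by (rule LS_box.occupation_eq(2)[OF box \<beta> \<mu>_less \<mu>_sums])

lemma W_nonneg: "l \<ge> 1 \<Longrightarrow> Wt l J n k \<ge> 0" by (rule LS_box.W_nonneg[OF box])

lemma W_sums: "l \<ge> 1 \<Longrightarrow> J \<in> G l \<Longrightarrow> Wt l J n sums 1" by (rule LS_box.W_sums[OF box])

text \<open>For fixed \<open>k\<close> all weights are eventually at most
  \<open>4 * \<delta>\<close>, because no gap is longer than \<open>\<delta> * l\<close>, and the
  Bose factors add up to \<open>l * \<rho>\<close>. The argument holds below and above the critical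
  density alike.\<close>

theorem occupation_vanishes: "(\<lambda>l. occ l k / real l) \<longlonglongrightarrow> 0"
proof (rule LIMSEQ_I)
  fix s :: real assume s: "s > 0"
  define \<delta> where "\<delta> = s / (8 * \<rho>)"
  have \<delta>: "\<delta> > 0" using s \<rho> by (simp add: \<delta>_def)
  have "\<forall>\<^sub>F l in sequentially. norm (occ l k / real l - 0) < s"
    using eventually_gaplen_le[OF reg r \<delta>] eventually_ge_at_top[of 1]
  proof eventually_elim
    case (elim l)
    interpret LS_box X l "\<phi> l" "E l" "\<psi> l" "\<epsilon> l" by (rule box[OF elim(2)])
    have Wd: "Wt l J n k \<le> 4 * \<delta>" if J: "J \<in> G l" for J n
    proof -
      have "Wt l J n k \<le> 4 * gaplen J / real l" by (rule W_le[OF J])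
      also have "\<dots> \<le> 4 * (\<delta> * real l) / real l"
        using elim J by (intro divide_right_mono mult_left_mono) auto
      finally show ?thesis using elim by simp
    qed
    have "ennreal (occ l k) \<le> (\<Sum>J\<in>G l. \<Sum>n. ennreal (4 * \<delta>) * ennreal (nb l J n))"
      unfolding occ_ennreal[OF elim(2)]
    proof (intro sum_mono suminf_le summableI)
      fix J n assume J: "J \<in> G l"
      have "nb l J n * Wt l J n k \<le> 4 * \<delta> * nb l J n"
        using Wd[OF J, of n] nb_pos[OF elim(2) J, of n] by (simp add: mult.commute mult_left_mono)
      then show "ennreal (nb l J n * Wt l J n k) \<le> ennreal (4 * \<delta>) * ennreal (nb l J n)"
        using nb_pos[OF elim(2) J, of n] \<delta> by (subst ennreal_mult[symmetric]) (auto intro!: ennreal_leI)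
    qed
    also have "\<dots> = ennreal (4 * \<delta>) * ennreal (real l * \<rho>)"
      by (simp add: sum_distrib_left[symmetric] nb_ennreal[OF elim(2)])
    also have "\<dots> = ennreal (4 * \<delta> * (real l * \<rho>))"
      using \<delta> \<rho> by (simp add: ennreal_mult)
    finally have "occ l k \<le> 4 * \<delta> * (real l * \<rho>)" using \<delta> \<rho> by (subst (asm) ennreal_le_iff) auto
    also have "\<dots> = s / 2 * real l" using \<rho> by (simp add: \<delta>_def)
    finally have "occ l k / real l \<le> s / 2" using elim by (simp add: divide_le_eq)
    also have "s / 2 < s" using s by simp
    finally have "occ l k / real l < s" .
    moreover have "occ l k / real l \<ge> 0" using occ_nonneg[OF elim(2), of k] by simp
    ultimately show ?case by (simp only: real_norm_def diff_0_right abs_of_nonneg)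
  qed
  then show "\<exists>no. \<forall>l\<ge>no. norm (occ l k / real l - 0) < s" by (simp add: eventually_sequentially)
qed

text \<open>Kept in \<open>ennreal\<close> for the kinetic energies, an unbounded weight whose sum
  is not yet known to be finite.\<close>

lemma occ_weighted_ennreal:
  assumes l: "l \<ge> 1" and h: "\<And>k. h k \<ge> 0"
  shows "(\<Sum>k. ennreal (h k * occ l k)) = (\<Sum>J\<in>G l. \<Sum>n. ennreal (nb l J n) * (\<Sum>k. ennreal (h k * Wt l J n k)))"
proof -
  have "(\<Sum>k. ennreal (h k * occ l k)) = (\<Sum>k. \<Sum>J\<in>G l. \<Sum>n. ennreal (h k) * ennreal (nb l J n * Wt l J n k))"
    using h occ_nonneg[OF l] by (simp add: ennreal_mult occ_ennreal[OF l] sum_distrib_left)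
  also have "\<dots> = (\<Sum>J\<in>G l. \<Sum>n. \<Sum>k. ennreal (h k) * ennreal (nb l J n * Wt l J n k))"
    by (rule ennreal_suminf_sum_commute)
  also have "\<dots> = (\<Sum>J\<in>G l. \<Sum>n. \<Sum>k. ennreal (nb l J n) * ennreal (h k * Wt l J n k))"
  proof (intro sum.cong refl suminf_cong)
    fix J n k assume "J \<in> G l"
    then show "ennreal (h k) * ennreal (nb l J n * Wt l J n k) = ennreal (nb l J n) * ennreal (h k * Wt l J n k)"
      using h W_nonneg[OF l, of J n k] nb_pos[OF l, of J n] by (simp add: ennreal_mult ac_simps)
  qed
  finally show ?thesis by simp
qed

lemma W_weighted:
  assumes l: "l \<ge> 1" and J: "J \<in> G l" and h: "\<And>k. 0 \<le> h k" "\<And>k. h k \<le> B"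
  shows "summable (\<lambda>k. h k * Wt l J n k)" "0 \<le> (\<Sum>k. h k * Wt l J n k)" "(\<Sum>k. h k * Wt l J n k) \<le> B"
proof -
  have B: "(\<lambda>k. B * Wt l J n k) sums (B * 1)" by (intro sums_mult W_sums l J)
  have le: "h k * Wt l J n k \<le> B * Wt l J n k" for k using h W_nonneg[OF l] by (intro mult_right_mono)
  have nn: "0 \<le> h k * Wt l J n k" for k using h W_nonneg[OF l] by (intro mult_nonneg_nonneg)
  show sm: "summable (\<lambda>k. h k * Wt l J n k)"
    by (rule summable_comparison_test'[OF sums_summable[OF B], where N = 0]) (use le nn in auto)
  show "0 \<le> (\<Sum>k. h k * Wt l J n k)" by (intro suminf_nonneg sm nn)
  have "(\<Sum>k. h k * Wt l J n k) \<le> (\<Sum>k. B * Wt l J n k)" by (intro suminf_le le sm sums_summable[OF B])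
  then show "(\<Sum>k. h k * Wt l J n k) \<le> B" using B by (simp add: sums_iff)
qed

lemma occ_weighted:
  assumes l: "l \<ge> 1" and h: "\<And>k. 0 \<le> h k" "\<And>k. h k \<le> B"
  shows "(\<lambda>k. h k * occ l k) sums (\<Sum>J\<in>G l. \<Sum>n. nb l J n * (\<Sum>k. h k * Wt l J n k))"
    "\<And>J. J \<in> G l \<Longrightarrow> summable (\<lambda>n. nb l J n * (\<Sum>k. h k * Wt l J n k))"
proof -
  define v where "v J n = (\<Sum>k. h k * Wt l J n k)" for J n
  have v: "0 \<le> v J n" "v J n \<le> B" "summable (\<lambda>k. h k * Wt l J n k)" if "J \<in> G l" for J n
    unfolding v_def by (intro W_weighted[OF l that h])+
  have nn: "nb l J n * v J n \<ge> 0" if "J \<in> G l" for J n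
    using v[OF that] nb_pos[OF l that, of n] by simp
  have sm: "summable (\<lambda>n. nb l J n * v J n)" if J: "J \<in> G l" for J
  proof (rule summable_comparison_test'[OF summable_mult2[OF nb_summable[OF l J], of B], where N = 0])
    show "norm (nb l J n * v J n) \<le> nb l J n * B" for n
      using nn[OF J, of n] v[OF J, of n] nb_pos[OF l J, of n] by simp
  qed
  then show "summable (\<lambda>n. nb l J n * (\<Sum>k. h k * Wt l J n k))" if "J \<in> G l" for J
    using that by (simp add: v_def)
  define c where "c = (\<Sum>J\<in>G l. \<Sum>n. nb l J n * v J n)"
  have c: "c \<ge> 0" unfolding c_def using sm nn by (intro sum_nonneg suminf_nonneg) auto
  have "(\<Sum>k. ennreal (h k * occ l k)) = (\<Sum>J\<in>G l. \<Sum>n. ennreal (nb l J n * v J n))"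
    unfolding occ_weighted_ennreal[OF l h(1)]
  proof (intro sum.cong refl suminf_cong)
    fix J n assume J: "J \<in> G l"
    have "(\<Sum>k. ennreal (h k * Wt l J n k)) = ennreal (v J n)"
      unfolding v_def using h W_nonneg[OF l] by (intro suminf_ennreal2 v(3) J mult_nonneg_nonneg)
    then show "ennreal (nb l J n) * (\<Sum>k. ennreal (h k * Wt l J n k)) = ennreal (nb l J n * v J n)"
      using nb_pos[OF l J, of n] v[OF J, of n] by (simp add: ennreal_mult)
  qed
  also have "\<dots> = ennreal c" unfolding c_def using sm nn by (intro ennreal_sum_modes)
  finally have eq: "(\<Sum>k. ennreal (h k * occ l k)) = ennreal c" .
  have nnk: "0 \<le> h k * occ l k" for k using h occ_nonneg[OF l] by (intro mult_nonneg_nonneg)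
  have smk: "summable (\<lambda>k. h k * occ l k)"
    by (rule summable_suminf_not_top) (auto simp: nnk eq)
  then have "ennreal (\<Sum>k. h k * occ l k) = ennreal c"
    using eq nnk by (simp add: suminf_ennreal2)
  then have "(\<Sum>k. h k * occ l k) = c" using c smk nnk by (simp add: suminf_nonneg)
  then show "(\<lambda>k. h k * occ l k) sums (\<Sum>J\<in>G l. \<Sum>n. nb l J n * (\<Sum>k. h k * Wt l J n k))"
    using smk unfolding c_def v_def by (simp add: sums_iff)
qed

lemma occ_sums: "l \<ge> 1 \<Longrightarrow> occ l sums (real l * \<rho>)"
proof -
  assume l: "l \<ge> 1"
  have "(\<lambda>k. 1 * occ l k) sums (\<Sum>J\<in>G l. \<Sum>n. nb l J n * (\<Sum>k. 1 * Wt l J n k))"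
    by (rule occ_weighted(1)[OF l, where B = 1]) auto
  also have "(\<Sum>J\<in>G l. \<Sum>n. nb l J n * (\<Sum>k. 1 * Wt l J n k)) = (\<Sum>J\<in>G l. \<Sum>n. nb l J n)"
    using W_sums[OF l] by (intro sum.cong refl suminf_cong) (simp add: sums_iff)
  finally show ?thesis by (simp add: nb_sum[OF l])
qed

lemma modes_abs_le:
  fixes x y :: "real set \<Rightarrow> nat \<Rightarrow> real"
  assumes le: "\<And>J n. J \<in> A \<Longrightarrow> \<bar>x J n\<bar> \<le> y J n" and sm: "\<And>J. J \<in> A \<Longrightarrow> summable (y J)"
  shows "\<bar>\<Sum>J\<in>A. \<Sum>n. x J n\<bar> \<le> (\<Sum>J\<in>A. \<Sum>n. y J n)"
proof (rule order_trans[OF sum_abs sum_mono])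
  fix J assume J: "J \<in> A"
  have sx: "summable (\<lambda>n. \<bar>x J n\<bar>)"
    by (rule summable_comparison_test'[OF sm[OF J], where N = 0]) (use le[OF J] in auto)
  have "\<bar>\<Sum>n. x J n\<bar> \<le> (\<Sum>n. \<bar>x J n\<bar>)" by (rule summable_rabs[OF sx])
  also have "\<dots> \<le> (\<Sum>n. y J n)" by (intro suminf_le le J sx sm)
  finally show "\<bar>\<Sum>n. x J n\<bar> \<le> (\<Sum>n. y J n)" .
qed

text \<open>Such a gap reaches into the strip of width \<open>t\<close> at an end of the box, so it
  lies within \<open>t + M\<close> of that end.\<close>

lemma boundary_gaps:
  assumes l: "l \<ge> 1" and t: "t \<ge> 0" and M: "\<And>J. J \<in> G l \<Longrightarrow> gaplen J \<le> M"
  shows "(\<Sum>J | J \<in> G l \<and> \<not> (- real l / 2 \<le> Inf J - t \<and> Sup J + t \<le> real l / 2). gaplen J) \<le> 2 * (t + M)"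
proof -
  let ?B = "{J \<in> G l. \<not> (- real l / 2 \<le> Inf J - t \<and> Sup J + t \<le> real l / 2)}"
  obtain J0 where "J0 \<in> G l" using LS_box.gaps_nonempty[OF box[OF l]] by blast
  then have M0: "M \<ge> 0" using M[of J0] len[of J0 l] by simp
  let ?C = "{- real l / 2..- real l / 2 + (t + M)} \<union> {real l / 2 - (t + M)..real l / 2}"
  have "(\<Sum>J\<in>?B. gaplen J) = measure lborel (\<Union>?B)" by (rule sum_gaplen_subset[OF fin]) auto
  also have "\<dots> \<le> measure lborel ?C"
  proof (rule measure_mono_fmeasurable)
    show "\<Union>?B \<subseteq> ?C"
    proof
      fix x assume "x \<in> \<Union>?B"
      then obtain J where J: "J \<in> G l" "\<not> (- real l / 2 \<le> Inf J - t \<and> Sup J + t \<le> real l / 2)" "x \<in> J" by auto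
      note I = gap_interval[OF fin J(1)]
      have "Inf J < x \<and> x < Sup J" using J(3) I(1) by (metis greaterThanLessThan_iff)
      moreover have "Sup J - Inf J \<le> M" using M[OF J(1)] by (simp add: gaplen_def)
      ultimately show "x \<in> ?C" using J(2) I by auto
    qed
    show "\<Union>?B \<in> sets lborel" using finG gap_sets[OF fin] by (intro sets.finite_Union) auto
    show "?C \<in> fmeasurable lborel" by (intro fmeasurable.Un) (auto simp: fmeasurable_def emeasure_lborel_Icc_eq)
  qed
  also have "\<dots> \<le> measure lborel {- real l / 2..- real l / 2 + (t + M)} + measure lborel {real l / 2 - (t + M)..real l / 2}"
    by (rule measure_Un_le) auto
  also have "\<dots> = 2 * (t + M)" using M0 t by simp
  finally show ?thesis .
qed

end

section \<open>Limit of the occupation-weighted cosines\<close>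

text \<open>No level is at or below 0, so the integrated density of states vanishes at 0, and right
  continuity does the rest. It bounds the number of low modes in \<open>cos_limit\<close>.\<close>

lemma law_ids_at_0:
  assumes r: "r > 0" and s: "s > 0"
  obtains d where "d > 0" "\<And>\<delta>. 0 < \<delta> \<Longrightarrow> \<delta> < d \<Longrightarrow> law_ids r \<delta> < s"
proof -
  have "mode_weight.mode_density (count_w 0) L = 0" for L
    using box_energy_pos[of L] by (auto simp: mode_weight.mode_density_def[OF count_weight] not_le[symmetric])
  then have "law_ids r 0 = 0" by (simp add: law_ids_def)
  then have "(law_ids r \<longlongrightarrow> 0) (at_right 0)"
    using law_ids_right_continuous[OF r, of 0] by (simp add: continuous_within)
  from order_tendstoD(2)[OF this s] obtain d where "d > 0" "\<And>\<delta>. 0 < \<delta> \<Longrightarrow> \<delta> < d \<Longrightarrow> law_ids r \<delta> < s"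
    unfolding eventually_at_right_field by auto
  then show ?thesis by (rule that)
qed

text \<open>The critical density enters through what it bounds: the limiting densities at strictly
  negative potential \<open>- \<eta>\<close>.\<close>

locale condensed = LS_sequence +
  fixes \<rho>c :: real
  assumes crit: "\<And>\<eta>. \<eta> > 0 \<Longrightarrow> bose_density \<beta> r \<eta> \<le> \<rho>c" and \<rho>c: "\<rho>c < \<rho>"
begin

lemma eventually_bose_sum:
  assumes \<eta>: "\<eta> > 0" and s: "\<rho>c < s"
  shows "\<forall>\<^sub>F l in sequentially. (\<Sum>J\<in>G l. \<Sum>n. bose \<beta> (- \<eta>) (e J n)) / real l < s"
proof -
  have lim: "(\<lambda>l. (\<Sum>J\<in>G l. \<Sum>n. bose \<beta> (- \<eta>) (e J n)) / real l) \<longlonglongrightarrow> bose_density \<beta> r \<eta>"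
    unfolding bose_density_def by (rule mode_weight.mode_average[OF bose_weight[OF \<beta> \<eta>] reg r])
  show ?thesis by (rule order_tendstoD(2)[OF lim le_less_trans[OF crit[OF \<eta>] s]])
qed

lemma bose_summable: "\<eta> > 0 \<Longrightarrow> J \<in> G l \<Longrightarrow> summable (\<lambda>n. bose \<beta> (- \<eta>) (e J n))"
  by (rule mode_weight.summable_w[OF bose_weight[OF \<beta>] len])

text \<open>From above, \<open>\<mu> l\<close> stays below the ground level of any gap, and gaps
  longer than \<open>pi / sqrt \<eta>\<close> occur. From below, a potential of
  \<open>- \<eta>\<close> or less would leave room for fewer than \<open>\<rho>\<close> particles
  per unit length.\<close>

lemma eventually_\<mu>_small:
  assumes \<eta>: "\<eta> > 0"
  shows "\<forall>\<^sub>F l in sequentially. \<bar>\<mu> l\<bar> < \<eta>"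
proof -
  have "pi / sqrt \<eta> > 0" using \<eta> by simp
  note eventually_long_gap[OF reg this]
  moreover have "\<forall>\<^sub>F l in sequentially. (\<Sum>J\<in>G l. \<Sum>n. bose \<beta> (- \<eta>) (e J n)) / real l < \<rho>"
    by (rule eventually_bose_sum[OF \<eta> \<rho>c])
  ultimately show ?thesis using eventually_ge_at_top[of 1]
  proof eventually_elim
    case (elim l)
    then obtain J where J: "J \<in> G l" "gaplen J > pi / sqrt \<eta>" by blast
    have "wave (gaplen J) 0 < sqrt \<eta>" using J(2) len[OF J(1)] \<eta> by (simp add: wave_def field_simps)
    moreover have "wave (gaplen J) 0 > 0" by (rule wave_pos[OF len[OF J(1)]])
    ultimately have "(wave (gaplen J) 0)\<^sup>2 < (sqrt \<eta>)\<^sup>2" by (intro power_strict_mono) auto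
    then have "e J 0 < \<eta>" using \<eta> by (simp add: box_energy_def)
    then have up: "\<mu> l < \<eta>" using \<mu>_less_e[OF elim(3) J(1), of 0] by simp
    have "\<mu> l > - \<eta>"
    proof (rule ccontr)
      assume "\<not> \<mu> l > - \<eta>"
      then have le: "\<mu> l \<le> - \<eta>" by simp
      have "(\<Sum>J\<in>G l. \<Sum>n. nb l J n) \<le> (\<Sum>J\<in>G l. \<Sum>n. bose \<beta> (- \<eta>) (e J n))"
      proof (intro sum_mono suminf_le nb_summable elim bose_summable \<eta>)
        fix J n assume J: "J \<in> G l"
        show "nb l J n \<le> bose \<beta> (- \<eta>) (e J n)" using e_pos[OF J, of n] \<eta> by (intro bose_mono \<beta> le) simp
      qed
      then have "real l * \<rho> \<le> (\<Sum>J\<in>G l. \<Sum>n. bose \<beta> (- \<eta>) (e J n))" by (simp add: nb_sum[OF elim(3)])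
      then show False using elim by (simp add: divide_less_eq mult.commute)
    qed
    with up show ?case by simp
  qed
qed

lemma exp_energy_sum:
  assumes a: "a > 0"
  shows "J \<in> G l \<Longrightarrow> summable (\<lambda>n. exp (- a * e J n))" "J \<in> G l \<Longrightarrow> (\<Sum>n. exp (- a * e J n)) \<le> exp (1 / (2 * a)) * gaplen J"
proof -
  interpret mode_weight "\<lambda>n L. exp (- a * box_energy L n)" 1 a "{}" by (rule exp_weight[OF a])
  show "summable (\<lambda>n. exp (- a * e J n))" if "J \<in> G l" by (rule summable_w[OF len[OF that]])
  show "(\<Sum>n. exp (- a * e J n)) \<le> exp (1 / (2 * a)) * gaplen J" if "J \<in> G l"
    using abs_suminf_le[OF len[OF that]] by (simp add: Kw_def)
qed

text \<open>The kinetic energy of a mode is at most its level, by \<open>W_energy\<close>. Levels up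
  to 1 cost at most the particle number; higher ones are compared with the Bose factor at potential
  0, whose product with the energy decays exponentially.\<close>

lemma eventually_energy_bound:
  "\<exists>C. \<forall>\<^sub>F l in sequentially. (\<Sum>k. ennreal (\<epsilon> l k * occ l k)) \<le> ennreal (C * real l)"
proof -
  obtain s where s: "s > 0" "s \<le> 1 / 2"
    "\<And>\<mu> \<mu>' e. \<bar>\<mu>\<bar> < s \<Longrightarrow> \<bar>\<mu>'\<bar> < s \<Longrightarrow> e \<ge> 1 \<Longrightarrow> \<bar>bose \<beta> \<mu> e - bose \<beta> \<mu>' e\<bar> \<le> 1 * bose \<beta> \<mu>' e"
    using bose_close[OF \<beta> zero_less_one zero_less_one] by blast
  \<comment> \<open>The 2 comes from the comparison with potential 0, and
    \<open>exp (1 / \<beta>)\<close> from \<open>exp_box_energy_le\<close> with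
    \<open>a = \<beta> / 2\<close>.\<close>
  define C where "C = \<rho> + 2 / \<beta> * exp (1 / \<beta>)"
  have "\<forall>\<^sub>F l in sequentially. (\<Sum>k. ennreal (\<epsilon> l k * occ l k)) \<le> ennreal (C * real l)"
    using eventually_\<mu>_small[OF s(1)] eventually_ge_at_top[of 1]
  proof eventually_elim
    case (elim l)
    interpret LS_box X l "\<phi> l" "E l" "\<psi> l" "\<epsilon> l" by (rule box[OF elim(2)])
    have le: "nb l J n * e J n \<le> nb l J n + 2 / \<beta> * exp (- (\<beta> / 2) * e J n)" if J: "J \<in> G l" for J n
    proof (cases "e J n \<le> 1")
      case True
      have "nb l J n * e J n \<le> nb l J n * 1" using nb_pos[OF elim(2) J, of n] True by (intro mult_left_mono) auto
      moreover have "0 \<le> 2 / \<beta> * exp (- (\<beta> / 2) * e J n)" using \<beta> by simp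
      ultimately show ?thesis by simp
    next
      case False
      have "\<bar>nb l J n - bose \<beta> 0 (e J n)\<bar> \<le> 1 * bose \<beta> 0 (e J n)"
        using elim(1) s(1) False by (intro s(3)) auto
      then have "nb l J n \<le> 2 * bose \<beta> 0 (e J n)" by linarith
      then have "nb l J n * e J n \<le> 2 * bose \<beta> 0 (e J n) * e J n"
        using e_pos[OF J, of n] by (intro mult_right_mono) auto
      also have "\<dots> \<le> 2 / \<beta> * exp (- (\<beta> / 2) * e J n)"
        using bose_energy_le(1)[OF \<beta> e_pos[OF J, of n]] by simp
      finally show ?thesis using nb_pos[OF elim(2) J, of n] by simp
    qed
    have "(\<Sum>k. ennreal (\<epsilon> l k * occ l k)) = (\<Sum>J\<in>G l. \<Sum>n. ennreal (nb l J n) * (\<Sum>k. ennreal (\<epsilon> l k * Wt l J n k)))"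
      by (rule occ_weighted_ennreal[OF elim(2) \<epsilon>_nonneg])
    also have "\<dots> \<le> (\<Sum>J\<in>G l. \<Sum>n. ennreal (nb l J n + 2 / \<beta> * exp (- (\<beta> / 2) * e J n)))"
    proof (intro sum_mono suminf_le summableI)
      fix J n assume J: "J \<in> G l"
      have "(\<Sum>k. ennreal (\<epsilon> l k * Wt l J n k)) \<le> ennreal (e J n)"
      proof (rule suminf_le_const[OF summableI])
        fix K
        have "(\<Sum>k<K. ennreal (\<epsilon> l k * Wt l J n k)) = ennreal (\<Sum>k<K. \<epsilon> l k * Wt l J n k)"
          by (intro sum_ennreal mult_nonneg_nonneg \<epsilon>_nonneg W_nonneg)
        also have "\<dots> \<le> ennreal (e J n)" by (intro ennreal_leI W_energy[OF J])
        finally show "(\<Sum>k<K. ennreal (\<epsilon> l k * Wt l J n k)) \<le> ennreal (e J n)" .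
      qed
      then have "ennreal (nb l J n) * (\<Sum>k. ennreal (\<epsilon> l k * Wt l J n k)) \<le> ennreal (nb l J n) * ennreal (e J n)"
        by (rule mult_left_mono) simp
      also have "\<dots> = ennreal (nb l J n * e J n)"
        using nb_pos[OF elim(2) J, of n] e_pos[OF J, of n] by (simp add: ennreal_mult)
      also have "\<dots> \<le> ennreal (nb l J n + 2 / \<beta> * exp (- (\<beta> / 2) * e J n))" by (intro ennreal_leI le J)
      finally show "ennreal (nb l J n) * (\<Sum>k. ennreal (\<epsilon> l k * Wt l J n k)) \<le> ennreal (nb l J n + 2 / \<beta> * exp (- (\<beta> / 2) * e J n))" .
    qed
    also have "\<dots> = ennreal (\<Sum>J\<in>G l. \<Sum>n. nb l J n + 2 / \<beta> * exp (- (\<beta> / 2) * e J n))"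
    proof (rule ennreal_sum_modes)
      fix J assume J: "J \<in> G l"
      show "0 \<le> nb l J n + 2 / \<beta> * exp (- (\<beta> / 2) * e J n)" for n
        using nb_pos[OF elim(2) J, of n] \<beta> by simp
      show "summable (\<lambda>n. nb l J n + 2 / \<beta> * exp (- (\<beta> / 2) * e J n))"
        using \<beta> by (intro summable_add nb_summable elim(2) J summable_mult exp_energy_sum(1)[OF _ J]) simp
    qed
    also have "(\<Sum>J\<in>G l. \<Sum>n. nb l J n + 2 / \<beta> * exp (- (\<beta> / 2) * e J n)) \<le> (\<Sum>J\<in>G l. (\<Sum>n. nb l J n) + 2 / \<beta> * (exp (1 / \<beta>) * gaplen J))"
    proof (rule sum_mono)
      fix J assume J: "J \<in> G l"
      have b2: "\<beta> / 2 > 0" using \<beta> by simp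
      have "(\<Sum>n. nb l J n + 2 / \<beta> * exp (- (\<beta> / 2) * e J n)) = (\<Sum>n. nb l J n) + 2 / \<beta> * (\<Sum>n. exp (- (\<beta> / 2) * e J n))"
        by (subst suminf_add[symmetric]) (intro nb_summable elim(2) J summable_mult exp_energy_sum(1)[OF b2 J], intro nb_summable elim(2) J summable_mult exp_energy_sum(1)[OF b2 J],
            subst suminf_mult[OF exp_energy_sum(1)[OF b2 J]], rule refl)
      moreover have "2 / \<beta> * (\<Sum>n. exp (- (\<beta> / 2) * e J n)) \<le> 2 / \<beta> * (exp (1 / \<beta>) * gaplen J)"
        using exp_energy_sum(2)[OF b2 J] \<beta> by (intro mult_left_mono) auto
      ultimately show "(\<Sum>n. nb l J n + 2 / \<beta> * exp (- (\<beta> / 2) * e J n)) \<le> (\<Sum>n. nb l J n) + 2 / \<beta> * (exp (1 / \<beta>) * gaplen J)" by linarith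
    qed
    also have "\<dots> = (\<Sum>J\<in>G l. \<Sum>n. nb l J n) + 2 / \<beta> * exp (1 / \<beta>) * (\<Sum>J\<in>G l. gaplen J)"
      by (simp add: sum.distrib sum_distrib_left mult.assoc)
    also have "\<dots> = C * real l" using nb_sum[OF elim(2)] sum_gaplen[OF fin] by (simp add: C_def algebra_simps)
    finally show ?case by (simp add: ennreal_leI)
  qed
  then show ?thesis by blast
qed

text \<open>Above \<open>\<delta>\<close> the Bose factors at \<open>\<mu> l\<close> and at a fixed
  potential \<open>- \<eta>\<close> agree up to a factor \<open>1 + \<kappa>\<close>, so these
  levels hold hardly more than \<open>\<rho>c\<close> particles per unit length; the surplus must
  sit below.\<close>

lemma eventually_low_energy_mass:
  assumes \<delta>: "\<delta> > 0"
  shows "\<forall>\<^sub>F l in sequentially. (\<Sum>J\<in>G l. \<Sum>n. if e J n \<le> \<delta> then nb l J n else 0) \<ge> (\<rho> - \<rho>c) / 2 * real l"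
proof -
  \<comment> \<open>\<open>m\<close> and \<open>\<kappa>\<close> each give away a quarter of the
    surplus \<open>\<rho> - \<rho>c\<close>, which leaves the half that is claimed;
    \<open>\<bar>m\<bar> + 1\<close> keeps the denominator positive.\<close>
  define m where "m = \<rho>c + (\<rho> - \<rho>c) / 4"
  have m: "\<rho>c < m" using \<rho>c by (simp add: m_def)
  define \<kappa> where "\<kappa> = (\<rho> - \<rho>c) / (4 * (\<bar>m\<bar> + 1))"
  have \<kappa>: "\<kappa> > 0" using \<rho>c by (simp add: \<kappa>_def)
  have \<kappa>m: "\<kappa> * m \<le> (\<rho> - \<rho>c) / 4"
  proof -
    have "\<kappa> * m \<le> \<kappa> * (\<bar>m\<bar> + 1)" using \<kappa> by (intro mult_left_mono) auto
    also have "\<dots> = (\<rho> - \<rho>c) / 4"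
    proof -
      have "x / (4 * y) * y = x / 4" if "y \<noteq> 0" for x y :: real using that by simp
      moreover have "\<bar>m\<bar> + 1 \<noteq> 0" by linarith
      ultimately show ?thesis unfolding \<kappa>_def by blast
    qed
    finally show ?thesis .
  qed
  obtain s where s: "s > 0" "s \<le> \<delta> / 2"
    "\<And>\<mu> \<mu>' e. \<bar>\<mu>\<bar> < s \<Longrightarrow> \<bar>\<mu>'\<bar> < s \<Longrightarrow> e \<ge> \<delta> \<Longrightarrow> \<bar>bose \<beta> \<mu> e - bose \<beta> \<mu>' e\<bar> \<le> \<kappa> * bose \<beta> \<mu>' e"
    using bose_close[OF \<beta> \<delta> \<kappa>] by blast
  define \<eta> where "\<eta> = s / 2"
  have \<eta>: "\<eta> > 0" "\<bar>- \<eta>\<bar> < s" using s by (auto simp: \<eta>_def)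
  show ?thesis
    using eventually_\<mu>_small[OF s(1)] eventually_bose_sum[OF \<eta>(1) m] eventually_ge_at_top[of 1]
  proof eventually_elim
    case (elim l)
    let ?S = "\<Sum>J\<in>G l. \<Sum>n. bose \<beta> (- \<eta>) (e J n)"
    have bp: "bose \<beta> (- \<eta>) (e J n) > 0" if "J \<in> G l" for J n
      using e_pos[OF that, of n] \<eta> by (intro bose_pos \<beta>) simp
    have le: "nb l J n \<le> (if e J n \<le> \<delta> then nb l J n else 0) + (1 + \<kappa>) * bose \<beta> (- \<eta>) (e J n)" if J: "J \<in> G l" for J n
    proof (cases "e J n \<le> \<delta>")
      case True
      then show ?thesis using bp[OF J, of n] \<kappa> by simp
    next
      case False
      have "\<bar>nb l J n - bose \<beta> (- \<eta>) (e J n)\<bar> \<le> \<kappa> * bose \<beta> (- \<eta>) (e J n)"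
        using elim(1) \<eta> False by (intro s(3)) auto
      then show ?thesis using False by (simp add: distrib_right)
    qed
    have sm: "summable (\<lambda>n. if e J n \<le> \<delta> then nb l J n else 0)" if J: "J \<in> G l" for J
      by (rule summable_comparison_test'[OF nb_summable[OF elim(3) J], where N = 0])
         (use nb_pos[OF elim(3) J] in \<open>auto simp: less_imp_le\<close>)
    have sb: "summable (\<lambda>n. (1 + \<kappa>) * bose \<beta> (- \<eta>) (e J n))" if J: "J \<in> G l" for J
      by (rule summable_mult[OF bose_summable[OF \<eta>(1) J]])
    have "real l * \<rho> = (\<Sum>J\<in>G l. \<Sum>n. nb l J n)" by (rule nb_sum[OF elim(3), symmetric])
    also have "\<dots> \<le> (\<Sum>J\<in>G l. \<Sum>n. (if e J n \<le> \<delta> then nb l J n else 0) + (1 + \<kappa>) * bose \<beta> (- \<eta>) (e J n))"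
      by (intro sum_mono suminf_le le nb_summable elim summable_add sm sb)
    also have "\<dots> = (\<Sum>J\<in>G l. (\<Sum>n. if e J n \<le> \<delta> then nb l J n else 0) + (1 + \<kappa>) * (\<Sum>n. bose \<beta> (- \<eta>) (e J n)))"
    proof (intro sum.cong refl)
      fix J assume J: "J \<in> G l"
      show "(\<Sum>n. (if e J n \<le> \<delta> then nb l J n else 0) + (1 + \<kappa>) * bose \<beta> (- \<eta>) (e J n)) = 
          (\<Sum>n. if e J n \<le> \<delta> then nb l J n else 0) + (1 + \<kappa>) * (\<Sum>n. bose \<beta> (- \<eta>) (e J n))"
        unfolding suminf_add[OF sm[OF J] sb[OF J], symmetric] suminf_mult[OF bose_summable[OF \<eta>(1) J]] ..
    qed
    also have "\<dots> = (\<Sum>J\<in>G l. \<Sum>n. if e J n \<le> \<delta> then nb l J n else 0) + (1 + \<kappa>) * ?S"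
      by (simp only: sum.distrib sum_distrib_left)
    also have "(1 + \<kappa>) * ?S \<le> (1 + \<kappa>) * (m * real l)"
      using elim \<kappa> by (intro mult_left_mono) (auto simp: divide_less_eq)
    also have "\<dots> \<le> (\<rho>c + (\<rho> - \<rho>c) / 2) * real l"
    proof -
      have "(1 + \<kappa>) * m \<le> \<rho>c + (\<rho> - \<rho>c) / 2" 
      proof -
        have "(1 + \<kappa>) * m = m + \<kappa> * m" by (simp add: distrib_right)
        moreover have "m + (\<rho> - \<rho>c) / 4 = \<rho>c + (\<rho> - \<rho>c) / 2" by (simp add: m_def field_simps)
        ultimately show ?thesis using \<kappa>m by linarith
      qed
      then show ?thesis unfolding mult.assoc[symmetric] by (rule mult_right_mono) simp
    qed
    finally show ?case by (simp add: field_simps)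
  qed
qed

definition cosdef where "cosdef t l k = 1 - cos (t * sqrt (2 * \<epsilon> l k))"

text \<open>A function of \<open>r\<close>, \<open>\<beta>\<close> and \<open>t\<close> alone:
  neither the sample nor the potentials enter, which makes the limit measure deterministic.\<close>

definition limD where "limD t = (\<integral>L. mode_weight.mode_density (\<lambda>n L. bose \<beta> 0 (box_energy L n) * (1 - overlap t L n)) L \<partial>gap_law r)"

text \<open>The low modes contribute little because \<open>1 - cos\<close> is at most \<open>t\<^sup>2\<close> times the energy; the high modes
  are treated with \<open>\<mu> l \<longlonglongrightarrow> 0\<close>, and gaps near the boundary are negligible.\<close>

lemma cos_limit:
  assumes t: "t \<ge> 0"
  shows "(\<lambda>l. (\<Sum>k. cosdef t l k * occ l k) / real l) \<longlonglongrightarrow> limD t"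
proof -
  interpret ow: mode_weight "\<lambda>n L. bose \<beta> 0 (box_energy L n) * (1 - overlap t L n)" "t\<^sup>2 / \<beta>" "\<beta> / 2" "{t}"
    by (rule overlap_weight[OF \<beta> t])
  define w where "w J n = bose \<beta> 0 (e J n) * (1 - overlap t (gaplen J) n)" for J n
  define B where "B l = (\<Sum>J\<in>G l. \<Sum>n. w J n)" for l
  define A where "A l = (\<Sum>k. cosdef t l k * occ l k)" for l
  have Blim: "(\<lambda>l. B l / real l) \<longlonglongrightarrow> limD t"
    unfolding B_def w_def limD_def by (rule ow.mode_average[OF reg r])
  define K where "K = exp (1 / \<beta>)"
  have K: "K > 0" by (simp add: K_def)
  have t2: "t\<^sup>2 / \<beta> \<ge> 0" using \<beta> by simp
  \<comment> \<open>The summands are the occupation of low modes, the limiting weight of low modes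
    bounded by their number, and the error on high modes. In \<open>5 * \<delta>\<close>, one
    \<open>\<delta>\<close> is the relative error of the Bose factors and four come from the gaps
    near the boundary.\<close>
  have main: "\<forall>\<^sub>F l in sequentially. \<bar>A l - B l\<bar> \<le> (t\<^sup>2 * \<delta> * \<rho> + t\<^sup>2 / \<beta> * (law_ids r \<delta> + \<delta>) + t\<^sup>2 / \<beta> * K * (5 * \<delta>)) * real l"
    if \<delta>: "\<delta> > 0" for \<delta>
  proof -
    obtain s where s: "s > 0" "s \<le> \<delta> / 2"
      "\<And>\<mu> \<mu>' e. \<bar>\<mu>\<bar> < s \<Longrightarrow> \<bar>\<mu>'\<bar> < s \<Longrightarrow> e \<ge> \<delta> \<Longrightarrow> \<bar>bose \<beta> \<mu> e - bose \<beta> \<mu>' e\<bar> \<le> \<delta> * bose \<beta> \<mu>' e"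
      using bose_close[OF \<beta> \<delta> \<delta>] by blast
    have "(\<lambda>l. (\<Sum>J\<in>G l. \<Sum>n. count_w \<delta> n (gaplen J)) / real l) \<longlonglongrightarrow> law_ids r \<delta>"
      unfolding law_ids_def by (rule mode_weight.mode_average[OF count_weight reg r])
    then have cnt: "\<forall>\<^sub>F l in sequentially. (\<Sum>J\<in>G l. \<Sum>n. count_w \<delta> n (gaplen J)) / real l < law_ids r \<delta> + \<delta>"
      using \<delta> by (intro order_tendstoD) auto
    have tl: "\<forall>\<^sub>F l in sequentially. t \<le> \<delta> * real l"
    proof (rule eventually_sequentiallyI[of "nat \<lceil>t / \<delta>\<rceil>"])
      fix l assume "nat \<lceil>t / \<delta>\<rceil> \<le> l"
      then have "t / \<delta> \<le> real l" by linarith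
      then show "t \<le> \<delta> * real l" using \<delta> by (simp add: divide_le_eq mult.commute)
    qed
    show ?thesis
      using eventually_\<mu>_small[OF s(1)] cnt eventually_gaplen_le[OF reg r \<delta>] tl eventually_ge_at_top[of 1]
    proof eventually_elim
      case (elim l)
      interpret LS_box X l "\<phi> l" "E l" "\<psi> l" "\<epsilon> l" by (rule box[OF elim(5)])
      let ?h = "cosdef t l"
      have h: "0 \<le> ?h k" "?h k \<le> 2" "?h k \<le> t\<^sup>2 * \<epsilon> l k" for k
      proof -
        have "?h k \<le> (t * sqrt (2 * \<epsilon> l k))\<^sup>2 / 2" unfolding cosdef_def by (rule one_minus_cos_le)
        also have "\<dots> = t\<^sup>2 * \<epsilon> l k" using \<epsilon>_nonneg[of k] by (simp add: power_mult_distrib)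
        finally show "?h k \<le> t\<^sup>2 * \<epsilon> l k" .
        show "0 \<le> ?h k" "?h k \<le> 2"
          using cos_le_one[of "t * sqrt (2 * \<epsilon> l k)"] cos_ge_minus_one[of "t * sqrt (2 * \<epsilon> l k)"] unfolding cosdef_def by linarith+
      qed
      define v where "v J n = (\<Sum>k. ?h k * Wt l J n k)" for J n
      have v0: "0 \<le> v J n" "summable (\<lambda>k. ?h k * Wt l J n k)" if "J \<in> G l" for J n
        unfolding v_def using W_weighted[OF elim(5) that, where h = "cosdef t l" and B = 2] h by blast+
      have v1: "v J n \<le> t\<^sup>2 * e J n" if J: "J \<in> G l" for J n
      proof -
        have "(\<Sum>k<m. ?h k * Wt l J n k) \<le> t\<^sup>2 * e J n" for m
        proof -
          have "(\<Sum>k<m. ?h k * Wt l J n k) \<le> (\<Sum>k<m. t\<^sup>2 * (\<epsilon> l k * Wt l J n k))"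
            unfolding mult.assoc[symmetric] by (intro sum_mono mult_right_mono h(3) W_nonneg)
          also have "\<dots> = t\<^sup>2 * (\<Sum>k<m. \<epsilon> l k * Wt l J n k)" by (simp add: sum_distrib_left)
          also have "\<dots> \<le> t\<^sup>2 * e J n" by (intro mult_left_mono W_energy[OF J]) simp
          finally show ?thesis .
        qed
        then show ?thesis unfolding v_def by (intro suminf_le_const v0(2) J)
      qed
      \<comment> \<open>Gaps at distance at least \<open>t\<close> from both ends of the box, where
        \<open>W_cos\<close> applies; \<open>i\<close> marks the remaining ones.\<close>
      let ?Int = "\<lambda>J. - real l / 2 \<le> Inf J - t \<and> Sup J + t \<le> real l / 2"
      have v2: "v J n = 1 - overlap t (gaplen J) n" if J: "J \<in> G l" "?Int J" for J n
      proof -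
        have "(\<lambda>k. Wt l J n k - cos (t * sqrt (2 * \<epsilon> l k)) * Wt l J n k) sums (1 - overlap t (gaplen J) n)"
          using J t by (intro sums_diff W_sums W_cos) auto
        then show ?thesis unfolding v_def cosdef_def by (simp add: sums_iff left_diff_distrib)
      qed
      define i where "i J = (if ?Int J then 0 else 1 :: real)" for J
      define y where "y J n = t\<^sup>2 * \<delta> * nb l J n + t\<^sup>2 / \<beta> * count_w \<delta> n (gaplen J) + t\<^sup>2 / \<beta> * (\<delta> + i J) * exp (- (\<beta> / 2) * e J n)" for J n
      have le: "\<bar>nb l J n * v J n - w J n\<bar> \<le> y J n" if J: "J \<in> G l" for J n
      proof -
        have nbp: "nb l J n > 0" by (rule nb_pos[OF elim(5) J])
        have ep: "e J n > 0" by (rule e_pos[OF J])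
        note b = bose_energy_le[OF \<beta> ep]
        note o = overlap_bounds[OF len[OF J] t, of n]
        have w0: "0 \<le> w J n" using b(3) o(1) by (simp add: w_def)
        have w1: "w J n \<le> t\<^sup>2 * (bose \<beta> 0 (e J n) * e J n)"
        proof -
          have "w J n \<le> bose \<beta> 0 (e J n) * (t\<^sup>2 * e J n)" unfolding w_def using b(3) o(3) by (intro mult_left_mono) auto
          then show ?thesis by (simp add: ac_simps)
        qed
        have i0: "0 \<le> i J" by (simp add: i_def)
        have ex: "0 \<le> t\<^sup>2 / \<beta> * (\<delta> + i J) * exp (- (\<beta> / 2) * e J n)"
          using t2 i0 \<delta> by (intro mult_nonneg_nonneg) auto
        show ?thesis
        \<comment> \<open>On low modes the Bose factors at \<open>\<mu> l\<close> and at 0 are not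
          comparable, so both terms are estimated separately, one by the occupation times
          \<open>t\<^sup>2 * \<delta>\<close>, the other by \<open>t\<^sup>2 / \<beta>\<close> per
          mode. On high modes the potential is first replaced by 0, then \<open>v\<close> by
          \<open>1 - overlap\<close>.\<close>
        proof (cases "e J n \<le> \<delta>")
          case True
          have "nb l J n * v J n \<le> nb l J n * (t\<^sup>2 * \<delta>)"
          proof (rule mult_left_mono)
            have "t\<^sup>2 * e J n \<le> t\<^sup>2 * \<delta>" using True by (intro mult_left_mono) auto
            then show "v J n \<le> t\<^sup>2 * \<delta>" using v1[OF J, of n] by linarith
          qed (use nbp in simp)
          moreover have "w J n \<le> t\<^sup>2 * (1 / \<beta>)"
            using w1 mult_left_mono[OF b(2), of "t\<^sup>2"] by simp
          moreover have "0 \<le> nb l J n * v J n" using nbp v0(1)[OF J, of n] by simp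
          ultimately have "\<bar>nb l J n * v J n - w J n\<bar> \<le> nb l J n * (t\<^sup>2 * \<delta>) + t\<^sup>2 * (1 / \<beta>)" using w0 by linarith
          then show ?thesis unfolding y_def using True ex by (simp add: ac_simps)
        next
          case False
          let ?x = "t\<^sup>2 / \<beta> * exp (- (\<beta> / 2) * e J n)"
          have bx: "bose \<beta> 0 (e J n) * (t\<^sup>2 * e J n) \<le> ?x"
            using mult_left_mono[OF b(1), of "t\<^sup>2"] by (simp add: ac_simps)
          have "\<bar>nb l J n - bose \<beta> 0 (e J n)\<bar> \<le> \<delta> * bose \<beta> 0 (e J n)"
            using elim(1) s(1) False by (intro s(3)) auto
          then have "\<bar>nb l J n - bose \<beta> 0 (e J n)\<bar> * v J n \<le> (\<delta> * bose \<beta> 0 (e J n)) * (t\<^sup>2 * e J n)"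
            using v0(1)[OF J] v1[OF J] b(3) \<delta> by (intro mult_mono) auto
          also have "\<dots> \<le> \<delta> * ?x" using mult_left_mono[OF bx, of \<delta>] \<delta> by (simp add: ac_simps)
          finally have 1: "\<bar>nb l J n * v J n - bose \<beta> 0 (e J n) * v J n\<bar> \<le> \<delta> * ?x"
            using v0(1)[OF J, of n] by (simp add: left_diff_distrib[symmetric] abs_mult)
          have 2: "\<bar>bose \<beta> 0 (e J n) * v J n - w J n\<bar> \<le> i J * ?x"
          proof (cases "?Int J")
            case True
            then show ?thesis using v2[OF J True, of n] by (simp add: w_def i_def)
          next
            case False
            have "0 \<le> bose \<beta> 0 (e J n) * v J n" using b(3) v0(1)[OF J] by simp
            moreover have "bose \<beta> 0 (e J n) * v J n \<le> ?x"
              using mult_left_mono[OF v1[OF J, of n], of "bose \<beta> 0 (e J n)"] b(3) bx by linarith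
            moreover have "w J n \<le> ?x" using w1 bx by (simp add: ac_simps)
            ultimately have "\<bar>bose \<beta> 0 (e J n) * v J n - w J n\<bar> \<le> ?x" using w0 by linarith
            moreover have "i J = 1" using False by (simp add: i_def)
            ultimately show ?thesis by simp
          qed
          have "\<bar>nb l J n * v J n - w J n\<bar> \<le> (\<delta> + i J) * ?x"
            using 1 2 unfolding distrib_right by linarith
          moreover have "0 \<le> t\<^sup>2 * \<delta> * nb l J n" using \<delta> nbp by simp
          ultimately show ?thesis unfolding y_def using False by (simp add: ac_simps)
        qed
      qed
      have b2: "\<beta> / 2 > 0" using \<beta> by simp
      have sc: "summable (\<lambda>n. count_w \<delta> n (gaplen J))" if "J \<in> G l" for J
        by (rule mode_weight.summable_w[OF count_weight len[OF that]])
      have sy: "summable (y J)" if J: "J \<in> G l" for J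
        unfolding y_def by (intro summable_add summable_mult nb_summable[OF elim(5) J] sc[OF J] exp_energy_sum(1)[OF b2 J])
      have sv: "summable (\<lambda>n. nb l J n * v J n)" if "J \<in> G l" for J
        unfolding v_def by (rule occ_weighted(2)[OF elim(5) h(1,2) that])
      have sw: "summable (w J)" if "J \<in> G l" for J
        unfolding w_def by (rule ow.summable_w[OF len[OF that]])
      have "A l = (\<Sum>J\<in>G l. \<Sum>n. nb l J n * v J n)"
        unfolding A_def v_def using occ_weighted(1)[OF elim(5) h(1,2)] by (simp add: sums_iff)
      then have "A l - B l = (\<Sum>J\<in>G l. \<Sum>n. nb l J n * v J n - w J n)"
        unfolding B_def by (simp only: sum_subtractf[symmetric]) (intro sum.cong refl suminf_diff sv sw)
      then have "\<bar>A l - B l\<bar> \<le> (\<Sum>J\<in>G l. \<Sum>n. y J n)"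
        using modes_abs_le[OF le sy] by simp
      also have "\<dots> = (\<Sum>J\<in>G l. t\<^sup>2 * \<delta> * (\<Sum>n. nb l J n) + t\<^sup>2 / \<beta> * (\<Sum>n. count_w \<delta> n (gaplen J)) + t\<^sup>2 / \<beta> * (\<delta> + i J) * (\<Sum>n. exp (- (\<beta> / 2) * e J n)))"
      proof (intro sum.cong refl)
        fix J assume J: "J \<in> G l"
        have "y J sums (t\<^sup>2 * \<delta> * (\<Sum>n. nb l J n) + t\<^sup>2 / \<beta> * (\<Sum>n. count_w \<delta> n (gaplen J)) + t\<^sup>2 / \<beta> * (\<delta> + i J) * (\<Sum>n. exp (- (\<beta> / 2) * e J n)))"
          unfolding y_def by (intro sums_add sums_mult summable_sums nb_summable[OF elim(5) J] sc[OF J] exp_energy_sum(1)[OF b2 J])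
        then show "(\<Sum>n. y J n) = t\<^sup>2 * \<delta> * (\<Sum>n. nb l J n) + t\<^sup>2 / \<beta> * (\<Sum>n. count_w \<delta> n (gaplen J)) + t\<^sup>2 / \<beta> * (\<delta> + i J) * (\<Sum>n. exp (- (\<beta> / 2) * e J n))"
          by (simp add: sums_iff)
      qed
      also have "\<dots> \<le> (\<Sum>J\<in>G l. t\<^sup>2 * \<delta> * (\<Sum>n. nb l J n) + t\<^sup>2 / \<beta> * (\<Sum>n. count_w \<delta> n (gaplen J)) + t\<^sup>2 / \<beta> * (\<delta> + i J) * (K * gaplen J))"
      proof (intro sum_mono add_left_mono mult_left_mono)
        fix J assume J: "J \<in> G l"
        show "(\<Sum>n. exp (- (\<beta> / 2) * e J n)) \<le> K * gaplen J"
          using exp_energy_sum(2)[OF b2 J] by (simp add: K_def)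
        show "0 \<le> t\<^sup>2 / \<beta> * (\<delta> + i J)" using t2 \<delta> by (intro mult_nonneg_nonneg) (auto simp: i_def)
      qed
      also have "\<dots> = t\<^sup>2 * \<delta> * (\<Sum>J\<in>G l. \<Sum>n. nb l J n) + t\<^sup>2 / \<beta> * (\<Sum>J\<in>G l. \<Sum>n. count_w \<delta> n (gaplen J)) + t\<^sup>2 / \<beta> * K * (\<Sum>J\<in>G l. (\<delta> + i J) * gaplen J)"
        by (simp only: sum.distrib sum_distrib_left ac_simps)
      also have "(\<Sum>J\<in>G l. (\<delta> + i J) * gaplen J) = \<delta> * real l + (\<Sum>J | J \<in> G l \<and> \<not> ?Int J. gaplen J)"
      proof -
        have "(\<Sum>J\<in>G l. (\<delta> + i J) * gaplen J) = \<delta> * (\<Sum>J\<in>G l. gaplen J) + (\<Sum>J\<in>G l. i J * gaplen J)"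
          by (simp only: distrib_right sum.distrib sum_distrib_left)
        also have "(\<Sum>J\<in>G l. i J * gaplen J) = (\<Sum>J\<in>G l. if \<not> ?Int J then gaplen J else 0)"
          by (intro sum.cong) (auto simp: i_def)
        also have "\<dots> = (\<Sum>J | J \<in> G l \<and> \<not> ?Int J. gaplen J)"
          by (rule sum.inter_filter[OF finG, symmetric])
        finally show ?thesis by (simp only: sum_gaplen[OF fin])
      qed
      finally have bnd: "\<bar>A l - B l\<bar> \<le> t\<^sup>2 * \<delta> * (real l * \<rho>) + t\<^sup>2 / \<beta> * (\<Sum>J\<in>G l. \<Sum>n. count_w \<delta> n (gaplen J)) + t\<^sup>2 / \<beta> * K * (\<delta> * real l + (\<Sum>J | J \<in> G l \<and> \<not> ?Int J. gaplen J))"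
        by (simp only: nb_sum[OF elim(5)])
      have 1: "(\<Sum>J\<in>G l. \<Sum>n. count_w \<delta> n (gaplen J)) \<le> (law_ids r \<delta> + \<delta>) * real l"
        using elim(2,5) by (simp add: divide_less_eq)
      have 2: "(\<Sum>J | J \<in> G l \<and> \<not> ?Int J. gaplen J) \<le> 4 * \<delta> * real l"
        using boundary_gaps[OF elim(5) t, of "\<delta> * real l"] elim(3,4) by simp
      have "t\<^sup>2 / \<beta> * (\<Sum>J\<in>G l. \<Sum>n. count_w \<delta> n (gaplen J)) \<le> t\<^sup>2 / \<beta> * ((law_ids r \<delta> + \<delta>) * real l)"
        by (rule mult_left_mono[OF 1 t2])
      moreover have "t\<^sup>2 / \<beta> * K * (\<delta> * real l + (\<Sum>J | J \<in> G l \<and> \<not> ?Int J. gaplen J)) \<le> t\<^sup>2 / \<beta> * K * (5 * \<delta> * real l)"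
        using 2 t2 K by (intro mult_left_mono mult_nonneg_nonneg) auto
      ultimately have "\<bar>A l - B l\<bar> \<le> t\<^sup>2 * \<delta> * (real l * \<rho>) + t\<^sup>2 / \<beta> * ((law_ids r \<delta> + \<delta>) * real l) + t\<^sup>2 / \<beta> * K * (5 * \<delta> * real l)"
        using bnd by linarith
      moreover have "x * \<delta> * (y * \<rho>) + c * ((z + \<delta>) * y) + c * K * (5 * \<delta> * y) = (x * \<delta> * \<rho> + c * (z + \<delta>) + c * K * (5 * \<delta>)) * y" for x y z c
        by (simp add: algebra_simps)
      ultimately show ?case by metis
    qed
  qed
  have "(\<lambda>l. (A l - B l) / real l) \<longlonglongrightarrow> 0"
  proof (rule LIMSEQ_I)
    fix s :: real assume s: "s > 0"
    \<comment> \<open>The bound of \<open>main\<close> is linear in \<open>\<delta>\<close> and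
      \<open>law_ids r \<delta>\<close>; \<open>Q - 1\<close> collects the coefficients, and the
      extra 1 makes \<open>Q\<close> positive and the estimate strict.\<close>
    define Q where "Q = t\<^sup>2 * \<rho> + t\<^sup>2 / \<beta> * 2 + t\<^sup>2 / \<beta> * K * 5 + 1"
    have Q: "Q > 0" unfolding Q_def using \<rho> t2 K by (intro add_nonneg_pos add_nonneg_nonneg mult_nonneg_nonneg) auto
    define q where "q = s / (2 * Q)"
    have q: "q > 0" using s Q by (simp add: q_def)
    obtain d where d: "d > 0" "\<And>\<delta>. 0 < \<delta> \<Longrightarrow> \<delta> < d \<Longrightarrow> law_ids r \<delta> < q"
      using law_ids_at_0[OF r q] by blast
    define \<delta> where "\<delta> = min (d / 2) q"
    have \<delta>: "\<delta> > 0" "\<delta> \<le> q" "law_ids r \<delta> \<le> q" using d q by (auto simp: \<delta>_def less_imp_le)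
    have "t\<^sup>2 * \<delta> * \<rho> + t\<^sup>2 / \<beta> * (law_ids r \<delta> + \<delta>) + t\<^sup>2 / \<beta> * K * (5 * \<delta>) \<le> t\<^sup>2 * q * \<rho> + t\<^sup>2 / \<beta> * (q + q) + t\<^sup>2 / \<beta> * K * (5 * q)"
      using \<delta> \<rho> t2 mult_nonneg_nonneg[OF t2 less_imp_le[OF K]] by (intro add_mono mult_left_mono mult_right_mono) auto
    also have "\<dots> = (Q - 1) * q" by (simp add: Q_def algebra_simps)
    also have "\<dots> < Q * q" using q by (intro mult_strict_right_mono) auto
    also have "\<dots> = s / 2" using Q by (simp add: q_def)
    finally have R: "t\<^sup>2 * \<delta> * \<rho> + t\<^sup>2 / \<beta> * (law_ids r \<delta> + \<delta>) + t\<^sup>2 / \<beta> * K * (5 * \<delta>) < s / 2" .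
    have "\<forall>\<^sub>F l in sequentially. norm ((A l - B l) / real l - 0) < s"
      using main[OF \<delta>(1)] eventually_ge_at_top[of 1]
    proof eventually_elim
      case (elim l)
      have "\<bar>A l - B l\<bar> / real l \<le> t\<^sup>2 * \<delta> * \<rho> + t\<^sup>2 / \<beta> * (law_ids r \<delta> + \<delta>) + t\<^sup>2 / \<beta> * K * (5 * \<delta>)"
        using elim by (subst pos_divide_le_eq) auto
      also have "\<dots> < s / 2" by (rule R)
      also have "\<dots> < s" using s by simp
      finally show ?case by (simp only: real_norm_def diff_0_right abs_divide abs_of_nat)
    qed
    then show "\<exists>no. \<forall>l\<ge>no. norm ((A l - B l) / real l - 0) < s" by (simp add: eventually_sequentially)
  qed
  from tendsto_add[OF this Blim] show ?thesis by (simp add: A_def diff_divide_distrib)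
qed

end

section \<open>The limiting momentum distribution\<close>

definition point_sum :: "(nat \<Rightarrow> real) \<Rightarrow> (nat \<Rightarrow> real) \<Rightarrow> real measure" where
  "point_sum q x = distr (density (count_space UNIV) (\<lambda>k. ennreal (q k))) borel x"

lemma integral_point_sum:
  fixes f :: "real \<Rightarrow> 'b::{banach, second_countable_topology}"
  assumes q: "\<And>k. q k \<ge> 0" "summable q" and f[measurable]: "f \<in> borel_measurable borel" and B: "\<And>y. norm (f y) \<le> B"
  shows "(\<lambda>k. q k *\<^sub>R f (x k)) sums (\<integral>y. f y \<partial>point_sum q x)"
proof -
  have "(\<integral>y. f y \<partial>point_sum q x) = (\<integral>k. f (x k) \<partial>density (count_space UNIV) (\<lambda>k. ennreal (q k)))"
    unfolding point_sum_def by (rule integral_distr) (simp_all add: f)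
  also have "\<dots> = (\<integral>k. q k *\<^sub>R f (x k) \<partial>count_space UNIV)"
    by (rule integral_density) (simp_all add: q)
  finally have eq: "(\<integral>y. f y \<partial>point_sum q x) = (\<integral>k. q k *\<^sub>R f (x k) \<partial>count_space UNIV)" .
  have "summable (\<lambda>k. norm (q k *\<^sub>R f (x k)))"
  proof (rule summable_comparison_test'[OF summable_mult2[OF q(2), of B], where N = 0])
    show "norm (norm (q k *\<^sub>R f (x k))) \<le> q k * B" for k
      using q(1)[of k] B[of "x k"] by (simp add: mult_left_mono)
  qed
  then have "integrable (count_space UNIV) (\<lambda>k. q k *\<^sub>R f (x k))" by (simp only: integrable_count_space_nat_iff)
  from sums_integral_count_space_nat[OF this] show ?thesis unfolding eq .
qed

lemma prob_space_point_sum: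
  assumes q: "\<And>k. q k \<ge> 0" "q sums 1"
  shows "real_distribution (point_sum q x)"
proof -
  let ?D = "density (count_space UNIV) (\<lambda>k. ennreal (q k))"
  have "emeasure ?D (space ?D) = (\<Sum>k. ennreal (q k))"
    by (simp add: emeasure_density nn_integral_count_space_nat)
  also have "\<dots> = 1" using q by (simp add: sums_iff suminf_ennreal2)
  finally interpret D: prob_space ?D by (rule prob_spaceI)
  show ?thesis unfolding point_sum_def by (rule D.real_distribution_distr) simp
qed

section \<open>Symmetrised momentum distribution of one box\<close>

context LS_sequence
begin

definition kap where "kap l k = sqrt (2 * \<epsilon> l k)"

text \<open>The momentum distribution, symmetrised so that its characteristic function is a cosine series:
  index \<open>j\<close> stands for the momentum \<open>kap l (j div 2)\<close> with the sign given by the parity of \<open>j\<close>.\<close>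

definition symw where "symw l j = occ l (j div 2) / (2 * (real l * \<rho>))"

definition symx where "symx l j = (if even j then kap l (j div 2) else - kap l (j div 2))"

definition sym where "sym l = point_sum (symw l) (symx l)"

lemma symw_nonneg: "l \<ge> 1 \<Longrightarrow> symw l j \<ge> 0"
  using occ_nonneg \<rho> by (simp add: symw_def)

lemma pair_sum: "sum f {n * 2..<n * 2 + 2} = f (2 * n) + f (Suc (2 * n))" for f :: "nat \<Rightarrow> 'b::comm_monoid_add"
  by (simp add: numeral_2_eq_2 mult.commute)

lemma symw_summable: "l \<ge> 1 \<Longrightarrow> summable (symw l)"
proof -
  assume l: "l \<ge> 1"
  have p: "sum (symw l) {n * 2..<n * 2 + 2} = occ l n / (real l * \<rho>)" for n
    unfolding pair_sum by (simp add: symw_def)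
  have "(\<Sum>j<N. symw l j) \<le> 1" for N
  proof -
    have "(\<Sum>j<N. symw l j) \<le> (\<Sum>j<N * 2. symw l j)"
      by (intro sum_mono2) (auto intro: symw_nonneg l)
    also have "\<dots> = (\<Sum>n<N. sum (symw l) {n * 2..<n * 2 + 2})" by (rule sum.nat_group[symmetric])
    also have "\<dots> = (\<Sum>n<N. occ l n) / (real l * \<rho>)" by (simp only: p sum_divide_distrib)
    also have "\<dots> \<le> (real l * \<rho>) / (real l * \<rho>)"
    proof (rule divide_right_mono)
      show "(\<Sum>n<N. occ l n) \<le> real l * \<rho>"
        using occ_sums[OF l] sum_le_suminf[OF sums_summable[OF occ_sums[OF l]], of "{..<N}"] occ_nonneg[OF l]
        by (simp add: sums_iff)
    qed (use \<rho> in simp)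
    finally show ?thesis using l \<rho> by simp
  qed
  then have "(\<Sum>j\<le>N. symw l j) \<le> 1" for N by (simp only: lessThan_Suc_atMost[symmetric])
  then show ?thesis by (rule bounded_imp_summable[OF symw_nonneg[OF l]])
qed

lemma symw_sums: "l \<ge> 1 \<Longrightarrow> symw l sums 1"
proof -
  assume l: "l \<ge> 1"
  have p: "sum (symw l) {n * 2..<n * 2 + 2} = occ l n / (real l * \<rho>)" for n
    unfolding pair_sum by (simp add: symw_def)
  have "(\<lambda>n. occ l n / (real l * \<rho>)) sums (real l * \<rho> / (real l * \<rho>))"
    by (intro sums_divide occ_sums l)
  then have "(\<lambda>n. occ l n / (real l * \<rho>)) sums 1" using l \<rho> by simp
  moreover have "(\<lambda>n. sum (symw l) {n * 2..<n * 2 + 2}) sums (\<Sum>j. symw l j)"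
    by (intro sums_group summable_sums symw_summable l) simp
  ultimately have "(\<Sum>j. symw l j) = 1" unfolding p by (metis sums_unique2)
  then show ?thesis using summable_sums[OF symw_summable[OF l]] by simp
qed

lemma real_distribution_sym: "l \<ge> 1 \<Longrightarrow> real_distribution (sym l)"
  unfolding sym_def by (intro prob_space_point_sum symw_nonneg symw_sums)

lemma integral_sym:
  fixes f :: "real \<Rightarrow> 'b::{banach, second_countable_topology}"
  assumes l: "l \<ge> 1" and f: "f \<in> borel_measurable borel" and B: "\<And>y. norm (f y) \<le> B"
  shows "(\<lambda>k. (occ l k / (real l * \<rho>)) *\<^sub>R ((1 / 2) *\<^sub>R (f (kap l k) + f (- kap l k)))) sums (\<integral>y. f y \<partial>sym l)"
proof -
  have "(\<lambda>k. symw l k *\<^sub>R f (symx l k)) sums (\<integral>y. f y \<partial>sym l)"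
    unfolding sym_def by (rule integral_point_sum[OF symw_nonneg[OF l] symw_summable[OF l] f B])
  from sums_group[OF this, of 2]
  have "(\<lambda>n. sum (\<lambda>k. symw l k *\<^sub>R f (symx l k)) {n * 2..<n * 2 + 2}) sums (\<integral>y. f y \<partial>sym l)" by simp
  moreover have "sum (\<lambda>k. symw l k *\<^sub>R f (symx l k)) {n * 2..<n * 2 + 2} = 
      (occ l n / (real l * \<rho>)) *\<^sub>R ((1 / 2) *\<^sub>R (f (kap l n) + f (- kap l n)))" for n
    unfolding pair_sum by (simp add: symw_def symx_def scaleR_add_right mult.commute[of 2])
  ultimately show ?thesis by simp
qed

lemma even_integral_sym:
  fixes f :: "real \<Rightarrow> real"
  assumes l: "l \<ge> 1" and f: "f \<in> borel_measurable borel" and B: "\<And>y. \<bar>f y\<bar> \<le> B" and ev: "\<And>y. f (- y) = f y"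
  shows "(\<lambda>k. f (kap l k) * occ l k) sums (real l * \<rho> * (\<integral>y. f y \<partial>sym l))"
proof -
  have "(\<lambda>k. (occ l k / (real l * \<rho>)) *\<^sub>R ((1 / 2) *\<^sub>R (f (kap l k) + f (- kap l k)))) sums (\<integral>y. f y \<partial>sym l)"
    by (rule integral_sym[OF l f]) (use B in simp)
  then have "(\<lambda>k. occ l k / (real l * \<rho>) * f (kap l k)) sums (\<integral>y. f y \<partial>sym l)" by (simp add: ev)
  from sums_mult[OF this, of "real l * \<rho>"] show ?thesis using l \<rho> by (simp add: mult.commute)
qed

text \<open>A function of the energy \<open>y\<^sup>2 / 2\<close> is an even function of the
  momentum, so the occupation measure is \<open>\<rho>\<close> times the image of the probability
  law \<open>sym l\<close> under this map.\<close>

lemma occupation_measure_integral: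
  fixes f :: "real \<Rightarrow> real"
  assumes l: "l \<ge> 1" and f: "f \<in> borel_measurable borel" and B: "\<And>y. \<bar>f y\<bar> \<le> B"
  shows "(\<integral>y. f y \<partial>occupation_measure l (\<epsilon> l) (occ l)) = \<rho> * (\<integral>y. f (y\<^sup>2 / 2) \<partial>sym l)"
proof -
  have om: "occupation_measure l (\<epsilon> l) (occ l) = point_sum (\<lambda>k. occ l k / real l) (\<epsilon> l)"
    by (simp add: occupation_measure_def point_sum_def)
  have "(\<lambda>k. (occ l k / real l) *\<^sub>R f (\<epsilon> l k)) sums (\<integral>y. f y \<partial>occupation_measure l (\<epsilon> l) (occ l))"
    unfolding om using occ_nonneg[OF l] sums_summable[OF occ_sums[OF l]] B
    by (intro integral_point_sum f) auto
  from sums_mult[OF this, of "real l"]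
  have 1: "(\<lambda>k. f (\<epsilon> l k) * occ l k) sums (real l * (\<integral>y. f y \<partial>occupation_measure l (\<epsilon> l) (occ l)))"
    using l by (simp add: mult.commute)
  have "(\<lambda>k. f ((kap l k)\<^sup>2 / 2) * occ l k) sums (real l * \<rho> * (\<integral>y. f (y\<^sup>2 / 2) \<partial>sym l))"
    by (rule even_integral_sym[OF l, where B = B]) (use B f in \<open>auto intro: measurable_compose[OF _ f]\<close>)
  moreover have "(kap l k)\<^sup>2 / 2 = \<epsilon> l k" for k
    using LS_box.\<epsilon>_nonneg[OF box[OF l], of k] by (simp add: kap_def)
  ultimately have "(\<lambda>k. f (\<epsilon> l k) * occ l k) sums (real l * \<rho> * (\<integral>y. f (y\<^sup>2 / 2) \<partial>sym l))" by simp
  from sums_unique2[OF 1 this] show ?thesis using l by simp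
qed

end

section \<open>Convergence of the momentum distributions and the atom at zero\<close>

context condensed
begin

text \<open>Opposite momenta cancel the imaginary part. The modulus of \<open>t\<close> serves
  \<open>cos_limit\<close>, which is stated for nonnegative \<open>t\<close>.\<close>

lemma char_sym:
  assumes l: "l \<ge> 1"
  shows "char (sym l) t = complex_of_real (1 - (\<Sum>k. cosdef \<bar>t\<bar> l k * occ l k) / real l / \<rho>)"
proof -
  let ?q = "\<lambda>k. occ l k / (real l * \<rho>)"
  have "(\<lambda>k. ?q k *\<^sub>R ((1 / 2) *\<^sub>R (iexp (t * kap l k) + iexp (t * - kap l k)))) sums char (sym l) t"
    unfolding char_def
  proof (rule integral_sym[OF l, where B = 1])
    show "(\<lambda>y. iexp (t * y)) \<in> borel_measurable borel"
      by (intro borel_measurable_continuous_onI continuous_intros)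
  qed simp
  moreover have "?q k *\<^sub>R ((1 / 2) *\<^sub>R (iexp (t * kap l k) + iexp (t * - kap l k))) = complex_of_real (?q k * cos (\<bar>t\<bar> * kap l k))" for k
  proof -
    have "cos (\<bar>t\<bar> * kap l k) = cos (t * kap l k)" by (cases "t \<ge> 0") (auto simp: abs_if)
    moreover have "iexp (t * kap l k) + iexp (t * - kap l k) = complex_of_real (2 * cos (t * kap l k))"
      by (simp add: complex_eq_iff Re_exp Im_exp)
    ultimately show ?thesis by (simp add: scaleR_conv_of_real)
  qed
  ultimately have 1: "(\<lambda>k. complex_of_real (?q k * cos (\<bar>t\<bar> * kap l k))) sums char (sym l) t" by simp
  have h: "0 \<le> cosdef \<bar>t\<bar> l k" "cosdef \<bar>t\<bar> l k \<le> 2" for k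
    using cos_le_one[of "\<bar>t\<bar> * sqrt (2 * \<epsilon> l k)"] cos_ge_minus_one[of "\<bar>t\<bar> * sqrt (2 * \<epsilon> l k)"] unfolding cosdef_def by linarith+
  have "(\<lambda>k. occ l k - cosdef \<bar>t\<bar> l k * occ l k) sums (real l * \<rho> - (\<Sum>k. cosdef \<bar>t\<bar> l k * occ l k))"
    by (intro sums_diff occ_sums l summable_sums sums_summable[OF occ_weighted(1)[OF l h]])
  from sums_divide[OF this, of "real l * \<rho>"]
  have "(\<lambda>k. (occ l k - cosdef \<bar>t\<bar> l k * occ l k) / (real l * \<rho>)) sums ((real l * \<rho> - (\<Sum>k. cosdef \<bar>t\<bar> l k * occ l k)) / (real l * \<rho>))" .
  moreover have "(occ l k - cosdef \<bar>t\<bar> l k * occ l k) / (real l * \<rho>) = ?q k * cos (\<bar>t\<bar> * kap l k)" for k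
  proof -
    have "occ l k - cosdef \<bar>t\<bar> l k * occ l k = occ l k * cos (\<bar>t\<bar> * kap l k)"
      unfolding cosdef_def kap_def by algebra
    then show ?thesis by simp
  qed
  moreover have "(real l * \<rho> - s) / (real l * \<rho>) = 1 - s / real l / \<rho>" for s
    using l \<rho> by (simp add: diff_divide_distrib)
  ultimately have "(\<lambda>k. ?q k * cos (\<bar>t\<bar> * kap l k)) sums (1 - (\<Sum>k. cosdef \<bar>t\<bar> l k * occ l k) / real l / \<rho>)" by simp
  then have "(\<lambda>k. complex_of_real (?q k * cos (\<bar>t\<bar> * kap l k))) sums complex_of_real (1 - (\<Sum>k. cosdef \<bar>t\<bar> l k * occ l k) / real l / \<rho>)"
    by (rule sums_of_real)
  from sums_unique2[OF 1 this] show ?thesis .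
qed

text \<open>The shift by \<open>Suc l0\<close> skips box size 0, for which \<open>sym\<close> has no
  mass, and matches the sequence in \<open>tight_sym\<close>.\<close>

lemma char_sym_limit: "(\<lambda>l. char (sym (l + Suc l0)) t) \<longlonglongrightarrow> complex_of_real (1 - limD \<bar>t\<bar> / \<rho>)"
proof -
  have "(\<lambda>l. (\<Sum>k. cosdef \<bar>t\<bar> l k * occ l k) / real l) \<longlonglongrightarrow> limD \<bar>t\<bar>"
    by (rule cos_limit) simp
  then have lim: "(\<lambda>l. complex_of_real (1 - (\<Sum>k. cosdef \<bar>t\<bar> l k * occ l k) / real l / \<rho>)) \<longlonglongrightarrow> complex_of_real (1 - limD \<bar>t\<bar> / \<rho>)"
    using \<rho> by (intro tendsto_of_real tendsto_diff tendsto_const tendsto_divide) auto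
  have "(\<lambda>l. complex_of_real (1 - (\<Sum>k. cosdef \<bar>t\<bar> (l + Suc l0) k * occ (l + Suc l0) k) / real (l + Suc l0) / \<rho>)) =
      (\<lambda>l. char (sym (l + Suc l0)) t)"
    by (intro ext char_sym[symmetric]) simp
  with LIMSEQ_ignore_initial_segment[OF lim, of "Suc l0"] show ?thesis by (simp only:)
qed

text \<open>Chebyshev's inequality for the second moment of the momentum, which is twice the kinetic
  energy per particle.\<close>

lemma tight_sym: "\<exists>l0. tight (\<lambda>n. sym (n + Suc l0))"
proof -
  obtain C0 where C0: "\<forall>\<^sub>F l in sequentially. (\<Sum>k. ennreal (\<epsilon> l k * occ l k)) \<le> ennreal (C0 * real l)"
    using eventually_energy_bound by blast
  define C where "C = max C0 1"
  obtain l0 where l0: "\<And>l. l \<ge> l0 \<Longrightarrow> (\<Sum>k. ennreal (\<epsilon> l k * occ l k)) \<le> ennreal (C0 * real l)"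
    using C0 by (auto simp: eventually_sequentially)
  have "tight (\<lambda>n. sym (n + Suc l0))"
    unfolding tight_def
  proof (intro conjI allI impI)
    show "real_distribution (sym (n + Suc l0))" for n by (rule real_distribution_sym) simp
    fix s :: real assume s: "s > 0"
    \<comment> \<open>Chosen so that \<open>2 * C / (\<rho> * R\<^sup>2) = s / 2\<close>. The
      doubled window contains all \<open>y\<close> with \<open>\<bar>y\<bar> \<le> R\<close>
      although it is open at the left.\<close>
    define R where "R = sqrt (4 * C / (\<rho> * s))"
    have R: "R > 0" "R\<^sup>2 = 4 * C / (\<rho> * s)" using \<rho> s by (auto simp: R_def C_def)
    have "1 - s < measure (sym (n + Suc l0)) {- (2 * R)<..2 * R}" for n
    proof -
      define l where "l = n + Suc l0"
      have l: "l \<ge> 1" "l \<ge> l0" by (auto simp: l_def)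
      interpret S: real_distribution "sym l" by (rule real_distribution_sym[OF l(1)])
      define f where "f y = (if R < \<bar>y\<bar> then 1 else 0 :: real)" for y
      have [measurable]: "f \<in> borel_measurable borel" unfolding f_def[abs_def] by measurable
      have fle: "f y \<le> y\<^sup>2 / R\<^sup>2" for y
      proof (cases "R < \<bar>y\<bar>")
        case True
        then have "R\<^sup>2 \<le> \<bar>y\<bar>\<^sup>2" using R(1) by (intro power_mono) auto
        then have "1 \<le> y\<^sup>2 / R\<^sup>2" using R(1) by (simp add: le_divide_eq)
        then show ?thesis using True by (simp add: f_def)
      qed (simp add: f_def)
      have en: "\<epsilon> l k \<ge> 0" for k by (rule LS_box.\<epsilon>_nonneg[OF box[OF l(1)]])
      have nn: "0 \<le> \<epsilon> l k * occ l k" for k using en occ_nonneg[OF l(1)] by simp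
      have eb: "(\<Sum>k. ennreal (\<epsilon> l k * occ l k)) \<le> ennreal (C * real l)"
        by (rule order_trans[OF l0[OF l(2)] ennreal_leI]) (intro mult_right_mono, auto simp: C_def)
      have sme: "summable (\<lambda>k. \<epsilon> l k * occ l k)"
        by (rule summable_suminf_not_top[OF nn]) (use eb in \<open>auto simp: top_unique\<close>)
      have "ennreal (\<Sum>k. \<epsilon> l k * occ l k) \<le> ennreal (C * real l)"
        using eb by (simp add: suminf_ennreal2[OF nn sme])
      then have e: "(\<Sum>k. \<epsilon> l k * occ l k) \<le> C * real l" by (subst (asm) ennreal_le_iff) (auto simp: C_def)
      have fs: "(\<lambda>k. f (kap l k) * occ l k) sums (real l * \<rho> * (\<integral>y. f y \<partial>sym l))"
        by (rule even_integral_sym[OF l(1), where B = 1]) (auto simp: f_def)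
      have "real l * \<rho> * (\<integral>y. f y \<partial>sym l) = (\<Sum>k. f (kap l k) * occ l k)" using fs by (simp add: sums_iff)
      also have "\<dots> \<le> (\<Sum>k. 2 / R\<^sup>2 * (\<epsilon> l k * occ l k))"
      proof (intro suminf_le sums_summable[OF fs] summable_mult sme)
        fix k
        have "f (kap l k) * occ l k \<le> (kap l k)\<^sup>2 / R\<^sup>2 * occ l k"
          using occ_nonneg[OF l(1)] by (intro mult_right_mono fle)
        then show "f (kap l k) * occ l k \<le> 2 / R\<^sup>2 * (\<epsilon> l k * occ l k)" using en[of k] by (simp add: kap_def)
      qed
      also have "\<dots> = 2 / R\<^sup>2 * (\<Sum>k. \<epsilon> l k * occ l k)" by (rule suminf_mult[OF sme])
      also have "\<dots> \<le> 2 / R\<^sup>2 * (C * real l)" by (intro mult_left_mono e) simp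
      also have "\<dots> = s / 2 * (real l * \<rho>)" unfolding R(2) using \<rho> s by (simp add: C_def field_simps)
      finally have "(real l * \<rho>) * (\<integral>y. f y \<partial>sym l) \<le> (real l * \<rho>) * (s / 2)" by (simp only: mult.commute)
      then have If: "(\<integral>y. f y \<partial>sym l) \<le> s / 2" using l \<rho> by (subst (asm) mult_le_cancel_left_pos) auto
      have "(\<integral>y. indicator {- (2 * R)<..2 * R} y + f y \<partial>sym l) \<ge> (\<integral>y. 1 \<partial>sym l)"
        using R by (intro integral_mono Bochner_Integration.integrable_add S.integrable_const_bound[where B = 1])
          (auto simp: f_def indicator_def)
      moreover have "(\<integral>y. indicator {- (2 * R)<..2 * R} y + f y \<partial>sym l) = measure (sym l) {- (2 * R)<..2 * R} + (\<integral>y. f y \<partial>sym l)"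
        by (subst Bochner_Integration.integral_add) (auto intro!: S.integrable_const_bound[where B = 1] simp: f_def)
      ultimately have "1 \<le> measure (sym l) {- (2 * R)<..2 * R} + s / 2" using If S.prob_space by simp
      then show ?thesis using s unfolding l_def by simp
    qed
    then show "\<exists>a b. a < b \<and> (\<forall>n. 1 - s < measure (sym (n + Suc l0)) {a<..b})"
      using R by (intro exI[of _ "- (2 * R)"] exI[of _ "2 * R"]) auto
  qed
  then show ?thesis by blast
qed

text \<open>Tightness yields a limit law along a subsequence, and the characteristic functions
  converge along the whole sequence, so their limit is the characteristic function of that law. This
  stands in for a direct proof that the limit is continuous at 0.\<close>

lemma limit_law_exists: "\<exists>P. real_distribution P \<and> (\<forall>t. char P t = complex_of_real (1 - limD \<bar>t\<bar> / \<rho>))"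
proof -
  obtain l0 where t: "tight (\<lambda>n. sym (n + Suc l0))" using tight_sym by blast
  obtain u P where u: "strict_mono (u :: nat \<Rightarrow> nat)" and P: "real_distribution P"
    and wc: "weak_conv_m ((\<lambda>n. sym (n + Suc l0)) \<circ> id \<circ> u) P"
    using tight_imp_convergent_subsubsequence[OF t strict_mono_id] by blast
  have "char P t = complex_of_real (1 - limD \<bar>t\<bar> / \<rho>)" for t
  proof -
    have "(\<lambda>n. char (((\<lambda>n. sym (n + Suc l0)) \<circ> id \<circ> u) n) t) \<longlonglongrightarrow> char P t"
      by (rule levy_continuity1[OF _ P wc]) (auto intro: real_distribution_sym)
    moreover have "(\<lambda>n. char (((\<lambda>n. sym (n + Suc l0)) \<circ> id \<circ> u) n) t) \<longlonglongrightarrow> complex_of_real (1 - limD \<bar>t\<bar> / \<rho>)"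
      using LIMSEQ_subseq_LIMSEQ[OF char_sym_limit[of l0 t] u] by (simp add: comp_def)
    ultimately show ?thesis by (rule LIMSEQ_unique)
  qed
  with P show ?thesis by blast
qed

text \<open>\<open>P\<close> is any law with this characteristic function, not just the limit found
  for the present sample, so that one \<open>P\<close> can serve all samples.\<close>

context
  fixes P :: "real measure"
  assumes P: "real_distribution P" and char_P: "\<And>t. char P t = complex_of_real (1 - limD \<bar>t\<bar> / \<rho>)"
begin

lemma sym_integral_limit:
  assumes f: "continuous_on UNIV f" and B: "\<And>y. \<bar>f y\<bar> \<le> (B :: real)"
  shows "(\<lambda>l. \<integral>y. f y \<partial>sym l) \<longlonglongrightarrow> (\<integral>y. f y \<partial>P)"
proof -
  have rd: "real_distribution (sym (n + Suc 0))" for n by (rule real_distribution_sym) simp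
  have "weak_conv_m (\<lambda>n. sym (n + Suc 0)) P"
    by (rule levy_continuity[OF rd P]) (use char_sym_limit[of 0] in \<open>simp only: char_P\<close>)
  then have "(\<lambda>n. \<integral>y. f y \<partial>sym (n + Suc 0)) \<longlonglongrightarrow> (\<integral>y. f y \<partial>P)"
    using f B by (intro weak_conv_imp_integral_bdd_continuous_conv[OF rd P, where B = B])
      (auto simp: continuous_on_eq_continuous_at)
  then show ?thesis by (simp add: LIMSEQ_imp_Suc)
qed

lemma converges_weakly_occupation:
  "converges_weakly (\<lambda>l. occupation_measure l (\<epsilon> l) (occ l)) (density (distr P borel (\<lambda>y. y\<^sup>2 / 2)) (\<lambda>_. ennreal \<rho>))"
  unfolding converges_weakly_def
proof (intro allI impI)
  fix f :: "real \<Rightarrow> real"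
  assume f: "continuous_on UNIV f" and "bounded (range f)"
  then obtain B where B: "\<And>y. \<bar>f y\<bar> \<le> B" by (auto simp: bounded_iff)
  interpret P: real_distribution P by (rule P)
  have fm[measurable]: "f \<in> borel_measurable borel" using f by (rule borel_measurable_continuous_onI)
  have "continuous_on UNIV (\<lambda>y. f (y\<^sup>2 / 2))"
    by (rule continuous_on_compose2[OF f]) (auto intro!: continuous_intros)
  from tendsto_mult[OF tendsto_const[of \<rho>] sym_integral_limit[OF this B]]
  have "(\<lambda>l. \<rho> * (\<integral>y. f (y\<^sup>2 / 2) \<partial>sym l)) \<longlonglongrightarrow> \<rho> * (\<integral>y. f (y\<^sup>2 / 2) \<partial>P)" .
  moreover have "\<forall>\<^sub>F l in sequentially. \<rho> * (\<integral>y. f (y\<^sup>2 / 2) \<partial>sym l) = (\<integral>y. f y \<partial>occupation_measure l (\<epsilon> l) (occ l))"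
    using eventually_ge_at_top[of 1] by eventually_elim (rule occupation_measure_integral[OF _ fm B, symmetric])
  ultimately have "(\<lambda>l. \<integral>y. f y \<partial>occupation_measure l (\<epsilon> l) (occ l)) \<longlonglongrightarrow> \<rho> * (\<integral>y. f (y\<^sup>2 / 2) \<partial>P)"
    by (rule Lim_transform_eventually)
  moreover have "(\<integral>y. f y \<partial>density (distr P borel (\<lambda>y. y\<^sup>2 / 2)) (\<lambda>_. ennreal \<rho>)) = \<rho> * (\<integral>y. f (y\<^sup>2 / 2) \<partial>P)"
    using \<rho> by (subst integral_density) (auto simp: integral_distr)
  ultimately show "(\<lambda>l. \<integral>y. f y \<partial>occupation_measure l (\<epsilon> l) (occ l)) \<longlonglongrightarrow> 
      (\<integral>y. f y \<partial>density (distr P borel (\<lambda>y. y\<^sup>2 / 2)) (\<lambda>_. ennreal \<rho>))" by simp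
qed

text \<open>Below energy \<open>d\<^sup>2 / 4\<close> a mode keeps at least half of its mass under
  the tent, since the tent loses at most \<open>2 / d\<^sup>2\<close> times the kinetic energy.
  These modes carry \<open>(\<rho> - \<rho>c) / 2\<close> particles per unit length and
  \<open>sym\<close> is normalised by \<open>\<rho>\<close>, so the bound is independent of
  \<open>d\<close>.\<close>

lemma tent_lower_bound:
  assumes d: "d > 0"
  shows "(\<integral>y. max 0 (1 - y\<^sup>2 / d\<^sup>2) \<partial>P) \<ge> (\<rho> - \<rho>c) / (4 * \<rho>)"
proof -
  define f where "f y = max 0 (1 - y\<^sup>2 / d\<^sup>2)" for y :: real
  have fb: "0 \<le> f y" "f y \<le> 1" for y by (auto simp: f_def)
  have fc: "continuous_on UNIV f" unfolding f_def using d by (intro continuous_intros) auto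
  have fm: "f \<in> borel_measurable borel" using fc by (rule borel_measurable_continuous_onI)
  have lim: "(\<lambda>l. \<integral>y. f y \<partial>sym l) \<longlonglongrightarrow> (\<integral>y. f y \<partial>P)"
    by (rule sym_integral_limit[OF fc, where B = 1]) (use fb in auto)
  define \<delta> where "\<delta> = d\<^sup>2 / 4"
  have \<delta>: "\<delta> > 0" using d by (simp add: \<delta>_def)
  have "\<forall>\<^sub>F l in sequentially. (\<rho> - \<rho>c) / (4 * \<rho>) \<le> (\<integral>y. f y \<partial>sym l)"
    using eventually_low_energy_mass[OF \<delta>] eventually_ge_at_top[of 1]
  proof eventually_elim
    case (elim l)
    interpret LS_box X l "\<phi> l" "E l" "\<psi> l" "\<epsilon> l" by (rule box[OF elim(2)])
    let ?h = "\<lambda>k. f (kap l k)"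
    define v where "v J n = (\<Sum>k. ?h k * Wt l J n k)" for J n
    have vs: "0 \<le> v J n" "summable (\<lambda>k. ?h k * Wt l J n k)" if "J \<in> G l" for J n
      unfolding v_def using W_weighted[OF elim(2) that, where h = ?h and B = 1] fb by blast+
    have sv: "summable (\<lambda>n. nb l J n * v J n)" if "J \<in> G l" for J
      unfolding v_def by (rule occ_weighted(2)[OF elim(2) fb that])
    have v: "1 / 2 \<le> v J n" if J: "J \<in> G l" and e: "e J n \<le> \<delta>" for J n
    proof -
      have s1: "(\<lambda>k. Wt l J n k - ?h k * Wt l J n k) sums (1 - v J n)"
        unfolding v_def by (intro sums_diff W_sums J summable_sums vs(2))
      have "(\<Sum>k<m. Wt l J n k - ?h k * Wt l J n k) \<le> 1 / 2" for m
      proof -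
        have "(\<Sum>k<m. Wt l J n k - ?h k * Wt l J n k) \<le> (\<Sum>k<m. 2 / d\<^sup>2 * (\<epsilon> l k * Wt l J n k))"
        proof (rule sum_mono)
          fix k
          have "1 - ?h k \<le> 2 / d\<^sup>2 * \<epsilon> l k" using \<epsilon>_nonneg[of k] by (simp add: f_def kap_def max_def)
          from mult_right_mono[OF this W_nonneg[of J n k]]
          show "Wt l J n k - ?h k * Wt l J n k \<le> 2 / d\<^sup>2 * (\<epsilon> l k * Wt l J n k)" by (simp add: left_diff_distrib mult.assoc)
        qed
        also have "\<dots> = 2 / d\<^sup>2 * (\<Sum>k<m. \<epsilon> l k * Wt l J n k)" by (simp only: sum_distrib_left)
        also have "\<dots> \<le> 2 / d\<^sup>2 * \<delta>"
          using order_trans[OF W_energy[OF J] e] by (intro mult_left_mono) auto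
        also have "\<dots> = 1 / 2" using d by (simp add: \<delta>_def)
        finally show ?thesis .
      qed
      then have "(\<Sum>k. Wt l J n k - ?h k * Wt l J n k) \<le> 1 / 2"
        by (intro suminf_le_const sums_summable[OF s1])
      then show ?thesis using s1 by (simp add: sums_iff)
    qed
    have "(\<rho> - \<rho>c) / 4 * real l = 1 / 2 * ((\<rho> - \<rho>c) / 2 * real l)" by simp
    also have "\<dots> \<le> 1 / 2 * (\<Sum>J\<in>G l. \<Sum>n. if e J n \<le> \<delta> then nb l J n else 0)"
      by (intro mult_left_mono elim(1)) simp
    also have "\<dots> = (\<Sum>J\<in>G l. 1 / 2 * (\<Sum>n. if e J n \<le> \<delta> then nb l J n else 0))" by (simp only: sum_distrib_left)
    also have "\<dots> \<le> (\<Sum>J\<in>G l. \<Sum>n. nb l J n * v J n)"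
    proof (rule sum_mono)
      fix J assume J: "J \<in> G l"
      have sm: "summable (\<lambda>n. if e J n \<le> \<delta> then nb l J n else 0)"
        by (rule summable_comparison_test'[OF nb_summable[OF elim(2) J], where N = 0])
           (use nb_pos[OF elim(2) J] in \<open>auto simp: less_imp_le\<close>)
      have "1 / 2 * (\<Sum>n. if e J n \<le> \<delta> then nb l J n else 0) = (\<Sum>n. 1 / 2 * (if e J n \<le> \<delta> then nb l J n else 0))"
        by (rule suminf_mult[OF sm, symmetric])
      also have "\<dots> \<le> (\<Sum>n. nb l J n * v J n)"
      proof (intro suminf_le summable_mult sm sv J)
        fix n
        show "1 / 2 * (if e J n \<le> \<delta> then nb l J n else 0) \<le> nb l J n * v J n"
          using nb_pos[OF elim(2) J, of n] vs(1)[OF J, of n] mult_left_mono[OF v[OF J, of n], of "nb l J n"] by auto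
      qed
      finally show "1 / 2 * (\<Sum>n. if e J n \<le> \<delta> then nb l J n else 0) \<le> (\<Sum>n. nb l J n * v J n)" .
    qed
    also have "\<dots> = real l * \<rho> * (\<integral>y. f y \<partial>sym l)"
    proof (rule sums_unique2)
      show "(\<lambda>k. ?h k * occ l k) sums (\<Sum>J\<in>G l. \<Sum>n. nb l J n * v J n)"
        unfolding v_def by (rule occ_weighted(1)[OF elim(2) fb])
      show "(\<lambda>k. ?h k * occ l k) sums (real l * \<rho> * (\<integral>y. f y \<partial>sym l))"
        by (rule even_integral_sym[OF elim(2) fm, where B = 1]) (use fb in \<open>auto simp: f_def\<close>)
    qed
    finally have "(\<rho> - \<rho>c) / 4 * real l \<le> (\<rho> * (\<integral>y. f y \<partial>sym l)) * real l" by (simp add: ac_simps)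
    then have "(\<rho> - \<rho>c) / 4 \<le> \<rho> * (\<integral>y. f y \<partial>sym l)" using elim(2) by (subst (asm) mult_le_cancel_right_pos) auto
    then show ?case using \<rho> by (simp add: divide_le_eq ac_simps)
  qed
  then have "(\<rho> - \<rho>c) / (4 * \<rho>) \<le> (\<integral>y. f y \<partial>P)"
    by (intro tendsto_lowerbound[OF lim]) auto
  then show ?thesis by (simp add: f_def)
qed

text \<open>The tents decrease to the indicator of 0 while their integrals stay above a bound
  independent of the width.\<close>

lemma atom: "measure P {0} > 0"
proof -
  interpret P: real_distribution P by (rule P)
  have lim: "(\<lambda>n. \<integral>y. max 0 (1 - y\<^sup>2 / (1 / real (Suc n))\<^sup>2) \<partial>P) \<longlonglongrightarrow> (\<integral>y. indicator {0} y \<partial>P)"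
  proof (rule integral_dominated_convergence[where w = "\<lambda>_. 1"])
    show "AE y in P. (\<lambda>n. max 0 (1 - y\<^sup>2 / (1 / real (Suc n))\<^sup>2)) \<longlonglongrightarrow> indicator {0} y"
    proof (rule AE_I2)
      fix y :: real
      show "(\<lambda>n. max 0 (1 - y\<^sup>2 / (1 / real (Suc n))\<^sup>2)) \<longlonglongrightarrow> indicator {0} y"
      proof (cases "y = 0")
        case False
        have "\<forall>\<^sub>F n in sequentially. max 0 (1 - y\<^sup>2 / (1 / real (Suc n))\<^sup>2) = 0"
        proof (rule eventually_sequentiallyI[of "nat \<lceil>1 / \<bar>y\<bar>\<rceil>"])
          fix n assume "nat \<lceil>1 / \<bar>y\<bar>\<rceil> \<le> n"
          then have "1 / \<bar>y\<bar> \<le> real (Suc n)" by linarith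
          then have "1 \<le> \<bar>y\<bar> * real (Suc n)" using False by (simp add: divide_le_eq mult.commute)
          then have "1\<^sup>2 \<le> (\<bar>y\<bar> * real (Suc n))\<^sup>2" by (intro power_mono) auto
          then have "1 \<le> y\<^sup>2 / (1 / real (Suc n))\<^sup>2" by (simp add: power_mult_distrib power_divide del: of_nat_Suc)
          then show "max 0 (1 - y\<^sup>2 / (1 / real (Suc n))\<^sup>2) = 0" by simp
        qed
        then show ?thesis using False by (simp add: tendsto_eventually)
      qed simp
    qed
  qed (auto simp: max_def)
  have "(\<rho> - \<rho>c) / (4 * \<rho>) \<le> (\<integral>y. indicator {0} y \<partial>P)"
    by (rule LIMSEQ_le_const[OF lim]) (use tent_lower_bound in \<open>auto simp del: of_nat_Suc\<close>)
  moreover have "(\<rho> - \<rho>c) / (4 * \<rho>) > 0" using \<rho> \<rho>c by simp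
  ultimately show ?thesis by simp
qed

end

end

lemma LS_boxI:
  assumes "regular X r" "l \<ge> 1" "eigensystem (\<Lambda> l) (LS_hamiltonian X l) \<phi> E"
    "eigensystem (\<Lambda> l) (dirichlet_hamiltonian (\<Lambda> l)) \<psi> \<epsilon>"
  shows "LS_box X l \<phi> E \<psi> \<epsilon>"
  using assms by unfold_locales (auto simp: regular_def)

theorem theorem6p3:
  fixes M :: "'w measure"
    and X :: "'w \<Rightarrow> real set"
    and \<beta> \<rho> r :: real
    and \<phi> :: "'w \<Rightarrow> nat \<Rightarrow> nat \<Rightarrow> real \<Rightarrow> complex"
    and E :: "'w \<Rightarrow> nat \<Rightarrow> nat \<Rightarrow> real"
    and \<psi> :: "nat \<Rightarrow> nat \<Rightarrow> real \<Rightarrow> complex"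
    and \<epsilon> :: "nat \<Rightarrow> nat \<Rightarrow> real"
    and \<mu> :: "'w \<Rightarrow> nat \<Rightarrow> real"
  defines "occ \<equiv> (\<lambda>\<omega> l k. mean_occupation \<beta> (\<Lambda> l) (\<phi> \<omega> l) (E \<omega> l) (\<mu> \<omega> l) (\<psi> l k))"
  assumes "prob_space M" and "\<beta> > 0" and "\<rho> > 0" and "r > 0"
    and "poisson_process M r X"
    and "\<And>\<omega> l. \<omega> \<in> space M \<Longrightarrow> l \<ge> 1 \<Longrightarrow>
           eigensystem (\<Lambda> l) (LS_hamiltonian (X \<omega>) l) (\<phi> \<omega> l) (E \<omega> l)"
    and "\<And>l. l \<ge> 1 \<Longrightarrow> eigensystem (\<Lambda> l) (dirichlet_hamiltonian (\<Lambda> l)) (\<psi> l) (\<epsilon> l)"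
    and "\<And>\<omega> l. \<omega> \<in> space M \<Longrightarrow> l \<ge> 1 \<Longrightarrow>
           \<mu> \<omega> l < E \<omega> l 0 \<and>
           (\<lambda>i. 1 / (exp (\<beta> * (E \<omega> l i - \<mu> \<omega> l)) - 1)) sums (real l * \<rho>)"
  shows "(AE \<omega> in M. \<forall>k. (\<lambda>l. occ \<omega> l k / real l) \<longlonglongrightarrow> 0) \<and>
         (critical_density \<beta> (ids M E) < ennreal \<rho> \<longrightarrow>
            (\<exists>m. sets m = sets borel \<and> finite_measure m \<and>
                 (AE \<omega> in M. converges_weakly
                    (\<lambda>l. occupation_measure l (\<epsilon> l) (occ \<omega> l)) m) \<and>
                 emeasure m {0} > 0))"
proof -
  interpret prob_space M by fact
  have reg: "AE \<omega> in M. regular (X \<omega>) r" by (rule AE_regular[OF assms(2,6)])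
  have seq: "LS_sequence (X \<omega>) r \<beta> \<rho> (\<phi> \<omega>) (E \<omega>) \<psi> \<epsilon> (\<mu> \<omega>)"
    if "\<omega> \<in> space M" "regular (X \<omega>) r" for \<omega>
  proof (rule LS_sequence.intro)
    show "regular (X \<omega>) r" by fact
    show "r > 0" "\<beta> > 0" "\<rho> > 0" by fact+
    show "LS_box (X \<omega>) l (\<phi> \<omega> l) (E \<omega> l) (\<psi> l) (\<epsilon> l)" if "1 \<le> l" for l
      using \<open>regular (X \<omega>) r\<close> that assms(7)[OF \<open>\<omega> \<in> space M\<close> that] assms(8)[OF that] by (rule LS_boxI)
    show "\<mu> \<omega> l < E \<omega> l 0" "(\<lambda>i. bose \<beta> (\<mu> \<omega> l) (E \<omega> l i)) sums (real l * \<rho>)" if "1 \<le> l" for l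
      using assms(9)[OF \<open>\<omega> \<in> space M\<close> that] by (simp_all add: bose_def)
  qed
  have occ: "LS_sequence.occ \<beta> (\<phi> \<omega>) (E \<omega>) \<psi> (\<mu> \<omega>) = occ \<omega>" if "\<omega> \<in> space M" "regular (X \<omega>) r" for \<omega>
    unfolding occ_def LS_sequence.occ_def[OF seq[OF that], abs_def] ..
  have part1: "AE \<omega> in M. \<forall>k. (\<lambda>l. occ \<omega> l k / real l) \<longlonglongrightarrow> 0"
    using reg AE_space by eventually_elim (use LS_sequence.occupation_vanishes[OF seq] occ in force)
  moreover have "\<exists>m. sets m = sets borel \<and> finite_measure m \<and>
      (AE \<omega> in M. converges_weakly (\<lambda>l. occupation_measure l (\<epsilon> l) (occ \<omega> l)) m) \<and> emeasure m {0} > 0"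
    if cd: "critical_density \<beta> (ids M E) < ennreal \<rho>"
  proof -
    have "ids M E = law_ids r"
      using ids_eq_law_ids[OF assms(2,5) reg, of \<phi> E \<psi> \<epsilon>] LS_sequence.box[OF seq] by (intro ext) blast
    then have cd': "critical_density \<beta> (law_ids r) < ennreal \<rho>" using cd by simp
    \<comment> \<open>The critical density is an extended real; being below
      \<open>ennreal \<rho>\<close> it is finite.\<close>
    define \<rho>c where "\<rho>c = enn2real (critical_density \<beta> (law_ids r))"
    have \<rho>c: "critical_density \<beta> (law_ids r) = ennreal \<rho>c"
      using cd' unfolding \<rho>c_def by (intro ennreal_enn2real[symmetric]) (metis ennreal_less_top less_trans)
    have \<rho>c0: "\<rho>c \<ge> 0" by (simp add: \<rho>c_def)
    have less: "\<rho>c < \<rho>" using cd' \<rho>c0 unfolding \<rho>c by (simp add: ennreal_less_iff)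
    have "bose_density \<beta> r \<eta> \<le> \<rho>c" if "\<eta> > 0" for \<eta>
      using bose_density_le_critical[OF assms(3,5) that] \<rho>c0 unfolding \<rho>c by (simp add: ennreal_le_iff)
    then have cond: "condensed (X \<omega>) r \<beta> \<rho> (\<phi> \<omega>) (E \<omega>) \<psi> \<epsilon> (\<mu> \<omega>) \<rho>c" if "\<omega> \<in> space M" "regular (X \<omega>) r" for \<omega>
      using seq[OF that] less unfolding condensed_def condensed_axioms_def by blast
    \<comment> \<open>Any good sample may define \<open>P\<close>, since the target characteristic
      function is the same for all of them.\<close>
    obtain \<omega>0 where \<omega>0: "\<omega>0 \<in> space M" "regular (X \<omega>0) r"
    proof -
      have "AE \<omega> in M. \<omega> \<in> space M \<and> regular (X \<omega>) r" using reg AE_space by eventually_elim simp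
      then have "\<exists>\<omega>. \<omega> \<in> space M \<and> regular (X \<omega>) r"
        by (rule eventually_happens'[OF ae_filter_bot])
      then show ?thesis using that by blast
    qed
    interpret W0: condensed "X \<omega>0" r \<beta> \<rho> "\<phi> \<omega>0" "E \<omega>0" \<psi> \<epsilon> "\<mu> \<omega>0" \<rho>c by (rule cond[OF \<omega>0])
    obtain P where P: "real_distribution P" "\<And>t. char P t = complex_of_real (1 - W0.limD \<bar>t\<bar> / \<rho>)"
      using W0.limit_law_exists by blast
    interpret P: real_distribution P by (rule P)
    define m where "m = density (distr P borel (\<lambda>y. y\<^sup>2 / 2)) (\<lambda>_. ennreal \<rho>)"
    have "AE \<omega> in M. converges_weakly (\<lambda>l. occupation_measure l (\<epsilon> l) (occ \<omega> l)) m"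
      using reg AE_space
    proof eventually_elim
      case (elim \<omega>)
      \<comment> \<open>For both samples \<open>limD\<close> unfolds to the same integral over
        \<open>gap_law r\<close>.\<close>
      have "char P t = complex_of_real (1 - condensed.limD r \<beta> \<bar>t\<bar> / \<rho>)" for t
        unfolding P(2) W0.limD_def condensed.limD_def[OF cond[OF elim(2,1)]] ..
      from condensed.converges_weakly_occupation[OF cond[OF elim(2,1)] P(1) this]
      show ?case unfolding m_def occ[OF elim(2,1)] .
    qed
    moreover have "sets m = sets borel" by (simp add: m_def)
    moreover have em: "emeasure m A = ennreal \<rho> * emeasure P ((\<lambda>y. y\<^sup>2 / 2) -` A)" if "A \<in> sets borel" for A
      using that by (simp add: m_def emeasure_density nn_integral_cmult_indicator emeasure_distr)
    moreover have "finite_measure m"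
      by (rule finite_measureI) (use em[of UNIV] P.emeasure_space_1 in \<open>auto simp: m_def ennreal_mult_eq_top_iff\<close>)
    moreover have "emeasure m {0} > 0"
    proof -
      have "(\<lambda>y::real. y\<^sup>2 / 2) -` {0} = {0}" by auto
      then have "emeasure m {0} = ennreal (\<rho> * measure P {0})"
        using em[of "{0}"] assms(4) by (simp add: P.emeasure_eq_measure ennreal_mult)
      then show ?thesis using W0.atom[OF P] assms(4) by simp
    qed
    ultimately show ?thesis by blast
  qed
  ultimately show ?thesis by blast
qed

end
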